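(* For tropical cycles $X$ and $Y$ in $N_{\mathbb R}$, the stable intersection $X\cdot Y$ is also a tropical cycle: it is balanced, and of codimension $$\operatorname{codim}(X\cdot Y)=\operatorname{codim}(X)+\operatorname{codim}(Y)$$ (where $X\cdot Y$ may be the zero cycle, which is regarded as having every codimension). In particular, when $X$ and $Y$ have positive multiplicities, $\operatorname{supp}(X\cdot Y)$ is empty or pure of this codimension.
   Context: Let $N\cong\mathbb Z^n$ be a lattice and $N_{\mathbb R}=N\otimes_{\mathbb Z}\mathbb R$. Polyhedral complexes are finite and rational (each polyhedron is a finite intersection of half-spaces $\{x:\langle u,x\rangle\le c\}$ with $u\in\operatorname{Hom}(N,\mathbb Z)$, $c\in\mathbb R$). For a polyhedron $\sigma$, $N_\sigma$ is the maximal sublattice of $N$ parallel to the affine span of $\sigma$. A tropical $k$-cycle $X$ is a pure $k$-dimensional polyhedral complex in which every facet $\sigma$ carries a multiplicity $\operatorname{mult}_X(\sigma)\in\mathbb Q$ and which is balanced: for each ridge (codimension-one face) $\tau$, $\sum_{\sigma\supset\tau}\operatorname{mult}_X(\sigma)v_{\sigma/\tau}\in\operatorname{span}_{\mathbb Q}(N_\tau)$, the sum being over facets $\sigma\supset\tau$, where $v_{\sigma/\tau}\in N$ points from $\tau$ into $\sigma$ and generates $N_\sigma$ together with $N_\tau$. Facets of multiplicity $0$ are ignored (if none remain, the cycle is the zero cycle), and cycles with a common refinement carrying equal multiplicities are identified. $\operatorname{supp}(X)$ is the union of the closed facets of nonzero multiplicity. "Positive multiplicities" means all facet multiplicities are $>0$.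 The cycle sum $X\oplus Y$ of cycles of equal dimension is the union with multiplicities added on overlaps. Links: for a polyhedron $\sigma\ni\omega$, $\operatorname{link}_\omega(\sigma)=\{u:\omega+\varepsilon u\in\sigma\text{ for all sufficiently small }\varepsilon>0\}$; $\operatorname{link}_\omega(X)=\{\operatorname{link}_\omega(\sigma):\omega\in\sigma\in X\}$ with inherited multiplicities; $\operatorname{link}_\gamma$ for a polyhedron $\gamma$ means the link at a relative interior point of $\gamma$. Stable intersection: for tropical cycles $X,Y$ with positive multiplicities, $\operatorname{supp}(X\cdot Y)=\{\omega\in N_{\mathbb R}:\operatorname{supp}(\operatorname{link}_\omega X)-\operatorname{supp}(\operatorname{link}_\omega Y)=N_{\mathbb R}\}$, where $S-T=\{s-t\}$; it is a subcomplex of the common refinement $\{\sigma_1\cap\sigma_2:\sigma_1\in X,\sigma_2\in Y\}$. A cell $\gamma$ of it with $\operatorname{codim}(\gamma)=\operatorname{codim}(X)+\operatorname{codim}(Y)$ has multiplicity $\operatorname{mult}_{X\cdot Y}(\gamma)=\sum_{\sigma,\tau}\operatorname{mult}_X(\sigma)\operatorname{mult}_Y(\tau)[N:N_\sigma+N_\tau]$, the sum being over pairs of facets $\sigma\in\operatorname{link}_\gamma(X)$, $\tau\in\operatorname{link}_\gamma(Y)$ with $v\in\sigma-\tau$, for a fixed generic $v\in N_{\mathbb R}$ (the value is independent of generic $v$). Every tropical cycle is a $\mathbb Q$-linear combination (with respect to $\oplus$) of cycles with positive multiplicities, and the product is extended to arbitrary cycles by bilinearity. *)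

theory Defs
  imports "HOL-Analysis.Analysis"
begin

text \<open>
  The lattice \<open>N\<close> is the integer lattice of \<open>N\<^sub>R = real ^ 'n\<close>; its dual is identified with it via the
  inner product.
\<close>

definition int_lattice :: "(real ^ 'n) set" where
  "int_lattice = {x. \<forall>i. x $ i \<in> \<int>}"

definition rational_polyhedron :: "(real ^ 'n) set \<Rightarrow> bool" where
  "rational_polyhedron \<sigma> \<longleftrightarrow>
     (\<exists>H. finite H \<and> (\<forall>(u, c)\<in>H. u \<in> int_lattice) \<and> \<sigma> = (\<Inter>(u, c)\<in>H. {x. u \<bullet> x \<le> c}))"

definition lin_space :: "(real ^ 'n) set \<Rightarrow> (real ^ 'n) set" where
  "lin_space \<sigma> = span {x - y | x y. x \<in> \<sigma> \<and> y \<in> \<sigma>}"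

definition lattice_of :: "(real ^ 'n) set \<Rightarrow> (real ^ 'n) set" where
  "lattice_of \<sigma> = int_lattice \<inter> lin_space \<sigma>"

definition rat_span :: "(real ^ 'n) set \<Rightarrow> (real ^ 'n) set" where
  "rat_span S = {\<Sum>w\<in>F. of_rat (c w) *\<^sub>R w | F c. finite F \<and> F \<subseteq> S}"

definition pointwise_diff :: "(real ^ 'n) set \<Rightarrow> (real ^ 'n) set \<Rightarrow> (real ^ 'n) set" where
  "pointwise_diff S T = {s - t | s t. s \<in> S \<and> t \<in> T}"


section \<open>Weighted polyhedral complexes\<close>

text \<open>Cells are nonempty, although \<^term>\<open>{}\<close> is a face of every set in the sense of \<open>face_of\<close>.\<close>

definition polyhedral_complex :: "(real ^ 'n) set set \<Rightarrow> bool" where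
  "polyhedral_complex C \<longleftrightarrow>
     finite C \<and>
     (\<forall>\<sigma>\<in>C. rational_polyhedron \<sigma> \<and> \<sigma> \<noteq> {}) \<and>
     (\<forall>\<sigma>\<in>C. \<forall>\<phi>. \<phi> face_of \<sigma> \<and> \<phi> \<noteq> {} \<longrightarrow> \<phi> \<in> C) \<and>
     (\<forall>\<sigma>\<in>C. \<forall>\<tau>\<in>C. (\<sigma> \<inter> \<tau>) face_of \<sigma> \<and> (\<sigma> \<inter> \<tau>) face_of \<tau>)"

definition facets :: "'a set set \<Rightarrow> 'a set set" where
  "facets C = {\<sigma>\<in>C. \<forall>\<rho>\<in>C. \<sigma> \<subseteq> \<rho> \<longrightarrow> \<rho> = \<sigma>}"

definition ridges :: "(real ^ 'n) set set \<Rightarrow> (real ^ 'n) set set" where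
  "ridges C = {\<tau>. \<exists>\<sigma>\<in>facets C. \<tau> facet_of \<sigma>}"

text \<open>
  Dimensions are integers, so for \<open>p > n\<close> only the empty complex is pure of codimension \<open>p\<close>;
  the empty complex is pure of every codimension.
\<close>

definition pure_codim :: "nat \<Rightarrow> (real ^ 'n) set set \<Rightarrow> bool" where
  "pure_codim p C \<longleftrightarrow> (\<forall>\<sigma>\<in>facets C. aff_dim \<sigma> = int CARD('n) - int p)"

text \<open>The values of \<open>facet_mult\<close> at sets that are not facets are irrelevant.\<close>

record 'a weighted_complex =
  cells :: "'a set set"
  facet_mult :: "'a set \<Rightarrow> rat"

definition positive :: "'a weighted_complex \<Rightarrow> bool" where
  "positive X \<longleftrightarrow> (\<forall>\<sigma>\<in>facets (cells X). facet_mult X \<sigma> > 0)"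

definition support :: "'a weighted_complex \<Rightarrow> 'a set" where
  "support X = \<Union>{\<sigma>\<in>facets (cells X). facet_mult X \<sigma> \<noteq> 0}"


section \<open>Links\<close>

definition link :: "real ^ 'n \<Rightarrow> (real ^ 'n) set \<Rightarrow> (real ^ 'n) set" where
  "link \<omega> \<sigma> = {u. eventually (\<lambda>\<epsilon>. \<omega> + \<epsilon> *\<^sub>R u \<in> \<sigma>) (at_right 0)}"

definition link_at :: "real ^ 'n \<Rightarrow> (real ^ 'n) weighted_complex \<Rightarrow> (real ^ 'n) weighted_complex" where
  "link_at \<omega> X =
     \<lparr> cells = link \<omega> ` {\<sigma>\<in>cells X. \<omega> \<in> \<sigma>},
       facet_mult = (\<lambda>\<kappa>. facet_mult X (the_inv_into {\<sigma>\<in>cells X. \<omega> \<in> \<sigma>} (link \<omega>) \<kappa>)) \<rparr>"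

definition link_cell :: "(real ^ 'n) set \<Rightarrow> (real ^ 'n) weighted_complex \<Rightarrow> (real ^ 'n) weighted_complex" where
  "link_cell \<gamma> X = link_at (SOME \<omega>. \<omega> \<in> rel_interior \<gamma>) X"


section \<open>Tropical cycles\<close>

definition primitive_normal :: "(real ^ 'n) set \<Rightarrow> (real ^ 'n) set \<Rightarrow> real ^ 'n \<Rightarrow> bool" where
  "primitive_normal \<tau> \<sigma> v \<longleftrightarrow>
     (\<forall>\<omega>\<in>rel_interior \<tau>. v \<in> link \<omega> \<sigma>) \<and>
     lattice_of \<sigma> = {w + of_int a *\<^sub>R v | w a. w \<in> lattice_of \<tau>}"

definition balanced_at :: "(real ^ 'n) weighted_complex \<Rightarrow> (real ^ 'n) set \<Rightarrow> bool" where
  "balanced_at X \<tau> \<longleftrightarrow>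
     (\<exists>v. (\<forall>\<sigma>\<in>facets (cells X). \<tau> \<subseteq> \<sigma> \<longrightarrow> primitive_normal \<tau> \<sigma> (v \<sigma>)) \<and>
          (\<Sum>\<sigma> | \<sigma> \<in> facets (cells X) \<and> \<tau> \<subseteq> \<sigma>. of_rat (facet_mult X \<sigma>) *\<^sub>R v \<sigma>)
            \<in> rat_span (lattice_of \<tau>))"

definition tropical_cycle :: "nat \<Rightarrow> (real ^ 'n) weighted_complex \<Rightarrow> bool" where
  "tropical_cycle p X \<longleftrightarrow>
     polyhedral_complex (cells X) \<and> pure_codim p (cells X) \<and> (\<forall>\<tau>\<in>ridges (cells X). balanced_at X \<tau>)"


section \<open>Equality and linear combinations of cycles\<close>

definition drop_zero :: "'a weighted_complex \<Rightarrow> 'a weighted_complex" where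
  "drop_zero X =
     X \<lparr> cells := {\<tau>\<in>cells X. \<exists>\<sigma>\<in>facets (cells X). facet_mult X \<sigma> \<noteq> 0 \<and> \<tau> \<subseteq> \<sigma>} \<rparr>"

definition refines :: "'a weighted_complex \<Rightarrow> 'a weighted_complex \<Rightarrow> bool" where
  "refines Z X \<longleftrightarrow>
     \<Union>(cells Z) = \<Union>(cells X) \<and>
     (\<forall>\<sigma>\<in>cells Z. \<exists>\<rho>\<in>cells X. \<sigma> \<subseteq> \<rho>) \<and>
     (\<forall>\<sigma>\<in>facets (cells Z). \<forall>\<rho>\<in>facets (cells X). \<sigma> \<subseteq> \<rho> \<longrightarrow> facet_mult Z \<sigma> = facet_mult X \<rho>)"

definition cycle_eq :: "(real ^ 'n) weighted_complex \<Rightarrow> (real ^ 'n) weighted_complex \<Rightarrow> bool" where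
  "cycle_eq X Y \<longleftrightarrow>
     (\<exists>Z. polyhedral_complex (cells Z) \<and> refines Z (drop_zero X) \<and> refines Z (drop_zero Y))"

text \<open>
  For a cell \<open>\<sigma>\<close> of full dimension in a subdivision of \<open>X\<close>, the sum has at most one term: the
  multiplicity of the facet of \<open>X\<close> containing \<open>\<sigma>\<close>, or \<open>0\<close> if \<open>\<sigma>\<close> lies outside \<open>X\<close>.
\<close>

definition mult_on :: "'a weighted_complex \<Rightarrow> 'a set \<Rightarrow> rat" where
  "mult_on X \<sigma> = (\<Sum>\<rho> | \<rho> \<in> facets (cells X) \<and> \<sigma> \<subseteq> \<rho>. facet_mult X \<rho>)"

text \<open>
  \<open>lincomb ts Z\<close>: the weighted complex \<open>Z\<close> represents the cycle sum of the \<open>a X\<close> with \<open>(a, X)\<close> in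
  \<open>ts\<close>. Its cells subdivide the union of all the \<open>X\<close>, compatibly with every cell of every \<open>X\<close>, and
  multiplicities are added on overlaps. Facets of multiplicity \<open>0\<close> may arise by cancellation.
\<close>

definition lincomb :: "(rat \<times> (real ^ 'n) weighted_complex) list \<Rightarrow> (real ^ 'n) weighted_complex \<Rightarrow> bool" where
  "lincomb ts Z \<longleftrightarrow>
     polyhedral_complex (cells Z) \<and>
     \<Union>(cells Z) = (\<Union>(a, X)\<in>set ts. \<Union>(cells X)) \<and>
     (\<forall>(a, X)\<in>set ts. \<forall>\<rho>\<in>cells X. \<rho> = \<Union>{\<sigma>\<in>cells Z. \<sigma> \<subseteq> \<rho>}) \<and>
     (\<forall>\<sigma>\<in>facets (cells Z). facet_mult Z \<sigma> = (\<Sum>(a, X)\<leftarrow>ts. a * mult_on X \<sigma>))"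


section \<open>Stable intersection\<close>

definition stable_support :: "(real ^ 'n) weighted_complex \<Rightarrow> (real ^ 'n) weighted_complex \<Rightarrow> (real ^ 'n) set" where
  "stable_support X Y =
     {\<omega>. pointwise_diff (support (link_at \<omega> X)) (support (link_at \<omega> Y)) = UNIV}"

text \<open>
  The index \<open>[N : N\<^sub>\<sigma> + N\<^sub>\<tau>]\<close> as the number of cosets. It is only used when \<open>\<sigma> - \<tau>\<close> has full
  dimension, and is then finite.
\<close>

definition lattice_index :: "(real ^ 'n) set \<Rightarrow> (real ^ 'n) set \<Rightarrow> nat" where
  "lattice_index \<sigma> \<tau> =
     card ((\<lambda>x. {x + a + b | a b. a \<in> lattice_of \<sigma> \<and> b \<in> lattice_of \<tau>}) ` int_lattice)"

text \<open>Generic means outside all the cones \<open>\<sigma> - \<tau>\<close> that are not of full dimension.\<close>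

definition generic :: "(real ^ 'n) weighted_complex \<Rightarrow> (real ^ 'n) weighted_complex \<Rightarrow> real ^ 'n \<Rightarrow> bool" where
  "generic X Y v \<longleftrightarrow>
     (\<forall>\<sigma>\<in>cells X. \<forall>\<tau>\<in>cells Y.
        v \<in> pointwise_diff \<sigma> \<tau> \<longrightarrow> aff_dim (pointwise_diff \<sigma> \<tau>) = int CARD('n))"

definition displacement_mult ::
  "(real ^ 'n) weighted_complex \<Rightarrow> (real ^ 'n) weighted_complex \<Rightarrow> real ^ 'n \<Rightarrow> rat" where
  "displacement_mult X Y v =
     (\<Sum>(\<sigma>, \<tau>) | \<sigma> \<in> facets (cells X) \<and> \<tau> \<in> facets (cells Y) \<and> v \<in> pointwise_diff \<sigma> \<tau>.
        facet_mult X \<sigma> * facet_mult Y \<tau> * of_nat (lattice_index \<sigma> \<tau>))"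

text \<open>The stable intersection of cycles with positive multiplicities.\<close>

definition stable_intersection ::
  "(real ^ 'n) weighted_complex \<Rightarrow> (real ^ 'n) weighted_complex \<Rightarrow> (real ^ 'n) weighted_complex" where
  "stable_intersection X Y =
     \<lparr> cells = {\<gamma>. (\<exists>\<sigma>\<in>cells X. \<exists>\<tau>\<in>cells Y. \<gamma> = \<sigma> \<inter> \<tau>) \<and> \<gamma> \<noteq> {} \<and> \<gamma> \<subseteq> stable_support X Y},
       facet_mult = (\<lambda>\<gamma>. displacement_mult (link_cell \<gamma> X) (link_cell \<gamma> Y)
          (SOME v. generic (link_cell \<gamma> X) (link_cell \<gamma> Y) v)) \<rparr>"

text \<open>
  The bilinear extension to arbitrary cycles, as a relation: \<open>W\<close> represents \<open>X \<cdot> Y\<close> if it is obtained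
  from some expressions of \<open>X\<close> and \<open>Y\<close> as linear combinations of cycles with positive
  multiplicities. Nothing is presupposed about the dimension of \<open>W\<close> or about balancing.
\<close>

definition positive_decomposition ::
  "nat \<Rightarrow> (real ^ 'n) weighted_complex \<Rightarrow> (rat \<times> (real ^ 'n) weighted_complex) list \<Rightarrow> bool" where
  "positive_decomposition p X ts \<longleftrightarrow>
     (\<forall>(a, X')\<in>set ts. tropical_cycle p X' \<and> positive X') \<and> (\<exists>Z. lincomb ts Z \<and> cycle_eq Z X)"

definition stable_product ::
  "nat \<Rightarrow> nat \<Rightarrow> (real ^ 'n) weighted_complex \<Rightarrow> (real ^ 'n) weighted_complex \<Rightarrow> (real ^ 'n) weighted_complex \<Rightarrow> bool" where
  "stable_product p q X Y W \<longleftrightarrow>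
     (\<exists>xs ys. positive_decomposition p X xs \<and> positive_decomposition q Y ys \<and>
        lincomb [(a * b, stable_intersection X' Y'). (a, X') \<leftarrow> xs, (b, Y') \<leftarrow> ys] W)"

end

theory Submission
  imports Defs
begin

text \<open>
  The product \<open>X \<cdot> Y\<close> is the intersection of \<open>X \<times> Y\<close> with the diagonal. Everything rests on one fact about a
  balanced complex \<open>E\<close> and a rational subspace \<open>M\<close>: the degree of the projection of \<open>E\<close> along \<open>M\<close>, that is, the
  sum of \<open>m s * [N : N\<^sub>s + (M \<inter> N)]\<close> over the facets \<open>s\<close> with \<open>z \<in> s + M\<close>, does not depend on the generic
  point \<open>z\<close>. It can change only across the images \<open>\<rho> + M\<close> of ridges, where balancing at \<open>\<rho>\<close> makes both sides agree,
  and generic points can be joined by paths that avoid everything of codimension at least 2.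

  For the links of \<open>X \<times> Y\<close> and the diagonal this is the independence of the multiplicities from the generic
  displacement. For positive multiplicities the degree vanishes everywhere or nowhere, so a single pair of transversal
  facets through a point already puts it into the support, which is thus the union of the intersections of
  transversal facets and pure. Balancing at a ridge \<open>R\<close> is tested against the integral functionals \<open>f\<close> vanishing
  on \<open>R\<close>: for the subspace of the diagonal given by \<open>f = 0\<close>, the degree at a generic point near \<open>f = 1\<close> is the
  sum of multiplicity times \<open>f\<close>-height of the primitive normals over the facets on the positive side, and likewise for
  \<open>f = - 1\<close>.

  Linear combinations of cycles are subdivided by a hyperplane arrangement, and balancing passes to
  subdivisions and sums. Adding large multiples of the affine spans of the facets writes every cycle as a
  difference of cycles with positive multiplicities.
\<close>

section \<open>Directions of convex sets\<close>

text \<open>The degree theorem is applied three times, and only the subspace \<open>M\<close> of the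
  product changes: the whole diagonal for the multiplicities, the diagonal over a complement of the
  common directions of one transversal pair for the support, the diagonal over the kernel of
  \<open>f\<close> for balancing. The links need not be pointed; the theorem allows invariance under
  a subspace \<open>K\<close> of \<open>M\<close>, for the multiplicities and for balancing the
  diagonal copy of the directions of the cell at which the link is taken. Hence the dimension
  hypothesis: dim E + dim M exceeds the ambient dimension by exactly dim K. A facet \<open>s\<close>
  whose image fills the space is then mapped injectively modulo \<open>K\<close>, which makes
  \<open>s + M\<close> closed and its faces images of faces of \<open>s\<close>. For balancing, a
  point near height 1 must be generic for the projection at the ridge, while the count there has to
  split into the displacement counts of the adjacent facets. A displacement by a small multiple of a
  pair \<open>(d1, d2)\<close> achieves both: the pair is generic in the product, and
  \<open>d1 - d2\<close> avoids all nontransversal sums of direction spaces, a condition independent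
  of the point at which links are taken.\<close>

definition dirs :: "'a::euclidean_space set \<Rightarrow> 'a set" where
  "dirs S = span {x - y | x y. x \<in> S \<and> y \<in> S}"

lemma subspace_dirs [simp, intro]: "subspace (dirs S)"
  by (simp add: dirs_def)

lemma diff_in_dirs: "x \<in> S \<Longrightarrow> y \<in> S \<Longrightarrow> x - y \<in> dirs S"
  unfolding dirs_def by (rule span_base) blast

lemma dirs_mono: "S \<subseteq> T \<Longrightarrow> dirs S \<subseteq> dirs T"
  unfolding dirs_def by (rule span_mono) blast

lemma dirs_subset:
  assumes "subspace T" "x \<in> S" "\<And>y. y \<in> S \<Longrightarrow> y - x \<in> T"
  shows "dirs S \<subseteq> T"
proof -
  have "a - b \<in> T" if "a \<in> S" "b \<in> S" for a b
    using subspace_diff[OF assms(1) assms(3)[OF that(1)] assms(3)[OF that(2)]] by simp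
  then show ?thesis
    unfolding dirs_def by (intro span_minimal assms(1)) blast
qed

lemma affine_hull_dirs:
  assumes "x \<in> S"
  shows "affine hull S = {y. y - x \<in> dirs S}"
proof (rule hull_unique)
  show "S \<subseteq> {y. y - x \<in> dirs S}"
    using assms by (auto intro: diff_in_dirs)
  show "affine {y. y - x \<in> dirs S}"
    unfolding affine_def
  proof (intro ballI allI impI)
    fix a b and u v :: real
    assume a: "a \<in> {y. y - x \<in> dirs S}" "b \<in> {y. y - x \<in> dirs S}" and uv: "u + v = 1"
    have "u *\<^sub>R a + v *\<^sub>R b - x = u *\<^sub>R (a - x) + v *\<^sub>R (b - x)"
      using uv by (simp add: algebra_simps flip: scaleR_add_left)
    then show "u *\<^sub>R a + v *\<^sub>R b \<in> {y. y - x \<in> dirs S}"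
      using a by (simp add: subspace_add subspace_scale)
  qed
  fix t assume t: "S \<subseteq> t" "affine t"
  have "{d. x + d \<in> t} = (\<lambda>y. y - x) ` t"
    by (auto simp: image_iff algebra_simps intro!: bexI[of _ "x + _"])
  then have sub: "subspace {d. x + d \<in> t}"
    using affine_diffs_subspace_subtract[OF t(2), of x] t(1) assms by auto
  have "dirs S \<subseteq> {d. x + d \<in> t}"
    by (rule dirs_subset[OF sub assms]) (use t in auto)
  then show "{y. y - x \<in> dirs S} \<subseteq> t"
    by force
qed

lemma dim_dirs: "S \<noteq> {} \<Longrightarrow> aff_dim S = int (dim (dirs S))"
proof -
  assume "S \<noteq> {}"
  then obtain x where x: "x \<in> S" by blast
  have "(\<lambda>y. y - x) ` S \<subseteq> dirs S" using x by (auto intro: diff_in_dirs)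
  moreover have "dirs S \<subseteq> span ((\<lambda>y. y - x) ` S)"
    by (rule dirs_subset[OF _ x]) (auto intro: span_base)
  ultimately have "span ((\<lambda>y. y - x) ` S) = dirs S"
    by (metis span_minimal subset_antisym subspace_dirs)
  then have "dim (dirs S) = dim ((\<lambda>y. y - x) ` S)"
    by (metis dim_span)
  then show ?thesis
    using aff_dim_eq_dim_subtract[of x S] x by (simp add: hull_inc)
qed

lemma dirs_translate_subset:
  assumes "subspace T" "x \<in> S" "\<And>d. d \<in> T \<Longrightarrow> \<exists>e>0. x + e *\<^sub>R d \<in> S"
  shows "T \<subseteq> dirs S"
proof
  fix d assume "d \<in> T"
  then obtain e where "e > 0" "x + e *\<^sub>R d \<in> S" using assms(3) by blast
  then have "e *\<^sub>R d \<in> dirs S" using diff_in_dirs[of "x + e *\<^sub>R d" S x] assms(2) by simp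
  then show "d \<in> dirs S" using \<open>e > 0\<close> subspace_scale[OF subspace_dirs, of "e *\<^sub>R d" S "1/e"] by simp
qed

lemma rel_interior_dirs:
  assumes "x \<in> rel_interior S" "d \<in> dirs S"
  shows "\<exists>e>0. \<forall>t. \<bar>t\<bar> \<le> e \<longrightarrow> x + t *\<^sub>R d \<in> S"
proof -
  obtain e where e: "e > 0" "x \<in> S" "cball x e \<inter> affine hull S \<subseteq> S"
    using assms(1) by (auto simp: mem_rel_interior_cball)
  have "x + t *\<^sub>R d \<in> S" if "\<bar>t\<bar> \<le> e / (norm d + 1)" for t
  proof -
    have "norm (t *\<^sub>R d) \<le> e / (norm d + 1) * norm d"
      unfolding norm_scaleR using that by (intro mult_right_mono) auto
    also have "\<dots> \<le> e"
      using e(1) by (simp add: divide_simps mult_left_mono add_nonneg_pos)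
    finally have "x + t *\<^sub>R d \<in> cball x e"
      by (simp add: dist_norm)
    moreover have "x + t *\<^sub>R d \<in> affine hull S"
      using assms(2) by (simp add: affine_hull_dirs[OF e(2)] subspace_scale)
    ultimately show ?thesis using e by blast
  qed
  moreover have "e / (norm d + 1) > 0" using e(1) by (simp add: add_nonneg_pos)
  ultimately show ?thesis by blast
qed

lemma rel_interiorI_dirs:
  assumes "x \<in> S" "e > 0" "\<And>d. d \<in> dirs S \<Longrightarrow> norm d < e \<Longrightarrow> x + d \<in> S"
  shows "x \<in> rel_interior S"
proof -
  have "y \<in> S" if "y \<in> ball x e" "y \<in> affine hull S" for y
    using assms(3)[of "y - x"] that by (simp add: affine_hull_dirs[OF assms(1)] dist_norm norm_minus_commute)
  then show ?thesis using assms by (auto simp: mem_rel_interior_ball)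
qed

lemma dirs_Times:
  assumes "S \<noteq> {}" "T \<noteq> {}"
  shows "dirs (S \<times> T) = dirs S \<times> dirs T"
proof
  obtain x y where x: "x \<in> S" "y \<in> T" using assms by blast
  show "dirs (S \<times> T) \<subseteq> dirs S \<times> dirs T"
    by (rule dirs_subset[of _ "(x,y)"]) (use x in \<open>auto intro: diff_in_dirs subspace_Times\<close>)
  have 1: "dirs S \<subseteq> {d. (d, 0) \<in> dirs (S \<times> T)}"
  proof (rule dirs_subset[OF _ x(1)])
    show "subspace {d. (d, 0) \<in> dirs (S \<times> T)}"
    proof -
      have "linear (\<lambda>d::'a. (d, 0::'b))" by (auto intro!: linearI)
      from linear_subspace_vimage[OF this subspace_dirs] show ?thesis by (simp add: vimage_def)
    qed
    show "z - x \<in> {d. (d, 0) \<in> dirs (S \<times> T)}" if "z \<in> S" for z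
      using diff_in_dirs[of "(z,y)" "S \<times> T" "(x,y)"] that x by simp
  qed
  have 2: "dirs T \<subseteq> {d. (0, d) \<in> dirs (S \<times> T)}"
  proof (rule dirs_subset[OF _ x(2)])
    show "subspace {d. (0, d) \<in> dirs (S \<times> T)}"
    proof -
      have "linear (\<lambda>d::'b. (0::'a, d))" by (auto intro!: linearI)
      from linear_subspace_vimage[OF this subspace_dirs] show ?thesis by (simp add: vimage_def)
    qed
    show "z - y \<in> {d. (0, d) \<in> dirs (S \<times> T)}" if "z \<in> T" for z
      using diff_in_dirs[of "(x,z)" "S \<times> T" "(x,y)"] that x by simp
  qed
  show "dirs S \<times> dirs T \<subseteq> dirs (S \<times> T)"
  proof clarify
    fix a b assume "a \<in> dirs S" "b \<in> dirs T"
    then have "(a,0) + (0,b) \<in> dirs (S \<times> T)" using 1 2 by (intro subspace_add) auto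
    then show "(a,b) \<in> dirs (S \<times> T)" by simp
  qed
qed

section \<open>Avoiding finitely many affine subspaces\<close>

lemma affine_line_at_most_one:
  assumes "affine A" "x + s *\<^sub>R d \<in> A" "x + t *\<^sub>R d \<in> A" "s \<noteq> t"
  shows "x + r *\<^sub>R d \<in> A"
proof -
  define c where "c = (r - s) / (t - s)"
  have cs: "c * (t - s) = r - s" using assms(4) by (simp add: c_def)
  have "(1 - c) *\<^sub>R (x + s *\<^sub>R d) + c *\<^sub>R (x + t *\<^sub>R d) \<in> A"
    using assms by (intro mem_affine) auto
  moreover have "(1 - c) *\<^sub>R (x + s *\<^sub>R d) + c *\<^sub>R (x + t *\<^sub>R d) = x + (s + c * (t - s)) *\<^sub>R d"
    by (simp add: algebra_simps)
  ultimately show ?thesis by (simp add: cs)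
qed

text \<open>A line not contained in an affine set meets it at most once. Generic choices below are
  all made by moving along such a line.\<close>

lemma segment_finite_bad:
  assumes "finite \<A>" "\<And>A. A \<in> \<A> \<Longrightarrow> affine A" "\<And>A. A \<in> \<A> \<Longrightarrow> \<exists>t. x + t *\<^sub>R d \<notin> A"
  shows "finite {t::real. \<exists>A\<in>\<A>. x + t *\<^sub>R d \<in> A}"
proof -
  have "finite {t. x + t *\<^sub>R d \<in> A}" if A: "A \<in> \<A>" for A
  proof (cases "\<exists>s. x + s *\<^sub>R d \<in> A")
    case True
    then obtain s where s: "x + s *\<^sub>R d \<in> A" by blast
    then have "{t. x + t *\<^sub>R d \<in> A} \<subseteq> {s}"
      using affine_line_at_most_one[OF assms(2)[OF A] s] assms(3)[OF A] by blast
    then show ?thesis by (rule finite_subset) simp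
  qed auto
  then have "finite (\<Union>A\<in>\<A>. {t. x + t *\<^sub>R d \<in> A})" using assms(1) by blast
  moreover have "{t. \<exists>A\<in>\<A>. x + t *\<^sub>R d \<in> A} = (\<Union>A\<in>\<A>. {t. x + t *\<^sub>R d \<in> A})" by blast
  ultimately show ?thesis by simp
qed

lemma infinite_real_interval_minus_finite:
  assumes "finite B" "0 < (e::real)"
  shows "\<exists>t. 0 < t \<and> t < e \<and> t \<notin> B"
proof (rule ccontr)
  assume "\<not> ?thesis"
  then have "{0<..<e} \<subseteq> B" by auto
  then show False using assms finite_subset infinite_Ioo by blast
qed

text \<open>Induction on the family: a point \<open>y0\<close> avoiding the earlier members is moved
  towards a point \<open>y1\<close> outside the new one, and all but finitely many points of the
  segment between them avoid every member.\<close>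

lemma convex_avoid_affine:
  assumes "convex S" "S \<noteq> {}" "finite \<A>" "\<And>A. A \<in> \<A> \<Longrightarrow> affine A \<and> \<not> S \<subseteq> A"
  shows "\<exists>y\<in>S. \<forall>A\<in>\<A>. y \<notin> A"
  using assms(3,4)
proof (induction \<A>)
  case empty
  then show ?case using assms(2) by auto
next
  case (insert A \<A>)
  then obtain y0 where y0: "y0 \<in> S" "\<forall>A\<in>\<A>. y0 \<notin> A" by auto
  obtain y1 where y1: "y1 \<in> S" "y1 \<notin> A" using insert.prems by blast
  have "finite {t::real. \<exists>B\<in>insert A \<A>. y0 + t *\<^sub>R (y1 - y0) \<in> B}"
  proof (rule segment_finite_bad)
    fix B assume B: "B \<in> insert A \<A>"
    show "\<exists>t. y0 + t *\<^sub>R (y1 - y0) \<notin> B"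
    proof (cases "B = A")
      case True
      then show ?thesis using y1 by (intro exI[of _ 1]) simp
    next
      case False
      then show ?thesis using y0 B by (intro exI[of _ 0]) simp
    qed
  qed (use insert in auto)
  from infinite_real_interval_minus_finite[OF this, of 1]
  obtain t where t: "0 < t" "t < 1" "\<forall>B\<in>insert A \<A>. y0 + t *\<^sub>R (y1 - y0) \<notin> B" by auto
  have "y0 + t *\<^sub>R (y1 - y0) = (1 - t) *\<^sub>R y0 + t *\<^sub>R y1" by (simp add: algebra_simps)
  then have "y0 + t *\<^sub>R (y1 - y0) \<in> S"
    using assms(1) y0 y1 t by (simp add: convexD)
  then show ?case using t by blast
qed

text \<open>An avoiding point somewhere in \<open>S\<close> is enough: on the segment from
  \<open>x\<close> towards it only finitely many points are bad, so good ones occur arbitrarily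
  close to \<open>x\<close>.\<close>

lemma convex_avoid_affine_near:
  fixes S :: "'a::real_normed_vector set"
  assumes "convex S" "x \<in> S" "finite \<A>" "\<And>A. A \<in> \<A> \<Longrightarrow> affine A \<and> \<not> S \<subseteq> A" "e > 0"
  shows "\<exists>y\<in>S. dist x y < e \<and> (\<forall>A\<in>\<A>. y \<notin> A)"
proof -
  obtain y where y: "y \<in> S" "\<forall>A\<in>\<A>. y \<notin> A"
    using convex_avoid_affine[OF assms(1) _ assms(3,4)] assms(2) by blast
  have "finite {t::real. \<exists>B\<in>\<A>. x + t *\<^sub>R (y - x) \<in> B}"
  proof (rule segment_finite_bad)
    show "\<exists>t. x + t *\<^sub>R (y - x) \<notin> B" if "B \<in> \<A>" for B
      using y that by (intro exI[of _ 1]) simp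
  qed (use assms in auto)
  from infinite_real_interval_minus_finite[OF this, of "min 1 (e / (norm (y - x) + 1))"]
  obtain t where t: "0 < t" "t < 1" "t < e / (norm (y - x) + 1)" "\<forall>B\<in>\<A>. x + t *\<^sub>R (y - x) \<notin> B"
    using assms(5) by (auto simp: add_nonneg_pos)
  have "x + t *\<^sub>R (y - x) = (1 - t) *\<^sub>R x + t *\<^sub>R y" by (simp add: algebra_simps)
  then have "x + t *\<^sub>R (y - x) \<in> S"
    using assms y t by (simp add: convexD)
  moreover have "dist x (x + t *\<^sub>R (y - x)) < e"
  proof -
    have "t * norm (y - x) \<le> t * (norm (y - x) + 1)" using t by simp
    also have "\<dots> < e" using t(3) pos_less_divide_eq[of "norm (y - x) + 1" t e] by (simp add: add_nonneg_pos)
    finally show ?thesis using t by (simp add: dist_norm)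
  qed
  ultimately show ?thesis using t by blast
qed

lemma convex_cover_full:
  fixes S :: "'a::real_normed_vector set"
  assumes "convex S" "S \<subseteq> \<Union>\<T>" "finite \<T>" "\<And>T. T \<in> \<T> \<Longrightarrow> closed T"
  shows "S \<subseteq> \<Union>{T\<in>\<T>. S \<subseteq> affine hull T}"
proof
  fix x assume x: "x \<in> S"
  let ?U = "\<Union>{T\<in>\<T>. S \<subseteq> affine hull T}"
  have "closed ?U" using assms by (intro closed_Union) auto
  moreover have "\<exists>y\<in>?U. dist y x < e" if "e > 0" for e
  proof -
    have "\<exists>y\<in>S. dist x y < e \<and> (\<forall>A\<in>(\<lambda>T. affine hull T) ` {T\<in>\<T>. \<not> S \<subseteq> affine hull T}. y \<notin> A)"
      by (rule convex_avoid_affine_near) (use assms x that in auto)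
    then obtain y where y: "y \<in> S" "dist x y < e" "\<And>T. T \<in> \<T> \<Longrightarrow> \<not> S \<subseteq> affine hull T \<Longrightarrow> y \<notin> affine hull T"
      by auto
    then obtain T where "T \<in> \<T>" "y \<in> T" using assms(2) by blast
    then have "y \<in> ?U" using y(3)[of T] hull_inc[of y T affine] by blast
    then show ?thesis using y(2) by (intro bexI[of _ y]) (auto simp: dist_commute)
  qed
  ultimately show "x \<in> ?U" by (metis closed_approachable)
qed

text \<open>Local shape of a convex set \<open>Q\<close> at a relatively interior point
  \<open>z\<close> of a wall \<open>P\<close>: a single point \<open>b\<close> strictly above the
  wall forces a whole half-ball into \<open>Q\<close>, because a nearby \<open>y\<close> is a convex
  combination of \<open>b\<close> and a point \<open>z + h\<close> of \<open>P\<close>. The subspace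
  \<open>D\<close> allows the same statement inside the span of a cell of smaller dimension.\<close>

lemma half_ball_in_convex:
  assumes "convex Q" "P \<subseteq> Q" "z \<in> rel_interior P" "\<And>y. u \<bullet> (y - z) = 0 \<Longrightarrow> y - z \<in> D \<Longrightarrow> y \<in> affine hull P"
    "b \<in> Q" "u \<bullet> b > u \<bullet> z" "b - z \<in> D" "subspace D"
  shows "\<exists>e>0. \<forall>y. dist z y < e \<and> y - z \<in> D \<and> u \<bullet> y \<ge> u \<bullet> z \<longrightarrow> y \<in> Q"
proof -
  obtain e where e: "e > 0" "z \<in> P" "ball z e \<inter> affine hull P \<subseteq> P"
    using assms(3) by (auto simp: mem_rel_interior_ball)
  define k where "k = u \<bullet> (b - z)"
  have k: "k > 0" using assms(6) by (simp add: k_def inner_diff_right)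
  define C where "C = norm u / k"
  have C: "C \<ge> 0" using k by (simp add: C_def)
  \<comment> \<open>The first bound keeps the weight \<open>t\<close> of \<open>b\<close> at most
    1/2, the second keeps the norm of \<open>h\<close> below \<open>e\<close>, so that
    \<open>z + h\<close> still lies in \<open>P\<close>.\<close>
  define d where "d = min (1 / (2 * (C + 1))) (e / (2 * (1 + C * norm (b - z)) + 1))"
  have pos: "2 * (1 + C * norm (b - z)) + 1 > 0" using mult_nonneg_nonneg[OF C norm_ge_zero, of "b - z"]
    by (simp add: algebra_simps)
  have d: "d > 0" using e(1) C pos by (simp add: d_def)
  have "y \<in> Q" if y: "dist z y < d" "y - z \<in> D" "u \<bullet> y \<ge> u \<bullet> z" for y
  proof -
    define t where "t = u \<bullet> (y - z) / k"
    have ny: "norm (y - z) < d" using y(1) by (simp add: dist_norm norm_minus_commute)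
    have t0: "t \<ge> 0" using y(3) k by (simp add: t_def inner_diff_right)
    have tC: "t \<le> C * norm (y - z)"
      using k norm_cauchy_schwarz[of u "y - z"] by (simp add: t_def C_def divide_right_mono)
    also have "C * norm (y - z) \<le> (C + 1) * d" using C ny by (intro mult_mono) auto
    also have "\<dots> \<le> (C + 1) * (1 / (2 * (C + 1)))" using C by (intro mult_left_mono) (auto simp: d_def)
    also have "\<dots> = 1/2" using C by simp
    finally have t2: "t \<le> 1/2" .
    define h where "h = (1 / (1 - t)) *\<^sub>R ((y - z) - t *\<^sub>R (b - z))"
    have h: "u \<bullet> h = 0" using k by (simp add: h_def inner_diff_right t_def flip: k_def)
        (simp add: k_def inner_diff_right)
    have hD: "h \<in> D" using assms(7,8) y(2) by (simp add: h_def subspace_scale subspace_diff)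
    have "norm h \<le> (1 / (1 - t)) * (norm (y - z) + t * norm (b - z))"
      unfolding h_def using t0 t2 norm_triangle_ineq4[of "y - z" "t *\<^sub>R (b - z)"]
      by (simp add: divide_right_mono)
    also have "\<dots> \<le> 2 * (norm (y - z) + C * norm (y - z) * norm (b - z))"
      using t0 t2 tC by (intro mult_mono add_mono mult_right_mono) (auto simp: field_simps intro: add_nonneg_nonneg)
    also have "\<dots> = 2 * (1 + C * norm (b - z)) * norm (y - z)" by (simp add: algebra_simps)
    also have "\<dots> \<le> 2 * (1 + C * norm (b - z)) * (e / (2 * (1 + C * norm (b - z)) + 1))"
      using ny C by (intro mult_left_mono) (auto simp: d_def)
    also have "\<dots> < e" using e(1) pos by (simp add: field_simps)
    finally have nh: "norm h < e" .
    have "z + h \<in> P"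
      using e(3) nh assms(4)[of "z + h"] h hD by (auto simp: dist_norm)
    then have "z + h \<in> Q" using assms(2) by blast
    then have "(1 - t) *\<^sub>R (z + h) + t *\<^sub>R b \<in> Q"
      using assms(1,5) t0 t2 by (intro convexD) auto
    also have "(1 - t) *\<^sub>R (z + h) + t *\<^sub>R b = y"
    proof -
      have "(1 - t) *\<^sub>R h = (y - z) - t *\<^sub>R (b - z)"
        using t2 by (simp add: h_def)
      then show ?thesis by (simp add: scaleR_right_distrib) (simp add: algebra_simps)
    qed
    finally show ?thesis .
  qed
  then show ?thesis using d by blast
qed

section \<open>Rational subspaces and lattice indices\<close>

text \<open>Like \<open>dirs\<close> for \<open>lin_space\<close>, this restates
  \<open>int_lattice\<close> over an arbitrary Euclidean space, because the argument also runs in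
  the product of \<open>real ^ 'n\<close> with itself.\<close>

definition zlat :: "'a::euclidean_space set" where
  "zlat = {x. \<forall>b\<in>Basis. x \<bullet> b \<in> \<int>}"

definition add_subgroup :: "'a::ab_group_add set \<Rightarrow> bool" where
  "add_subgroup B \<longleftrightarrow> 0 \<in> B \<and> (\<forall>x\<in>B. \<forall>y\<in>B. x - y \<in> B)"

lemma add_subgroup_0: "add_subgroup B \<Longrightarrow> 0 \<in> B"
  and add_subgroup_diff: "add_subgroup B \<Longrightarrow> x \<in> B \<Longrightarrow> y \<in> B \<Longrightarrow> x - y \<in> B"
  by (auto simp: add_subgroup_def)

lemma add_subgroup_minus: "add_subgroup B \<Longrightarrow> x \<in> B \<Longrightarrow> - x \<in> B"
  using add_subgroup_diff[of B 0 x] add_subgroup_0[of B] by simp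

lemma add_subgroup_add: "add_subgroup B \<Longrightarrow> x \<in> B \<Longrightarrow> y \<in> B \<Longrightarrow> x + y \<in> B"
  using add_subgroup_diff[of B x "- y"] add_subgroup_minus[of B y] by simp

lemma add_subgroup_sum:
  assumes "add_subgroup B" "\<And>i. i \<in> I \<Longrightarrow> f i \<in> B"
  shows "sum f I \<in> B"
  using assms(2)
proof (induction I rule: infinite_finite_induct)
  case (insert x F)
  then show ?case using add_subgroup_add[OF assms(1)] by auto
qed (use add_subgroup_0[OF assms(1)] in auto)

lemma add_subgroup_scale_nat:
  fixes B :: "'a::real_vector set"
  assumes "add_subgroup B" "x \<in> B"
  shows "real n *\<^sub>R x \<in> B"
proof (induction n)
  case (Suc n)
  then show ?case using add_subgroup_add[OF assms(1) Suc assms(2)]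
    by (simp add: algebra_simps)
qed (use add_subgroup_0[OF assms(1)] in auto)

lemma add_subgroup_scale_int:
  fixes B :: "'a::real_vector set"
  assumes "add_subgroup B" "x \<in> B"
  shows "real_of_int a *\<^sub>R x \<in> B"
proof (cases a rule: int_cases2)
  case (nonneg n)
  then show ?thesis using add_subgroup_scale_nat[OF assms] by simp
next
  case (nonpos n)
  then show ?thesis using add_subgroup_minus[OF assms(1) add_subgroup_scale_nat[OF assms]] by simp
qed

lemma subspace_imp_add_subgroup: "subspace S \<Longrightarrow> add_subgroup S"
  by (simp add: add_subgroup_def subspace_0 subspace_diff)

lemma add_subgroup_Int: "add_subgroup A \<Longrightarrow> add_subgroup B \<Longrightarrow> add_subgroup (A \<inter> B)"
  by (simp add: add_subgroup_def)

lemma add_subgroup_plus: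
  assumes "add_subgroup A" "add_subgroup B"
  shows "add_subgroup {a + b | a b. a \<in> A \<and> b \<in> B}"
  unfolding add_subgroup_def
proof (intro conjI ballI)
  have "0 + 0 \<in> {a + b | a b. a \<in> A \<and> b \<in> B}"
    using add_subgroup_0[OF assms(1)] add_subgroup_0[OF assms(2)] by blast
  then show "0 \<in> {a + b | a b. a \<in> A \<and> b \<in> B}" by simp
  fix x y assume "x \<in> {a + b | a b. a \<in> A \<and> b \<in> B}" "y \<in> {a + b | a b. a \<in> A \<and> b \<in> B}"
  then obtain a b a' b' where "x = a + b" "y = a' + b'" "a \<in> A" "b \<in> B" "a' \<in> A" "b' \<in> B" by blast
  then have "x - y = (a - a') + (b - b')" "a - a' \<in> A" "b - b' \<in> B"
    using assms by (auto simp: add_subgroup_diff)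
  then show "x - y \<in> {a + b | a b. a \<in> A \<and> b \<in> B}" by blast
qed

lemma add_subgroup_zlat [simp]: "add_subgroup zlat"
  by (auto simp: add_subgroup_def zlat_def inner_diff_left)

lemma Basis_subset_zlat: "Basis \<subseteq> zlat"
  by (auto simp: zlat_def inner_Basis)

lemma inner_zlat: "x \<in> zlat \<Longrightarrow> y \<in> zlat \<Longrightarrow> x \<bullet> y \<in> \<int>"
  by (subst euclidean_inner) (auto simp: zlat_def intro!: Ints_mult)

lemma zlat_Times: "(zlat :: ('a::euclidean_space \<times> 'b::euclidean_space) set) = zlat \<times> zlat"
  by (auto simp: zlat_def Basis_prod_def ball_Un image_iff inner_Pair)

lemma finite_zlat_cball: "finite (zlat \<inter> cball (0::'a::euclidean_space) R)"
proof -
  let ?f = "\<lambda>x::'a. restrict (\<lambda>b. \<lfloor>x \<bullet> b\<rfloor>) Basis"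
  have "inj_on ?f (zlat \<inter> cball 0 R)"
  proof (rule inj_onI)
    fix x y :: 'a
    assume x: "x \<in> zlat \<inter> cball 0 R" and y: "y \<in> zlat \<inter> cball 0 R" and eq: "?f x = ?f y"
    show "x = y"
    proof (rule euclidean_eqI)
      fix b :: 'a assume b: "b \<in> Basis"
      have "\<lfloor>x \<bullet> b\<rfloor> = \<lfloor>y \<bullet> b\<rfloor>" using fun_cong[OF eq, of b] b by simp
      moreover have "x \<bullet> b \<in> \<int>" "y \<bullet> b \<in> \<int>" using x y b by (auto simp: zlat_def)
      ultimately show "x \<bullet> b = y \<bullet> b" by (metis Ints_cases floor_of_int)
    qed
  qed
  moreover have "?f ` (zlat \<inter> cball 0 R) \<subseteq> (\<Pi>\<^sub>E b\<in>Basis. {\<lfloor>-R\<rfloor>..\<lfloor>R\<rfloor>})"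
  proof (clarsimp simp: PiE_iff)
    fix x b :: 'a assume "norm x \<le> R" "b \<in> Basis"
    then have "\<bar>x \<bullet> b\<bar> \<le> R" using Basis_le_norm order_trans by blast
    then show "\<lfloor>- R\<rfloor> \<le> \<lfloor>x \<bullet> b\<rfloor> \<and> \<lfloor>x \<bullet> b\<rfloor> \<le> \<lfloor>R\<rfloor>"
      by (intro conjI floor_mono) auto
  qed
  moreover have "finite (\<Pi>\<^sub>E b\<in>(Basis::'a set). {\<lfloor>-R\<rfloor>..\<lfloor>R\<rfloor>})"
    by (intro finite_PiE) auto
  ultimately show ?thesis by (meson finite_imageD finite_subset)
qed

section \<open>Rational subspaces\<close>

definition rational_subspace :: "'a::euclidean_space set \<Rightarrow> bool" where
  "rational_subspace S \<longleftrightarrow> subspace S \<and> S \<subseteq> span (S \<inter> zlat)"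

lemma rational_subspaceD: "rational_subspace S \<Longrightarrow> subspace S"
  by (simp add: rational_subspace_def)

lemma span_rational: "rational_subspace S \<Longrightarrow> span (S \<inter> zlat) = S"
  unfolding rational_subspace_def using span_minimal[of "S \<inter> zlat" S] by blast

lemma rational_subspace_span:
  assumes "F \<subseteq> zlat"
  shows "rational_subspace (span F)"
proof -
  have "span F \<subseteq> span (span F \<inter> zlat)"
    using assms by (intro span_mono) (auto intro: span_base)
  then show ?thesis by (simp add: rational_subspace_def)
qed

lemma rational_subspace_UNIV [simp]: "rational_subspace UNIV"
proof -
  have "(UNIV::'a set) = span Basis" by simp
  also have "rational_subspace \<dots>" by (rule rational_subspace_span) (rule Basis_subset_zlat)
  finally show ?thesis by simp
qed

lemma rational_subspace_basis:
  assumes "rational_subspace S"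
  obtains F where "F \<subseteq> S \<inter> zlat" "independent F" "span F = S" "finite F"
proof -
  obtain F where "F \<subseteq> S \<inter> zlat" "independent F" "S \<inter> zlat \<subseteq> span F"
    by (rule maximal_independent_subset[of "S \<inter> zlat"])
  moreover from this have "span F = S"
    using span_rational[OF assms] by (metis span_eq span_superset subset_trans)
  ultimately show ?thesis using that finiteI_independent by blast
qed

text \<open>Elimination with a lattice vector \<open>b0\<close> of \<open>S\<close> on which
  \<open>u\<close> does not vanish: the map taking \<open>x\<close> to
  \<open>(u \<bullet> b0) *\<^sub>R x - (u \<bullet> x) *\<^sub>R b0\<close> sends lattice vectors
  of \<open>S\<close> to lattice vectors in the hyperplane and acts on the hyperplane as a nonzero
  scalar.\<close>

lemma rational_subspace_hyperplane:
  assumes S: "rational_subspace S" and u: "u \<in> zlat"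
  shows "rational_subspace (S \<inter> {x. u \<bullet> x = 0})"
proof (cases "\<forall>b\<in>S \<inter> zlat. u \<bullet> b = 0")
  case True
  then have "span (S \<inter> zlat) \<subseteq> {x. u \<bullet> x = 0}"
    by (intro span_minimal) (auto simp: subspace_hyperplane)
  then have "S \<inter> {x. u \<bullet> x = 0} = S" using span_rational[OF S] by auto
  then show ?thesis using S by simp
next
  case False
  then obtain b0 where b0: "b0 \<in> S" "b0 \<in> zlat" "u \<bullet> b0 \<noteq> 0" by blast
  let ?T = "span (S \<inter> {x. u \<bullet> x = 0} \<inter> zlat)"
  have sub: "subspace S" using S by (rule rational_subspaceD)
  have "(u \<bullet> b0) *\<^sub>R x - (u \<bullet> x) *\<^sub>R b0 \<in> ?T" if "x \<in> span (S \<inter> zlat)" for x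
    using that
  proof (induction rule: span_induct_alt)
    case base
    then show ?case by (simp add: span_zero)
  next
    case (step c b y)
    have "(u \<bullet> b0) *\<^sub>R b - (u \<bullet> b) *\<^sub>R b0 \<in> zlat"
    proof -
      obtain i j where "u \<bullet> b0 = real_of_int i" "u \<bullet> b = real_of_int j"
        using inner_zlat[OF u] b0 step by (metis Ints_cases IntD2)
      then show ?thesis using b0 step
        by (simp add: add_subgroup_diff add_subgroup_scale_int)
    qed
    moreover have "(u \<bullet> b0) *\<^sub>R b - (u \<bullet> b) *\<^sub>R b0 \<in> S" using sub b0 step
      by (simp add: subspace_diff subspace_scale)
    ultimately have "(u \<bullet> b0) *\<^sub>R b - (u \<bullet> b) *\<^sub>R b0 \<in> ?T"
      by (intro span_base) (auto simp: inner_diff_right)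
    then have "c *\<^sub>R ((u \<bullet> b0) *\<^sub>R b - (u \<bullet> b) *\<^sub>R b0) + ((u \<bullet> b0) *\<^sub>R y - (u \<bullet> y) *\<^sub>R b0) \<in> ?T"
      using step by (intro span_add span_scale) auto
    then show ?case by (simp add: algebra_simps)
  qed
  then have *: "(u \<bullet> b0) *\<^sub>R x - (u \<bullet> x) *\<^sub>R b0 \<in> ?T" if "x \<in> S" for x
    using that span_rational[OF S] by auto
  have "x \<in> ?T" if "x \<in> S" "u \<bullet> x = 0" for x
    using *[OF that(1)] that(2) b0(3) span_scale[of "(u \<bullet> b0) *\<^sub>R x" _ "1/(u \<bullet> b0)"] by simp
  then show ?thesis using sub
    by (auto simp: rational_subspace_def subspace_Int subspace_hyperplane subspace_inter)
qed

lemma rational_subspace_equations: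
  assumes "rational_subspace S" "finite F" "F \<subseteq> zlat"
  shows "rational_subspace (S \<inter> {x. \<forall>u\<in>F. u \<bullet> x = 0})"
  using assms(2,3)
proof (induction F)
  case empty
  then show ?case using assms(1) by simp
next
  case (insert u F)
  have "S \<inter> {x. \<forall>v\<in>insert u F. v \<bullet> x = 0} = (S \<inter> {x. \<forall>v\<in>F. v \<bullet> x = 0}) \<inter> {x. u \<bullet> x = 0}"
    by auto
  moreover have "rational_subspace ((S \<inter> {x. \<forall>v\<in>F. v \<bullet> x = 0}) \<inter> {x. u \<bullet> x = 0})"
    using insert by (intro rational_subspace_hyperplane) auto
  ultimately show ?case by (simp only:)
qed

lemma orthogonal_span_iff: "(\<forall>y\<in>span F. y \<bullet> x = 0) \<longleftrightarrow> (\<forall>u\<in>F. u \<bullet> (x::'a::euclidean_space) = 0)"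
proof
  assume "\<forall>u\<in>F. u \<bullet> x = 0"
  then have "span F \<subseteq> {y. x \<bullet> y = 0}"
    using subspace_hyperplane[of x] by (intro span_minimal) (auto simp: inner_commute)
  then show "\<forall>y\<in>span F. y \<bullet> x = 0" by (auto simp: inner_commute)
qed (auto intro: span_base)

lemma rational_orthogonal_comp:
  assumes "rational_subspace S"
  shows "rational_subspace (orthogonal_comp S)"
proof -
  obtain F where F: "F \<subseteq> S \<inter> zlat" "span F = S" "finite F"
    using rational_subspace_basis[OF assms] by metis
  have "orthogonal_comp S = UNIV \<inter> {x. \<forall>u\<in>F. u \<bullet> x = 0}"
    using orthogonal_span_iff[of F] F(2) by (auto simp: orthogonal_comp_def orthogonal_def)
  then show ?thesis using rational_subspace_equations[OF rational_subspace_UNIV F(3)] F(1) by auto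
qed

text \<open>\<open>T\<close> is the solution set of finitely many integral equations, given by a
  lattice basis of its orthogonal complement; imposing them on \<open>S\<close> preserves
  rationality.\<close>

lemma rational_subspace_Int:
  assumes "rational_subspace S" "rational_subspace T"
  shows "rational_subspace (S \<inter> T)"
proof -
  obtain F where F: "F \<subseteq> orthogonal_comp T \<inter> zlat" "span F = orthogonal_comp T" "finite F"
    using rational_subspace_basis[OF rational_orthogonal_comp[OF assms(2)]] by metis
  have "T = orthogonal_comp (orthogonal_comp T)"
    using orthogonal_comp_self rational_subspaceD[OF assms(2)] by metis
  also have "\<dots> = {x. \<forall>u\<in>F. u \<bullet> x = 0}"
    using orthogonal_span_iff[of F] F(2) by (auto simp: orthogonal_comp_def orthogonal_def)
  finally show ?thesis using rational_subspace_equations[OF assms(1) F(3)] F(1) by auto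
qed

lemma rational_subspace_plus:
  assumes "rational_subspace S" "rational_subspace T"
  shows "rational_subspace {x + y | x y. x \<in> S \<and> y \<in> T}"
proof -
  have "span ((S \<inter> zlat) \<union> (T \<inter> zlat)) = {x + y | x y. x \<in> S \<and> y \<in> T}"
    unfolding span_Un span_rational[OF assms(1)] span_rational[OF assms(2)] by auto
  then show ?thesis
    using rational_subspace_span[of "(S \<inter> zlat) \<union> (T \<inter> zlat)"] by auto
qed

lemma rational_subspace_Times:
  assumes "rational_subspace S" "rational_subspace T"
  shows "rational_subspace (S \<times> T)"
proof -
  have s: "subspace S" "subspace T" using assms by (auto simp: rational_subspace_def)
  let ?Z = "(S \<times> T) \<inter> zlat"
  have l1: "linear (\<lambda>d. (d, 0::'b))" "linear (\<lambda>d. (0::'a, d))" by (auto intro!: linearI)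
  have "(\<lambda>d. (d, 0::'b)) ` span (S \<inter> zlat) \<subseteq> span ?Z"
    unfolding linear_span_image[OF l1(1), symmetric]
    by (rule span_mono) (use s add_subgroup_0[OF add_subgroup_zlat] in \<open>auto simp: zlat_Times subspace_0\<close>)
  moreover have "(\<lambda>d. (0::'a, d)) ` span (T \<inter> zlat) \<subseteq> span ?Z"
    unfolding linear_span_image[OF l1(2), symmetric]
    by (rule span_mono) (use s add_subgroup_0[OF add_subgroup_zlat] in \<open>auto simp: zlat_Times subspace_0\<close>)
  ultimately have *: "(a, 0) \<in> span ?Z" "(0, b) \<in> span ?Z" if "a \<in> S" "b \<in> T" for a b
    using that unfolding span_rational[OF assms(1)] span_rational[OF assms(2)] by auto
  have "(a, b) \<in> span ?Z" if "a \<in> S" "b \<in> T" for a b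
    using span_add[OF *[OF that]] by simp
  then show ?thesis using s by (auto simp: rational_subspace_def subspace_Times)
qed

text \<open>The orthogonal complement serves: the inner product is integral on the lattice, so the
  complement of a rational subspace is rational.\<close>

lemma rational_complement:
  assumes "rational_subspace Q"
  obtains M where "rational_subspace M" "M \<inter> Q = {0}" "{x + y | x y. x \<in> M \<and> y \<in> Q} = UNIV"
proof -
  obtain M where "M = orthogonal_comp Q" by blast
  have "subspace Q" using assms by (rule rational_subspaceD)
  have "M \<inter> Q = {0}" using \<open>M = _\<close> \<open>subspace Q\<close>
    by (auto simp: orthogonal_comp_def orthogonal_def subspace_0)
  moreover have "{x + y | x y. x \<in> M \<and> y \<in> Q} = UNIV"
    using subspace_sum_orthogonal_comp[OF \<open>subspace Q\<close>] \<open>M = _\<close>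
    unfolding set_plus_def by (auto simp: set_eq_iff) (metis add.commute)
  ultimately show ?thesis using that rational_orthogonal_comp[OF assms] \<open>M = _\<close> by blast
qed

text \<open>The orthogonal complement of \<open>S\<close> is spanned by its lattice points. If all
  of these vanished on \<open>T\<close>, taking complements twice would give
  \<open>T \<subseteq> S\<close>.\<close>

lemma rational_separating_functional:
  assumes S: "rational_subspace S" and "subspace T" "S \<subseteq> T" "S \<noteq> T"
  obtains u where "u \<in> zlat" "\<And>x. x \<in> S \<Longrightarrow> u \<bullet> x = 0" "\<exists>x\<in>T. u \<bullet> x \<noteq> 0"
proof -
  have "\<exists>u\<in>orthogonal_comp S \<inter> zlat. \<exists>x\<in>T. u \<bullet> x \<noteq> 0"
  proof (rule ccontr)
    assume "\<not> ?thesis"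
    then have "orthogonal_comp S \<inter> zlat \<subseteq> orthogonal_comp T"
      by (auto simp: orthogonal_comp_def orthogonal_def inner_commute)
    then have "orthogonal_comp S \<subseteq> orthogonal_comp T"
      using span_rational[OF rational_orthogonal_comp[OF S]]
      by (metis span_minimal subspace_orthogonal_comp)
    then have "T \<subseteq> S"
      using orthogonal_comp_self[OF rational_subspaceD[OF S]] orthogonal_comp_self[OF assms(2)]
        orthogonal_comp_anti_mono by metis
    then show False using assms by blast
  qed
  then show ?thesis using that by (auto simp: orthogonal_comp_def orthogonal_def inner_commute)
qed

lemma hyperplane_in_subspace:
  fixes S :: "'a::euclidean_space set"
  assumes "subspace S" "subspace T" "S \<subseteq> T" "dim T = dim S + 1" "\<And>x. x \<in> S \<Longrightarrow> u \<bullet> x = 0" "\<exists>x\<in>T. u \<bullet> x \<noteq> 0"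
  shows "S = T \<inter> {x. u \<bullet> x = 0}"
proof (rule subspace_dim_equal)
  show "S \<subseteq> T \<inter> {x. u \<bullet> x = 0}" using assms by auto
  have sub: "subspace (T \<inter> {x. u \<bullet> x = 0})" using assms by (simp add: subspace_inter subspace_hyperplane)
  then show "subspace (T \<inter> {x. u \<bullet> x = 0})" .
  have "T \<inter> {x. u \<bullet> x = 0} \<subset> T" using assms(6) by blast
  then have "dim (T \<inter> {x. u \<bullet> x = 0}) < dim T"
    using dim_psubset[of "T \<inter> {x. u \<bullet> x = 0}" T] sub assms(2) by (metis span_eq_iff)
  then show "dim (T \<inter> {x. u \<bullet> x = 0}) \<le> dim S" using assms(4) by simp
qed (use assms in auto)

text \<open>The values of \<open>\<phi>\<close> on \<open>D\<close> form a nonzero subgroup of the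
  integers. An element with the least positive value generates it, by division with
  remainder.\<close>

lemma int_valued_generator:
  fixes \<phi> :: "'a::real_vector \<Rightarrow> real"
  assumes D: "add_subgroup D" and \<phi>: "linear \<phi>" "\<And>x. x \<in> D \<Longrightarrow> \<phi> x \<in> \<int>" "\<exists>x\<in>D. \<phi> x \<noteq> 0"
  obtains v where "v \<in> D" "\<phi> v > 0" "\<And>x. x \<in> D \<Longrightarrow> \<exists>a::int. \<phi> x = of_int a * \<phi> v"
proof -
  define P where "P = (\<lambda>n::nat. n > 0 \<and> (\<exists>x\<in>D. \<phi> x = real n))"
  obtain x where x: "x \<in> D" "\<phi> x \<noteq> 0" using \<phi>(3) by blast
  obtain i where i: "\<phi> x = of_int i" using \<phi>(2)[OF x(1)] by (metis Ints_cases)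
  have "\<exists>n. P n"
  proof (cases "i > 0")
    case True
    then show ?thesis unfolding P_def using x i by (intro exI[of _ "nat i"]) auto
  next
    case False
    then have "\<phi> (- x) = real (nat (- i))" "nat (-i) > 0" using i x \<phi>(1) by (auto simp: linear_neg)
    then show ?thesis unfolding P_def using x add_subgroup_minus[OF D] by blast
  qed
  then have P: "P (LEAST n. P n)" by (rule LeastI_ex)
  define n where "n = (LEAST n. P n)"
  obtain v where v: "v \<in> D" "\<phi> v = real n" "n > 0" using P by (auto simp: P_def n_def)
  have "\<exists>a::int. \<phi> y = of_int a * \<phi> v" if y: "y \<in> D" for y
  proof -
    obtain j where j: "\<phi> y = of_int j" using \<phi>(2)[OF y] by (metis Ints_cases)
    define r where "r = j mod int n"
    have r: "0 \<le> r" "r < int n" using v(3) by (auto simp: r_def)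
    have "\<phi> (y - of_int (j div int n) *\<^sub>R v) = of_int (j - (j div int n) * int n)"
      using \<phi>(1) j v by (simp add: linear_diff linear_scale)
    also have "\<dots> = of_int r" by (simp add: r_def minus_div_mult_eq_mod)
    finally have e: "\<phi> (y - of_int (j div int n) *\<^sub>R v) = of_int r" .
    have "y - of_int (j div int n) *\<^sub>R v \<in> D"
      using D y v by (simp add: add_subgroup_diff add_subgroup_scale_int)
    have "r = 0"
    proof (rule ccontr)
      assume "r \<noteq> 0"
      then have "P (nat r)" unfolding P_def using r e \<open>y - _ \<in> D\<close> by (intro conjI bexI) auto
      then have "n \<le> nat r" unfolding n_def by (rule Least_le)
      then show False using r by linarith
    qed
    then have "j = (j div int n) * int n" by (auto simp: r_def)
    then have "\<phi> y = of_int (j div int n) * \<phi> v" using j v by (metis of_int_mult of_int_of_nat_eq)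
    then show ?thesis by blast
  qed
  then show ?thesis using that v by simp
qed

text \<open>A generator of the lattice of \<open>T\<close> modulo that of \<open>S\<close>:
  \<open>u\<close> is an integral functional cutting \<open>S\<close> out of \<open>T\<close>, and
  \<open>v\<close> takes its least positive value on the lattice of \<open>T\<close>. At this stage
  the sign of \<open>v\<close> has no geometric meaning.\<close>

lemma primitive_vector_exists:
  assumes S: "rational_subspace S" and T: "rational_subspace T" and ST: "S \<subseteq> T" "dim T = dim S + 1"
  obtains u v where "u \<in> zlat" "v \<in> T \<inter> zlat" "u \<bullet> v > 0" "S = T \<inter> {x. u \<bullet> x = 0}"
    "T \<inter> zlat = {w + of_int a *\<^sub>R v | w a. w \<in> S \<inter> zlat}"
proof -
  have "S \<noteq> T" using ST by auto
  then obtain u where u: "u \<in> zlat" "\<And>x. x \<in> S \<Longrightarrow> u \<bullet> x = 0" "\<exists>x\<in>T. u \<bullet> x \<noteq> 0"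
    using rational_separating_functional[OF S rational_subspaceD[OF T] ST(1)] by metis
  have eq: "S = T \<inter> {x. u \<bullet> x = 0}"
    using hyperplane_in_subspace[OF _ _ ST u(2,3)] S T rational_subspaceD by blast
  have sub: "add_subgroup (T \<inter> zlat)"
    by (intro add_subgroup_Int subspace_imp_add_subgroup rational_subspaceD[OF T] add_subgroup_zlat)
  have "\<exists>x\<in>T \<inter> zlat. u \<bullet> x \<noteq> 0"
  proof (rule ccontr)
    assume "\<not> ?thesis"
    then have "span (T \<inter> zlat) \<subseteq> {x. u \<bullet> x = 0}"
      by (intro span_minimal) (auto simp: subspace_hyperplane)
    then show False using span_rational[OF T] u(3) by auto
  qed
  moreover have "linear ((\<bullet>) u)" by (simp add: bounded_linear.linear bounded_linear_inner_right)
  ultimately obtain v where v: "v \<in> T \<inter> zlat" "u \<bullet> v > 0" "\<And>x. x \<in> T \<inter> zlat \<Longrightarrow> \<exists>a::int. u \<bullet> x = of_int a * (u \<bullet> v)"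
    using int_valued_generator[OF sub, of "(\<bullet>) u"] inner_zlat[OF u(1)] by blast
  have "T \<inter> zlat = {w + of_int a *\<^sub>R v | w a. w \<in> S \<inter> zlat}"
  proof
    show "T \<inter> zlat \<subseteq> {w + of_int a *\<^sub>R v | w a. w \<in> S \<inter> zlat}"
    proof
      fix x assume x: "x \<in> T \<inter> zlat"
      then obtain a :: int where a: "u \<bullet> x = of_int a * (u \<bullet> v)" using v by blast
      have "x - of_int a *\<^sub>R v \<in> T \<inter> zlat" using sub x v by (simp add: add_subgroup_diff add_subgroup_scale_int del: Int_iff)
      then have "x - of_int a *\<^sub>R v \<in> S \<inter> zlat" using a by (simp add: eq inner_diff_right)
      then show "x \<in> {w + of_int a *\<^sub>R v | w a. w \<in> S \<inter> zlat}"
        by (intro CollectI exI[of _ "x - of_int a *\<^sub>R v"] exI[of _ a]) simp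
    qed
    show "{w + of_int a *\<^sub>R v | w a. w \<in> S \<inter> zlat} \<subseteq> T \<inter> zlat"
    proof clarify
      fix w and a :: int assume "w \<in> S" "w \<in> zlat"
      then have "w \<in> T \<inter> zlat" using ST by auto
      then show "w + of_int a *\<^sub>R v \<in> T \<inter> zlat" using sub v by (simp add: add_subgroup_add add_subgroup_scale_int del: Int_iff)
    qed
  qed
  then show ?thesis using that u(1) v(1,2) eq by blast
qed

section \<open>Lattice indices\<close>

definition idx :: "'a::ab_group_add set \<Rightarrow> 'a set \<Rightarrow> nat" where
  "idx D B = card ((\<lambda>x. {x + b | b. b \<in> B}) ` D)"

lemma coset_eq_iff:
  assumes "add_subgroup B"
  shows "{x + b | b. b \<in> B} = {y + b | b. b \<in> B} \<longleftrightarrow> x - y \<in> B"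
proof
  assume "{x + b | b. b \<in> B} = {y + b | b. b \<in> B}"
  moreover have "x + 0 \<in> {x + b | b. b \<in> B}" using add_subgroup_0[OF assms] by blast
  ultimately obtain b where "x = y + b" "b \<in> B" by auto
  then show "x - y \<in> B" by simp
next
  assume xy: "x - y \<in> B"
  have 1: "{x + b | b. b \<in> B} \<subseteq> {y + b | b. b \<in> B}" if "x - y \<in> B" for x y
  proof clarify
    fix b assume "b \<in> B"
    then have "x + b = y + ((x - y) + b)" "(x - y) + b \<in> B" using that assms by (auto simp: add_subgroup_add)
    then show "\<exists>c. x + b = y + c \<and> c \<in> B" by blast
  qed
  have "y - x \<in> B" using add_subgroup_minus[OF assms xy] by simp
  then show "{x + b | b. b \<in> B} = {y + b | b. b \<in> B}" using 1 xy by blast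
qed

text \<open>Multiplicativity of the index along kernel and image of \<open>\<phi>\<close>: with
  chosen representatives \<open>s\<close> and \<open>r\<close>, the cosets of \<open>B\<close> in
  \<open>D\<close> correspond to pairs of a coset in the image and a coset in the kernel. Since this
  is a bijection of sets of cosets, the equation also holds when infinite indices are read as
  \<open>0\<close>.\<close>

lemma idx_hom:
  fixes D :: "'a::ab_group_add set" and \<phi> :: "'a \<Rightarrow> 'b::ab_group_add"
  assumes D: "add_subgroup D" and B: "add_subgroup B" "B \<subseteq> D"
    and \<phi>: "\<And>x y. \<phi> (x - y) = \<phi> x - \<phi> y"
  shows "idx D B = idx (\<phi> ` D) (\<phi> ` B) * idx {x\<in>D. \<phi> x = 0} {x\<in>B. \<phi> x = 0}"
proof -
  have \<phi>0: "\<phi> 0 = 0" using \<phi>[of 0 0] by simp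
  have \<phi>a: "\<phi> (x + y) = \<phi> x + \<phi> y" for x y using \<phi>[of x "-y"] \<phi>[of 0 y] \<phi>0 by simp
  have \<phi>B: "add_subgroup (\<phi> ` B)" unfolding add_subgroup_def
    using B(1) \<phi>0 by (auto simp: add_subgroup_def simp flip: \<phi>)
  have kB: "add_subgroup {x\<in>B. \<phi> x = 0}" using B(1) \<phi> \<phi>0 by (auto simp: add_subgroup_def)
  let ?c = "\<lambda>x. {x + b | b. b \<in> B}"
  let ?d = "\<lambda>x. {x + b | b. b \<in> \<phi> ` B}"
  let ?k = "\<lambda>x. {x + b | b. b \<in> {x\<in>B. \<phi> x = 0}}"
  let ?K = "{x\<in>D. \<phi> x = 0}"
  define s where "s = (\<lambda>Q. SOME x. x \<in> D \<and> ?d (\<phi> x) = Q)"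
  define r where "r = (\<lambda>Q. SOME x. x \<in> ?K \<and> ?k x = Q)"
  have s: "s Q \<in> D \<and> ?d (\<phi> (s Q)) = Q" if "Q \<in> ?d ` \<phi> ` D" for Q
    unfolding s_def by (rule someI_ex) (use that in blast)
  have r: "r Q \<in> ?K \<and> ?k (r Q) = Q" if "Q \<in> ?k ` ?K" for Q
    unfolding r_def by (rule someI_ex) (use that in blast)
  have "bij_betw (\<lambda>(P, Q). ?c (s P + r Q)) ((?d ` \<phi> ` D) \<times> (?k ` ?K)) (?c ` D)"
    unfolding bij_betw_def
  proof
    show "inj_on (\<lambda>(P, Q). ?c (s P + r Q)) ((?d ` \<phi> ` D) \<times> (?k ` ?K))"
    proof (rule inj_onI)
      fix p q
      assume pq: "p \<in> (?d ` \<phi> ` D) \<times> (?k ` ?K)" "q \<in> (?d ` \<phi> ` D) \<times> (?k ` ?K)"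
        and eqpq: "(case p of (P, Q) \<Rightarrow> ?c (s P + r Q)) = (case q of (P, Q) \<Rightarrow> ?c (s P + r Q))"
      obtain P Q P' Q' where p: "p = (P, Q)" and q: "q = (P', Q')" by (cases p, cases q)
      have P: "P \<in> ?d ` \<phi> ` D" "P' \<in> ?d ` \<phi> ` D" and Q: "Q \<in> ?k ` ?K" "Q' \<in> ?k ` ?K"
        using pq unfolding p q mem_Times_iff fst_conv snd_conv by blast+
      have eq: "?c (s P + r Q) = ?c (s P' + r Q')" using eqpq unfolding p q split_conv .
      have d: "(s P + r Q) - (s P' + r Q') \<in> B" using eq coset_eq_iff[OF B(1)] by blast
      have "\<phi> ((s P + r Q) - (s P' + r Q')) = \<phi> (s P) - \<phi> (s P')"
        using r[OF Q(1)] r[OF Q(2)] by (simp add: \<phi> \<phi>a)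
      then have "\<phi> (s P) - \<phi> (s P') \<in> \<phi> ` B" using d by (metis image_eqI)
      then have "?d (\<phi> (s P)) = ?d (\<phi> (s P'))" using coset_eq_iff[OF \<phi>B] by blast
      then have PP: "P = P'" using s[OF P(1)] s[OF P(2)] by simp
      then have "r Q - r Q' \<in> B" using d by simp
      then have "r Q - r Q' \<in> {x\<in>B. \<phi> x = 0}" using r[OF Q(1)] r[OF Q(2)] by (simp add: \<phi>)
      then have "?k (r Q) = ?k (r Q')" using coset_eq_iff[OF kB] by blast
      then have "Q = Q'" using r[OF Q(1)] r[OF Q(2)] by simp
      then show "p = q" using PP p q by simp
    qed
    show "(\<lambda>(P, Q). ?c (s P + r Q)) ` ((?d ` \<phi> ` D) \<times> (?k ` ?K)) = ?c ` D"
    proof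
      show "(\<lambda>(P, Q). ?c (s P + r Q)) ` ((?d ` \<phi> ` D) \<times> (?k ` ?K)) \<subseteq> ?c ` D"
      proof (rule image_subsetI)
        fix p assume p: "p \<in> (?d ` \<phi> ` D) \<times> (?k ` ?K)"
        obtain P Q where PQ: "p = (P, Q)" by (cases p)
        have "P \<in> ?d ` \<phi> ` D" "Q \<in> ?k ` ?K"
          using p unfolding PQ mem_Times_iff fst_conv snd_conv by blast+
        from s[OF this(1)] r[OF this(2)] have "s P + r Q \<in> D" by (intro add_subgroup_add[OF D]) blast+
        then show "(case p of (P, Q) \<Rightarrow> ?c (s P + r Q)) \<in> ?c ` D" unfolding PQ split_conv by (rule imageI)
      qed
      show "?c ` D \<subseteq> (\<lambda>(P, Q). ?c (s P + r Q)) ` ((?d ` \<phi> ` D) \<times> (?k ` ?K))"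
      proof (rule image_subsetI)
        fix x assume x: "x \<in> D"
        define P where "P = ?d (\<phi> x)"
        have P: "P \<in> ?d ` \<phi> ` D" using x by (auto simp: P_def)
        have "?d (\<phi> x) = ?d (\<phi> (s P))" using s[OF P] by (simp add: P_def)
        then have "\<phi> x - \<phi> (s P) \<in> \<phi> ` B" using coset_eq_iff[OF \<phi>B] by blast
        then obtain b where b: "b \<in> B" "\<phi> x - \<phi> (s P) = \<phi> b" by blast
        \<comment> \<open>Subtracting the representative of the image coset and the correction
          \<open>b\<close> from \<open>B\<close> moves \<open>x\<close> into the kernel without
          changing its coset beyond the representative.\<close>
        define k where "k = x - s P - b"
        have "s P \<in> D" using s[OF P] by blast
        then have "k \<in> D" unfolding k_def using x b(1) B(2)
          by (intro add_subgroup_diff[OF D]) auto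
        moreover have "\<phi> k = 0" unfolding k_def \<phi> using b(2) by simp
        ultimately have k: "k \<in> ?K" by simp
        define Q where "Q = ?k k"
        have Q: "Q \<in> ?k ` ?K" using k by (auto simp: Q_def)
        have "?k (r Q) = ?k k" using r[OF Q] by (simp add: Q_def)
        then have "r Q - k \<in> B" using coset_eq_iff[OF kB] by blast
        then have "(r Q - k) - b \<in> B" using b B(1) by (simp add: add_subgroup_diff)
        then have "(s P + r Q) - x \<in> B" by (simp add: k_def algebra_simps)
        then have "?c (s P + r Q) = ?c x" using coset_eq_iff[OF B(1)] by blast
        then show "?c x \<in> (\<lambda>(P, Q). ?c (s P + r Q)) ` ((?d ` \<phi> ` D) \<times> (?k ` ?K))"
          using P Q by (intro image_eqI[of _ _ "(P,Q)"]) simp_all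
      qed
    qed
  qed
  then have "card (?c ` D) = card ((?d ` \<phi> ` D) \<times> (?k ` ?K))"
    by (rule bij_betw_same_card[symmetric])
  then show ?thesis unfolding idx_def card_cartesian_product .
qed

lemma idx_refl: "add_subgroup D \<Longrightarrow> idx D D = 1"
proof -
  assume D: "add_subgroup D"
  define c where "c = (\<lambda>x. {x + b | b. b \<in> D})"
  have *: "c x = c 0" if "x \<in> D" for x
    using coset_eq_iff[OF D, of x 0] that unfolding c_def by simp
  have "c ` D \<subseteq> {c 0}"
    by (rule image_subsetI) (simp add: *)
  moreover have "c 0 \<in> c ` D" by (rule imageI[OF add_subgroup_0[OF D]])
  ultimately have "c ` D = {c 0}" by (intro subset_antisym) (simp_all only: insert_subset empty_subsetI simp_thms)
  then have "card (c ` D) = 1" by simp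
  then show ?thesis by (simp only: idx_def c_def)
qed

text \<open>The index is the absolute value of \<open>k\<close>. For \<open>k = 0\<close> there are
  infinitely many cosets, \<open>card\<close> gives \<open>0\<close>, and the right side is
  \<open>0\<close> as well.\<close>

lemma idx_multiples:
  fixes g c :: real
  assumes "g > 0" "c = of_int k * g"
  shows "real (idx (range (\<lambda>a::int. of_int a * g)) (range (\<lambda>a::int. of_int a * c))) = \<bar>c\<bar> / g"
proof -
  let ?G = "range (\<lambda>a::int. of_int a * g)" and ?C = "range (\<lambda>a::int. of_int a * c)"
  have C: "add_subgroup ?C"
  proof -
    have "0 \<in> ?C" by (rule image_eqI[of _ _ 0]) auto
    moreover have "x - y \<in> ?C" if xy: "x \<in> ?C" "y \<in> ?C" for x y
    proof -
      obtain a b :: int where "x = of_int a * c" "y = of_int b * c" using xy by fast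
      then show ?thesis by (intro image_eqI[of _ _ "a - b"]) (auto simp: algebra_simps)
    qed
    ultimately show ?thesis unfolding add_subgroup_def by blast
  qed
  let ?q = "\<lambda>x. {x + b | b. b \<in> ?C}"
  have eq: "?q (of_int i * g) = ?q (of_int j * g) \<longleftrightarrow> k dvd (i - j)" for i j
  proof -
    have "?q (of_int i * g) = ?q (of_int j * g) \<longleftrightarrow> of_int (i - j) * g \<in> ?C"
      unfolding coset_eq_iff[OF C] by (simp only: of_int_diff left_diff_distrib)
    also have "\<dots> \<longleftrightarrow> (\<exists>a::int. of_int (i - j) * g = of_int (a * k) * g)"
      unfolding assms(2) image_iff of_int_mult mult.assoc by simp
    also have "\<dots> \<longleftrightarrow> (\<exists>a. i - j = a * k)"
      using assms(1) by (simp del: of_int_mult of_int_diff)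
    also have "\<dots> \<longleftrightarrow> k dvd (i - j)" by (auto simp: dvd_def mult.commute)
    finally show ?thesis .
  qed
  show ?thesis
  proof (cases "k = 0")
    case True
    have "inj (\<lambda>i::int. ?q (of_int i * g))"
      by (rule injI) (use eq True in auto)
    then have "infinite (range (\<lambda>i::int. ?q (of_int i * g)))"
      using finite_imageD infinite_UNIV_int by blast
    moreover have "?q ` ?G = range (\<lambda>i::int. ?q (of_int i * g))" by auto
    ultimately show ?thesis using True assms by (simp add: idx_def)
  next
    case False
    have "?q ` ?G = (\<lambda>i. ?q (of_int i * g)) ` {0..<\<bar>k\<bar>}"
    proof
      show "?q ` ?G \<subseteq> (\<lambda>i. ?q (of_int i * g)) ` {0..<\<bar>k\<bar>}"
      proof clarify
        fix i :: int
        have "?q (of_int i * g) = ?q (of_int (i mod \<bar>k\<bar>) * g)"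
          unfolding eq using dvd_minus_mod[of "\<bar>k\<bar>" i] unfolding abs_dvd_iff .
        then show "?q (of_int i * g) \<in> (\<lambda>i. ?q (of_int i * g)) ` {0..<\<bar>k\<bar>}"
          by (rule image_eqI) (use False in simp)
      qed
    qed auto
    moreover have "inj_on (\<lambda>i. ?q (of_int i * g)) {0..<\<bar>k\<bar>}"
    proof (rule inj_onI)
      fix i j assume i: "i \<in> {0..<\<bar>k\<bar>}" "j \<in> {0..<\<bar>k\<bar>}" "?q (of_int i * g) = ?q (of_int j * g)"
      then have "k dvd (i - j)" using eq by blast
      then have "\<bar>k\<bar> dvd \<bar>i - j\<bar>" by simp
      moreover have "\<bar>i - j\<bar> < \<bar>k\<bar>" using i by auto
      ultimately show "i = j" using zdvd_imp_le by fastforce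
    qed
    ultimately have "idx ?G ?C = nat \<bar>k\<bar>" by (simp add: idx_def card_image)
    then show ?thesis using assms by (simp add: abs_mult)
  qed
qed

text \<open>Finiteness of the index: take a basis consisting of vectors of \<open>B\<close>.
  Replacing coordinates by their fractional parts moves every lattice point within its coset into
  the ball of radius \<open>R\<close>, which contains finitely many lattice points.\<close>

lemma idx_pos:
  fixes B :: "'a::euclidean_space set"
  assumes B: "add_subgroup B" "B \<subseteq> zlat" "span B = UNIV"
  shows "idx zlat B > 0"
proof -
  obtain F where F: "F \<subseteq> B" "independent F" "B \<subseteq> span F"
    by (rule maximal_independent_subset[of B])
  have fin: "finite F" using F(2) finiteI_independent by blast
  have "span F = UNIV" using B(3) span_mono[OF F(3)] unfolding span_span by auto
  define R where "R = (\<Sum>f\<in>F. norm f)"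
  let ?q = "\<lambda>x. {x + b | b. b \<in> B}"
  have "?q ` zlat \<subseteq> ?q ` (zlat \<inter> cball 0 R)"
  proof (rule image_subsetI)
    fix x :: 'a assume x: "x \<in> zlat"
    have "x \<in> span F" using \<open>span F = UNIV\<close> by simp
    then obtain c where c: "x = (\<Sum>f\<in>F. c f *\<^sub>R f)" using fin by (auto simp: span_finite)
    define b where "b = (\<Sum>f\<in>F. of_int \<lfloor>c f\<rfloor> *\<^sub>R f)"
    have b: "b \<in> B" unfolding b_def
      using F(1) B(1) by (intro add_subgroup_sum add_subgroup_scale_int) auto
    have "x - b = (\<Sum>f\<in>F. (c f - of_int \<lfloor>c f\<rfloor>) *\<^sub>R f)"
      by (simp add: c b_def sum_subtractf algebra_simps)
    also have "norm \<dots> \<le> (\<Sum>f\<in>F. 1 * norm f)"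
    proof (rule sum_norm_le)
      fix f assume "f \<in> F"
      have "\<bar>c f - of_int \<lfloor>c f\<rfloor>\<bar> \<le> 1" by linarith
      then show "norm ((c f - of_int \<lfloor>c f\<rfloor>) *\<^sub>R f) \<le> 1 * norm f"
        unfolding norm_scaleR by (intro mult_right_mono) auto
    qed
    finally have "x - b \<in> cball 0 R" by (simp add: R_def)
    moreover have "x - b \<in> zlat" using x b B(2) by (auto intro: add_subgroup_diff)
    moreover have "?q x = ?q (x - b)" using coset_eq_iff[OF B(1), of x "x - b"] b by simp
    ultimately show "?q x \<in> ?q ` (zlat \<inter> cball 0 R)" by blast
  qed
  then have "finite (?q ` zlat)" by (rule finite_subset) (simp add: finite_zlat_cball)
  moreover have "?q ` zlat \<noteq> {}" using add_subgroup_0[OF add_subgroup_zlat] by blast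
  ultimately show ?thesis by (simp add: idx_def card_gt_0_iff)
qed

text \<open>Index of the lattice generated by a subgroup \<open>A\<close> of a rational hyperplane and a vector \<open>v\<close>: up to
  a factor not depending on \<open>v\<close> it is the lattice height of \<open>v\<close>, also when that is \<open>0\<close>, the index being
  infinite then and hence \<open>0\<close> as a \<open>card\<close>.\<close>

lemma idx_hyperplane:
  fixes u :: "'a::euclidean_space"
  assumes u: "u \<in> zlat" "u \<noteq> 0" and A: "add_subgroup A" "A \<subseteq> zlat" "\<And>x. x \<in> A \<Longrightarrow> u \<bullet> x = 0"
  shows "\<exists>\<kappa>. \<forall>v\<in>zlat. u \<bullet> v \<noteq> 0 \<longrightarrow>
    real (idx zlat {a + of_int i *\<^sub>R v | a i. a \<in> A}) = \<kappa> * \<bar>u \<bullet> v\<bar>"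
proof -
  have lin: "linear ((\<bullet>) u)" by (simp add: bounded_linear.linear bounded_linear_inner_right)
  have "\<exists>x\<in>zlat. u \<bullet> x \<noteq> 0" using u by (intro bexI[of _ u]) auto
  then obtain w where w: "w \<in> zlat" "u \<bullet> w > 0" "\<And>x. x \<in> zlat \<Longrightarrow> \<exists>a::int. u \<bullet> x = of_int a * (u \<bullet> w)"
    using int_valued_generator[OF add_subgroup_zlat lin] inner_zlat[OF u(1)] by blast
  \<comment> \<open>The image under \<open>u\<close> of the whole lattice is generated by
    \<open>u \<bullet> w\<close>, and that of the sublattice by \<open>u \<bullet> v\<close>; the
    kernels contribute the index of \<open>A\<close> in the lattice of the hyperplane.\<close>
  define \<kappa> where "\<kappa> = real (idx {x\<in>zlat. u \<bullet> x = 0} A) / (u \<bullet> w)"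
  have "real (idx zlat {a + of_int i *\<^sub>R v | a i. a \<in> A}) = \<kappa> * \<bar>u \<bullet> v\<bar>" if v: "v \<in> zlat" "u \<bullet> v \<noteq> 0" for v
  proof -
    let ?B = "{a + of_int i *\<^sub>R v | a i. a \<in> A}"
    have Beq: "?B = {a + b | a b. a \<in> A \<and> b \<in> range (\<lambda>i::int. of_int i *\<^sub>R v)}" by auto
    have V: "add_subgroup (range (\<lambda>i::int. of_int i *\<^sub>R v))"
    proof -
      have "0 \<in> range (\<lambda>i::int. of_int i *\<^sub>R v)" by (rule image_eqI[of _ _ 0]) auto
      moreover have "x - y \<in> range (\<lambda>i::int. of_int i *\<^sub>R v)"
        if xy: "x \<in> range (\<lambda>i::int. of_int i *\<^sub>R v)" "y \<in> range (\<lambda>i::int. of_int i *\<^sub>R v)" for x y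
      proof -
        obtain i j :: int where "x = of_int i *\<^sub>R v" "y = of_int j *\<^sub>R v" using xy by fast
        then show ?thesis by (intro image_eqI[of _ _ "i - j"]) (auto simp: algebra_simps)
      qed
      ultimately show ?thesis unfolding add_subgroup_def by blast
    qed
    have B: "add_subgroup ?B" unfolding Beq by (rule add_subgroup_plus[OF A(1) V])
    have Bz: "?B \<subseteq> zlat"
    proof clarify
      fix a and i :: int assume "a \<in> A"
      then have "a \<in> zlat" using A(2) by blast
      then show "a + of_int i *\<^sub>R v \<in> zlat"
        using v(1) by (intro add_subgroup_add[OF add_subgroup_zlat] add_subgroup_scale_int[OF add_subgroup_zlat])
    qed
    have e1: "idx zlat ?B = idx ((\<bullet>) u ` zlat) ((\<bullet>) u ` ?B) * idx {x\<in>zlat. u \<bullet> x = 0} {x\<in>?B. u \<bullet> x = 0}"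
      by (rule idx_hom[OF add_subgroup_zlat B Bz]) (simp add: inner_diff_right)
    have e2: "(\<bullet>) u ` zlat = range (\<lambda>a::int. of_int a * (u \<bullet> w))"
    proof
      show "(\<bullet>) u ` zlat \<subseteq> range (\<lambda>a::int. of_int a * (u \<bullet> w))" using w(3) by blast
      show "range (\<lambda>a::int. of_int a * (u \<bullet> w)) \<subseteq> (\<bullet>) u ` zlat"
      proof clarify
        fix a :: int
        show "of_int a * (u \<bullet> w) \<in> (\<bullet>) u ` zlat"
          by (rule image_eqI[of _ _ "of_int a *\<^sub>R w"]) (use w(1) add_subgroup_scale_int[OF add_subgroup_zlat] in auto)
      qed
    qed
    have e3: "(\<bullet>) u ` ?B = range (\<lambda>a::int. of_int a * (u \<bullet> v))"
    proof
      show "(\<bullet>) u ` ?B \<subseteq> range (\<lambda>a::int. of_int a * (u \<bullet> v))" using A(3) by (auto simp: inner_add_right)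
      show "range (\<lambda>a::int. of_int a * (u \<bullet> v)) \<subseteq> (\<bullet>) u ` ?B"
      proof clarify
        fix a :: int
        have "0 + of_int a *\<^sub>R v \<in> ?B" using add_subgroup_0[OF A(1)] by blast
        then show "of_int a * (u \<bullet> v) \<in> (\<bullet>) u ` ?B"
          by (intro image_eqI[of _ _ "of_int a *\<^sub>R v"]) auto
      qed
    qed
    have e4: "{x\<in>?B. u \<bullet> x = 0} = A"
    proof
      show "{x\<in>?B. u \<bullet> x = 0} \<subseteq> A" using v(2) A(3) by (auto simp: inner_add_right)
      show "A \<subseteq> {x\<in>?B. u \<bullet> x = 0}"
      proof
        fix a assume "a \<in> A"
        then have "a + of_int 0 *\<^sub>R v \<in> ?B" by blast
        then show "a \<in> {x\<in>?B. u \<bullet> x = 0}" using A(3)[OF \<open>a \<in> A\<close>] by simp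
      qed
    qed
    obtain k :: int where k: "u \<bullet> v = of_int k * (u \<bullet> w)" using w(3)[OF v(1)] by blast
    show ?thesis unfolding e1 of_nat_mult e2 e3 e4 idx_multiples[OF w(2) k] \<kappa>_def by simp
  qed
  then show ?thesis by (intro exI ballI impI)
qed

section \<open>Complexes of convex sets\<close>

text \<open>The join of a point with a set of codimension at least 2 has codimension at least 1. Its
  complement contains the endpoints whose segments from \<open>z\<close> avoid the set, except
  possibly at \<open>z\<close> itself.\<close>

lemma affine_insert_avoid:
  fixes A :: "'a::euclidean_space set"
  assumes "aff_dim A + 2 \<le> int DIM('a)"
  shows "affine hull (insert z A) \<noteq> UNIV"
proof
  assume "affine hull (insert z A) = UNIV"
  then have "aff_dim (insert z A) = int DIM('a)" by (metis aff_dim_UNIV aff_dim_affine_hull)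
  moreover have "aff_dim (insert z A) \<le> aff_dim A + 1" by (simp add: aff_dim_insert)
  ultimately show False using assms by linarith
qed

text \<open>The point \<open>z2\<close> is moved slightly to a point \<open>y\<close> of
  \<open>\<Gamma>\<close> off the joins of \<open>z1\<close> with the members of
  \<open>\<A>\<close>. Then the segment from \<open>z1\<close> to \<open>y\<close> stays where
  \<open>f\<close> is locally constant on \<open>\<Gamma>\<close>, and connectedness of the segment
  finishes the argument.\<close>

lemma generic_constant:
  fixes f :: "'a::euclidean_space \<Rightarrow> 'b"
  assumes B: "finite \<B>" "\<And>B. B \<in> \<B> \<Longrightarrow> affine B \<and> B \<noteq> UNIV" "- \<Union>\<B> \<subseteq> \<Gamma>"
    and A: "finite \<A>" "\<And>A. A \<in> \<A> \<Longrightarrow> affine A \<and> aff_dim A + 2 \<le> int DIM('a)"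
    and loc: "\<And>z. z \<in> \<Gamma> \<or> z \<notin> \<Union>\<A> \<Longrightarrow>
       \<exists>e>0. \<forall>z'\<in>\<Gamma>. \<forall>z''\<in>\<Gamma>. dist z z' < e \<and> dist z z'' < e \<longrightarrow> f z' = f z''"
    and z: "z1 \<in> \<Gamma>" "z2 \<in> \<Gamma>"
  shows "f z1 = f z2"
proof -
  have dense: "\<exists>z'\<in>\<Gamma>. dist z z' < e" if "e > 0" for z e
  proof -
    have "\<exists>y\<in>UNIV. dist z y < e \<and> (\<forall>A\<in>\<B>. y \<notin> A)"
      by (rule convex_avoid_affine_near) (use B that in auto)
    then show ?thesis using B(3) by blast
  qed
  obtain e2 where e2: "e2 > 0" "\<And>z' z''. z' \<in> \<Gamma> \<Longrightarrow> z'' \<in> \<Gamma> \<Longrightarrow> dist z2 z' < e2 \<Longrightarrow> dist z2 z'' < e2 \<Longrightarrow> f z' = f z''"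
    using loc[of z2] z(2) by blast
  have "\<exists>y\<in>UNIV. dist z2 y < e2 \<and> (\<forall>A\<in>\<B> \<union> (\<lambda>A. affine hull (insert z1 A)) ` \<A>. y \<notin> A)"
  proof (rule convex_avoid_affine_near)
    fix C assume C: "C \<in> \<B> \<union> (\<lambda>A. affine hull (insert z1 A)) ` \<A>"
    then have "affine C \<and> C \<noteq> UNIV" using B(2) A(2) affine_insert_avoid by auto
    then show "affine C \<and> \<not> UNIV \<subseteq> C" by auto
  qed (use A(1) B(1) e2 in auto)
  then obtain y where y: "dist z2 y < e2" "\<And>B. B \<in> \<B> \<Longrightarrow> y \<notin> B"
    "\<And>A. A \<in> \<A> \<Longrightarrow> y \<notin> affine hull (insert z1 A)" by blast
  have y\<Gamma>: "y \<in> \<Gamma>" using B(3) y(2) by blast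
  have fy: "f y = f z2" using e2(2)[OF y\<Gamma> z(2) y(1)] e2(1) by simp
  let ?S = "closed_segment z1 y"
  have good: "z \<in> \<Gamma> \<or> z \<notin> \<Union>\<A>" if zS: "z \<in> ?S" for z
  proof (rule ccontr)
    assume neg: "\<not> ?thesis"
    then obtain A where A: "A \<in> \<A>" "z \<in> A" "z \<notin> \<Gamma>" by blast
    obtain t where t: "0 \<le> t" "z = (1 - t) *\<^sub>R z1 + t *\<^sub>R y" using zS by (auto simp: closed_segment_def)
    have t0: "t \<noteq> 0" using t A z by auto
    have "z - z1 = t *\<^sub>R (y - z1)" using t(2) by (simp add: algebra_simps)
    then have "y = z1 + (1 / t) *\<^sub>R (z - z1)" using t0 by simp
    also have "\<dots> = (1 - 1/t) *\<^sub>R z1 + (1/t) *\<^sub>R z" by (simp add: algebra_simps)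
    also have "\<dots> \<in> affine hull (insert z1 A)"
      by (rule mem_affine[OF affine_affine_hull]) (use A in \<open>auto intro: hull_inc\<close>)
    finally show False using y(3) A by blast
  qed
  \<comment> \<open>Points of the segment need not lie in \<open>\<Gamma>\<close>, and
    \<open>f\<close> is uncontrolled there. It is replaced by the common value of \<open>f\<close>
    at the points of \<open>\<Gamma>\<close> close by, which exist since \<open>\<Gamma>\<close> is
    dense.\<close>
  define g where "g = (\<lambda>z. SOME v. \<exists>e>0. \<forall>z'\<in>\<Gamma>. dist z z' < e \<longrightarrow> f z' = v)"
  have g: "\<exists>e>0. \<forall>z'\<in>\<Gamma>. dist z z' < e \<longrightarrow> f z' = g z" if zS: "z \<in> ?S" for z
  proof -
    obtain e where e: "e > 0" "\<forall>z'\<in>\<Gamma>. \<forall>z''\<in>\<Gamma>. dist z z' < e \<and> dist z z'' < e \<longrightarrow> f z' = f z''"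
      using loc[OF good[OF zS]] by (elim exE conjE)
    obtain w where w: "w \<in> \<Gamma>" "dist z w < e" using dense[OF e(1)] by blast
    have "\<exists>v. \<exists>e>0. \<forall>z'\<in>\<Gamma>. dist z z' < e \<longrightarrow> f z' = v"
    proof (intro exI[of _ "f w"] exI[of _ e] conjI ballI impI)
      show "f z' = f w" if "z' \<in> \<Gamma>" "dist z z' < e" for z'
        using e(2)[rule_format, OF that(1) w(1)] that(2) w(2) by blast
    qed (fact e(1))
    then show ?thesis unfolding g_def by (rule someI_ex)
  qed
  have gf: "g z = f z" if zS: "z \<in> ?S" and z\<Gamma>: "z \<in> \<Gamma>" for z
  proof -
    obtain e where "e > 0" "\<forall>z'\<in>\<Gamma>. dist z z' < e \<longrightarrow> f z' = g z" using g[OF zS] by blast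
    then show ?thesis using z\<Gamma> by (metis dist_self)
  qed
  have "g constant_on ?S"
  proof (rule locally_constant_imp_constant)
    fix a assume a: "a \<in> ?S"
    obtain e where e: "e > 0" "\<And>z'. z' \<in> \<Gamma> \<Longrightarrow> dist a z' < e \<Longrightarrow> f z' = g a" using g[OF a] by blast
    have "g x = g a" if x: "x \<in> ?S \<inter> ball a e" for x
    proof -
      obtain d where d: "d > 0" "\<And>z'. z' \<in> \<Gamma> \<Longrightarrow> dist x z' < d \<Longrightarrow> f z' = g x" using g[of x] x by blast
      have "min d (e - dist a x) > 0" using d x by auto
      then obtain w where w: "w \<in> \<Gamma>" "dist x w < min d (e - dist a x)" using dense by blast
      have "dist a w < e" using w dist_triangle[of a w x] by simp
      then have "f w = g a" "f w = g x" using d(2)[OF w(1)] e(2)[OF w(1)] w(2) by simp_all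
      then show ?thesis by simp
    qed
    moreover have "openin (top_of_set ?S) (?S \<inter> ball a e)" by (simp add: openin_open_Int)
    moreover have "a \<in> ?S \<inter> ball a e" using a e(1) by simp
    ultimately show "\<exists>T. openin (top_of_set ?S) T \<and> a \<in> T \<and> (\<forall>x\<in>T. g x = g a)"
      by (intro exI[of _ "?S \<inter> ball a e"] conjI ballI)
  qed simp
  then obtain v where "\<And>x. x \<in> ?S \<Longrightarrow> g x = v" unfolding constant_on_def by blast
  then have "g z1 = g y" by simp
  then show ?thesis using gf[of z1] gf[of y] z(1) y\<Gamma> fy by simp
qed

text \<open>The axioms of \<open>polyhedral_complex\<close> with closed convex cells in place of
  rational polyhedra and over any Euclidean space, so that products and links fit as well.
  Rationality enters separately, through the direction spaces of the cells.\<close>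

definition convex_complex :: "'a::euclidean_space set set \<Rightarrow> bool" where
  "convex_complex C \<longleftrightarrow>
     finite C \<and> (\<forall>c\<in>C. closed c \<and> convex c \<and> c \<noteq> {}) \<and>
     (\<forall>c\<in>C. \<forall>\<phi>. \<phi> face_of c \<and> \<phi> \<noteq> {} \<longrightarrow> \<phi> \<in> C) \<and>
     (\<forall>c\<in>C. \<forall>d\<in>C. (c \<inter> d) face_of c \<and> (c \<inter> d) face_of d)"

lemma convex_complexD:
  assumes "convex_complex C"
  shows "finite C" "c \<in> C \<Longrightarrow> closed c" "c \<in> C \<Longrightarrow> convex c" "c \<in> C \<Longrightarrow> c \<noteq> {}"
    "c \<in> C \<Longrightarrow> \<phi> face_of c \<Longrightarrow> \<phi> \<noteq> {} \<Longrightarrow> \<phi> \<in> C" "c \<in> C \<Longrightarrow> d \<in> C \<Longrightarrow> (c \<inter> d) face_of d"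
proof -
  note d = assms[unfolded convex_complex_def]
  note d1 = d[THEN conjunct2, THEN conjunct1, rule_format]
  note d2 = d[THEN conjunct2, THEN conjunct2, THEN conjunct1, rule_format]
  note d3 = d[THEN conjunct2, THEN conjunct2, THEN conjunct2, rule_format]
  show "finite C" by (rule d[THEN conjunct1])
  show "c \<in> C \<Longrightarrow> closed c" by (rule d1[THEN conjunct1])
  show "c \<in> C \<Longrightarrow> convex c" by (rule d1[THEN conjunct2, THEN conjunct1])
  show "c \<in> C \<Longrightarrow> c \<noteq> {}" by (rule d1[THEN conjunct2, THEN conjunct2])
  show "c \<in> C \<Longrightarrow> \<phi> face_of c \<Longrightarrow> \<phi> \<noteq> {} \<Longrightarrow> \<phi> \<in> C" by (rule d2[OF _ conjI])
  show "c \<in> C \<Longrightarrow> d \<in> C \<Longrightarrow> (c \<inter> d) face_of d" by (rule d3[THEN conjunct2])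
qed

lemma rational_polyhedron_closed_convex:
  assumes "rational_polyhedron s"
  shows "closed s" "convex s"
proof -
  obtain H where H: "s = (\<Inter>(u, c)\<in>H. {x. u \<bullet> x \<le> c})"
    using assms by (auto simp: rational_polyhedron_def)
  show "closed s" unfolding H by (intro closed_INT ballI) (auto simp: closed_halfspace_le)
  show "convex s" unfolding H by (intro convex_INT) (auto simp: convex_halfspace_le)
qed

lemma polyhedral_complex_convex:
  assumes "polyhedral_complex C"
  shows "convex_complex C"
proof -
  note d = assms[unfolded polyhedral_complex_def]
  have 1: "finite C" by (rule d[THEN conjunct1])
  have 2: "\<forall>c\<in>C. closed c \<and> convex c \<and> c \<noteq> {}"
  proof
    fix c assume "c \<in> C"
    then have "rational_polyhedron c \<and> c \<noteq> {}" by (rule d[THEN conjunct2, THEN conjunct1, rule_format])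
    then show "closed c \<and> convex c \<and> c \<noteq> {}" using rational_polyhedron_closed_convex by blast
  qed
  show ?thesis unfolding convex_complex_def
    by (rule conjI[OF 1 conjI[OF 2 d[THEN conjunct2, THEN conjunct2]]])
qed

lemma face_dim_less:
  fixes c :: "'a::euclidean_space set"
  assumes "convex c" "d face_of c" "d \<noteq> c" "d \<noteq> {}"
  shows "dim (dirs d) < dim (dirs c)"
proof -
  have "c \<noteq> {}" using face_of_imp_subset[OF assms(2)] assms(4) by auto
  then show ?thesis using face_of_aff_dim_lt[OF assms(1-3)] assms(4) by (simp add: dim_dirs)
qed

text \<open>Induction on the dimension: a point outside the relative interior lies on a supporting
  hyperplane that cuts out a proper face.\<close>

lemma carrier_face:
  fixes c :: "'a::euclidean_space set"
  assumes "convex c" "x \<in> c"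
  shows "\<exists>d. d face_of c \<and> x \<in> rel_interior d"
  using assms
proof (induction "dim (dirs c)" arbitrary: c rule: less_induct)
  case less
  show ?case
  proof (cases "x \<in> rel_interior c")
    case True
    then show ?thesis using face_of_refl[OF less.prems(1)] by blast
  next
    case False
    then obtain a where a: "\<And>y. y \<in> c \<Longrightarrow> a \<bullet> x \<le> a \<bullet> y" "\<And>y. y \<in> rel_interior c \<Longrightarrow> a \<bullet> x < a \<bullet> y"
      using supporting_hyperplane_rel_boundary[OF less.prems] by metis
    define d where "d = c \<inter> {y. a \<bullet> y = a \<bullet> x}"
    have d: "d face_of c" unfolding d_def
      using face_of_Int_supporting_hyperplane_ge[of c "a \<bullet> x" a] a(1) less.prems by blast
    have xd: "x \<in> d" using less.prems by (simp add: d_def)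
    obtain y where y: "y \<in> rel_interior c" using less.prems rel_interior_eq_empty by blast
    then have "y \<in> c" "y \<notin> d" using a(2)[OF y] rel_interior_subset by (auto simp: d_def)
    then have "d \<noteq> c" by blast
    then have "dim (dirs d) < dim (dirs c)" using face_dim_less[OF less.prems(1) d] xd by blast
    then obtain e where "e face_of d" "x \<in> rel_interior e"
      using less.hyps[of d] d xd face_of_imp_convex by blast
    then show ?thesis using d face_of_trans by blast
  qed
qed

lemma carrier_exists:
  assumes "convex_complex C" "c \<in> C" "x \<in> c"
  obtains d where "d \<in> C" "d face_of c" "x \<in> rel_interior d"
proof -
  obtain d where d: "d face_of c" "x \<in> rel_interior d"
    using carrier_face[OF convex_complexD(3)[OF assms(1,2)] assms(3)] by blast
  then have "d \<noteq> {}" using rel_interior_subset by auto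
  then have "d \<in> C" using convex_complexD(5)[OF assms(1,2) d(1)] by blast
  then show ?thesis using that d by blast
qed

lemma complex_face_subset: "convex_complex C \<Longrightarrow> c \<in> C \<Longrightarrow> d \<in> C \<Longrightarrow> d \<subseteq> c \<Longrightarrow> d face_of c"
  using convex_complexD(6)[of C d c] by (metis inf.absorb1)

text \<open>The intersection with \<open>d\<close> is a face of \<open>c\<close> that meets the
  relative interior of \<open>c\<close>, hence is all of \<open>c\<close>.\<close>

lemma carrier_subset:
  assumes "convex_complex C" "c \<in> C" "d \<in> C" "x \<in> rel_interior c" "x \<in> d"
  shows "c \<subseteq> d"
proof -
  have "(d \<inter> c) face_of c" by (rule convex_complexD(6)[OF assms(1,3,2)])
  moreover have "x \<in> (d \<inter> c) \<inter> rel_interior c"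
    using assms(4,5) subsetD[OF rel_interior_subset assms(4)] by simp
  ultimately have "c \<subseteq> d \<inter> c" using subset_of_face_of[OF _ order_refl, of "d \<inter> c" c] by blast
  then show ?thesis by blast
qed

lemma carrier_unique:
  assumes "convex_complex C" "c \<in> C" "d \<in> C" "x \<in> rel_interior c" "x \<in> rel_interior d"
  shows "c = d"
  by (intro subset_antisym carrier_subset[OF assms(1,2,3,4)] carrier_subset[OF assms(1,3,2,5)])
    (use assms(4,5) subsetD[OF rel_interior_subset] in blast)+

lemma facets_subset: "facets C \<subseteq> C"
  by (auto simp: facets_def)

lemma facet_exists:
  assumes "finite C" "c \<in> C"
  obtains s where "s \<in> facets C" "c \<subseteq> s"
proof -
  obtain s where "s \<in> C" "c \<subseteq> s" "\<And>d. d \<in> C \<Longrightarrow> s \<subseteq> d \<Longrightarrow> d = s"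
    using finite_has_maximal2[OF assms] by metis
  then have "s \<in> facets C" unfolding facets_def by blast
  then show ?thesis using that \<open>c \<subseteq> s\<close> by blast
qed

section \<open>Sums with a subspace\<close>

lemma set_plus_iff: "z \<in> S + T \<longleftrightarrow> (\<exists>x\<in>S. z - x \<in> T)" for z :: "'a::ab_group_add"
proof
  assume "z \<in> S + T"
  then obtain x y where "z = x + y" "x \<in> S" "y \<in> T" by (rule set_plus_elim)
  then show "\<exists>x\<in>S. z - x \<in> T" by (intro bexI[of _ x]) auto
next
  assume "\<exists>x\<in>S. z - x \<in> T"
  then obtain x where "x \<in> S" "z - x \<in> T" by blast
  then have "x + (z - x) \<in> S + T" by (rule set_plus_intro)
  then show "z \<in> S + T" by simp
qed

lemma set_plus_eq: "S + T = {x + y | x y. x \<in> S \<and> y \<in> T}"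
  by (auto simp: set_plus_def)

lemma subspace_set_plus: "subspace S \<Longrightarrow> subspace T \<Longrightarrow> subspace (S + T)"
  unfolding set_plus_eq by (rule subspace_sums)

lemma dim_set_plus: "subspace S \<Longrightarrow> subspace T \<Longrightarrow> dim (S + T) + dim (S \<inter> T) = dim S + dim T"
  for S :: "'a::euclidean_space set"
  unfolding set_plus_eq by (rule dim_sums_Int)

lemma dirs_set_plus:
  assumes "S \<noteq> {}" "subspace M"
  shows "dirs (S + M) = dirs S + M"
proof
  obtain x where x: "x \<in> S" using assms by blast
  have x0: "x \<in> S + M" using x assms(2) by (auto simp: set_plus_iff subspace_0 intro!: bexI[of _ x])
  show "dirs (S + M) \<subseteq> dirs S + M"
  proof (rule dirs_subset[OF _ x0])
    fix y assume "y \<in> S + M"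
    then obtain s where "s \<in> S" "y - s \<in> M" by (auto simp: set_plus_iff)
    then show "y - x \<in> dirs S + M" using x diff_in_dirs unfolding set_plus_iff
      by (intro bexI[of _ "s - x"]) auto
  qed (use assms subspace_set_plus in auto)
  have 1: "dirs S \<subseteq> dirs (S + M)"
  proof (rule dirs_mono, rule subsetI)
    fix y assume "y \<in> S"
    then show "y \<in> S + M" using assms(2) by (auto simp: set_plus_iff subspace_0 intro!: bexI[of _ y])
  qed
  have 2: "M \<subseteq> dirs (S + M)"
  proof
    fix m assume "m \<in> M"
    then have "x + m \<in> S + M" using x by (rule set_plus_intro[rotated])
    then show "m \<in> dirs (S + M)" using diff_in_dirs[OF _ x0] by fastforce
  qed
  show "dirs S + M \<subseteq> dirs (S + M)"
    using 1 2 by (auto simp: set_plus_def intro!: subspace_add)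
qed

lemma proper_subspace_hyperplane:
  fixes S :: "'a::euclidean_space set"
  assumes "subspace S" "dim S + 1 = DIM('a)"
  obtains u where "u \<noteq> 0" "S = {y. u \<bullet> y = 0}"
proof -
  obtain u where u: "u \<noteq> 0" "span S \<subseteq> {y. u \<bullet> y = 0}"
    using lowdim_subset_hyperplane[of S] assms by auto
  have "S = UNIV \<inter> {y. u \<bullet> y = 0}"
  proof (rule hyperplane_in_subspace)
    show "\<exists>x\<in>UNIV. u \<bullet> x \<noteq> 0" using u(1) by (intro bexI[of _ u]) auto
  qed (use assms u span_superset in auto)
  then show ?thesis using that u(1) by simp
qed

section \<open>Degrees of projections\<close>

lemma subset_plus_subspace:
  assumes "subspace M"
  shows "S \<subseteq> S + M"
proof
  fix x assume "x \<in> S"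
  then show "x \<in> S + M" using set_plus_intro[OF _ subspace_0[OF assms], of x S] by simp
qed

lemma convex_plus_subspace: "subspace M \<Longrightarrow> convex c \<Longrightarrow> convex (c + M)"
  by (rule convex_set_plus[OF _ subspace_imp_convex])

lemma set_plus_mono_left: "S \<subseteq> T \<Longrightarrow> S + M \<subseteq> T + M"
  unfolding set_plus_def by blast

lemma rel_interior_plus_subspace:
  fixes c :: "'a::euclidean_space set"
  assumes "subspace M" "convex c"
  shows "rel_interior (c + M) = rel_interior c + M"
  using rel_interior_sum[OF assms(2) subspace_imp_convex[OF assms(1)]]
    rel_interior_affine[OF subspace_imp_affine[OF assms(1)]]
  by (simp only:)

text \<open>When \<open>dirs \<rho> + M\<close> is the hyperplane on which \<open>u\<close>
  vanishes, these are the facets around \<open>\<rho>\<close> whose images contain the positive half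
  of a small ball at each relatively interior point of the wall \<open>\<rho> + M\<close>.\<close>

definition wall_side :: "'a::euclidean_space set set \<Rightarrow> 'a set \<Rightarrow> 'a \<Rightarrow> 'a set set" where
  "wall_side E \<rho> u = {s\<in>facets E. \<rho> \<subseteq> s \<and> (\<exists>x\<in>\<rho>. \<exists>y\<in>s. u \<bullet> x < u \<bullet> y)}"

lemma wall_sideI:
  assumes "s \<in> facets E" "\<rho> \<subseteq> s" "x \<in> \<rho>" "y \<in> s" "u \<bullet> x < u \<bullet> y"
  shows "s \<in> wall_side E \<rho> u"
  unfolding wall_side_def using assms by blast

section \<open>Projection of a complex along \<open>M\<close>, modulo the invariant directions
  \<open>K\<close>\<close>

context
  fixes E :: "'a::euclidean_space set set" and M K :: "'a set" and W :: "'a set \<Rightarrow> real"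
  assumes cx: "convex_complex E"
    and M: "subspace M" and K: "subspace K" and KM: "K \<subseteq> M"
    and inv: "\<And>c x k. c \<in> E \<Longrightarrow> x \<in> c \<Longrightarrow> k \<in> K \<Longrightarrow> x + k \<in> c"
    and dims: "\<And>s. s \<in> facets E \<Longrightarrow> dim (dirs s) + dim M = DIM('a) + dim K"
begin

lemma K_subset_dirs: "c \<in> E \<Longrightarrow> K \<subseteq> dirs c"
proof
  fix k assume "c \<in> E" "k \<in> K"
  obtain x where "x \<in> c" using convex_complexD(4)[OF cx \<open>c \<in> E\<close>] by blast
  then show "k \<in> dirs c" using diff_in_dirs[OF inv[OF \<open>c \<in> E\<close> _ \<open>k \<in> K\<close>], of x x] by simp
qed

text \<open>By the dimension count the directions of \<open>s\<close> lost in the projection have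
  the dimension of \<open>K\<close>, and they contain \<open>K\<close>. So two points of
  \<open>s\<close> with the same image differ by an element of \<open>K\<close>.\<close>

lemma full_kernel:
  assumes "s \<in> facets E" "dirs s + M = UNIV"
  shows "dirs s \<inter> M = K"
proof -
  have "dim (dirs s + M) + dim (dirs s \<inter> M) = dim (dirs s) + dim M"
    by (rule dim_set_plus) (use M in auto)
  then have "dim (dirs s \<inter> M) = dim K" using dims[OF assms(1)] assms(2) by simp
  moreover have "K \<subseteq> dirs s \<inter> M" using K_subset_dirs KM assms(1) facets_subset by blast
  ultimately show ?thesis
    using subspace_dim_equal[of K "dirs s \<inter> M"] K M by (simp add: subspace_inter)
qed

text \<open>The sum of a closed set and a subspace need not be closed. Here the fibres of the
  projection on the affine span of \<open>s\<close> are translates of \<open>K\<close>, under which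
  \<open>s\<close> is invariant, so membership of \<open>y\<close> in \<open>s + M\<close> can be
  tested at one point of that span depending continuously on \<open>y\<close>.\<close>

lemma closed_full:
  assumes s: "s \<in> facets E" and full: "dirs s + M = UNIV"
  shows "closed (s + M)"
proof -
  have sE: "s \<in> E" using s facets_subset by blast
  obtain x0 where x0: "x0 \<in> s" using convex_complexD(4)[OF cx sE] by blast
  have "\<exists>l. l \<in> dirs s \<and> h - l \<in> M" for h
    using full set_plus_iff[of h "dirs s" M] by blast
  then obtain l where l: "\<And>h. l h \<in> dirs s" "\<And>h. h - l h \<in> M" by metis
  \<comment> \<open>A linear choice of representatives modulo \<open>M\<close> inside
    \<open>dirs s\<close>, built from the choices \<open>l\<close> on the standard basis. It is
    unique only up to \<open>K\<close>, which the invariance absorbs.\<close>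
  define g where "g = (\<lambda>h. \<Sum>b\<in>Basis. (h \<bullet> b) *\<^sub>R l b)"
  have g1: "g h \<in> dirs s" for h unfolding g_def
    by (intro subspace_sum subspace_scale subspace_dirs l)
  have "h - g h = (\<Sum>b\<in>Basis. (h \<bullet> b) *\<^sub>R (b - l b))" for h
    by (simp add: g_def scaleR_diff_right sum_subtractf euclidean_representation)
  then have g2: "h - g h \<in> M" for h
    by (simp add: M subspace_sum subspace_scale l)
  have gadd: "g (x + y) = g x + g y" for x y
    by (simp add: g_def inner_add_left scaleR_add_left sum.distrib)
  have key: "y \<in> s + M \<longleftrightarrow> x0 + g (y - x0) \<in> s" for y
  proof
    assume "x0 + g (y - x0) \<in> s"
    moreover have "y - (x0 + g (y - x0)) \<in> M" using g2[of "y - x0"] by (simp add: algebra_simps)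
    ultimately show "y \<in> s + M" unfolding set_plus_iff by blast
  next
    assume "y \<in> s + M"
    then obtain x where x: "x \<in> s" "y - x \<in> M" unfolding set_plus_iff by blast
    have a: "g (y - x) \<in> K"
      using g1[of "y - x"] subspace_diff[OF M x(2) g2[of "y - x"]] full_kernel[OF assms] by auto
    have b: "(x - x0) - g (x - x0) \<in> K"
      using g2[of "x - x0"] subspace_diff[OF subspace_dirs diff_in_dirs[OF x(1) x0] g1[of "x - x0"]]
        full_kernel[OF assms] by auto
    have "x + (g (y - x) - ((x - x0) - g (x - x0))) \<in> s"
      by (rule inv[OF sE x(1) subspace_diff[OF K a b]])
    moreover have "g (y - x0) = g (y - x) + g (x - x0)" using gadd[of "y - x" "x - x0"] by simp
    ultimately show "x0 + g (y - x0) \<in> s" by (simp add: algebra_simps)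
  qed
  have "s + M = (\<lambda>y. x0 + g (y - x0)) -` s" using key by auto
  moreover have "continuous_on UNIV (\<lambda>y. x0 + g (y - x0))"
    unfolding g_def by (intro continuous_intros)
  ultimately show ?thesis
    using closed_vimage[OF convex_complexD(2)[OF cx sE]] by (simp only:)
qed

text \<open>The face carries a preimage of \<open>z\<close> in its relative interior. The dimension
  formula says that the codimension of \<open>\<rho> + M\<close> in the space equals the codimension
  of \<open>\<rho>\<close> in \<open>s\<close>: both lose exactly \<open>K\<close> in the projection
  beyond \<open>M\<close> itself.\<close>

lemma face_at:
  assumes s: "s \<in> facets E" and full: "dirs s + M = UNIV" and z: "z \<in> s + M"
  obtains \<rho> where "\<rho> \<in> E" "\<rho> face_of s" "z \<in> rel_interior (\<rho> + M)" "dim (dirs \<rho> + M) + dim (dirs s) = dim (dirs \<rho>) + DIM('a)"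
proof -
  have sE: "s \<in> E" using s facets_subset by blast
  obtain x where x: "x \<in> s" "z - x \<in> M" using z unfolding set_plus_iff by blast
  obtain \<rho> where \<rho>: "\<rho> \<in> E" "\<rho> face_of s" "x \<in> rel_interior \<rho>"
    using carrier_exists[OF cx sE x(1)] by metis
  have "z \<in> rel_interior (\<rho> + M)"
    unfolding rel_interior_plus_subspace[OF M convex_complexD(3)[OF cx \<rho>(1)]] set_plus_iff using \<rho>(3) x(2) by blast
  moreover have "dirs \<rho> \<inter> M = K"
    using K_subset_dirs[OF \<rho>(1)] KM full_kernel[OF s full] dirs_mono[OF face_of_imp_subset[OF \<rho>(2)]] by blast
  then have "dim (dirs \<rho> + M) + dim K = dim (dirs \<rho>) + dim M"
    using dim_set_plus[OF subspace_dirs M, of \<rho>] by simp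
  then have "dim (dirs \<rho> + M) + dim (dirs s) = dim (dirs \<rho>) + DIM('a)"
    using dims[OF s] by simp
  ultimately show ?thesis using that \<rho> by blast
qed

lemma rel_interior_K_inv:
  assumes "c \<in> E" "x \<in> rel_interior c" "k \<in> K"
  shows "x + k \<in> rel_interior c"
proof -
  have "(+) k ` c = c"
  proof
    show "(+) k ` c \<subseteq> c" using inv[OF assms(1) _ assms(3)] by (auto simp: add.commute)
    show "c \<subseteq> (+) k ` c"
    proof
      fix y assume "y \<in> c"
      then have "y + (- k) \<in> c" using inv[OF assms(1)] assms(3) K subspace_neg by blast
      then show "y \<in> (+) k ` c" by (intro image_eqI[of _ _ "y + (- k)"]) auto
    qed
  qed
  then have "(+) k ` rel_interior c = rel_interior c" using rel_interior_translation[of k c] by simp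
  moreover have "x + k = k + x" by simp
  ultimately show ?thesis using assms(2) by (metis image_eqI)
qed

text \<open>Two preimages of \<open>z\<close> in \<open>s\<close> differ by an element of
  \<open>K\<close>, and translation by \<open>K\<close> preserves the relative interior of every
  cell.\<close>

lemma face_at_unique:
  assumes s: "s \<in> facets E" and full: "dirs s + M = UNIV"
    and \<rho>: "\<rho> \<in> E" "\<rho> \<subseteq> s" "z \<in> rel_interior (\<rho> + M)" and \<rho>': "\<rho>' \<in> E" "\<rho>' \<subseteq> s" "z \<in> rel_interior (\<rho>' + M)"
  shows "\<rho> = \<rho>'"
proof -
  obtain x where x: "x \<in> rel_interior \<rho>" "z - x \<in> M"
    using \<rho>(3) unfolding rel_interior_plus_subspace[OF M convex_complexD(3)[OF cx \<rho>(1)]] set_plus_iff by blast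
  obtain y where y: "y \<in> rel_interior \<rho>'" "z - y \<in> M"
    using \<rho>'(3) unfolding rel_interior_plus_subspace[OF M convex_complexD(3)[OF cx \<rho>'(1)]] set_plus_iff by blast
  have "x \<in> s" "y \<in> s" using x y \<rho>(2) \<rho>'(2) rel_interior_subset by blast+
  then have "y - x \<in> dirs s \<inter> M" using subspace_diff[OF M x(2) y(2)] diff_in_dirs by simp
  then have "y - x \<in> K" using full_kernel[OF s full] by simp
  then have "x + (y - x) \<in> rel_interior \<rho>" using rel_interior_K_inv[OF \<rho>(1) x(1)] by blast
  then show ?thesis using carrier_unique[OF cx \<rho>(1) \<rho>'(1) _ y(1)] by simp
qed

text \<open>The facet has a direction on which \<open>u\<close> is nonzero, and adding it to the
  hyperplane gives everything.\<close>

lemma wall_side_full: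
  assumes "s \<in> wall_side E \<rho> u" "dirs \<rho> + M = {y. u \<bullet> y = 0}"
  shows "dirs s + M = UNIV"
proof -
  obtain x y where xy: "x \<in> \<rho>" "y \<in> s" "\<rho> \<subseteq> s" "u \<bullet> x < u \<bullet> y"
    using assms(1) by (auto simp: wall_side_def)
  have d: "y - x \<in> dirs s" using xy diff_in_dirs by blast
  have k: "u \<bullet> (y - x) \<noteq> 0" using xy by (simp add: inner_diff_right)
  have "w \<in> dirs s + M" for w
  proof -
    define c where "c = (u \<bullet> w) / (u \<bullet> (y - x))"
    have "u \<bullet> (w - c *\<^sub>R (y - x)) = 0" using k by (simp add: c_def inner_diff_right)
    then have "w - c *\<^sub>R (y - x) \<in> dirs \<rho> + M" using assms(2) by simp
    then obtain d' where d': "d' \<in> dirs \<rho>" "w - c *\<^sub>R (y - x) - d' \<in> M" unfolding set_plus_iff by blast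
    have "c *\<^sub>R (y - x) + d' \<in> dirs s"
      using d d'(1) dirs_mono[OF xy(3)] by (intro subspace_add subspace_scale) auto
    moreover have "w - (c *\<^sub>R (y - x) + d') \<in> M" using d'(2) by (simp add: algebra_simps)
    ultimately show ?thesis unfolding set_plus_iff by blast
  qed
  then show ?thesis by blast
qed

lemma affine_hull_wall:
  assumes "dirs \<rho> + M = {y. u \<bullet> y = 0}" "z \<in> \<rho> + M"
  shows "y \<in> affine hull (\<rho> + M) \<longleftrightarrow> u \<bullet> y = u \<bullet> z"
proof -
  have "\<rho> \<noteq> {}" using assms(2) by (auto simp: set_plus_iff)
  then show ?thesis
    using dirs_set_plus[OF _ M, of \<rho>] assms
    by (simp add: affine_hull_dirs[OF assms(2)] inner_diff_right)
qed

lemma wall_half_ball: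
  assumes "\<rho> \<in> E" "dirs \<rho> + M = {y. u \<bullet> y = 0}" "z \<in> rel_interior (\<rho> + M)" "s \<in> wall_side E \<rho> u"
  shows "\<exists>e>0. \<forall>y. dist z y < e \<and> u \<bullet> y \<ge> u \<bullet> z \<longrightarrow> y \<in> s + M"
proof -
  obtain x b where xy: "x \<in> \<rho>" "b \<in> s" "\<rho> \<subseteq> s" "u \<bullet> x < u \<bullet> b" "s \<in> E"
    using assms(4) facets_subset by (auto simp: wall_side_def)
  have zP: "z \<in> \<rho> + M" using assms(3) rel_interior_subset by blast
  have "x \<in> affine hull (\<rho> + M)" by (rule hull_inc[OF subsetD[OF subset_plus_subspace[OF M] xy(1)]])
  then have ux: "u \<bullet> x = u \<bullet> z" using affine_hull_wall[OF assms(2) zP] by simp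
  have "\<exists>e>0. \<forall>y. dist z y < e \<and> y - z \<in> UNIV \<and> u \<bullet> y \<ge> u \<bullet> z \<longrightarrow> y \<in> s + M"
  proof (rule half_ball_in_convex)
    show "convex (s + M)" by (rule convex_plus_subspace[OF M convex_complexD(3)[OF cx xy(5)]])
    show "\<rho> + M \<subseteq> s + M" by (rule set_plus_mono_left[OF xy(3)])
    show "z \<in> rel_interior (\<rho> + M)" by (rule assms(3))
    show "b \<in> s + M" using xy(2) subset_plus_subspace[OF M, of s] by blast
    show "u \<bullet> z < u \<bullet> b" using xy(4) ux by simp
    fix y assume "u \<bullet> (y - z) = 0"
    then show "y \<in> affine hull (\<rho> + M)"
      using affine_hull_wall[OF assms(2) zP] by (simp add: inner_diff_right)
  qed auto
  then show ?thesis by simp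
qed

abbreviation "generic_pts \<equiv> {z. \<forall>c\<in>E. z \<in> c + M \<longrightarrow> dirs c + M = UNIV}"

text \<open>A point off all \<open>c + M\<close> of codimension at least 2. A full facet image \<open>s + M\<close> has it outside, in
  its interior, or in the relative interior of exactly one wall \<open>\<rho> + M\<close>, \<open>\<rho>\<close> a ridge; near the point
  the images meeting such a wall look like half-spaces.\<close>

lemma degree_locally_constant:
  assumes bal: "\<And>\<rho> u. \<rho> \<in> E \<Longrightarrow> (\<exists>s\<in>facets E. \<rho> face_of s \<and> dim (dirs \<rho>) + 1 = dim (dirs s)) \<Longrightarrow>
       u \<noteq> 0 \<Longrightarrow> dirs \<rho> + M = {y. u \<bullet> y = 0} \<Longrightarrow> sum W (wall_side E \<rho> u) = sum W (wall_side E \<rho> (- u))"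
    and z: "\<And>c. c \<in> E \<Longrightarrow> z \<in> c + M \<Longrightarrow> DIM('a) \<le> dim (dirs c + M) + 1"
  shows "\<exists>e>0. \<exists>v. \<forall>z'\<in>generic_pts. dist z z' < e \<longrightarrow> sum W {s\<in>facets E. z' \<in> s + M} = v"
proof -
  have finE: "finite E" by (rule convex_complexD(1)[OF cx])
  have finF: "finite (facets E)" using finE facets_subset finite_subset by blast
  \<comment> \<open>The ridges whose images have \<open>z\<close> in the relative interior of a
    wall. Only crossing one of these walls changes the set of facets over points near
    \<open>z\<close>.\<close>
  define R where "R = {\<rho>\<in>E. z \<in> rel_interior (\<rho> + M) \<and> dim (dirs \<rho> + M) + 1 = DIM('a) \<and>
      (\<exists>s\<in>facets E. \<rho> face_of s \<and> dim (dirs \<rho>) + 1 = dim (dirs s))}"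
  have finR: "finite R" using finE by (simp add: R_def)
  have "\<exists>u. u \<noteq> 0 \<and> dirs \<rho> + M = {y. u \<bullet> y = 0}" if "\<rho> \<in> R" for \<rho>
    using proper_subspace_hyperplane[OF subspace_set_plus[OF subspace_dirs M, of \<rho>]] that unfolding R_def by blast
  then obtain u where u: "\<And>\<rho>. \<rho> \<in> R \<Longrightarrow> u \<rho> \<noteq> 0" "\<And>\<rho>. \<rho> \<in> R \<Longrightarrow> dirs \<rho> + M = {y. u \<rho> \<bullet> y = 0}" by metis
  have u': "\<And>\<rho>. \<rho> \<in> R \<Longrightarrow> dirs \<rho> + M = {y. (- u \<rho>) \<bullet> y = 0}" using u(2) by simp
  \<comment> \<open>Facets in \<open>A\<close> stay present over all points near \<open>z\<close>;
    \<open>Q z' \<rho>\<close> collects the facets around \<open>\<rho>\<close> on that side of the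
    wall on which \<open>z'\<close> lies.\<close>
  define A where "A = {s\<in>facets E. dirs s + M = UNIV \<and> z \<in> interior (s + M)}"
  define Q where "Q = (\<lambda>z' \<rho>. if u \<rho> \<bullet> z' > u \<rho> \<bullet> z then wall_side E \<rho> (u \<rho>) else wall_side E \<rho> (- u \<rho>))"
  have RE: "\<rho> \<in> E" and Rz: "z \<in> rel_interior (\<rho> + M)" if "\<rho> \<in> R" for \<rho> using that by (auto simp: R_def)
  have zP: "z \<in> \<rho> + M" if "\<rho> \<in> R" for \<rho> using Rz[OF that] rel_interior_subset by blast

  have "\<exists>e>0. \<forall>y. dist z y < e \<longrightarrow> y \<notin> s + M"
    if s: "s \<in> facets E" "dirs s + M = UNIV" "z \<notin> s + M" for s
  proof -
    have "open (- (s + M))" using closed_full[OF s(1,2)] by (simp add: open_Compl)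
    then obtain e where "e > 0" "ball z e \<subseteq> - (s + M)" using s(3) open_contains_ball by blast
    then show ?thesis by (intro exI[of _ e]) auto
  qed
  then obtain e1 where e1: "\<And>s. s \<in> facets E \<Longrightarrow> dirs s + M = UNIV \<Longrightarrow> z \<notin> s + M \<Longrightarrow> e1 s > 0"
    "\<And>s y. s \<in> facets E \<Longrightarrow> dirs s + M = UNIV \<Longrightarrow> z \<notin> s + M \<Longrightarrow> dist z y < e1 s \<Longrightarrow> y \<notin> s + M"
    by metis
  have "\<exists>e>0. \<forall>y. dist z y < e \<longrightarrow> y \<in> s + M" if s: "s \<in> A" for s
  proof -
    obtain e where "e > 0" "ball z e \<subseteq> s + M" using s by (auto simp: A_def mem_interior)
    then show ?thesis by (intro exI[of _ e]) auto
  qed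
  then obtain e2 where e2: "\<And>s. s \<in> A \<Longrightarrow> e2 s > 0" "\<And>s y. s \<in> A \<Longrightarrow> dist z y < e2 s \<Longrightarrow> y \<in> s + M"
    by metis
  have "\<exists>e>0. \<forall>y. dist z y < e \<and> u \<rho> \<bullet> y = u \<rho> \<bullet> z \<longrightarrow> y \<in> \<rho> + M" if \<rho>: "\<rho> \<in> R" for \<rho>
  proof -
    obtain e where "e > 0" "ball z e \<inter> affine hull (\<rho> + M) \<subseteq> \<rho> + M"
      using Rz[OF \<rho>] by (auto simp: mem_rel_interior_ball)
    then show ?thesis using affine_hull_wall[OF u(2)[OF \<rho>] zP[OF \<rho>]] by (intro exI[of _ e]) auto
  qed
  then obtain e3 where e3: "\<And>\<rho>. \<rho> \<in> R \<Longrightarrow> e3 \<rho> > 0"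
    "\<And>\<rho> y. \<rho> \<in> R \<Longrightarrow> dist z y < e3 \<rho> \<Longrightarrow> u \<rho> \<bullet> y = u \<rho> \<bullet> z \<Longrightarrow> y \<in> \<rho> + M" by metis
  have "\<exists>e>0. \<forall>y. dist z y < e \<and> u \<rho> \<bullet> y \<ge> u \<rho> \<bullet> z \<longrightarrow> y \<in> s + M" if "\<rho> \<in> R" "s \<in> wall_side E \<rho> (u \<rho>)" for \<rho> s
    by (rule wall_half_ball[OF RE[OF that(1)] u(2)[OF that(1)] Rz[OF that(1)] that(2)])
  then obtain e4 where e4: "\<And>\<rho> s. \<rho> \<in> R \<Longrightarrow> s \<in> wall_side E \<rho> (u \<rho>) \<Longrightarrow> e4 \<rho> s > 0"
    "\<And>\<rho> s y. \<rho> \<in> R \<Longrightarrow> s \<in> wall_side E \<rho> (u \<rho>) \<Longrightarrow> dist z y < e4 \<rho> s \<Longrightarrow> u \<rho> \<bullet> y \<ge> u \<rho> \<bullet> z \<Longrightarrow> y \<in> s + M" by metis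
  have "\<exists>e>0. \<forall>y. dist z y < e \<and> (- u \<rho>) \<bullet> y \<ge> (- u \<rho>) \<bullet> z \<longrightarrow> y \<in> s + M" if "\<rho> \<in> R" "s \<in> wall_side E \<rho> (- u \<rho>)" for \<rho> s
    by (rule wall_half_ball[OF RE[OF that(1)] u'[OF that(1)] Rz[OF that(1)] that(2)])
  then obtain e5 where e5: "\<And>\<rho> s. \<rho> \<in> R \<Longrightarrow> s \<in> wall_side E \<rho> (- u \<rho>) \<Longrightarrow> e5 \<rho> s > 0"
    "\<And>\<rho> s y. \<rho> \<in> R \<Longrightarrow> s \<in> wall_side E \<rho> (- u \<rho>) \<Longrightarrow> dist z y < e5 \<rho> s \<Longrightarrow> (- u \<rho>) \<bullet> y \<ge> (- u \<rho>) \<bullet> z \<Longrightarrow> y \<in> s + M" by metis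
  \<comment> \<open>All radii found so far; the element \<open>1\<close> keeps the set nonempty, so
    that its minimum exists.\<close>
  define S where "S = insert 1 (e1 ` {s\<in>facets E. dirs s + M = UNIV \<and> z \<notin> s + M} \<union> e2 ` A \<union> e3 ` R \<union>
      (\<lambda>(\<rho>,s). e4 \<rho> s) ` (SIGMA \<rho>:R. wall_side E \<rho> (u \<rho>)) \<union> (\<lambda>(\<rho>,s). e5 \<rho> s) ` (SIGMA \<rho>:R. wall_side E \<rho> (- u \<rho>)))"
  have finw: "finite (wall_side E \<rho> w)" for \<rho> w using finF by (simp add: wall_side_def)
  have finA: "finite A" using finF by (simp add: A_def)
  have finS: "finite S" unfolding S_def using finF finR finw finA by auto
  define e where "e = Min S"
  have "e \<in> S" unfolding e_def using finS by (intro Min_in) (auto simp: S_def)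
  then have e0: "e > 0" unfolding S_def using e1(1) e2(1) e3(1) e4(1) e5(1) by auto
  have eS: "e \<le> l" if "l \<in> S" for l unfolding e_def using finS that by simp

  have main: "{s\<in>facets E. z' \<in> s + M} = A \<union> (\<Union>\<rho>\<in>R. Q z' \<rho>)" if z': "z' \<in> generic_pts" "dist z z' < e" for z'
  proof (intro subset_antisym subsetI)
    fix s assume "s \<in> {s\<in>facets E. z' \<in> s + M}"
    then have s: "s \<in> facets E" "z' \<in> s + M" by auto
    have sE: "s \<in> E" using s(1) facets_subset by blast
    have full: "dirs s + M = UNIV" using z'(1) s(2) sE by blast
    have zs: "z \<in> s + M"
    proof (rule ccontr)
      assume n: "z \<notin> s + M"
      then have "e \<le> e1 s" using s(1) full by (intro eS) (simp add: S_def)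
      then show False using e1(2)[OF s(1) full n, of z'] z'(2) s(2) by simp
    qed
    obtain \<rho> where \<rho>: "\<rho> \<in> E" "\<rho> face_of s" "z \<in> rel_interior (\<rho> + M)"
      "dim (dirs \<rho> + M) + dim (dirs s) = dim (dirs \<rho>) + DIM('a)"
      using face_at[OF s(1) full zs] by metis
    show "s \<in> A \<union> (\<Union>\<rho>\<in>R. Q z' \<rho>)"
    proof (cases "\<rho> = s")
      case True
      have "affine hull (s + M) = UNIV"
        using dirs_set_plus[OF convex_complexD(4)[OF cx sE] M] full by (simp add: affine_hull_dirs[OF zs])
      then have "z \<in> interior (s + M)" using \<rho>(3) True rel_interior_interior by metis
      then show ?thesis using s(1) full by (simp add: A_def)
    next
      case False
      have "dim (dirs \<rho>) < dim (dirs s)"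
        using face_dim_less[OF convex_complexD(3)[OF cx sE] \<rho>(2) False convex_complexD(4)[OF cx \<rho>(1)]] .
      moreover have "DIM('a) \<le> dim (dirs \<rho> + M) + 1" using z[OF \<rho>(1)] \<rho>(3) rel_interior_subset by blast
      ultimately have "dim (dirs \<rho> + M) + 1 = DIM('a)" "dim (dirs \<rho>) + 1 = dim (dirs s)"
        using \<rho>(4) by linarith+
      then have \<rho>R: "\<rho> \<in> R" unfolding R_def using \<rho> s(1) by blast
      obtain x where x: "x \<in> \<rho>" using convex_complexD(4)[OF cx \<rho>(1)] by blast
      have ux: "u \<rho> \<bullet> x = u \<rho> \<bullet> z"
        using affine_hull_wall[OF u(2)[OF \<rho>R] zP[OF \<rho>R], of x] x subset_plus_subspace[OF M, of \<rho>] hull_inc[of x "\<rho> + M"] by blast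
      obtain y where y: "y \<in> s" "z' - y \<in> M" using s(2) unfolding set_plus_iff by blast
      have "z' - y \<in> dirs \<rho> + M" using y(2) subspace_0[OF subspace_dirs, of \<rho>] set_plus_intro[of 0 "dirs \<rho>" "z' - y" M] by simp
      then have uy: "u \<rho> \<bullet> y = u \<rho> \<bullet> z'" using u(2)[OF \<rho>R] by (simp add: inner_diff_right)
      \<comment> \<open>A point near \<open>z\<close> on the hyperplane of the wall lies in
        \<open>\<rho> + M\<close>, which is impossible for a generic point, as this image is not of
        full dimension.\<close>
      have ne: "u \<rho> \<bullet> z' \<noteq> u \<rho> \<bullet> z"
      proof
        assume eq: "u \<rho> \<bullet> z' = u \<rho> \<bullet> z"
        have "e \<le> e3 \<rho>" using \<rho>R by (intro eS) (simp add: S_def)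
        then have "z' \<in> \<rho> + M" using e3(2)[OF \<rho>R _ eq] z'(2) by simp
        then have "dirs \<rho> + M = UNIV" using z'(1) \<rho>(1) by blast
        then show False using \<open>dim (dirs \<rho> + M) + 1 = DIM('a)\<close> by simp
      qed
      have "s \<in> Q z' \<rho>"
      proof (cases "u \<rho> \<bullet> z' > u \<rho> \<bullet> z")
        case True
        then have "s \<in> wall_side E \<rho> (u \<rho>)" using ux uy
          by (intro wall_sideI[OF s(1) face_of_imp_subset[OF \<rho>(2)] x y(1)]) simp
        then show ?thesis using True by (simp add: Q_def)
      next
        case False
        then have "(- u \<rho>) \<bullet> x < (- u \<rho>) \<bullet> y" using ux uy ne by simp
        then have "s \<in> wall_side E \<rho> (- u \<rho>)"
          by (rule wall_sideI[OF s(1) face_of_imp_subset[OF \<rho>(2)] x y(1)])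
        then show ?thesis using False by (simp add: Q_def)
      qed
      then show ?thesis using \<rho>R by blast
    qed
  next
    fix s assume "s \<in> A \<union> (\<Union>\<rho>\<in>R. Q z' \<rho>)"
    then consider "s \<in> A" | \<rho> where "\<rho> \<in> R" "s \<in> Q z' \<rho>" by blast
    then show "s \<in> {s\<in>facets E. z' \<in> s + M}"
    proof cases
      case 1
      then have "e \<le> e2 s" by (intro eS) (simp add: S_def)
      then show ?thesis using e2(2)[OF 1, of z'] z'(2) 1 by (simp add: A_def)
    next
      case 2
      have f: "s \<in> facets E" using 2(2) unfolding Q_def wall_side_def by (auto split: if_splits)
      show ?thesis
      proof (cases "u \<rho> \<bullet> z' > u \<rho> \<bullet> z")
        case True
        then have w: "s \<in> wall_side E \<rho> (u \<rho>)" using 2(2) by (simp add: Q_def)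
        then have "e4 \<rho> s \<in> S" unfolding S_def using 2(1) by force
        then show ?thesis using e4(2)[OF 2(1) w, of z'] z'(2) True f eS by fastforce
      next
        case False
        then have w: "s \<in> wall_side E \<rho> (- u \<rho>)" using 2(2) by (simp add: Q_def)
        then have "e5 \<rho> s \<in> S" unfolding S_def using 2(1) by force
        then show ?thesis using e5(2)[OF 2(1) w, of z'] z'(2) False f eS by fastforce
      qed
    qed
  qed
  have Qfull: "dirs s + M = UNIV" "\<rho> \<subseteq> s" "\<rho> \<noteq> s" "s \<in> facets E" if "\<rho> \<in> R" "s \<in> Q z' \<rho>" for \<rho> s z'
  proof -
    have "\<exists>w. s \<in> wall_side E \<rho> w \<and> dirs \<rho> + M = {y. w \<bullet> y = 0}"
      using that(2) u(2)[OF that(1)] u'[OF that(1)] unfolding Q_def by (auto split: if_splits)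
    then obtain w where w: "s \<in> wall_side E \<rho> w" "dirs \<rho> + M = {y. w \<bullet> y = 0}" by blast
    show "dirs s + M = UNIV" by (rule wall_side_full[OF w])
    show "s \<in> facets E" "\<rho> \<subseteq> s" using w(1) by (auto simp: wall_side_def)
    show "\<rho> \<noteq> s" using \<open>dirs s + M = UNIV\<close> that(1) by (auto simp: R_def)
  qed
  have disj1: "A \<inter> Q z' \<rho> = {}" if \<rho>: "\<rho> \<in> R" for \<rho> z'
  proof (rule ccontr)
    assume "A \<inter> Q z' \<rho> \<noteq> {}"
    then obtain s where s: "s \<in> A" "s \<in> Q z' \<rho>" by blast
    have "z \<in> rel_interior (s + M)" using s(1) interior_subset_rel_interior by (auto simp: A_def)
    then have "\<rho> = s"
      using face_at_unique[OF Qfull(4,1)[OF \<rho> s(2)] RE[OF \<rho>] Qfull(2)[OF \<rho> s(2)] Rz[OF \<rho>], of s]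
        Qfull(4)[OF \<rho> s(2)] facets_subset by blast
    then show False using Qfull(3)[OF \<rho> s(2)] by blast
  qed
  have disj2: "Q z' \<rho> \<inter> Q z' \<rho>' = {}" if \<rho>: "\<rho> \<in> R" "\<rho>' \<in> R" "\<rho> \<noteq> \<rho>'" for \<rho> \<rho>' z'
  proof (rule ccontr)
    assume "Q z' \<rho> \<inter> Q z' \<rho>' \<noteq> {}"
    then obtain s where s: "s \<in> Q z' \<rho>" "s \<in> Q z' \<rho>'" by blast
    have "\<rho> = \<rho>'"
      by (rule face_at_unique[OF Qfull(4,1)[OF \<rho>(1) s(1)] RE[OF \<rho>(1)] Qfull(2)[OF \<rho>(1) s(1)] Rz[OF \<rho>(1)]
        RE[OF \<rho>(2)] Qfull(2)[OF \<rho>(2) s(2)] Rz[OF \<rho>(2)]])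
    then show False using \<rho>(3) by blast
  qed
  have finQ: "finite (Q z' \<rho>)" for z' \<rho> using finw by (simp add: Q_def)
  \<comment> \<open>The value on the right always refers to the positive sides. Whenever
    \<open>z'\<close> is on the negative side of a wall, \<open>bal\<close> exchanges the two
    sums.\<close>
  have "sum W {s\<in>facets E. z' \<in> s + M} = sum W A + (\<Sum>\<rho>\<in>R. sum W (wall_side E \<rho> (u \<rho>)))"
    if z': "z' \<in> generic_pts" "dist z z' < e" for z'
  proof -
    have "sum W {s\<in>facets E. z' \<in> s + M} = sum W A + sum W (\<Union>\<rho>\<in>R. Q z' \<rho>)"
      unfolding main[OF z']
    proof (rule sum.union_disjoint)
      show "A \<inter> (\<Union>\<rho>\<in>R. Q z' \<rho>) = {}" unfolding Int_UN_distrib using disj1 by (intro equals0I) blast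
    qed (use finA finR finQ in auto)
    also have "sum W (\<Union>\<rho>\<in>R. Q z' \<rho>) = (\<Sum>\<rho>\<in>R. sum W (Q z' \<rho>))"
    proof (rule sum.UNION_disjoint)
      show "\<forall>\<rho>\<in>R. \<forall>\<rho>'\<in>R. \<rho> \<noteq> \<rho>' \<longrightarrow> Q z' \<rho> \<inter> Q z' \<rho>' = {}" by (intro ballI impI disj2)
    qed (use finR finQ in auto)
    also have "\<dots> = (\<Sum>\<rho>\<in>R. sum W (wall_side E \<rho> (u \<rho>)))"
    proof (rule sum.cong[OF refl])
      fix \<rho> assume \<rho>: "\<rho> \<in> R"
      then have "\<exists>s\<in>facets E. \<rho> face_of s \<and> dim (dirs \<rho>) + 1 = dim (dirs s)" unfolding R_def by blast
      then show "sum W (Q z' \<rho>) = sum W (wall_side E \<rho> (u \<rho>))"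
        using bal[OF RE[OF \<rho>] _ u(1)[OF \<rho>] u(2)[OF \<rho>]] by (simp add: Q_def)
    qed
    finally show ?thesis .
  qed
  then show ?thesis
    by (intro exI[of _ e] exI[of _ "sum W A + (\<Sum>\<rho>\<in>R. sum W (wall_side E \<rho> (u \<rho>)))"] conjI ballI impI e0)
qed

text \<open>An instance of \<open>generic_constant\<close>: the affine hulls of images of positive
  codimension are avoided by generic points, those of codimension at least 2 by the path. At a
  generic point every image through it is full, so the local statement applies there too.\<close>

theorem degree_constant:
  assumes bal: "\<And>\<rho> u. \<rho> \<in> E \<Longrightarrow> (\<exists>s\<in>facets E. \<rho> face_of s \<and> dim (dirs \<rho>) + 1 = dim (dirs s)) \<Longrightarrow>
       u \<noteq> 0 \<Longrightarrow> dirs \<rho> + M = {y. u \<bullet> y = 0} \<Longrightarrow> sum W (wall_side E \<rho> u) = sum W (wall_side E \<rho> (- u))"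
    and z: "z1 \<in> generic_pts" "z2 \<in> generic_pts"
  shows "sum W {s\<in>facets E. z1 \<in> s + M} = sum W {s\<in>facets E. z2 \<in> s + M}"
proof (rule generic_constant[where f = "\<lambda>z. sum W {s\<in>facets E. z \<in> s + M}", OF _ _ _ _ _ _ z])
  let ?B = "(\<lambda>c. affine hull (c + M)) ` {c\<in>E. dirs c + M \<noteq> UNIV}"
  let ?A = "(\<lambda>c. affine hull (c + M)) ` {c\<in>E. dim (dirs c + M) + 2 \<le> DIM('a)}"
  have adim: "aff_dim (c + M) = int (dim (dirs c + M))" if "c \<in> E" for c
  proof -
    have "c \<noteq> {}" by (rule convex_complexD(4)[OF cx that])
    moreover from this have "c + M \<noteq> {}" using subset_plus_subspace[OF M, of c] by blast
    ultimately show ?thesis using dirs_set_plus[OF _ M, of c] by (simp add: dim_dirs)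
  qed
  show "finite ?B" "finite ?A" using convex_complexD(1)[OF cx] by auto
  show "affine B \<and> B \<noteq> UNIV" if B: "B \<in> ?B" for B
  proof -
    obtain c where c: "c \<in> E" "dirs c + M \<noteq> UNIV" "B = affine hull (c + M)" using B by blast
    have "B \<noteq> UNIV"
    proof
      assume "B = UNIV"
      then have "aff_dim (c + M) = int DIM('a)" using c(3) by (metis aff_dim_UNIV aff_dim_affine_hull)
      then have "dim (dirs c + M) = DIM('a)" using adim[OF c(1)] by simp
      then show False using c(2) subspace_set_plus[OF subspace_dirs M, of c] by (metis dim_eq_full span_eq_iff)
    qed
    then show ?thesis using c(3) by simp
  qed
  show "- \<Union>?B \<subseteq> generic_pts"
  proof clarify
    fix y c assume "y \<notin> \<Union>?B" "c \<in> E" "y \<in> c + M"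
    then show "dirs c + M = UNIV" using hull_inc[of y "c + M"] by blast
  qed
  show "affine A \<and> aff_dim A + 2 \<le> int DIM('a)" if "A \<in> ?A" for A
    using that adim by auto
  show "\<exists>e>0. \<forall>z'\<in>generic_pts. \<forall>z''\<in>generic_pts. dist y z' < e \<and> dist y z'' < e \<longrightarrow>
      sum W {s\<in>facets E. z' \<in> s + M} = sum W {s\<in>facets E. z'' \<in> s + M}"
    if y: "y \<in> generic_pts \<or> y \<notin> \<Union>?A" for y
  proof -
    have codim: "DIM('a) \<le> dim (dirs c + M) + 1" if c: "c \<in> E" "y \<in> c + M" for c
    proof (rule ccontr)
      assume "\<not> ?thesis"
      then have d: "dim (dirs c + M) + 2 \<le> DIM('a)" by simp
      then have "y \<in> \<Union>?A" using c hull_inc[of y "c + M"] by blast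
      then have "dirs c + M = UNIV" using y c by blast
      then show False using d by simp
    qed
    have "\<exists>e>0. \<exists>v. \<forall>z'\<in>generic_pts. dist y z' < e \<longrightarrow> sum W {s\<in>facets E. z' \<in> s + M} = v"
      by (rule degree_locally_constant) (fact bal codim)+
    then obtain e v where "e > 0" and ev: "\<forall>z'\<in>generic_pts. dist y z' < e \<longrightarrow> sum W {s\<in>facets E. z' \<in> s + M} = v"
      by (elim exE conjE)
    show ?thesis
    proof (intro exI[of _ e] conjI ballI impI)
      fix z' z'' assume z: "z' \<in> generic_pts" "z'' \<in> generic_pts" and "dist y z' < e \<and> dist y z'' < e"
      then show "sum W {s\<in>facets E. z' \<in> s + M} = sum W {s\<in>facets E. z'' \<in> s + M}"
        using ev[rule_format, OF z(1)] ev[rule_format, OF z(2)] by simp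
    qed (fact \<open>e > 0\<close>)
  qed
qed

end

text \<open>The notion \<open>primitive_normal\<close> without links and over any Euclidean space;
  entering \<open>s\<close> from one point of \<open>\<rho>\<close> is all that is required.\<close>

definition inward_primitive :: "'a::euclidean_space set \<Rightarrow> 'a set \<Rightarrow> 'a \<Rightarrow> bool" where
  "inward_primitive \<rho> s v \<longleftrightarrow>
     dirs s \<inter> zlat = {w + of_int a *\<^sub>R v | w a. w \<in> dirs \<rho> \<inter> zlat} \<and> (\<exists>x\<in>\<rho>. \<exists>e>0. x + e *\<^sub>R v \<in> s)"

text \<open>Balancing modulo the real space \<open>dirs \<rho>\<close> is stable under products and
  links; the rational span of \<open>balanced_at\<close> is recovered at the end. The dimension
  \<open>r\<close> is an integer, since a codimension may exceed the dimension of the space, in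
  which case there are no facets.\<close>

definition balanced_complex :: "'a::euclidean_space set set \<Rightarrow> ('a set \<Rightarrow> real) \<Rightarrow> int \<Rightarrow> bool" where
  "balanced_complex E m r \<longleftrightarrow>
     convex_complex E \<and> (\<forall>c\<in>E. rational_subspace (dirs c)) \<and> (\<forall>s\<in>facets E. int (dim (dirs s)) = r) \<and>
     (\<forall>\<rho>\<in>E. (\<exists>s\<in>facets E. \<rho> face_of s \<and> dim (dirs \<rho>) + 1 = dim (dirs s)) \<longrightarrow>
       (\<exists>v. (\<forall>s\<in>facets E. \<rho> \<subseteq> s \<longrightarrow> inward_primitive \<rho> s (v s)) \<and>
            (\<Sum>s | s \<in> facets E \<and> \<rho> \<subseteq> s. m s *\<^sub>R v s) \<in> dirs \<rho>))"

lemma balanced_complexD: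
  assumes "balanced_complex E m r"
  shows "convex_complex E" "c \<in> E \<Longrightarrow> rational_subspace (dirs c)" "s \<in> facets E \<Longrightarrow> int (dim (dirs s)) = r"
    "\<rho> \<in> E \<Longrightarrow> \<exists>s\<in>facets E. \<rho> face_of s \<and> dim (dirs \<rho>) + 1 = dim (dirs s) \<Longrightarrow>
      \<exists>v. (\<forall>s\<in>facets E. \<rho> \<subseteq> s \<longrightarrow> inward_primitive \<rho> s (v s)) \<and>
            (\<Sum>s | s \<in> facets E \<and> \<rho> \<subseteq> s. m s *\<^sub>R v s) \<in> dirs \<rho>"
proof -
  note d = assms[unfolded balanced_complex_def]
  show "convex_complex E" by (rule d[THEN conjunct1])
  show "c \<in> E \<Longrightarrow> rational_subspace (dirs c)" by (rule d[THEN conjunct2, THEN conjunct1, rule_format])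
  show "s \<in> facets E \<Longrightarrow> int (dim (dirs s)) = r"
    by (rule d[THEN conjunct2, THEN conjunct2, THEN conjunct1, rule_format])
  show "\<rho> \<in> E \<Longrightarrow> \<exists>s\<in>facets E. \<rho> face_of s \<and> dim (dirs \<rho>) + 1 = dim (dirs s) \<Longrightarrow>
      \<exists>v. (\<forall>s\<in>facets E. \<rho> \<subseteq> s \<longrightarrow> inward_primitive \<rho> s (v s)) \<and>
            (\<Sum>s | s \<in> facets E \<and> \<rho> \<subseteq> s. m s *\<^sub>R v s) \<in> dirs \<rho>"
    by (rule d[THEN conjunct2, THEN conjunct2, THEN conjunct2, THEN bspec, THEN mp])
qed

lemma inward_primitive_mem:
  assumes "inward_primitive \<rho> s v"
  shows "v \<in> zlat" "v \<in> dirs s"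
proof -
  have "0 + of_int 1 *\<^sub>R v \<in> {w + of_int a *\<^sub>R v | w a. w \<in> dirs \<rho> \<inter> zlat}"
    using add_subgroup_0[OF add_subgroup_zlat] subspace_0[OF subspace_dirs] by blast
  then show "v \<in> zlat" "v \<in> dirs s" using assms unfolding inward_primitive_def by auto
qed

lemma inward_primitive_decomp:
  assumes "inward_primitive \<rho> s v" "rational_subspace (dirs s)" "y \<in> dirs s"
  obtains d c where "d \<in> dirs \<rho>" "y = d + c *\<^sub>R v"
proof -
  have sub: "subspace {d + c *\<^sub>R v | d c. d \<in> dirs \<rho>}"
  proof -
    have "{d + c *\<^sub>R v | d c. d \<in> dirs \<rho>} = {x + y | x y. x \<in> dirs \<rho> \<and> y \<in> span {v}}"
      by (auto simp: span_singleton)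
    then show ?thesis using subspace_sums[OF subspace_dirs subspace_span, of \<rho> "{v}"] by (simp only:)
  qed
  have "dirs s \<inter> zlat \<subseteq> {d + c *\<^sub>R v | d c. d \<in> dirs \<rho>}"
    using assms(1) unfolding inward_primitive_def by blast
  then have "span (dirs s \<inter> zlat) \<subseteq> {d + c *\<^sub>R v | d c. d \<in> dirs \<rho>}" by (rule span_minimal[OF _ sub])
  then show ?thesis using assms(3) span_rational[OF assms(2)] that by blast
qed

text \<open>If \<open>v\<close> did not point to the side of \<open>u\<close> while some
  \<open>y\<close> in \<open>s\<close> lies on it, the segment from
  \<open>x0 + e *\<^sub>R v\<close> to \<open>y\<close> would cross the affine hull of
  \<open>\<rho>\<close> in an inner point. As \<open>\<rho>\<close> is a face, \<open>y\<close>
  would then belong to it, where \<open>u\<close> is constant.\<close>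

lemma wall_side_iff:
  assumes s: "s \<in> facets E" "convex s" "\<rho> face_of s" "rational_subspace (dirs s)" and v: "inward_primitive \<rho> s v"
    and u: "\<And>d. d \<in> dirs \<rho> \<Longrightarrow> u \<bullet> d = 0"
  shows "s \<in> wall_side E \<rho> u \<longleftrightarrow> u \<bullet> v > 0"
proof
  obtain x0 e where x0: "x0 \<in> \<rho>" "e > 0" "x0 + e *\<^sub>R v \<in> s" using v unfolding inward_primitive_def by blast
  have sub: "\<rho> \<subseteq> s" using s(3) by (rule face_of_imp_subset)
  show "s \<in> wall_side E \<rho> u" if "u \<bullet> v > 0"
  proof -
    have "u \<bullet> x0 < u \<bullet> (x0 + e *\<^sub>R v)" using that x0(2) by (simp add: inner_add_right)
    then show ?thesis unfolding wall_side_def using s(1) sub x0 by blast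
  qed
  show "u \<bullet> v > 0" if "s \<in> wall_side E \<rho> u"
  proof (rule ccontr)
    assume neg: "\<not> u \<bullet> v > 0"
    obtain x y where xy: "x \<in> \<rho>" "y \<in> s" "u \<bullet> x < u \<bullet> y" using \<open>s \<in> wall_side E \<rho> u\<close> unfolding wall_side_def by blast
    have "y - x \<in> dirs s" using xy sub diff_in_dirs by blast
    then obtain d c where dc: "d \<in> dirs \<rho>" "y - x = d + c *\<^sub>R v"
      using inward_primitive_decomp[OF v s(4)] by metis
    have "u \<bullet> (y - x) = c * (u \<bullet> v)" using u[OF dc(1)] by (simp add: dc(2) inner_add_right)
    then have pos: "c * (u \<bullet> v) > 0" using xy(3) by (simp add: inner_diff_right)
    then have c: "c < 0" using neg by (smt (verit) zero_less_mult_iff)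
    \<comment> \<open>The parameter at which the coefficients of \<open>v\<close> cancel, which puts
      \<open>p\<close> into the affine hull of \<open>\<rho>\<close>.\<close>
    define t where "t = e / (e - c)"
    have t: "0 < t" "t < 1" using c x0(2) by (auto simp: t_def)
    define p where "p = (1 - t) *\<^sub>R (x0 + e *\<^sub>R v) + t *\<^sub>R y"
    have "(1 - t) * e + t * c = 0" using c x0(2) by (simp add: t_def field_simps)
    then have z: "((1 - t) * e + t * c) *\<^sub>R v = 0" by simp
    have "y = x + d + c *\<^sub>R v" using dc(2) by (simp add: algebra_simps)
    then have "p = (1 - t) *\<^sub>R x0 + t *\<^sub>R (x + d) + ((1 - t) * e + t * c) *\<^sub>R v"
      unfolding p_def by (simp add: algebra_simps)
    then have p: "p = (1 - t) *\<^sub>R x0 + t *\<^sub>R (x + d)" unfolding z by simp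
    have "x + d \<in> affine hull \<rho>" using dc(1) by (simp add: affine_hull_dirs[OF xy(1)])
    then have "p \<in> affine hull \<rho>" unfolding p using x0(1)
      by (intro mem_affine[OF affine_affine_hull]) (auto intro: hull_inc)
    moreover have ps: "p \<in> s" unfolding p_def using s(2) x0(3) xy(2) t by (intro convexD) auto
    ultimately have pr: "p \<in> \<rho>" using face_of_imp_eq_affine_Int[OF s(2,3)] by blast
    have ne: "x0 + e *\<^sub>R v \<noteq> y"
    proof
      assume "x0 + e *\<^sub>R v = y"
      then have "y - x = (x0 - x) + e *\<^sub>R v" by simp
      then have "u \<bullet> (y - x) = u \<bullet> (x0 - x) + e * (u \<bullet> v)"
        by (simp only: inner_add_right inner_scaleR_right)
      moreover have "u \<bullet> (x0 - x) = 0" using u[OF diff_in_dirs[OF x0(1) xy(1)]] .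
      moreover have "e * (u \<bullet> v) \<le> 0" using neg x0(2) by (simp add: mult_le_0_iff)
      ultimately show False using xy(3) by (simp add: inner_diff_right)
    qed
    have "p \<in> open_segment (x0 + e *\<^sub>R v) y"
      unfolding p_def in_segment(2) using ne t by (intro conjI exI[of _ t]) simp_all
    then have "y \<in> \<rho>" by (rule face_ofD[OF s(3) _ x0(3) xy(2) pr, THEN conjunct2])
    then have "u \<bullet> (y - x) = 0" by (intro u diff_in_dirs xy(1))
    then show False using xy(3) by (simp add: inner_diff_right)
  qed
qed

section \<open>Lattice weights across a wall\<close>

definition plat :: "'a::euclidean_space set \<Rightarrow> 'a set \<Rightarrow> 'a set" where
  "plat s M = {a + b | a b. a \<in> dirs s \<inter> zlat \<and> b \<in> M \<inter> zlat}"

lemma plat_subgroup: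
  assumes "subspace M"
  shows "add_subgroup (plat s M)" "plat s M \<subseteq> zlat" "plat s M \<subseteq> dirs s + M"
proof -
  have 1: "add_subgroup (dirs s \<inter> zlat)" "add_subgroup (M \<inter> zlat)"
    by (intro add_subgroup_Int subspace_imp_add_subgroup subspace_dirs assms add_subgroup_zlat)+
  show "add_subgroup (plat s M)" unfolding plat_def by (rule add_subgroup_plus[OF 1])
  show "plat s M \<subseteq> zlat" unfolding plat_def using add_subgroup_add[OF add_subgroup_zlat] by blast
  show "plat s M \<subseteq> dirs s + M" unfolding plat_def set_plus_def by blast
qed

lemma idx_plat_pos:
  assumes "rational_subspace (dirs s)" "rational_subspace M" "dirs s + M = UNIV"
  shows "idx zlat (plat s M) > 0"
proof (rule idx_pos)
  have M: "subspace M" using assms(2) by (rule rational_subspaceD)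
  show "add_subgroup (plat s M)" "plat s M \<subseteq> zlat" using plat_subgroup[OF M] by auto
  have 0: "0 \<in> dirs s \<inter> zlat" "0 \<in> M \<inter> zlat"
    using add_subgroup_0[OF add_subgroup_zlat] M subspace_0 by auto
  have "dirs s \<inter> zlat \<subseteq> plat s M" unfolding plat_def
  proof
    fix x assume "x \<in> dirs s \<inter> zlat"
    then have "x + 0 \<in> {a + b | a b. a \<in> dirs s \<inter> zlat \<and> b \<in> M \<inter> zlat}" using 0(2) by blast
    then show "x \<in> {a + b | a b. a \<in> dirs s \<inter> zlat \<and> b \<in> M \<inter> zlat}" by simp
  qed
  then have d: "dirs s \<subseteq> span (plat s M)" using span_mono span_rational[OF assms(1)] by metis
  have "M \<inter> zlat \<subseteq> plat s M" unfolding plat_def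
  proof
    fix x assume "x \<in> M \<inter> zlat"
    then have "0 + x \<in> {a + b | a b. a \<in> dirs s \<inter> zlat \<and> b \<in> M \<inter> zlat}" using 0(1) by blast
    then show "x \<in> {a + b | a b. a \<in> dirs s \<inter> zlat \<and> b \<in> M \<inter> zlat}" by simp
  qed
  then have m: "M \<subseteq> span (plat s M)" using span_mono span_rational[OF assms(2)] by metis
  have "x \<in> span (plat s M)" for x
  proof -
    have "x \<in> dirs s + M" using assms(3) by simp
    then obtain a b where "x = a + b" "a \<in> dirs s" "b \<in> M" by (rule set_plus_elim)
    then show ?thesis using d m by (simp add: span_add subsetD)
  qed
  then show "span (plat s M) = UNIV" by blast
qed

text \<open>Near the wall, \<open>plat s M\<close> is generated by \<open>plat \<rho> M\<close> and
  the primitive vector \<open>v s\<close>, so its index is proportional to the height of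
  \<open>v s\<close> above the wall, with a factor that depends only on \<open>\<rho>\<close> and
  \<open>M\<close>. Pairing the balancing relation with \<open>u\<close> therefore equates the two
  sides.\<close>

lemma lattice_weights_balanced:
  fixes E :: "'a::euclidean_space set set"
  assumes E: "balanced_complex E m r" and M: "rational_subspace M"
    and \<rho>: "\<rho> \<in> E" "\<exists>s\<in>facets E. \<rho> face_of s \<and> dim (dirs \<rho>) + 1 = dim (dirs s)"
    and u: "u \<noteq> 0" "dirs \<rho> + M = {y. u \<bullet> y = 0}"
  defines "W \<equiv> \<lambda>s. m s * real (idx zlat (plat s M))"
  shows "sum W (wall_side E \<rho> u) = sum W (wall_side E \<rho> (- u))"
proof -
  note cx = balanced_complexD(1)[OF E]
  obtain v where v: "\<And>s. s \<in> facets E \<Longrightarrow> \<rho> \<subseteq> s \<Longrightarrow> inward_primitive \<rho> s (v s)"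
    and sum: "(\<Sum>s | s \<in> facets E \<and> \<rho> \<subseteq> s. m s *\<^sub>R v s) \<in> dirs \<rho>"
    using balanced_complexD(4)[OF E \<rho>] by blast
  define F where "F = {s. s \<in> facets E \<and> \<rho> \<subseteq> s}"
  have finF: "finite F" using convex_complexD(1)[OF cx] facets_subset by (auto simp: F_def intro: finite_subset)
  have Msub: "subspace M" using M by (rule rational_subspaceD)
  have dM: "dirs \<rho> \<subseteq> dirs \<rho> + M" "M \<subseteq> dirs \<rho> + M"
    using set_plus_intro[OF _ subspace_0[OF Msub], of _ "dirs \<rho>"] set_plus_intro[OF subspace_0[OF subspace_dirs], of _ M \<rho>] by auto
  have ud: "u \<bullet> d = 0" if "d \<in> dirs \<rho>" for d using dM(1) that u(2) by blast
  have side: "wall_side E \<rho> w = {s\<in>F. w \<bullet> v s > 0}" if w: "\<And>d. d \<in> dirs \<rho> \<Longrightarrow> w \<bullet> d = 0" for w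
  proof -
    have "s \<in> wall_side E \<rho> w \<longleftrightarrow> w \<bullet> v s > 0" if s: "s \<in> F" for s
    proof -
      have j: "s \<in> facets E" "\<rho> \<subseteq> s" "s \<in> E" using s facets_subset by (auto simp: F_def)
      show ?thesis
        by (rule wall_side_iff[OF j(1) convex_complexD(3)[OF cx j(3)] complex_face_subset[OF cx j(3) \<rho>(1) j(2)]
              balanced_complexD(2)[OF E j(3)] v[OF j(1,2)] w])
    qed
    moreover have "wall_side E \<rho> w \<subseteq> F" unfolding wall_side_def F_def by blast
    ultimately show ?thesis by blast
  qed
  have "rational_subspace (dirs \<rho> + M)"
    unfolding set_plus_eq by (rule rational_subspace_plus[OF balanced_complexD(2)[OF E \<rho>(1)] M])
  moreover have "dirs \<rho> + M \<noteq> UNIV" using u by (auto simp: set_eq_iff intro!: exI[of _ u])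
  ultimately obtain u' where u': "u' \<in> zlat" "\<And>x. x \<in> dirs \<rho> + M \<Longrightarrow> u' \<bullet> x = 0" "\<exists>x\<in>UNIV. u' \<bullet> x \<noteq> 0"
    using rational_separating_functional[of "dirs \<rho> + M" UNIV] by (metis subset_UNIV subspace_UNIV)
  \<comment> \<open>The wall spans a rational hyperplane, so it is also the kernel of an integral
    \<open>u'\<close>, which must be a multiple of the given normal \<open>u\<close>. Heights are
    measured with \<open>u'\<close>, signs with \<open>u\<close>.\<close>
  define c where "c = (u \<bullet> u') / (u \<bullet> u)"
  define y where "y = u' - c *\<^sub>R u"
  have "u \<bullet> y = 0" using u(1) by (simp add: y_def c_def inner_diff_right)
  then have "u' \<bullet> y = 0" using u'(2) u(2) by blast
  then have "y \<bullet> y = 0" using \<open>u \<bullet> y = 0\<close> unfolding y_def by (simp add: inner_diff_left)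
  then have uc: "u' = c *\<^sub>R u" by (simp add: y_def)
  have u'0: "u' \<noteq> 0" using u'(3) by auto
  then have c0: "c \<noteq> 0" using uc by auto
  obtain \<kappa> where \<kappa>: "\<And>w. w \<in> zlat \<Longrightarrow> u' \<bullet> w \<noteq> 0 \<Longrightarrow>
      real (idx zlat {a + of_int i *\<^sub>R w | a i. a \<in> plat \<rho> M}) = \<kappa> * \<bar>u' \<bullet> w\<bar>"
    using idx_hyperplane[OF u'(1) u'0 plat_subgroup(1,2)[OF Msub, of \<rho>]] u'(2) plat_subgroup(3)[OF Msub, of \<rho>] by blast
  have W: "W s = m s * (\<kappa> * \<bar>c\<bar> * \<bar>u \<bullet> v s\<bar>)" if s: "s \<in> F" "u \<bullet> v s \<noteq> 0" for s
  proof -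
    have ip: "inward_primitive \<rho> s (v s)" using v s(1) by (simp add: F_def)
    have l: "dirs s \<inter> zlat = {w + of_int a *\<^sub>R v s | w a. w \<in> dirs \<rho> \<inter> zlat}"
      using ip unfolding inward_primitive_def by blast
    have "plat s M = {a + of_int i *\<^sub>R v s | a i. a \<in> plat \<rho> M}"
    proof
      show "plat s M \<subseteq> {a + of_int i *\<^sub>R v s | a i. a \<in> plat \<rho> M}"
        unfolding plat_def l
      proof clarify
        fix w b and a :: int assume "w \<in> dirs \<rho>" "w \<in> zlat" "b \<in> M" "b \<in> zlat"
        then show "\<exists>a' i. w + of_int a *\<^sub>R v s + b = a' + of_int i *\<^sub>R v s \<and>
            a' \<in> {a + b | a b. a \<in> dirs \<rho> \<inter> zlat \<and> b \<in> M \<inter> zlat}"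
          by (intro exI[of _ "w + b"] exI[of _ a]) auto
      qed
      show "{a + of_int i *\<^sub>R v s | a i. a \<in> plat \<rho> M} \<subseteq> plat s M"
        unfolding plat_def l
      proof clarify
        fix w b and a :: int assume "w \<in> dirs \<rho>" "w \<in> zlat" "b \<in> M" "b \<in> zlat"
        then show "\<exists>a' b'. w + b + of_int a *\<^sub>R v s = a' + b' \<and>
            a' \<in> {w + of_int a *\<^sub>R v s | w a. w \<in> dirs \<rho> \<inter> zlat} \<and> b' \<in> M \<inter> zlat"
          by (intro exI[of _ "w + of_int a *\<^sub>R v s"] exI[of _ b]) auto
      qed
    qed
    moreover have "u' \<bullet> v s = c * (u \<bullet> v s)" by (simp add: uc)
    ultimately show ?thesis
      using \<kappa>[OF inward_primitive_mem(1)[OF ip]] s(2) c0 unfolding W_def by (simp add: abs_mult)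
  qed
  have "sum W (wall_side E \<rho> u) = (\<Sum>s\<in>{s\<in>F. u \<bullet> v s > 0}. \<kappa> * \<bar>c\<bar> * (m s * (u \<bullet> v s)))"
  proof -
    have "wall_side E \<rho> u = {s\<in>F. u \<bullet> v s > 0}" by (rule side) (rule ud)
    then show ?thesis by (simp only:) (rule sum.cong, auto simp: W)
  qed
  moreover have "sum W (wall_side E \<rho> (- u)) = (\<Sum>s\<in>{s\<in>F. u \<bullet> v s < 0}. - (\<kappa> * \<bar>c\<bar> * (m s * (u \<bullet> v s))))"
  proof -
    have "wall_side E \<rho> (- u) = {s\<in>F. u \<bullet> v s < 0}" using side[of "- u"] ud by simp
    then show ?thesis by (simp only:) (rule sum.cong, auto simp: W)
  qed
  moreover have "(\<Sum>s\<in>F. \<kappa> * \<bar>c\<bar> * (m s * (u \<bullet> v s))) = 0"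
  proof -
    have "(\<Sum>s\<in>F. \<kappa> * \<bar>c\<bar> * (m s * (u \<bullet> v s))) = \<kappa> * \<bar>c\<bar> * (u \<bullet> (\<Sum>s\<in>F. m s *\<^sub>R v s))"
      by (simp add: inner_sum_right sum_distrib_left)
    also have "u \<bullet> (\<Sum>s\<in>F. m s *\<^sub>R v s) = 0" using ud sum unfolding F_def by blast
    finally show ?thesis by simp
  qed
  moreover have "(\<Sum>s\<in>F. \<kappa> * \<bar>c\<bar> * (m s * (u \<bullet> v s))) =
      (\<Sum>s\<in>{s\<in>F. u \<bullet> v s > 0}. \<kappa> * \<bar>c\<bar> * (m s * (u \<bullet> v s))) + (\<Sum>s\<in>{s\<in>F. u \<bullet> v s < 0}. \<kappa> * \<bar>c\<bar> * (m s * (u \<bullet> v s)))"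
  proof -
    have "(\<Sum>s\<in>F. \<kappa> * \<bar>c\<bar> * (m s * (u \<bullet> v s))) =
      (\<Sum>s\<in>{s\<in>F. u \<bullet> v s > 0} \<union> {s\<in>F. u \<bullet> v s < 0}. \<kappa> * \<bar>c\<bar> * (m s * (u \<bullet> v s)))"
      by (rule sum.mono_neutral_right) (use finF in auto)
    also have "\<dots> = (\<Sum>s\<in>{s\<in>F. u \<bullet> v s > 0}. \<kappa> * \<bar>c\<bar> * (m s * (u \<bullet> v s))) + (\<Sum>s\<in>{s\<in>F. u \<bullet> v s < 0}. \<kappa> * \<bar>c\<bar> * (m s * (u \<bullet> v s)))"
      by (rule sum.union_disjoint) (use finF in auto)
    finally show ?thesis .
  qed
  ultimately show ?thesis by (simp add: sum_negf)
qed

theorem lattice_degree_constant: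
  fixes E :: "'a::euclidean_space set set"
  assumes E: "balanced_complex E m r" and M: "rational_subspace M" and K: "subspace K" "K \<subseteq> M"
    and inv: "\<And>c x k. c \<in> E \<Longrightarrow> x \<in> c \<Longrightarrow> k \<in> K \<Longrightarrow> x + k \<in> c"
    and r: "r + int (dim M) = int DIM('a) + int (dim K)"
    and z: "z1 \<in> generic_pts E M" "z2 \<in> generic_pts E M"
  shows "(\<Sum>s | s \<in> facets E \<and> z1 \<in> s + M. m s * real (idx zlat (plat s M))) =
    (\<Sum>s | s \<in> facets E \<and> z2 \<in> s + M. m s * real (idx zlat (plat s M)))"
proof (rule degree_constant[where K = K])
  show "convex_complex E" "subspace M" by (rule balanced_complexD(1)[OF E] rational_subspaceD[OF M])+
  show "dim (dirs s) + dim M = DIM('a) + dim K" if "s \<in> facets E" for s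
    using balanced_complexD(3)[OF E that] r by linarith
qed (fact K inv z | rule lattice_weights_balanced[OF E M], assumption+)+

lemma generic_near:
  fixes E :: "'a::euclidean_space set set"
  assumes cx: "convex_complex E" and M: "subspace M" and S: "convex S" "x \<in> S" "affine hull S = UNIV" "e > 0"
  shows "\<exists>y\<in>S. dist x y < e \<and> y \<in> generic_pts E M"
proof -
  let ?B = "(\<lambda>c. affine hull (c + M)) ` {c\<in>E. dirs c + M \<noteq> UNIV}"
  have "\<exists>y\<in>S. dist x y < e \<and> (\<forall>A\<in>?B. y \<notin> A)"
  proof (rule convex_avoid_affine_near[OF S(1,2) _ _ S(4)])
    show "finite ?B" using convex_complexD(1)[OF cx] by auto
    fix A assume "A \<in> ?B"
    then obtain c where c: "c \<in> E" "dirs c + M \<noteq> UNIV" "A = affine hull (c + M)" by blast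
    have cne: "c \<noteq> {}" by (rule convex_complexD(4)[OF cx c(1)])
    then obtain p where p: "p \<in> c + M" using subset_plus_subspace[OF M, of c] by blast
    have "A \<noteq> UNIV"
    proof
      assume "A = UNIV"
      then have "{y. y - p \<in> dirs c + M} = UNIV"
        using affine_hull_dirs[OF p] c(3) dirs_set_plus[OF cne M] by simp
      then have "(w + p) - p \<in> dirs c + M" for w by blast
      then show False using c(2) by auto
    qed
    moreover have "affine A" using c(3) by simp
    ultimately show "affine A \<and> \<not> S \<subseteq> A" using S(3) hull_minimal[of S A affine] by auto
  qed
  then obtain y where y: "y \<in> S" "dist x y < e" "\<forall>A\<in>?B. y \<notin> A" by (elim bexE conjE)
  have "y \<in> generic_pts E M"
  proof clarify
    fix c assume "c \<in> E" "y \<in> c + M"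
    then show "dirs c + M = UNIV" using y(3) hull_inc[of y "c + M" affine] by blast
  qed
  then show ?thesis using y(1,2) by blast
qed

text \<open>The one full facet \<open>s0\<close> makes the degree positive at some generic point,
  hence at all of them. So every generic point lies in the image of a full facet, and these finitely
  many images are closed, which extends the covering to all points.\<close>

theorem positive_cover:
  fixes E :: "'a::euclidean_space set set"
  assumes E: "balanced_complex E m r" and M: "rational_subspace M" and K: "subspace K" "K \<subseteq> M"
    and inv: "\<And>c x k. c \<in> E \<Longrightarrow> x \<in> c \<Longrightarrow> k \<in> K \<Longrightarrow> x + k \<in> c"
    and r: "r + int (dim M) = int DIM('a) + int (dim K)"
    and pos: "\<And>s. s \<in> facets E \<Longrightarrow> m s > 0"
    and full: "s0 \<in> facets E" "dirs s0 + M = UNIV"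
  shows "\<exists>s\<in>facets E. dirs s + M = UNIV \<and> z \<in> s + M"
proof -
  note cx = balanced_complexD(1)[OF E]
  have Msub: "subspace M" using M by (rule rational_subspaceD)
  have finF: "finite (facets E)" using convex_complexD(1)[OF cx] facets_subset finite_subset by blast
  have FE: "\<And>s. s \<in> facets E \<Longrightarrow> s \<in> E" using facets_subset by blast
  define f where "f = (\<lambda>y. \<Sum>s | s \<in> facets E \<and> y \<in> s + M. m s * real (idx zlat (plat s M)))"
  have s0: "convex s0" "s0 \<noteq> {}" using convex_complexD(3,4)[OF cx FE[OF full(1)]] by auto
  obtain p where p: "p \<in> s0 + M" using s0(2) subset_plus_subspace[OF Msub, of s0] by blast
  have "affine hull (s0 + M) = UNIV"
    using affine_hull_dirs[OF p] dirs_set_plus[OF s0(2) Msub] full(2) by simp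
  then obtain z1 where z1: "z1 \<in> s0 + M" "z1 \<in> generic_pts E M"
    using generic_near[OF cx Msub convex_plus_subspace[OF Msub s0(1)] p, of 1] by auto
  have W: "m s * real (idx zlat (plat s M)) \<ge> 0" if "s \<in> facets E" for s
    using pos[OF that] by simp
  have "0 < m s0 * real (idx zlat (plat s0 M))"
    using pos[OF full(1)] idx_plat_pos[OF balanced_complexD(2)[OF E FE[OF full(1)]] M full(2)] by simp
  also have "\<dots> \<le> f z1" unfolding f_def
    by (rule member_le_sum) (use full(1) z1(1) W finF in auto)
  finally have f1: "f z1 > 0" .
  let ?U = "\<Union>((\<lambda>s. s + M) ` {s\<in>facets E. dirs s + M = UNIV})"
  have dims: "dim (dirs s) + dim M = DIM('a) + dim K" if "s \<in> facets E" for s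
    using balanced_complexD(3)[OF E that] r by linarith
  have "closed ?U"
  proof (rule closed_Union)
    show "finite ((\<lambda>s. s + M) ` {s \<in> facets E. dirs s + M = UNIV})" using finF by simp
    show "\<forall>S\<in>(\<lambda>s. s + M) ` {s \<in> facets E. dirs s + M = UNIV}. closed S"
    proof clarify
      fix s assume "s \<in> facets E" "dirs s + M = UNIV"
      show "closed (s + M)"
        by (rule closed_full[where E = E and K = K]) fact+
    qed
  qed
  moreover have "\<exists>y\<in>?U. dist y z < e" if e: "e > 0" for e
  proof -
    obtain y where y: "dist z y < e" "y \<in> generic_pts E M"
      using generic_near[OF cx Msub convex_UNIV _ _ e, of z] by auto
    have "f y = f z1" unfolding f_def by (rule lattice_degree_constant[where K = K]) fact+
    then have "{s. s \<in> facets E \<and> y \<in> s + M} \<noteq> {}" using f1 unfolding f_def by (metis less_irrefl sum.empty)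
    then obtain s where s: "s \<in> facets E" "y \<in> s + M" by blast
    then have "dirs s + M = UNIV" using y(2) FE by blast
    then have "y \<in> ?U" using s by blast
    then show ?thesis using y(1) by (intro bexI[of _ y]) (auto simp: dist_commute)
  qed
  ultimately have "z \<in> ?U" using closed_approachable[of ?U z] by simp
  then show ?thesis by blast
qed

section \<open>Products of balanced complexes\<close>

definition prod_complex :: "'a set set \<Rightarrow> 'b set set \<Rightarrow> ('a \<times> 'b) set set" where
  "prod_complex E F = {c \<times> d | c d. c \<in> E \<and> d \<in> F}"

lemma prod_complex_convex:
  fixes E :: "'a::euclidean_space set set" and F :: "'b::euclidean_space set set"
  assumes E: "convex_complex E" and F: "convex_complex F"
  shows "convex_complex (prod_complex E F)"
  unfolding convex_complex_def
proof (intro conjI ballI allI impI)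
  have "prod_complex E F = (\<lambda>(c,d). c \<times> d) ` (E \<times> F)" by (auto simp: prod_complex_def)
  then show "finite (prod_complex E F)" using convex_complexD(1)[OF E] convex_complexD(1)[OF F] by simp
next
  fix x assume "x \<in> prod_complex E F"
  then obtain c d where x: "x = c \<times> d" "c \<in> E" "d \<in> F" by (auto simp: prod_complex_def)
  show "closed x" using x convex_complexD(2)[OF E] convex_complexD(2)[OF F] by (simp add: closed_Times)
  show "convex x" using x convex_complexD(3)[OF E] convex_complexD(3)[OF F] by (simp add: convex_Times)
  show "x \<noteq> {}" using x convex_complexD(4)[OF E] convex_complexD(4)[OF F] by simp
next
  fix x \<phi> assume "x \<in> prod_complex E F" and \<phi>: "\<phi> face_of x \<and> \<phi> \<noteq> {}"
  then obtain c d where x: "x = c \<times> d" "c \<in> E" "d \<in> F" by (auto simp: prod_complex_def)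
  obtain f g where fg: "f face_of c" "g face_of d" "\<phi> = f \<times> g" using \<phi> unfolding x(1) face_of_Times_decomp by blast
  have "f \<noteq> {}" "g \<noteq> {}" using \<phi> fg(3) by auto
  then show "\<phi> \<in> prod_complex E F"
    using convex_complexD(5)[OF E x(2) fg(1)] convex_complexD(5)[OF F x(3) fg(2)] fg(3) by (auto simp: prod_complex_def)
next
  fix x y assume "x \<in> prod_complex E F" "y \<in> prod_complex E F"
  then obtain c d c' d' where x: "x = c \<times> d" "c \<in> E" "d \<in> F" and y: "y = c' \<times> d'" "c' \<in> E" "d' \<in> F"
    unfolding prod_complex_def by blast
  have i: "x \<inter> y = (c \<inter> c') \<times> (d \<inter> d')" using x y by auto
  show "x \<inter> y face_of y" unfolding i unfolding y(1)
    by (rule face_of_Times[OF convex_complexD(6)[OF E x(2) y(2)] convex_complexD(6)[OF F x(3) y(3)]])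
  have i': "x \<inter> y = (c' \<inter> c) \<times> (d' \<inter> d)" using x y by auto
  show "x \<inter> y face_of x" unfolding i' unfolding x(1)
    by (rule face_of_Times[OF convex_complexD(6)[OF E y(2) x(2)] convex_complexD(6)[OF F y(3) x(3)]])
qed

lemma facets_prod_complex:
  assumes "\<And>c. c \<in> E \<Longrightarrow> c \<noteq> {}" "\<And>d. d \<in> F \<Longrightarrow> d \<noteq> {}"
  shows "facets (prod_complex E F) = prod_complex (facets E) (facets F)"
proof (intro subset_antisym subsetI)
  fix x assume "x \<in> facets (prod_complex E F)"
  then have xm: "x \<in> prod_complex E F" "\<And>y. y \<in> prod_complex E F \<Longrightarrow> x \<subseteq> y \<Longrightarrow> y = x"
    unfolding facets_def by blast+
  obtain c d where x: "x = c \<times> d" "c \<in> E" "d \<in> F" using xm(1) by (auto simp: prod_complex_def)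
  have ne: "c \<noteq> {}" "d \<noteq> {}" using assms x by auto
  have "c' = c" if c': "c' \<in> E" "c \<subseteq> c'" for c'
  proof -
    have "c' \<times> d \<in> prod_complex E F" using c' x by (auto simp: prod_complex_def)
    then have "c' \<times> d = c \<times> d" using xm(2)[of "c' \<times> d"] c'(2) x(1) by blast
    then show ?thesis using ne by (simp add: times_eq_iff)
  qed
  moreover have "d' = d" if d': "d' \<in> F" "d \<subseteq> d'" for d'
  proof -
    have "c \<times> d' \<in> prod_complex E F" using d' x by (auto simp: prod_complex_def)
    then have "c \<times> d' = c \<times> d" using xm(2)[of "c \<times> d'"] d'(2) x(1) by blast
    then show ?thesis using ne by (simp add: times_eq_iff)
  qed
  ultimately have "c \<in> facets E" "d \<in> facets F" using x by (auto simp: facets_def)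
  then show "x \<in> prod_complex (facets E) (facets F)" using x by (auto simp: prod_complex_def)
next
  fix x assume "x \<in> prod_complex (facets E) (facets F)"
  then obtain c d where x: "x = c \<times> d" "c \<in> facets E" "d \<in> facets F" by (auto simp: prod_complex_def)
  have cd: "c \<in> E" "d \<in> F" using x facets_subset by blast+
  have "y = x" if y: "y \<in> prod_complex E F" "x \<subseteq> y" for y
  proof -
    obtain c' d' where y': "y = c' \<times> d'" "c' \<in> E" "d' \<in> F" using y by (auto simp: prod_complex_def)
    have "c \<subseteq> c'" "d \<subseteq> d'" using y(2) assms cd unfolding x(1) y'(1) by (auto simp: times_subset_iff)
    then have "c' = c" "d' = d" using x y' unfolding facets_def by auto
    then show ?thesis using x y' by simp
  qed
  moreover have "x \<in> prod_complex E F" using x(1) cd by (auto simp: prod_complex_def)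
  ultimately show "x \<in> facets (prod_complex E F)" unfolding facets_def
    by (intro CollectI conjI ballI impI)
qed

text \<open>The lattice of a product of cells is the product of their lattices, so a vector that
  completes the lattice in one factor completes it in the product when \<open>0\<close> is put in
  the other factor.\<close>

lemma inward_primitive_Times_left:
  assumes "inward_primitive \<rho> s v" "t \<noteq> {}" "\<rho> \<noteq> {}" "s \<noteq> {}"
  shows "inward_primitive (\<rho> \<times> t) (s \<times> t) (v, 0)"
proof -
  have l: "dirs s \<inter> zlat = {w + of_int a *\<^sub>R v | w a. w \<in> dirs \<rho> \<inter> zlat}"
    using assms(1) unfolding inward_primitive_def by blast
  have "(dirs s \<inter> zlat) \<times> (dirs t \<inter> zlat) =
      {w + of_int a *\<^sub>R (v, 0) | w a. w \<in> (dirs \<rho> \<inter> zlat) \<times> (dirs t \<inter> zlat)}"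
    unfolding l by force
  then have "dirs (s \<times> t) \<inter> zlat = {w + of_int a *\<^sub>R (v, 0) | w a. w \<in> dirs (\<rho> \<times> t) \<inter> zlat}"
    unfolding dirs_Times[OF assms(4,2)] dirs_Times[OF assms(3,2)] zlat_Times Times_Int_Times .
  moreover obtain x e where "x \<in> \<rho>" "e > 0" "x + e *\<^sub>R v \<in> s" using assms(1) unfolding inward_primitive_def by blast
  moreover obtain j where "j \<in> t" using assms(2) by blast
  ultimately show ?thesis unfolding inward_primitive_def
    by (intro conjI bexI[of _ "(x, j)"] exI[of _ e]) auto
qed

lemma inward_primitive_Times_right:
  assumes "inward_primitive \<rho> s v" "t \<noteq> {}" "\<rho> \<noteq> {}" "s \<noteq> {}"
  shows "inward_primitive (t \<times> \<rho>) (t \<times> s) (0, v)"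
proof -
  have l: "dirs s \<inter> zlat = {w + of_int a *\<^sub>R v | w a. w \<in> dirs \<rho> \<inter> zlat}"
    using assms(1) unfolding inward_primitive_def by blast
  have "(dirs t \<inter> zlat) \<times> (dirs s \<inter> zlat) =
      {w + of_int a *\<^sub>R (0, v) | w a. w \<in> (dirs t \<inter> zlat) \<times> (dirs \<rho> \<inter> zlat)}"
    unfolding l by force
  then have "dirs (t \<times> s) \<inter> zlat = {w + of_int a *\<^sub>R (0, v) | w a. w \<in> dirs (t \<times> \<rho>) \<inter> zlat}"
    unfolding dirs_Times[OF assms(2,4)] dirs_Times[OF assms(2,3)] zlat_Times Times_Int_Times .
  moreover obtain x e where "x \<in> \<rho>" "e > 0" "x + e *\<^sub>R v \<in> s" using assms(1) unfolding inward_primitive_def by blast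
  moreover obtain j where "j \<in> t" using assms(2) by blast
  ultimately show ?thesis unfolding inward_primitive_def
    by (intro conjI bexI[of _ "(j, x)"] exI[of _ e]) auto
qed

text \<open>Around a ridge of the product one factor is a fixed facet and the other runs through the
  facets around a ridge. The relation of the varying factor, multiplied by the multiplicity of the
  fixed one, is the required relation. The factors of a nonempty product are read off as its
  projections.\<close>

theorem balanced_prod_complex:
  fixes E :: "'a::euclidean_space set set" and F :: "'b::euclidean_space set set"
  assumes E: "balanced_complex E m r" and F: "balanced_complex F n l"
  shows "balanced_complex (prod_complex E F) (\<lambda>c. m (fst ` c) * n (snd ` c)) (r + l)"
proof -
  note cE = balanced_complexD(1)[OF E] and cF = balanced_complexD(1)[OF F]
  note nE = convex_complexD(4)[OF cE] and nF = convex_complexD(4)[OF cF]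
  have fac: "facets (prod_complex E F) = prod_complex (facets E) (facets F)"
    by (rule facets_prod_complex) (use nE nF in auto)
  have FE: "\<And>c. c \<in> facets E \<Longrightarrow> c \<in> E" "\<And>c. c \<in> facets F \<Longrightarrow> c \<in> F" using facets_subset by blast+
  show ?thesis unfolding balanced_complex_def
  proof (intro conjI ballI impI)
    show "convex_complex (prod_complex E F)" by (rule prod_complex_convex[OF cE cF])
  next
    fix x assume "x \<in> prod_complex E F"
    then obtain c d where x: "x = c \<times> d" "c \<in> E" "d \<in> F" by (auto simp: prod_complex_def)
    show "rational_subspace (dirs x)" unfolding x(1) dirs_Times[OF nE[OF x(2)] nF[OF x(3)]]
      by (intro rational_subspace_Times balanced_complexD(2)[OF E] balanced_complexD(2)[OF F] x)
  next
    fix x assume "x \<in> facets (prod_complex E F)"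
    then obtain c d where x: "x = c \<times> d" "c \<in> facets E" "d \<in> facets F" unfolding fac by (auto simp: prod_complex_def)
    show "int (dim (dirs x)) = r + l" unfolding x(1) dirs_Times[OF nE[OF FE(1)[OF x(2)]] nF[OF FE(2)[OF x(3)]]]
      using balanced_complexD(3)[OF E x(2)] balanced_complexD(3)[OF F x(3)] by (simp add: dim_Times)
  next
    fix x assume xP: "x \<in> prod_complex E F"
      and "\<exists>s\<in>facets (prod_complex E F). x face_of s \<and> dim (dirs x) + 1 = dim (dirs s)"
    then obtain y where y: "y \<in> facets (prod_complex E F)" "x face_of y" "dim (dirs x) + 1 = dim (dirs y)" by blast
    obtain c d where x: "x = c \<times> d" "c \<in> E" "d \<in> F" using xP by (auto simp: prod_complex_def)
    obtain a b where ab: "y = a \<times> b" "a \<in> facets E" "b \<in> facets F" using y(1) unfolding fac by (auto simp: prod_complex_def)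
    have ne: "c \<noteq> {}" "d \<noteq> {}" "a \<noteq> {}" "b \<noteq> {}" using nE nF x ab FE by blast+
    have fc: "c face_of a" "d face_of b" using y(2) ne unfolding x(1) ab(1) face_of_Times_eq by auto
    have dimeq: "dim (dirs c) + dim (dirs d) + 1 = dim (dirs a) + dim (dirs b)"
      using y(3) unfolding x(1) ab(1) dirs_Times[OF ne(1,2)] dirs_Times[OF ne(3,4)] by (simp add: dim_Times)
    have conv: "convex a" "convex b" using convex_complexD(3)[OF cE] convex_complexD(3)[OF cF] ab FE by blast+
    have lc: "dim (dirs c) < dim (dirs a)" if "c \<noteq> a" by (rule face_dim_less[OF conv(1) fc(1) that ne(1)])
    have ld: "dim (dirs d) < dim (dirs b)" if "d \<noteq> b" by (rule face_dim_less[OF conv(2) fc(2) that ne(2)])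
    \<comment> \<open>A drop of one in the total dimension leaves exactly one factor a proper face,
      of codimension one.\<close>
    consider "d = b" "dim (dirs c) + 1 = dim (dirs a)" | "c = a" "dim (dirs d) + 1 = dim (dirs b)"
    proof (cases "d = b")
      case True
      then show ?thesis using dimeq that(1) by simp
    next
      case False
      then have "c = a" using dimeq lc ld by linarith
      then show ?thesis using dimeq that(2) by simp
    qed
    then show "\<exists>v. (\<forall>s\<in>facets (prod_complex E F). x \<subseteq> s \<longrightarrow> inward_primitive x s (v s)) \<and>
        (\<Sum>s | s \<in> facets (prod_complex E F) \<and> x \<subseteq> s. (m (fst ` s) * n (snd ` s)) *\<^sub>R v s) \<in> dirs x"
    proof cases
      case 1
      have "\<exists>s\<in>facets E. c face_of s \<and> dim (dirs c) + 1 = dim (dirs s)" using ab(2) fc(1) 1(2) by blast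
      from balanced_complexD(4)[OF E x(2) this]
      obtain v where v: "\<And>s. s \<in> facets E \<Longrightarrow> c \<subseteq> s \<Longrightarrow> inward_primitive c s (v s)"
        "(\<Sum>s | s \<in> facets E \<and> c \<subseteq> s. m s *\<^sub>R v s) \<in> dirs c" by blast
      have S: "{s. s \<in> facets (prod_complex E F) \<and> x \<subseteq> s} = (\<lambda>s. s \<times> d) ` {s. s \<in> facets E \<and> c \<subseteq> s}"
      proof (intro subset_antisym subsetI)
        fix z assume "z \<in> {s. s \<in> facets (prod_complex E F) \<and> x \<subseteq> s}"
        then obtain a' b' where z: "z = a' \<times> b'" "a' \<in> facets E" "b' \<in> facets F" "c \<times> d \<subseteq> a' \<times> b'"
          unfolding fac x(1) by (auto simp: prod_complex_def)
        have "c \<subseteq> a'" "d \<subseteq> b'" using z(4) ne by (auto simp: times_subset_iff)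
        moreover have "b' = d" using \<open>d \<subseteq> b'\<close> 1(1) ab(3) FE(2)[OF z(3)] unfolding facets_def by blast
        ultimately show "z \<in> (\<lambda>s. s \<times> d) ` {s. s \<in> facets E \<and> c \<subseteq> s}" using z by blast
      next
        fix z assume "z \<in> (\<lambda>s. s \<times> d) ` {s. s \<in> facets E \<and> c \<subseteq> s}"
        then obtain s where "z = s \<times> d" "s \<in> facets E" "c \<subseteq> s" by blast
        then show "z \<in> {s. s \<in> facets (prod_complex E F) \<and> x \<subseteq> s}"
          unfolding fac x(1) using 1(1) ab(3) by (auto simp: prod_complex_def)
      qed
      have inj: "inj_on (\<lambda>s. s \<times> d) {s. s \<in> facets E \<and> c \<subseteq> s}"
        using ne(2) by (intro inj_onI) (auto simp: times_eq_iff)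
      have "(\<Sum>s | s \<in> facets (prod_complex E F) \<and> x \<subseteq> s. (m (fst ` s) * n (snd ` s)) *\<^sub>R (v (fst ` s), 0::'b)) =
          (\<Sum>s | s \<in> facets E \<and> c \<subseteq> s. (m s * n d) *\<^sub>R (v s, 0))"
        unfolding S sum.reindex[OF inj] comp_def
      proof (rule sum.cong[OF refl])
        fix s assume "s \<in> {s. s \<in> facets E \<and> c \<subseteq> s}"
        then have "s \<noteq> {}" using ne(1) by auto
        then show "(m (fst ` (s \<times> d)) * n (snd ` (s \<times> d))) *\<^sub>R (v (fst ` (s \<times> d)), 0::'b) = (m s * n d) *\<^sub>R (v s, 0)"
          using ne(2) by simp
      qed
      also have "\<dots> = (n d *\<^sub>R (\<Sum>s | s \<in> facets E \<and> c \<subseteq> s. m s *\<^sub>R v s), 0)"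
        by (simp add: prod_eq_iff fst_sum snd_sum scaleR_sum_right mult.commute)
      also have "\<dots> \<in> dirs x" unfolding x(1) dirs_Times[OF ne(1,2)]
        using v(2) by (simp add: subspace_scale subspace_0)
      finally have "(\<Sum>s | s \<in> facets (prod_complex E F) \<and> x \<subseteq> s. (m (fst ` s) * n (snd ` s)) *\<^sub>R (v (fst ` s), 0::'b)) \<in> dirs x" .
      moreover have "inward_primitive x z (v (fst ` z), 0)" if z: "z \<in> facets (prod_complex E F)" "x \<subseteq> z" for z
      proof -
        have "z \<in> (\<lambda>s. s \<times> d) ` {s. s \<in> facets E \<and> c \<subseteq> s}" using z S by blast
        then obtain s where s: "z = s \<times> d" "s \<in> facets E" "c \<subseteq> s" by blast
        have "s \<noteq> {}" using s(3) ne(1) by auto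
        then show ?thesis using inward_primitive_Times_left[OF v(1)[OF s(2,3)] ne(2,1)] x(1) s(1) ne(2) by simp
      qed
      ultimately show ?thesis by (intro exI[of _ "\<lambda>s. (v (fst ` s), 0)"]) blast
    next
      case 2
      have "\<exists>s\<in>facets F. d face_of s \<and> dim (dirs d) + 1 = dim (dirs s)" using ab(3) fc(2) 2(2) by blast
      from balanced_complexD(4)[OF F x(3) this]
      obtain v where v: "\<And>s. s \<in> facets F \<Longrightarrow> d \<subseteq> s \<Longrightarrow> inward_primitive d s (v s)"
        "(\<Sum>s | s \<in> facets F \<and> d \<subseteq> s. n s *\<^sub>R v s) \<in> dirs d" by blast
      have S: "{s. s \<in> facets (prod_complex E F) \<and> x \<subseteq> s} = (\<lambda>s. c \<times> s) ` {s. s \<in> facets F \<and> d \<subseteq> s}"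
      proof (intro subset_antisym subsetI)
        fix z assume "z \<in> {s. s \<in> facets (prod_complex E F) \<and> x \<subseteq> s}"
        then obtain a' b' where z: "z = a' \<times> b'" "a' \<in> facets E" "b' \<in> facets F" "c \<times> d \<subseteq> a' \<times> b'"
          unfolding fac x(1) by (auto simp: prod_complex_def)
        have "c \<subseteq> a'" "d \<subseteq> b'" using z(4) ne by (auto simp: times_subset_iff)
        moreover have "a' = c" using \<open>c \<subseteq> a'\<close> 2(1) ab(2) FE(1)[OF z(2)] unfolding facets_def by blast
        ultimately show "z \<in> (\<lambda>s. c \<times> s) ` {s. s \<in> facets F \<and> d \<subseteq> s}" using z by blast
      next
        fix z assume "z \<in> (\<lambda>s. c \<times> s) ` {s. s \<in> facets F \<and> d \<subseteq> s}"
        then obtain s where "z = c \<times> s" "s \<in> facets F" "d \<subseteq> s" by blast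
        then show "z \<in> {s. s \<in> facets (prod_complex E F) \<and> x \<subseteq> s}"
          unfolding fac x(1) using 2(1) ab(2) by (auto simp: prod_complex_def)
      qed
      have inj: "inj_on (\<lambda>s. c \<times> s) {s. s \<in> facets F \<and> d \<subseteq> s}"
        using ne(1) by (intro inj_onI) (auto simp: times_eq_iff)
      have "(\<Sum>s | s \<in> facets (prod_complex E F) \<and> x \<subseteq> s. (m (fst ` s) * n (snd ` s)) *\<^sub>R (0::'a, v (snd ` s))) =
          (\<Sum>s | s \<in> facets F \<and> d \<subseteq> s. (m c * n s) *\<^sub>R (0, v s))"
        unfolding S sum.reindex[OF inj] comp_def
      proof (rule sum.cong[OF refl])
        fix s assume "s \<in> {s. s \<in> facets F \<and> d \<subseteq> s}"
        then have "s \<noteq> {}" using ne(2) by auto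
        then show "(m (fst ` (c \<times> s)) * n (snd ` (c \<times> s))) *\<^sub>R (0::'a, v (snd ` (c \<times> s))) = (m c * n s) *\<^sub>R (0, v s)"
          using ne(1) by simp
      qed
      also have "\<dots> = (0, m c *\<^sub>R (\<Sum>s | s \<in> facets F \<and> d \<subseteq> s. n s *\<^sub>R v s))"
        by (simp add: prod_eq_iff fst_sum snd_sum scaleR_sum_right mult.commute)
      also have "\<dots> \<in> dirs x" unfolding x(1) dirs_Times[OF ne(1,2)]
        using v(2) by (simp add: subspace_scale subspace_0)
      finally have "(\<Sum>s | s \<in> facets (prod_complex E F) \<and> x \<subseteq> s. (m (fst ` s) * n (snd ` s)) *\<^sub>R (0::'a, v (snd ` s))) \<in> dirs x" .
      moreover have "inward_primitive x z (0, v (snd ` z))" if z: "z \<in> facets (prod_complex E F)" "x \<subseteq> z" for z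
      proof -
        have "z \<in> (\<lambda>s. c \<times> s) ` {s. s \<in> facets F \<and> d \<subseteq> s}" using z S by blast
        then obtain s where s: "z = c \<times> s" "s \<in> facets F" "d \<subseteq> s" by blast
        have "s \<noteq> {}" using s(3) ne(2) by auto
        then show ?thesis using inward_primitive_Times_right[OF v(1)[OF s(2,3)] ne(1,2)] x(1) s(1) ne(1) by simp
      qed
      ultimately show ?thesis by (intro exI[of _ "\<lambda>s. (0, v (snd ` s))"]) blast
    qed
  qed
qed

section \<open>Links\<close>

lemma int_lattice_eq: "int_lattice = zlat"
  by (auto simp: int_lattice_def zlat_def Basis_vec_def inner_axis)

lemma lin_space_eq: "lin_space = dirs"
  by (intro ext) (simp add: lin_space_def dirs_def)

lemma lattice_of_eq: "lattice_of s = dirs s \<inter> zlat"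
  by (auto simp: lattice_of_def int_lattice_eq lin_space_eq)

text \<open>At a relatively interior point the tight inequalities are those that are equalities on
  all of \<open>s\<close>, and the others leave room in every direction. So the direction space is
  cut out by the integral equations \<open>F\<close>.\<close>

lemma rational_polyhedron_dirs:
  assumes "rational_polyhedron s" "s \<noteq> {}"
  shows "rational_subspace (dirs s)"
proof -
  obtain H where H: "finite H" "\<And>u c. (u, c) \<in> H \<Longrightarrow> u \<in> zlat" "s = (\<Inter>(u, c)\<in>H. {x. u \<bullet> x \<le> c})"
    using assms(1) unfolding rational_polyhedron_def int_lattice_eq by fast
  have mem: "x \<in> s \<longleftrightarrow> (\<forall>(u, c)\<in>H. u \<bullet> x \<le> c)" for x unfolding H(3) by auto
  obtain x where x: "x \<in> rel_interior s"
    using rational_polyhedron_closed_convex(2)[OF assms(1)] assms(2) rel_interior_eq_empty by blast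
  have xs: "x \<in> s" using x rel_interior_subset by blast
  define F where "F = {u. \<exists>c. (u, c) \<in> H \<and> u \<bullet> x = c}"
  have "F \<subseteq> fst ` H" by (force simp: F_def)
  then have finF: "finite F" using H(1) finite_surj by blast
  have Fz: "F \<subseteq> zlat" using H(2) by (auto simp: F_def)
  have "dirs s = UNIV \<inter> {d. \<forall>u\<in>F. u \<bullet> d = 0}"
  proof
    show "dirs s \<subseteq> UNIV \<inter> {d. \<forall>u\<in>F. u \<bullet> d = 0}"
    proof clarsimp
      fix d u assume d: "d \<in> dirs s" and "u \<in> F"
      then have u: "(u, u \<bullet> x) \<in> H" by (auto simp: F_def)
      obtain e where e: "e > 0" "\<forall>t. \<bar>t\<bar> \<le> e \<longrightarrow> x + t *\<^sub>R d \<in> s" using rel_interior_dirs[OF x d] by blast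
      have "u \<bullet> (x + e *\<^sub>R d) \<le> u \<bullet> x" "u \<bullet> (x + (-e) *\<^sub>R d) \<le> u \<bullet> x"
      proof -
        have "x + e *\<^sub>R d \<in> s" "x + (-e) *\<^sub>R d \<in> s" using e(2)[rule_format, of e] e(2)[rule_format, of "-e"] e(1) by simp_all
        then show "u \<bullet> (x + e *\<^sub>R d) \<le> u \<bullet> x" "u \<bullet> (x + (-e) *\<^sub>R d) \<le> u \<bullet> x"
          unfolding mem by (auto dest!: bspec[OF _ u] simp del: scaleR_minus_left)
      qed
      then have "e * (u \<bullet> d) \<le> 0" "e * (u \<bullet> d) \<ge> 0" by (simp_all add: inner_add_right inner_diff_right)
      then show "u \<bullet> d = 0" using e(1) by (smt (verit) mult_eq_0_iff)
    qed
    show "UNIV \<inter> {d. \<forall>u\<in>F. u \<bullet> d = 0} \<subseteq> dirs s"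
    proof (rule dirs_translate_subset[OF _ xs])
      show "subspace (UNIV \<inter> {d. \<forall>u\<in>F. u \<bullet> d = 0})" by (auto simp: subspace_def inner_add_right)
      fix d assume "d \<in> UNIV \<inter> {d. \<forall>u\<in>F. u \<bullet> d = 0}"
      then have d: "\<And>u. u \<in> F \<Longrightarrow> u \<bullet> d = 0" by blast
      have "\<forall>\<^sub>F e in at_right 0. u \<bullet> (x + e *\<^sub>R d) \<le> c" if uc: "(u, c) \<in> H" for u c
      proof (cases "u \<bullet> x = c")
        case True
        then show ?thesis using d[of u] uc by (auto simp: F_def inner_add_right)
      next
        case False
        then have lt: "u \<bullet> x < c" using xs uc unfolding mem by fastforce
        have "((\<lambda>e. u \<bullet> (x + e *\<^sub>R d)) \<longlongrightarrow> u \<bullet> (x + 0 *\<^sub>R d)) (at_right 0)"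
          by (intro tendsto_intros)
        then have "\<forall>\<^sub>F e in at_right 0. u \<bullet> (x + e *\<^sub>R d) < c"
          by (rule order_tendstoD(2)) (use lt in simp)
        then show ?thesis by eventually_elim simp
      qed
      then have "\<forall>\<^sub>F e in at_right 0. \<forall>(u,c)\<in>H. u \<bullet> (x + e *\<^sub>R d) \<le> c"
        using H(1) by (intro eventually_ball_finite) auto
      then have "\<forall>\<^sub>F e in at_right 0. x + e *\<^sub>R d \<in> s" unfolding mem .
      moreover have "\<forall>\<^sub>F e in at_right 0. (e::real) > 0" by (simp add: eventually_at_right_less)
      ultimately have "\<forall>\<^sub>F e in at_right 0. e > 0 \<and> x + e *\<^sub>R d \<in> s" by eventually_elim simp
      then show "\<exists>e>0. x + e *\<^sub>R d \<in> s"
        using eventually_happens trivial_limit_at_right_real by blast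
    qed
  qed
  then show ?thesis using rational_subspace_equations[OF rational_subspace_UNIV finF Fz] by simp
qed

lemma link_iff:
  assumes "convex s" "\<omega> \<in> s"
  shows "u \<in> link \<omega> s \<longleftrightarrow> (\<exists>e>0. \<omega> + e *\<^sub>R u \<in> s)"
proof
  assume "u \<in> link \<omega> s"
  then obtain b where "b > 0" "\<forall>y>0. y < b \<longrightarrow> \<omega> + y *\<^sub>R u \<in> s"
    unfolding link_def eventually_at_right_field by blast
  then show "\<exists>e>0. \<omega> + e *\<^sub>R u \<in> s" by (intro exI[of _ "b/2"]) auto
next
  assume "\<exists>e>0. \<omega> + e *\<^sub>R u \<in> s"
  then obtain e where e: "e > 0" "\<omega> + e *\<^sub>R u \<in> s" by blast
  have "\<omega> + y *\<^sub>R u \<in> s" if y: "0 < y" "y < e" for y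
  proof -
    have "(1 - y/e) *\<^sub>R \<omega> + (y/e) *\<^sub>R (\<omega> + e *\<^sub>R u) \<in> s"
      using assms e y by (intro convexD) auto
    also have "(1 - y/e) *\<^sub>R \<omega> + (y/e) *\<^sub>R (\<omega> + e *\<^sub>R u) = \<omega> + y *\<^sub>R u"
      using e by (simp add: algebra_simps)
    finally show ?thesis .
  qed
  then show "u \<in> link \<omega> s" unfolding link_def eventually_at_right_field using e(1) by blast
qed

lemma link_small:
  assumes "convex s" "\<omega> \<in> s" "u \<in> link \<omega> s"
  shows "\<exists>e>0. \<forall>y. 0 \<le> y \<and> y < e \<longrightarrow> \<omega> + y *\<^sub>R u \<in> s"
proof -
  obtain b where b: "b > 0" "\<forall>y>0. y < b \<longrightarrow> \<omega> + y *\<^sub>R u \<in> s"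
    using assms(3) unfolding link_def eventually_at_right_field by blast
  have "\<omega> + y *\<^sub>R u \<in> s" if "0 \<le> y" "y < b" for y
    using b(2) assms(2) that by (cases "y = 0") auto
  then show ?thesis using b(1) by blast
qed

lemma diff_in_link: "convex s \<Longrightarrow> \<omega> \<in> s \<Longrightarrow> y \<in> s \<Longrightarrow> y - \<omega> \<in> link \<omega> s"
  unfolding link_iff by (intro exI[of _ 1]) simp

lemma link_scale:
  assumes "convex s" "\<omega> \<in> s" "u \<in> link \<omega> s" "c > 0"
  shows "c *\<^sub>R u \<in> link \<omega> s"
proof -
  obtain e where e: "e > 0" "\<omega> + e *\<^sub>R u \<in> s" using assms(3) unfolding link_iff[OF assms(1,2)] by blast
  then have "\<omega> + (e/c) *\<^sub>R (c *\<^sub>R u) \<in> s" "e/c > 0" using assms(4) by auto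
  then show ?thesis unfolding link_iff[OF assms(1,2)] by blast
qed

lemma zero_in_link: "\<omega> \<in> s \<Longrightarrow> 0 \<in> link \<omega> s"
  by (simp add: link_def)

lemma link_add:
  assumes "convex s" "\<omega> \<in> s" "u \<in> link \<omega> s" "v \<in> link \<omega> s"
  shows "u + v \<in> link \<omega> s"
proof -
  obtain e where e: "e > 0" "\<And>y. 0 \<le> y \<Longrightarrow> y < e \<Longrightarrow> \<omega> + y *\<^sub>R u \<in> s"
    using link_small[OF assms(1,2,3)] by blast
  obtain d where d: "d > 0" "\<And>y. 0 \<le> y \<Longrightarrow> y < d \<Longrightarrow> \<omega> + y *\<^sub>R v \<in> s"
    using link_small[OF assms(1,2,4)] by blast
  define y where "y = min e d / 2"
  have y: "0 < y" "y < e" "y < d" using e(1) d(1) by (auto simp: y_def)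
  have "(1/2) *\<^sub>R (\<omega> + y *\<^sub>R u) + (1/2) *\<^sub>R (\<omega> + y *\<^sub>R v) \<in> s"
    by (rule convexD[OF assms(1) e(2) d(2)]) (use y in auto)
  also have "(1/2) *\<^sub>R (\<omega> + y *\<^sub>R u) + (1/2) *\<^sub>R (\<omega> + y *\<^sub>R v) = (1/2) *\<^sub>R \<omega> + (1/2) *\<^sub>R \<omega> + (y/2) *\<^sub>R (u + v)"
    by (simp add: scaleR_add_right)
  also have "\<dots> = \<omega> + (y/2) *\<^sub>R (u + v)" by (simp flip: scaleR_add_left)
  finally show ?thesis unfolding link_iff[OF assms(1,2)] using y(1) by (intro exI[of _ "y/2"]) simp
qed

lemma link_mono: "s \<subseteq> t \<Longrightarrow> link \<omega> s \<subseteq> link \<omega> t"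
  unfolding link_def by (auto elim: eventually_mono)

lemma link_Int: "link \<omega> (s \<inter> t) = link \<omega> s \<inter> link \<omega> t"
  by (auto simp: link_def eventually_conj_iff)

lemma convex_link:
  assumes "convex s" "\<omega> \<in> s"
  shows "convex (link \<omega> s)"
proof (rule convexI)
  fix x y and u v :: real
  assume h: "x \<in> link \<omega> s" "y \<in> link \<omega> s" "0 \<le> u" "0 \<le> v" "u + v = 1"
  have "c *\<^sub>R z \<in> link \<omega> s" if "z \<in> link \<omega> s" "0 \<le> c" for z c
    using link_scale[OF assms that(1), of c] that(2) zero_in_link[OF assms(2)] by (cases "c = 0") auto
  then show "u *\<^sub>R x + v *\<^sub>R y \<in> link \<omega> s" using link_add[OF assms] h by blast
qed

lemma dirs_link:
  assumes "convex s" "\<omega> \<in> s"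
  shows "dirs (link \<omega> s) = dirs s"
proof
  have "u \<in> dirs s" if u: "u \<in> link \<omega> s" for u
  proof -
    obtain e where e: "e > 0" "\<omega> + e *\<^sub>R u \<in> s" using u unfolding link_iff[OF assms] by blast
    have "(\<omega> + e *\<^sub>R u) - \<omega> \<in> dirs s" by (rule diff_in_dirs[OF e(2) assms(2)])
    then show ?thesis using subspace_scale[OF subspace_dirs, of "e *\<^sub>R u" s "1/e"] e(1) by simp
  qed
  then show "dirs (link \<omega> s) \<subseteq> dirs s"
    by (intro dirs_subset[OF subspace_dirs zero_in_link[OF assms(2)]]) simp
  show "dirs s \<subseteq> dirs (link \<omega> s)"
  proof (rule dirs_subset[OF subspace_dirs assms(2)])
    fix y assume "y \<in> s"
    then show "y - \<omega> \<in> dirs (link \<omega> s)"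
      using diff_in_dirs[OF diff_in_link[OF assms] zero_in_link[OF assms(2)]] by simp
  qed
qed

text \<open>The link is defined by the inequalities tight at \<open>\<omega>\<close>, made
  homogeneous; the slack ones hold for every direction when the parameter is small.\<close>

lemma rational_polyhedron_link:
  assumes "rational_polyhedron s" "\<omega> \<in> s"
  shows "rational_polyhedron (link \<omega> s)"
proof -
  obtain H where H: "finite H" "\<And>u c. (u, c) \<in> H \<Longrightarrow> u \<in> int_lattice" "s = (\<Inter>(u, c)\<in>H. {x. u \<bullet> x \<le> c})"
    using assms(1) unfolding rational_polyhedron_def by fast
  have mem: "x \<in> s \<longleftrightarrow> (\<forall>(u, c)\<in>H. u \<bullet> x \<le> c)" for x unfolding H(3) by auto
  define H' where "H' = {(u, 0::real) | u. (u, u \<bullet> \<omega>) \<in> H}"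
  have "H' \<subseteq> (\<lambda>(u, c). (u, 0)) ` H" by (force simp: H'_def)
  then have fin: "finite H'" using H(1) finite_surj by blast
  have "link \<omega> s = (\<Inter>(u, c)\<in>H'. {x. u \<bullet> x \<le> c})"
  proof (intro subset_antisym subsetI)
    fix d assume "d \<in> link \<omega> s"
    then obtain e where e: "e > 0" "\<omega> + e *\<^sub>R d \<in> s"
      using link_iff[OF rational_polyhedron_closed_convex(2)[OF assms(1)] assms(2)] by blast
    have "u \<bullet> d \<le> 0" if "(u, u \<bullet> \<omega>) \<in> H" for u
    proof -
      have "u \<bullet> (\<omega> + e *\<^sub>R d) \<le> u \<bullet> \<omega>" using e(2) that unfolding mem by fastforce
      then show ?thesis using e(1) by (simp add: inner_add_right mult_le_0_iff)
    qed
    then show "d \<in> (\<Inter>(u, c)\<in>H'. {x. u \<bullet> x \<le> c})" by (auto simp: H'_def)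
  next
    fix d assume "d \<in> (\<Inter>(u, c)\<in>H'. {x. u \<bullet> x \<le> c})"
    then have d: "\<And>u. (u, u \<bullet> \<omega>) \<in> H \<Longrightarrow> u \<bullet> d \<le> 0" by (auto simp: H'_def)
    have "\<forall>\<^sub>F e in at_right 0. u \<bullet> (\<omega> + e *\<^sub>R d) \<le> c" if uc: "(u, c) \<in> H" for u c
    proof (cases "u \<bullet> \<omega> = c")
      case True
      then have "u \<bullet> d \<le> 0" using d uc by blast
      then have "e > 0 \<Longrightarrow> u \<bullet> (\<omega> + e *\<^sub>R d) \<le> c" for e
        using True by (simp add: inner_add_right mult_le_0_iff)
      moreover have "\<forall>\<^sub>F e in at_right 0. (e::real) > 0" by (simp add: eventually_at_right_less)
      ultimately show ?thesis by (auto elim: eventually_mono)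
    next
      case False
      then have lt: "u \<bullet> \<omega> < c" using assms(2) uc unfolding mem by fastforce
      have "((\<lambda>e. u \<bullet> (\<omega> + e *\<^sub>R d)) \<longlongrightarrow> u \<bullet> (\<omega> + 0 *\<^sub>R d)) (at_right 0)"
        by (intro tendsto_intros)
      then have "\<forall>\<^sub>F e in at_right 0. u \<bullet> (\<omega> + e *\<^sub>R d) < c"
        by (rule order_tendstoD(2)) (use lt in simp)
      then show ?thesis by eventually_elim simp
    qed
    then have "\<forall>\<^sub>F e in at_right 0. \<forall>(u,c)\<in>H. u \<bullet> (\<omega> + e *\<^sub>R d) \<le> c"
      using H(1) by (intro eventually_ball_finite) auto
    then show "d \<in> link \<omega> s" unfolding link_def mem by simp
  qed
  moreover have "\<forall>(u, c)\<in>H'. u \<in> int_lattice" using H(2) by (auto simp: H'_def)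
  ultimately show ?thesis unfolding rational_polyhedron_def using fin by blast
qed

text \<open>A segment in the link, scaled down and moved to \<open>\<omega>\<close>, becomes a
  segment in \<open>s\<close>. One scale works for both endpoints and the inner point at
  once.\<close>

lemma link_face_of:
  assumes "convex s" "\<phi> face_of s" "\<omega> \<in> \<phi>"
  shows "link \<omega> \<phi> face_of link \<omega> s"
proof -
  have sub: "\<phi> \<subseteq> s" using assms(2) by (rule face_of_imp_subset)
  have w: "\<omega> \<in> s" using sub assms(3) by blast
  have c\<phi>: "convex \<phi>" using assms(2) by (rule face_of_imp_convex)
  have "a \<in> link \<omega> \<phi> \<and> b \<in> link \<omega> \<phi>"
    if h: "a \<in> link \<omega> s" "b \<in> link \<omega> s" "x \<in> link \<omega> \<phi>" "x \<in> open_segment a b" for a b x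
  proof -
    obtain e1 where e1: "e1 > 0" "\<And>y. 0 \<le> y \<Longrightarrow> y < e1 \<Longrightarrow> \<omega> + y *\<^sub>R a \<in> s"
      using link_small[OF assms(1) w h(1)] by blast
    obtain e2 where e2: "e2 > 0" "\<And>y. 0 \<le> y \<Longrightarrow> y < e2 \<Longrightarrow> \<omega> + y *\<^sub>R b \<in> s"
      using link_small[OF assms(1) w h(2)] by blast
    obtain e3 where e3: "e3 > 0" "\<And>y. 0 \<le> y \<Longrightarrow> y < e3 \<Longrightarrow> \<omega> + y *\<^sub>R x \<in> \<phi>"
      using link_small[OF c\<phi> assms(3) h(3)] by blast
    define y where "y = min e1 (min e2 e3) / 2"
    have y: "0 < y" "y < e1" "y < e2" "y < e3" using e1(1) e2(1) e3(1) by (auto simp: y_def)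
    obtain t where t: "0 < t" "t < 1" "x = (1 - t) *\<^sub>R a + t *\<^sub>R b" and ab: "a \<noteq> b"
      using h(4) by (auto simp: in_segment)
    have "\<omega> + y *\<^sub>R x = (1 - t) *\<^sub>R (\<omega> + y *\<^sub>R a) + t *\<^sub>R (\<omega> + y *\<^sub>R b)"
      unfolding t(3) by (simp add: algebra_simps)
    then have "\<omega> + y *\<^sub>R x \<in> open_segment (\<omega> + y *\<^sub>R a) (\<omega> + y *\<^sub>R b)"
      unfolding in_segment(2) using t(1,2) ab y(1) by (intro conjI exI[of _ t]) auto
    then have "\<omega> + y *\<^sub>R a \<in> \<phi> \<and> \<omega> + y *\<^sub>R b \<in> \<phi>"
      by (rule face_ofD[OF assms(2) _ e1(2)[of y] e2(2)[of y] e3(2)[of y]]) (use y in auto)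
    then show ?thesis unfolding link_iff[OF c\<phi> assms(3)] using y(1) by blast
  qed
  then show ?thesis unfolding face_of_def
    using link_mono[OF sub] convex_link[OF c\<phi> assms(3)] by blast
qed

lemma rel_interior_link:
  assumes "convex \<rho>" "\<omega> \<in> \<rho>" "e > 0" "\<omega> + e *\<^sub>R x \<in> rel_interior \<rho>"
  shows "x \<in> rel_interior (link \<omega> \<rho>)"
proof -
  obtain d where d: "d > 0" "cball (\<omega> + e *\<^sub>R x) d \<inter> affine hull \<rho> \<subseteq> \<rho>" and m: "\<omega> + e *\<^sub>R x \<in> \<rho>"
    using assms(4) by (auto simp: mem_rel_interior_cball)
  have "x + h \<in> link \<omega> \<rho>" if h: "h \<in> dirs (link \<omega> \<rho>)" "norm h < d / e" for h
  proof -
    have hd: "h \<in> dirs \<rho>" using h(1) dirs_link[OF assms(1,2)] by simp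
    have "\<omega> + e *\<^sub>R (x + h) \<in> affine hull \<rho>"
      unfolding affine_hull_dirs[OF m] using subspace_scale[OF subspace_dirs hd, of e]
      by (simp add: algebra_simps)
    moreover have "norm (e *\<^sub>R h) \<le> d" using h(2) assms(3) by (simp add: field_simps)
    then have "\<omega> + e *\<^sub>R (x + h) \<in> cball (\<omega> + e *\<^sub>R x) d" by (simp add: dist_norm algebra_simps)
    ultimately show ?thesis unfolding link_iff[OF assms(1,2)] using d(2) assms(3) by blast
  qed
  moreover have "x \<in> link \<omega> \<rho>" unfolding link_iff[OF assms(1,2)] using m assms(3) by blast
  moreover have "d / e > 0" using d(1) assms(3) by simp
  ultimately show ?thesis by (intro rel_interiorI_dirs[of x _ "d/e"]) auto
qed

text \<open>From \<open>\<omega>\<close> one can pass through \<open>\<omega>'\<close> and slightly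
  beyond without leaving \<open>\<gamma>\<close>. A convex combination of the point beyond with
  \<open>\<omega> + e *\<^sub>R u\<close> is \<open>\<omega>'\<close> plus a positive multiple of
  \<open>u\<close>.\<close>

lemma link_rel_interior_mono:
  assumes "convex s" "\<gamma> \<subseteq> s" "\<omega> \<in> \<gamma>" "\<omega>' \<in> rel_interior \<gamma>"
  shows "link \<omega> s \<subseteq> link \<omega>' s"
proof
  fix u assume "u \<in> link \<omega> s"
  moreover have w: "\<omega> \<in> s" "\<omega>' \<in> s" using assms rel_interior_subset by blast+
  ultimately obtain e where e: "e > 0" "\<omega> + e *\<^sub>R u \<in> s" using link_iff[OF assms(1)] by blast
  have "\<omega>' - \<omega> \<in> dirs \<gamma>" using assms(3,4) rel_interior_subset diff_in_dirs by blast
  then obtain t where t: "t > 0" "\<omega>' + t *\<^sub>R (\<omega>' - \<omega>) \<in> \<gamma>"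
    using rel_interior_dirs[OF assms(4)] by (metis abs_of_pos order_refl)
  \<comment> \<open>The weight for which the terms in \<open>\<omega>\<close> cancel and
    \<open>\<omega>'\<close> gets coefficient 1.\<close>
  define l where "l = 1 / (1 + t)"
  have l: "0 < l" "l < 1" "l * (1 + t) = 1" using t(1) by (auto simp: l_def)
  have "l *\<^sub>R (\<omega>' + t *\<^sub>R (\<omega>' - \<omega>)) + (1 - l) *\<^sub>R (\<omega> + e *\<^sub>R u) \<in> s"
    using assms(1,2) e(2) t(2) l by (intro convexD) auto
  also have "l *\<^sub>R (\<omega>' + t *\<^sub>R (\<omega>' - \<omega>)) + (1 - l) *\<^sub>R (\<omega> + e *\<^sub>R u) =
      (l * (1 + t)) *\<^sub>R \<omega>' + (1 - l * (1 + t)) *\<^sub>R \<omega> + ((1 - l) * e) *\<^sub>R u"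
    by (simp add: algebra_simps)
  also have "\<dots> = \<omega>' + ((1 - l) * e) *\<^sub>R u" by (simp add: l(3))
  finally show "u \<in> link \<omega>' s" unfolding link_iff[OF assms(1) w(2)]
    using l e(1) by (intro exI[of _ "(1 - l) * e"]) auto
qed

lemma link_rel_interior_eq:
  assumes "convex s" "\<gamma> \<subseteq> s" "\<omega> \<in> rel_interior \<gamma>" "\<omega>' \<in> rel_interior \<gamma>"
  shows "link \<omega> s = link \<omega>' s"
  using link_rel_interior_mono[OF assms(1,2) _ assms(4)] link_rel_interior_mono[OF assms(1,2) _ assms(3)]
    assms(3,4) rel_interior_subset by blast

text \<open>Since both a direction of \<open>\<gamma>\<close> and its negative can be followed
  inside \<open>\<gamma>\<close>, the link is invariant under all of them. This supplies the
  subspace \<open>K\<close> of the degree theorem.\<close>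

lemma link_dirs_inv:
  assumes "convex s" "\<gamma> \<subseteq> s" "\<omega> \<in> rel_interior \<gamma>" "u \<in> link \<omega> s" "d \<in> dirs \<gamma>"
  shows "u + d \<in> link \<omega> s"
proof -
  have w: "\<omega> \<in> s" using assms rel_interior_subset by blast
  obtain t where t: "t > 0" "\<And>l. \<bar>l\<bar> \<le> t \<Longrightarrow> \<omega> + l *\<^sub>R d \<in> \<gamma>"
    using rel_interior_dirs[OF assms(3,5)] by blast
  have "\<omega> + t *\<^sub>R d \<in> s" using t(2)[of t] t(1) assms(2) by auto
  then have "d \<in> link \<omega> s" unfolding link_iff[OF assms(1) w] using t(1) by blast
  then show ?thesis by (rule link_add[OF assms(1) w assms(4)])
qed

text \<open>A relatively interior point of \<open>s\<close>, pulled towards \<open>\<omega>\<close>,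
  stays relatively interior and eventually falls into \<open>t\<close>, so \<open>t\<close> contains
  \<open>s\<close>. It follows that a cell through \<open>\<omega>\<close> is determined by its
  link, as the inverse used in \<open>link_at\<close> requires.\<close>

lemma link_subset_iff:
  assumes C: "convex_complex C" and "s \<in> C" "t \<in> C" "\<omega> \<in> s" "\<omega> \<in> t"
  shows "link \<omega> s \<subseteq> link \<omega> t \<longleftrightarrow> s \<subseteq> t"
proof
  assume sub: "link \<omega> s \<subseteq> link \<omega> t"
  have c: "convex s" "convex t" using convex_complexD(3)[OF C] assms by auto
  obtain y where y: "y \<in> rel_interior s"
    using c(1) convex_complexD(4)[OF C assms(2)] rel_interior_eq_empty by blast
  then have "y - \<omega> \<in> link \<omega> t" using sub diff_in_link[OF c(1) assms(4)] rel_interior_subset by blast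
  then obtain e where e: "e > 0" "\<forall>l. 0 \<le> l \<and> l < e \<longrightarrow> \<omega> + l *\<^sub>R (y - \<omega>) \<in> t"
    using link_small[OF c(2) assms(5)] by blast
  define l where "l = min (e/2) 1"
  have l: "0 < l" "l < e" "l \<le> 1" using e(1) by (auto simp: l_def)
  have "\<omega> - l *\<^sub>R (\<omega> - y) \<in> rel_interior s"
    by (rule rel_interior_convex_shrink[OF c(1) y assms(4) l(1,3)])
  moreover have "\<omega> - l *\<^sub>R (\<omega> - y) = \<omega> + l *\<^sub>R (y - \<omega>)" by (simp add: algebra_simps)
  moreover have "\<omega> + l *\<^sub>R (y - \<omega>) \<in> t" using e(2) l by simp
  ultimately show "s \<subseteq> t" using carrier_subset[OF C assms(2,3)] by simp
qed (rule link_mono)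

lemma inj_on_link:
  assumes "convex_complex C"
  shows "inj_on (link \<omega>) {s\<in>C. \<omega> \<in> s}"
proof (rule inj_onI)
  fix s t assume "s \<in> {s\<in>C. \<omega> \<in> s}" "t \<in> {s\<in>C. \<omega> \<in> s}" and eq: "link \<omega> s = link \<omega> t"
  then have m: "s \<in> C" "t \<in> C" "\<omega> \<in> s" "\<omega> \<in> t" by auto
  show "s = t"
    using link_subset_iff[OF assms m] link_subset_iff[OF assms m(2,1,4,3)] eq by blast
qed

text \<open>For \<open>x\<close> relatively interior in the face, the cell carrying a point
  \<open>y\<close> inside the segment from \<open>\<omega>\<close> to
  \<open>\<omega> + e *\<^sub>R x\<close> contains \<open>\<omega>\<close>, because it is a face of
  \<open>s\<close>. Its link has \<open>x\<close> in its relative interior, and faces meeting in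
  relative interiors coincide.\<close>

lemma face_of_link:
  assumes C: "convex_complex C" and s: "s \<in> C" "\<omega> \<in> s" and \<phi>: "\<phi> face_of link \<omega> s" "\<phi> \<noteq> {}"
  obtains \<rho> where "\<rho> \<in> C" "\<omega> \<in> \<rho>" "\<rho> face_of s" "\<phi> = link \<omega> \<rho>"
proof -
  have cs: "convex s" by (rule convex_complexD(3)[OF C s(1)])
  obtain x where x: "x \<in> rel_interior \<phi>"
    using face_of_imp_convex[OF \<phi>(1)] \<phi>(2) rel_interior_eq_empty by blast
  have "x \<in> link \<omega> s" using x rel_interior_subset face_of_imp_subset[OF \<phi>(1)] by blast
  then obtain e where e: "e > 0" "\<omega> + e *\<^sub>R x \<in> s" using link_iff[OF cs s(2)] by blast
  define y where "y = \<omega> + (e/2) *\<^sub>R x"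
  have yeq: "y = (1 - 1/2) *\<^sub>R \<omega> + (1/2) *\<^sub>R (\<omega> + e *\<^sub>R x)"
  proof -
    have "(1 - 1/2) *\<^sub>R \<omega> + (1/2) *\<^sub>R (\<omega> + e *\<^sub>R x) = ((1/2) *\<^sub>R \<omega> + (1/2) *\<^sub>R \<omega>) + (e/2) *\<^sub>R x"
      by (simp add: scaleR_add_right)
    also have "(1/2) *\<^sub>R \<omega> + (1/2) *\<^sub>R \<omega> = \<omega>" by (simp flip: scaleR_add_left)
    finally show ?thesis by (simp add: y_def)
  qed
  have ys: "y \<in> s" unfolding yeq using cs s(2) e(2) by (intro convexD) auto
  obtain \<rho> where \<rho>: "\<rho> \<in> C" "\<rho> face_of s" "y \<in> rel_interior \<rho>" using carrier_exists[OF C s(1) ys] by metis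
  have y\<rho>: "y \<in> \<rho>" using \<rho>(3) rel_interior_subset by blast
  have w: "\<omega> \<in> \<rho>"
  proof (cases "x = 0")
    case True
    then show ?thesis using y\<rho> by (simp add: y_def)
  next
    case False
    then have "y \<in> open_segment \<omega> (\<omega> + e *\<^sub>R x)" unfolding in_segment(2) yeq
      using e(1) by (intro conjI exI[of _ "1/2"]) auto
    then show ?thesis by (rule face_ofD[OF \<rho>(2) _ s(2) e(2) y\<rho>, THEN conjunct1])
  qed
  have "x \<in> rel_interior (link \<omega> \<rho>)"
    by (rule rel_interior_link[OF convex_complexD(3)[OF C \<rho>(1)] w, of "e/2"]) (use e(1) \<rho>(3) in \<open>auto simp: y_def\<close>)
  then have "\<phi> = link \<omega> \<rho>"
    using face_of_eq[OF \<phi>(1) link_face_of[OF cs \<rho>(2) w]] x by blast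
  then show ?thesis using that \<rho>(1,2) w by blast
qed

lemma link_complex:
  assumes C: "convex_complex C" and rat: "\<And>s. s \<in> C \<Longrightarrow> rational_polyhedron s"
  shows "convex_complex (link \<omega> ` {s\<in>C. \<omega> \<in> s})"
  unfolding convex_complex_def
proof (intro conjI ballI allI impI)
  show "finite (link \<omega> ` {s\<in>C. \<omega> \<in> s})" using convex_complexD(1)[OF C] by simp
next
  fix x assume "x \<in> link \<omega> ` {s\<in>C. \<omega> \<in> s}"
  then obtain s where s: "x = link \<omega> s" "s \<in> C" "\<omega> \<in> s" by blast
  have "rational_polyhedron x" unfolding s(1) by (rule rational_polyhedron_link[OF rat[OF s(2)] s(3)])
  then show "closed x" "convex x" using rational_polyhedron_closed_convex by blast+
  show "x \<noteq> {}" using zero_in_link[OF s(3)] s(1) by blast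
next
  fix x \<phi> assume "x \<in> link \<omega> ` {s\<in>C. \<omega> \<in> s}" and \<phi>: "\<phi> face_of x \<and> \<phi> \<noteq> {}"
  then obtain s where s: "x = link \<omega> s" "s \<in> C" "\<omega> \<in> s" by blast
  obtain \<rho> where "\<rho> \<in> C" "\<omega> \<in> \<rho>" "\<phi> = link \<omega> \<rho>"
    using face_of_link[OF C s(2,3)] \<phi> unfolding s(1) by metis
  then show "\<phi> \<in> link \<omega> ` {s\<in>C. \<omega> \<in> s}" by blast
next
  fix x y assume "x \<in> link \<omega> ` {s\<in>C. \<omega> \<in> s}" "y \<in> link \<omega> ` {s\<in>C. \<omega> \<in> s}"
  then obtain s t where x: "x = link \<omega> s" "s \<in> C" "\<omega> \<in> s" and y: "y = link \<omega> t" "t \<in> C" "\<omega> \<in> t" by blast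
  have i: "x \<inter> y = link \<omega> (s \<inter> t)" using x y by (simp add: link_Int)
  show "x \<inter> y face_of y" unfolding i unfolding y(1)
    using link_face_of[OF convex_complexD(3)[OF C y(2)] convex_complexD(6)[OF C x(2) y(2)]] x y by blast
  have "(s \<inter> t) face_of s" using convex_complexD(6)[OF C y(2) x(2)] by (simp add: Int_commute)
  then show "x \<inter> y face_of x" unfolding i unfolding x(1)
    using link_face_of[OF convex_complexD(3)[OF C x(2)]] x y by blast
qed

lemma facets_link:
  assumes C: "convex_complex C"
  shows "facets (link \<omega> ` {s\<in>C. \<omega> \<in> s}) = link \<omega> ` {s\<in>facets C. \<omega> \<in> s}"
proof (intro subset_antisym subsetI)
  fix x assume x: "x \<in> facets (link \<omega> ` {s\<in>C. \<omega> \<in> s})"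
  then have "x \<in> link \<omega> ` {s\<in>C. \<omega> \<in> s}" using facets_subset by blast
  then obtain s where s: "x = link \<omega> s" "s \<in> C" "\<omega> \<in> s" by blast
  obtain \<rho> where \<rho>: "\<rho> \<in> facets C" "s \<subseteq> \<rho>" using facet_exists[OF convex_complexD(1)[OF C] s(2)] by metis
  have "\<rho> \<in> C" "\<omega> \<in> \<rho>" using \<rho> s(3) facets_subset by blast+
  then have "link \<omega> \<rho> = x" using x link_mono[OF \<rho>(2), of \<omega>] unfolding s(1) facets_def by blast
  then show "x \<in> link \<omega> ` {s\<in>facets C. \<omega> \<in> s}" using \<rho>(1) \<open>\<omega> \<in> \<rho>\<close> by blast
next
  fix x assume "x \<in> link \<omega> ` {s\<in>facets C. \<omega> \<in> s}"
  then obtain s where s: "x = link \<omega> s" "s \<in> facets C" "\<omega> \<in> s" by blast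
  have sC: "s \<in> C" using s(2) facets_subset by blast
  have "y = x" if y: "y \<in> link \<omega> ` {s\<in>C. \<omega> \<in> s}" "x \<subseteq> y" for y
  proof -
    obtain t where t: "y = link \<omega> t" "t \<in> C" "\<omega> \<in> t" using y(1) by blast
    have "s \<subseteq> t" using y(2) link_subset_iff[OF C sC t(2) s(3) t(3)] s(1) t(1) by simp
    then have "t = s" using s(2) t(2) unfolding facets_def by blast
    then show ?thesis using s(1) t(1) by simp
  qed
  moreover have "x \<in> link \<omega> ` {s\<in>C. \<omega> \<in> s}" using s sC by blast
  ultimately show "x \<in> facets (link \<omega> ` {s\<in>C. \<omega> \<in> s})" unfolding facets_def
    by (intro CollectI conjI ballI impI)
qed

lemma cells_link_at: "cells (link_at \<omega> X) = link \<omega> ` {s\<in>cells X. \<omega> \<in> s}"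
  by (simp add: link_at_def)

lemma facet_mult_link_at:
  assumes "convex_complex (cells X)" "s \<in> cells X" "\<omega> \<in> s"
  shows "facet_mult (link_at \<omega> X) (link \<omega> s) = facet_mult X s"
  using the_inv_into_f_f[OF inj_on_link[OF assms(1), of \<omega>], of s] assms(2,3) by (simp add: link_at_def)

lemma tropical_cycleD:
  fixes X :: "(real ^ 'n) weighted_complex"
  assumes "tropical_cycle p X"
  shows "polyhedral_complex (cells X)" "convex_complex (cells X)"
    "s \<in> facets (cells X) \<Longrightarrow> aff_dim s = int CARD('n) - int p"
    "t \<in> ridges (cells X) \<Longrightarrow> balanced_at X t" "s \<in> cells X \<Longrightarrow> rational_polyhedron s"
proof -
  show 1: "polyhedral_complex (cells X)" using assms by (simp add: tropical_cycle_def)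
  show "convex_complex (cells X)" by (rule polyhedral_complex_convex[OF 1])
  show "s \<in> facets (cells X) \<Longrightarrow> aff_dim s = int CARD('n) - int p"
    using assms by (simp add: tropical_cycle_def pure_codim_def)
  show "t \<in> ridges (cells X) \<Longrightarrow> balanced_at X t" using assms by (simp add: tropical_cycle_def)
  show "s \<in> cells X \<Longrightarrow> rational_polyhedron s"
    using 1[unfolded polyhedral_complex_def, THEN conjunct2, THEN conjunct1, rule_format, THEN conjunct1] .
qed

lemma facet_dim:
  fixes X :: "(real ^ 'n) weighted_complex"
  assumes "tropical_cycle p X" "s \<in> facets (cells X)"
  shows "int (dim (dirs s)) = int CARD('n) - int p"
proof -
  have "s \<in> cells X" using assms(2) facets_subset by blast
  then have "s \<noteq> {}" by (rule convex_complexD(4)[OF tropical_cycleD(2)[OF assms(1)]])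
  then show ?thesis using tropical_cycleD(3)[OF assms] by (simp add: dim_dirs)
qed

lemma rat_span_subset_span: "rat_span S \<subseteq> span S"
  unfolding rat_span_def by (auto intro!: span_sum span_scale intro: span_base)

lemma primitive_normal_inward:
  assumes "primitive_normal t s v" "convex t" "t \<noteq> {}" "convex s" "t \<subseteq> s"
  shows "inward_primitive t s v"
proof -
  obtain x where x: "x \<in> rel_interior t" using assms(2,3) rel_interior_eq_empty by blast
  then have "v \<in> link x s" using assms(1) by (simp add: primitive_normal_def)
  moreover have "x \<in> t" using x rel_interior_subset by blast
  ultimately have "\<exists>x\<in>t. \<exists>e>0. x + e *\<^sub>R v \<in> s" using link_iff[OF assms(4), of x] assms(5) by blast
  then show ?thesis using assms(1) by (simp add: primitive_normal_def inward_primitive_def lattice_of_eq)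
qed

text \<open>Ridges of the link come from ridges through \<open>\<omega>\<close>, and passing to
  links changes neither direction spaces nor primitive normals nor multiplicities, so the balancing
  relation is carried over unchanged.\<close>

theorem balanced_link_at:
  fixes X :: "(real ^ 'n) weighted_complex"
  assumes X: "tropical_cycle p X"
  shows "balanced_complex (cells (link_at \<omega> X)) (\<lambda>\<kappa>. of_rat (facet_mult (link_at \<omega> X) \<kappa>)) (int CARD('n) - int p)"
proof -
  note C = tropical_cycleD(2)[OF X]
  let ?C = "{s\<in>cells X. \<omega> \<in> s}" and ?F = "{s\<in>facets (cells X). \<omega> \<in> s}"
  have conv: "\<And>s. s \<in> cells X \<Longrightarrow> convex s" by (rule convex_complexD(3)[OF C])
  have FC: "\<And>s. s \<in> facets (cells X) \<Longrightarrow> s \<in> cells X" using facets_subset by blast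
  have dl: "\<And>s. s \<in> cells X \<Longrightarrow> \<omega> \<in> s \<Longrightarrow> dirs (link \<omega> s) = dirs s" using dirs_link conv by blast
  show ?thesis unfolding balanced_complex_def cells_link_at facets_link[OF C]
  proof (intro conjI ballI impI)
    show "convex_complex (link \<omega> ` ?C)" by (rule link_complex[OF C tropical_cycleD(5)[OF X]])
  next
    fix x assume "x \<in> link \<omega> ` ?C"
    then obtain s where s: "x = link \<omega> s" "s \<in> cells X" "\<omega> \<in> s" by blast
    have "s \<noteq> {}" using s(3) by blast
    then show "rational_subspace (dirs x)" unfolding s(1) dl[OF s(2,3)]
      by (rule rational_polyhedron_dirs[OF tropical_cycleD(5)[OF X s(2)]])
  next
    fix x assume "x \<in> link \<omega> ` ?F"
    then obtain s where s: "x = link \<omega> s" "s \<in> facets (cells X)" "\<omega> \<in> s" by blast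
    show "int (dim (dirs x)) = int CARD('n) - int p"
      unfolding s(1) dl[OF FC[OF s(2)] s(3)] by (rule facet_dim[OF X s(2)])
  next
    fix x assume "x \<in> link \<omega> ` ?C" and ex: "\<exists>s\<in>link \<omega> ` ?F. x face_of s \<and> dim (dirs x) + 1 = dim (dirs s)"
    then obtain \<rho> where \<rho>: "x = link \<omega> \<rho>" "\<rho> \<in> cells X" "\<omega> \<in> \<rho>" by blast
    obtain s0 where s0: "s0 \<in> facets (cells X)" "\<omega> \<in> s0" "x face_of link \<omega> s0" "dim (dirs x) + 1 = dim (dirs (link \<omega> s0))"
      using ex by blast
    have sub: "\<rho> \<subseteq> s0" using face_of_imp_subset[OF s0(3)] link_subset_iff[OF C \<rho>(2) FC[OF s0(1)] \<rho>(3) s0(2)] \<rho>(1) by simp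
    have "dim (dirs \<rho>) + 1 = dim (dirs s0)"
      using s0(4) unfolding \<rho>(1) dl[OF \<rho>(2,3)] dl[OF FC[OF s0(1)] s0(2)] .
    moreover have ne: "\<rho> \<noteq> {}" "s0 \<noteq> {}" using \<rho>(3) s0(2) by auto
    ultimately have "\<rho> facet_of s0" unfolding facet_of_def
      using complex_face_subset[OF C FC[OF s0(1)] \<rho>(2) sub] by (simp add: dim_dirs)
    then have "\<rho> \<in> ridges (cells X)" using s0(1) by (auto simp: ridges_def)
    then have "balanced_at X \<rho>" by (rule tropical_cycleD(4)[OF X])
    then obtain v where v: "\<And>s. s \<in> facets (cells X) \<Longrightarrow> \<rho> \<subseteq> s \<Longrightarrow> primitive_normal \<rho> s (v s)"
      "(\<Sum>s | s \<in> facets (cells X) \<and> \<rho> \<subseteq> s. of_rat (facet_mult X s) *\<^sub>R v s) \<in> rat_span (lattice_of \<rho>)"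
      unfolding balanced_at_def by blast
    define w where "w = (\<lambda>\<kappa>. v (the_inv_into ?C (link \<omega>) \<kappa>))"
    have w: "w (link \<omega> s) = v s" if "s \<in> cells X" "\<omega> \<in> s" for s
      unfolding w_def using the_inv_into_f_f[OF inj_on_link[OF C, of \<omega>], of s] that by simp
    have S: "{\<kappa>. \<kappa> \<in> link \<omega> ` ?F \<and> x \<subseteq> \<kappa>} = link \<omega> ` {s. s \<in> facets (cells X) \<and> \<rho> \<subseteq> s}"
    proof (intro subset_antisym subsetI)
      fix \<kappa> assume "\<kappa> \<in> {\<kappa>. \<kappa> \<in> link \<omega> ` ?F \<and> x \<subseteq> \<kappa>}"
      then obtain s where s: "\<kappa> = link \<omega> s" "s \<in> facets (cells X)" "\<omega> \<in> s" "link \<omega> \<rho> \<subseteq> link \<omega> s" using \<rho>(1) by blast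
      then have "\<rho> \<subseteq> s" using link_subset_iff[OF C \<rho>(2) FC[OF s(2)] \<rho>(3) s(3)] by simp
      then show "\<kappa> \<in> link \<omega> ` {s. s \<in> facets (cells X) \<and> \<rho> \<subseteq> s}" using s(1,2) by blast
    next
      fix \<kappa> assume "\<kappa> \<in> link \<omega> ` {s. s \<in> facets (cells X) \<and> \<rho> \<subseteq> s}"
      then obtain s where s: "\<kappa> = link \<omega> s" "s \<in> facets (cells X)" "\<rho> \<subseteq> s" by blast
      then show "\<kappa> \<in> {\<kappa>. \<kappa> \<in> link \<omega> ` ?F \<and> x \<subseteq> \<kappa>}" using link_mono[OF s(3), of \<omega>] \<rho>(1,3) by blast
    qed
    have m: "s \<in> cells X" "\<omega> \<in> s" if "s \<in> facets (cells X)" "\<rho> \<subseteq> s" for s using that FC \<rho>(3) by auto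
    have inj: "inj_on (link \<omega>) {s. s \<in> facets (cells X) \<and> \<rho> \<subseteq> s}"
    proof (rule inj_on_subset[OF inj_on_link[OF C, of \<omega>]], rule subsetI)
      fix s assume "s \<in> {s. s \<in> facets (cells X) \<and> \<rho> \<subseteq> s}"
      then show "s \<in> {s\<in>cells X. \<omega> \<in> s}" using m[of s] by simp
    qed
    have "(\<Sum>\<kappa> | \<kappa> \<in> link \<omega> ` ?F \<and> x \<subseteq> \<kappa>. of_rat (facet_mult (link_at \<omega> X) \<kappa>) *\<^sub>R w \<kappa>) =
        (\<Sum>s | s \<in> facets (cells X) \<and> \<rho> \<subseteq> s. of_rat (facet_mult X s) *\<^sub>R v s)"
      unfolding S sum.reindex[OF inj] comp_def
    proof (rule sum.cong[OF refl])
      fix s assume "s \<in> {s. s \<in> facets (cells X) \<and> \<rho> \<subseteq> s}"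
      then have "s \<in> cells X" "\<omega> \<in> s" using m[of s] by simp_all
      then show "of_rat (facet_mult (link_at \<omega> X) (link \<omega> s)) *\<^sub>R w (link \<omega> s) = of_rat (facet_mult X s) *\<^sub>R v s"
        by (simp only: w facet_mult_link_at[OF C])
    qed
    also have "\<dots> \<in> dirs x"
    proof -
      have "span (lattice_of \<rho>) \<subseteq> dirs \<rho>" unfolding lattice_of_eq by (rule span_minimal) auto
      then show ?thesis using v(2) rat_span_subset_span unfolding \<rho>(1) dl[OF \<rho>(2,3)] by blast
    qed
    finally have sum: "(\<Sum>\<kappa> | \<kappa> \<in> link \<omega> ` ?F \<and> x \<subseteq> \<kappa>. of_rat (facet_mult (link_at \<omega> X) \<kappa>) *\<^sub>R w \<kappa>) \<in> dirs x" .
    have "inward_primitive x \<kappa> (w \<kappa>)" if \<kappa>: "\<kappa> \<in> link \<omega> ` ?F" "x \<subseteq> \<kappa>" for \<kappa>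
    proof -
      have "\<kappa> \<in> link \<omega> ` {s. s \<in> facets (cells X) \<and> \<rho> \<subseteq> s}" using \<kappa> S by blast
      then obtain s where s: "\<kappa> = link \<omega> s" "s \<in> facets (cells X)" "\<rho> \<subseteq> s" by blast
      have "inward_primitive \<rho> s (v s)"
        by (rule primitive_normal_inward[OF v(1)[OF s(2,3)] conv[OF \<rho>(2)] ne(1) conv[OF FC[OF s(2)]] s(3)])
      then obtain y e where l: "dirs s \<inter> zlat = {w + of_int a *\<^sub>R v s | w a. w \<in> dirs \<rho> \<inter> zlat}"
        and y: "y \<in> \<rho>" "e > 0" "y + e *\<^sub>R v s \<in> s" unfolding inward_primitive_def by blast
      have eq: "(y - \<omega>) + e *\<^sub>R v s = (y + e *\<^sub>R v s) - \<omega>" by simp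
      have "(y - \<omega>) + e *\<^sub>R v s \<in> link \<omega> s"
        unfolding eq by (rule diff_in_link[OF conv[OF m(1)[OF s(2,3)]] m(2)[OF s(2,3)] y(3)])
      moreover have "y - \<omega> \<in> link \<omega> \<rho>" by (rule diff_in_link[OF conv[OF \<rho>(2)] \<rho>(3) y(1)])
      ultimately show ?thesis
        unfolding inward_primitive_def s(1) \<rho>(1) w[OF m[OF s(2,3)]] dl[OF m[OF s(2,3)]] dl[OF \<rho>(2,3)]
        using l y(2) by blast
    qed
    then show "\<exists>v. (\<forall>\<kappa>\<in>link \<omega> ` ?F. x \<subseteq> \<kappa> \<longrightarrow> inward_primitive x \<kappa> (v \<kappa>)) \<and>
        (\<Sum>\<kappa> | \<kappa> \<in> link \<omega> ` ?F \<and> x \<subseteq> \<kappa>. of_rat (facet_mult (link_at \<omega> X) \<kappa>) *\<^sub>R v \<kappa>) \<in> dirs x"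
      using sum by (intro exI[of _ w]) blast
  qed
qed

section \<open>The support of the stable intersection\<close>

definition diag :: "'a set \<Rightarrow> ('a \<times> 'a) set" where
  "diag S = (\<lambda>y. (y, y)) ` S"

lemma diag_iff [simp]: "(a, b) \<in> diag S \<longleftrightarrow> a = b \<and> a \<in> S"
  by (auto simp: diag_def)

lemma linear_diag: "linear (\<lambda>y::'a::euclidean_space. (y, y))"
  by (auto intro!: linearI)

lemma subspace_diag: "subspace S \<Longrightarrow> subspace (diag S)" for S :: "'a::euclidean_space set"
  unfolding diag_def by (rule linear_subspace_image[OF linear_diag])

lemma dim_diag: "dim (diag S) = dim S" for S :: "'a::euclidean_space set"
  unfolding diag_def by (rule dim_image_eq[OF linear_diag]) (auto intro: inj_onI)

lemma rational_diag:
  fixes S :: "'a::euclidean_space set"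
  assumes "rational_subspace S"
  shows "rational_subspace (diag S)"
proof -
  have "diag S = span ((\<lambda>y. (y, y)) ` (S \<inter> zlat))"
    unfolding linear_span_image[OF linear_diag] span_rational[OF assms] diag_def ..
  also have "rational_subspace \<dots>" by (rule rational_subspace_span) (auto simp: zlat_Times)
  finally show ?thesis .
qed

text \<open>Turns projections into intersections: \<open>z1 - s\<close> and \<open>z2 - t\<close>
  have a common point in \<open>S\<close>.\<close>

lemma in_prod_plus_diag: "(z1, z2) \<in> s \<times> t + diag S \<longleftrightarrow> (\<exists>y\<in>S. z1 - y \<in> s \<and> z2 - y \<in> t)"
  for s :: "'a::ab_group_add set"
proof
  assume "(z1, z2) \<in> s \<times> t + diag S"
  then obtain x where x: "x \<in> s \<times> t" "(z1, z2) - x \<in> diag S" unfolding set_plus_iff by blast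
  obtain a b where ab: "x = (a, b)" by (cases x)
  have "z1 - a = z2 - b" "z1 - a \<in> S" "a \<in> s" "b \<in> t" using x by (auto simp: ab)
  moreover have "z2 - (z1 - a) = b" using \<open>z1 - a = z2 - b\<close> by simp
  moreover have "z1 - (z1 - a) = a" by simp
  ultimately show "\<exists>y\<in>S. z1 - y \<in> s \<and> z2 - y \<in> t" by (metis)
next
  assume "\<exists>y\<in>S. z1 - y \<in> s \<and> z2 - y \<in> t"
  then obtain y where "y \<in> S" "z1 - y \<in> s" "z2 - y \<in> t" by blast
  then show "(z1, z2) \<in> s \<times> t + diag S" unfolding set_plus_iff
    by (intro bexI[of _ "(z1 - y, z2 - y)"]) auto
qed

text \<open>The difference of the two coordinates kills the diagonal and yields the condition on
  \<open>A + B\<close>; on the diagonal itself only the common directions of \<open>A\<close> and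
  \<open>B\<close> are available to complement \<open>S\<close>.\<close>

lemma prod_plus_diag_full:
  fixes A B S :: "'a::euclidean_space set"
  assumes "subspace A" "subspace B" "subspace S"
  shows "A \<times> B + diag S = UNIV \<longleftrightarrow> A + B = UNIV \<and> (A \<inter> B) + S = UNIV"
proof
  assume f: "A \<times> B + diag S = UNIV"
  have "v \<in> A + B" for v
  proof -
    have "(v, 0) \<in> A \<times> B + diag S" using f by simp
    then obtain y where y: "v - y \<in> A" "0 - y \<in> B" unfolding in_prod_plus_diag by blast
    have "v - (v - y) \<in> B" using subspace_neg[OF assms(2) y(2)] by simp
    then show ?thesis unfolding set_plus_iff using y(1) by blast
  qed
  moreover have "v \<in> (A \<inter> B) + S" for v
  proof -
    have "(v, v) \<in> A \<times> B + diag S" using f by simp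
    then obtain y where y: "y \<in> S" "v - y \<in> A" "v - y \<in> B" unfolding in_prod_plus_diag by blast
    then show ?thesis unfolding set_plus_iff by (intro bexI[of _ "v - y"]) auto
  qed
  ultimately show "A + B = UNIV \<and> (A \<inter> B) + S = UNIV" by blast
next
  assume f: "A + B = UNIV \<and> (A \<inter> B) + S = UNIV"
  have "(v, w) \<in> A \<times> B + diag S" for v w
  proof -
    have "v - w \<in> A + B" using f by simp
    then obtain a where a: "a \<in> A" "v - w - a \<in> B" unfolding set_plus_iff by blast
    have "v - a \<in> (A \<inter> B) + S" using f by simp
    then obtain q where q: "q \<in> A" "q \<in> B" "v - a - q \<in> S" unfolding set_plus_iff by blast
    have "v - (v - a - q) \<in> A" using subspace_add[OF assms(1) q(1) a(1)] by (simp add: algebra_simps)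
    moreover have "w - (v - a - q) \<in> B" using subspace_diff[OF assms(2) q(2) a(2)] by (simp add: algebra_simps)
    ultimately show ?thesis unfolding in_prod_plus_diag using q(3) by blast
  qed
  then show "A \<times> B + diag S = UNIV" by auto
qed

abbreviation transversal :: "(real ^ 'n) set \<Rightarrow> (real ^ 'n) set \<Rightarrow> bool" where
  "transversal s t \<equiv> dirs s + dirs t = UNIV"

lemma transversal_dim:
  fixes X Y :: "(real ^ 'n) weighted_complex"
  assumes "tropical_cycle p X" "tropical_cycle q Y" "s \<in> facets (cells X)" "t \<in> facets (cells Y)" "transversal s t"
  shows "int (dim (dirs s \<inter> dirs t)) = int CARD('n) - int (p + q)"
proof -
  have "dim (dirs s + dirs t) + dim (dirs s \<inter> dirs t) = dim (dirs s) + dim (dirs t)"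
    by (rule dim_set_plus) auto
  then show ?thesis
    using facet_dim[OF assms(1,3)] facet_dim[OF assms(2,4)] assms(5) by simp
qed

definition link_prod :: "real ^ 'n \<Rightarrow> (real ^ 'n) weighted_complex \<Rightarrow> (real ^ 'n) weighted_complex \<Rightarrow> ((real ^ 'n) \<times> (real ^ 'n)) set set" where
  "link_prod \<omega> X Y = prod_complex (cells (link_at \<omega> X)) (cells (link_at \<omega> Y))"

definition link_prod_mult :: "real ^ 'n \<Rightarrow> (real ^ 'n) weighted_complex \<Rightarrow> (real ^ 'n) weighted_complex \<Rightarrow> ((real ^ 'n) \<times> (real ^ 'n)) set \<Rightarrow> real" where
  "link_prod_mult \<omega> X Y = (\<lambda>c. of_rat (facet_mult (link_at \<omega> X) (fst ` c)) * of_rat (facet_mult (link_at \<omega> Y) (snd ` c)))"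

lemma balanced_link_prod:
  fixes X Y :: "(real ^ 'n) weighted_complex"
  assumes "tropical_cycle p X" "tropical_cycle q Y"
  shows "balanced_complex (link_prod \<omega> X Y) (link_prod_mult \<omega> X Y) ((int CARD('n) - int p) + (int CARD('n) - int q))"
  unfolding link_prod_def link_prod_mult_def
  by (rule balanced_prod_complex[OF balanced_link_at[OF assms(1)] balanced_link_at[OF assms(2)]])

lemma facets_link_at:
  assumes "convex_complex (cells X)"
  shows "facets (cells (link_at \<omega> X)) = link \<omega> ` {s\<in>facets (cells X). \<omega> \<in> s}"
  unfolding cells_link_at by (rule facets_link[OF assms])

lemma facets_link_prod:
  assumes "convex_complex (cells X)" "convex_complex (cells Y)"
  shows "facets (link_prod \<omega> X Y) = {link \<omega> s \<times> link \<omega> t | s t. s \<in> facets (cells X) \<and> t \<in> facets (cells Y) \<and> \<omega> \<in> s \<and> \<omega> \<in> t}"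
proof -
  have "facets (link_prod \<omega> X Y) = prod_complex (facets (cells (link_at \<omega> X))) (facets (cells (link_at \<omega> Y)))"
    unfolding link_prod_def
  proof (rule facets_prod_complex)
    show "c \<noteq> {}" if "c \<in> cells (link_at \<omega> X)" for c
      using that zero_in_link unfolding cells_link_at by blast
    show "c \<noteq> {}" if "c \<in> cells (link_at \<omega> Y)" for c
      using that zero_in_link unfolding cells_link_at by blast
  qed
  then show ?thesis unfolding facets_link_at[OF assms(1)] facets_link_at[OF assms(2)] prod_complex_def by blast
qed

lemma dirs_link_prod:
  assumes "convex s" "convex t" "\<omega> \<in> s" "\<omega> \<in> t"
  shows "dirs (link \<omega> s \<times> link \<omega> t) = dirs s \<times> dirs t"
proof -
  have "link \<omega> s \<noteq> {}" "link \<omega> t \<noteq> {}" using zero_in_link assms(3,4) by blast+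
  then show ?thesis using dirs_Times dirs_link[OF assms(1,3)] dirs_link[OF assms(2,4)] by metis
qed

lemma link_prod_mult_eq:
  assumes "convex_complex (cells X)" "convex_complex (cells Y)" "s \<in> cells X" "t \<in> cells Y" "\<omega> \<in> s" "\<omega> \<in> t"
  shows "link_prod_mult \<omega> X Y (link \<omega> s \<times> link \<omega> t) = of_rat (facet_mult X s) * of_rat (facet_mult Y t)"
proof -
  have "link \<omega> s \<noteq> {}" "link \<omega> t \<noteq> {}" using zero_in_link assms(5,6) by blast+
  then show ?thesis unfolding link_prod_mult_def
    using facet_mult_link_at[OF assms(1,3,5)] facet_mult_link_at[OF assms(2,4,6)] by simp
qed

lemma facet_convex: "tropical_cycle p X \<Longrightarrow> s \<in> facets (cells X) \<Longrightarrow> convex s"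
  using convex_complexD(3)[OF tropical_cycleD(2)] facets_subset by blast

text \<open>Replacing the diagonal by a complement \<open>M\<close> in it of the directions common to the given transversal pair
  makes the degree positive, so the projection along \<open>M\<close> is onto.\<close>

lemma transversal_cover:
  fixes X Y :: "(real ^ 'n) weighted_complex"
  assumes X: "tropical_cycle p X" "positive X" and Y: "tropical_cycle q Y" "positive Y"
    and s: "s0 \<in> facets (cells X)" "t0 \<in> facets (cells Y)" "\<omega> \<in> s0" "\<omega> \<in> t0" "transversal s0 t0"
  obtains M where "subspace M" "int (dim M) = int (p + q)"
    "\<And>z1 z2. \<exists>s\<in>facets (cells X). \<exists>t\<in>facets (cells Y). \<omega> \<in> s \<and> \<omega> \<in> t \<and> transversal s t \<and>
        (\<exists>y\<in>M. z1 - y \<in> link \<omega> s \<and> z2 - y \<in> link \<omega> t)"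
proof -
  note CX = tropical_cycleD(2)[OF X(1)] and CY = tropical_cycleD(2)[OF Y(1)]
  have FX: "\<And>s. s \<in> facets (cells X) \<Longrightarrow> s \<in> cells X" and FY: "\<And>s. s \<in> facets (cells Y) \<Longrightarrow> s \<in> cells Y"
    using facets_subset by blast+
  have ne: "s0 \<noteq> {}" "t0 \<noteq> {}" using s(3,4) by auto
  have ratQ: "rational_subspace (dirs s0 \<inter> dirs t0)"
    by (intro rational_subspace_Int rational_polyhedron_dirs ne tropical_cycleD(5)[OF X(1) FX[OF s(1)]]
        tropical_cycleD(5)[OF Y(1) FY[OF s(2)]])
  obtain M where M: "rational_subspace M" "M \<inter> (dirs s0 \<inter> dirs t0) = {0}" "{x + y | x y. x \<in> M \<and> y \<in> dirs s0 \<inter> dirs t0} = UNIV"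
    by (rule rational_complement[OF ratQ])
  have Ms: "subspace M" using M(1) by (rule rational_subspaceD)
  have "dim (M + (dirs s0 \<inter> dirs t0)) + dim (M \<inter> (dirs s0 \<inter> dirs t0)) = dim M + dim (dirs s0 \<inter> dirs t0)"
    by (rule dim_set_plus) (auto simp: Ms subspace_inter)
  then have "CARD('n) = dim M + dim (dirs s0 \<inter> dirs t0)" unfolding set_plus_eq M(2,3) by simp
  then have dM: "int (dim M) = int (p + q)" using transversal_dim[OF X(1) Y(1) s(1,2,5)] by linarith
  have full0: "dirs s0 \<times> dirs t0 + diag M = UNIV"
  proof -
    have "M + (dirs s0 \<inter> dirs t0) = UNIV" unfolding set_plus_eq by (rule M(3))
    then have "(dirs s0 \<inter> dirs t0) + M = UNIV" by (subst add.commute)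
    then show ?thesis using prod_plus_diag_full[OF subspace_dirs subspace_dirs Ms] s(5) by blast
  qed
  \<comment> \<open>As \<open>M\<close> has dimension \<open>p + q\<close> and meets the common
    directions only in \<open>0\<close>, the dimension hypothesis holds with \<open>K\<close> equal
    to zero, whatever cell carries \<open>\<omega>\<close>.\<close>
  have cover: "\<exists>c\<in>facets (link_prod \<omega> X Y). dirs c + diag M = UNIV \<and> z \<in> c + diag M" for z
  proof (rule positive_cover[where K = "{0}"])
    show "balanced_complex (link_prod \<omega> X Y) (link_prod_mult \<omega> X Y) ((int CARD('n) - int p) + (int CARD('n) - int q))"
      by (rule balanced_link_prod[OF X(1) Y(1)])
    show "rational_subspace (diag M)" by (rule rational_diag[OF M(1)])
    show "{0} \<subseteq> diag M" using subspace_0[OF subspace_diag[OF Ms]] by simp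
    show "(int CARD('n) - int p) + (int CARD('n) - int q) + int (dim (diag M)) = int DIM((real ^ 'n) \<times> (real ^ 'n)) + int (dim {0::(real ^ 'n) \<times> (real ^ 'n)})"
      unfolding dim_diag dM by simp
    show "link_prod_mult \<omega> X Y c > 0" if c: "c \<in> facets (link_prod \<omega> X Y)" for c
    proof -
      obtain s t where st: "c = link \<omega> s \<times> link \<omega> t" "s \<in> facets (cells X)" "t \<in> facets (cells Y)" "\<omega> \<in> s" "\<omega> \<in> t"
        using c unfolding facets_link_prod[OF CX CY] by blast
      show ?thesis unfolding st(1) link_prod_mult_eq[OF CX CY FX[OF st(2)] FY[OF st(3)] st(4,5)]
        using X(2) Y(2) st(2,3) by (simp add: positive_def)
    qed
    show "link \<omega> s0 \<times> link \<omega> t0 \<in> facets (link_prod \<omega> X Y)" unfolding facets_link_prod[OF CX CY] using s by blast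
    show "dirs (link \<omega> s0 \<times> link \<omega> t0) + diag M = UNIV"
      unfolding dirs_link_prod[OF facet_convex[OF X(1) s(1)] facet_convex[OF Y(1) s(2)] s(3,4)] by (rule full0)
  qed auto
  have "\<exists>s\<in>facets (cells X). \<exists>t\<in>facets (cells Y). \<omega> \<in> s \<and> \<omega> \<in> t \<and> transversal s t \<and>
        (\<exists>y\<in>M. z1 - y \<in> link \<omega> s \<and> z2 - y \<in> link \<omega> t)" for z1 z2
  proof -
    obtain c where c: "c \<in> facets (link_prod \<omega> X Y)" "dirs c + diag M = UNIV" "(z1, z2) \<in> c + diag M" using cover by blast
    obtain s t where st: "c = link \<omega> s \<times> link \<omega> t" "s \<in> facets (cells X)" "t \<in> facets (cells Y)" "\<omega> \<in> s" "\<omega> \<in> t"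
      using c(1) unfolding facets_link_prod[OF CX CY] by blast
    have "dirs s \<times> dirs t + diag M = UNIV"
      using c(2) unfolding st(1) dirs_link_prod[OF facet_convex[OF X(1) st(2)] facet_convex[OF Y(1) st(3)] st(4,5)] .
    then have "transversal s t" using prod_plus_diag_full[OF subspace_dirs subspace_dirs Ms] by blast
    moreover have "\<exists>y\<in>M. z1 - y \<in> link \<omega> s \<and> z2 - y \<in> link \<omega> t" using c(3) unfolding st(1) in_prod_plus_diag .
    ultimately show ?thesis using st(2-5) by blast
  qed
  then show ?thesis using that[OF Ms dM] by blast
qed

lemma support_link_at:
  assumes "convex_complex (cells X)" "positive X"
  shows "support (link_at \<omega> X) = \<Union>(link \<omega> ` {s\<in>facets (cells X). \<omega> \<in> s})"
proof -
  have "facet_mult (link_at \<omega> X) \<kappa> \<noteq> 0" if \<kappa>: "\<kappa> \<in> link \<omega> ` {s\<in>facets (cells X). \<omega> \<in> s}" for \<kappa>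
  proof -
    obtain s where s: "\<kappa> = link \<omega> s" "s \<in> facets (cells X)" "\<omega> \<in> s" using \<kappa> by blast
    have "s \<in> cells X" using s(2) facets_subset by blast
    then show ?thesis using facet_mult_link_at[OF assms(1) _ s(3)] s(1,2) assms(2) by (fastforce simp: positive_def)
  qed
  then have "{\<kappa> \<in> link \<omega> ` {s\<in>facets (cells X). \<omega> \<in> s}. facet_mult (link_at \<omega> X) \<kappa> \<noteq> 0} = link \<omega> ` {s\<in>facets (cells X). \<omega> \<in> s}"
    by blast
  then show ?thesis unfolding support_def facets_link_at[OF assms(1)] by simp
qed

text \<open>One direction evaluates the covering at a vector outside all proper sums
  \<open>dirs s + dirs t\<close>, so the pair of links reaching it is transversal. The other applies
  \<open>transversal_cover\<close> to \<open>(v, 0)\<close>. From here on the support is handled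
  through transversal pairs only.\<close>

theorem stable_support_iff:
  fixes X Y :: "(real ^ 'n) weighted_complex"
  assumes X: "tropical_cycle p X" "positive X" and Y: "tropical_cycle q Y" "positive Y"
  shows "\<omega> \<in> stable_support X Y \<longleftrightarrow>
    (\<exists>s\<in>facets (cells X). \<exists>t\<in>facets (cells Y). \<omega> \<in> s \<and> \<omega> \<in> t \<and> transversal s t)"
proof -
  note CX = tropical_cycleD(2)[OF X(1)] and CY = tropical_cycleD(2)[OF Y(1)]
  let ?D = "pointwise_diff (support (link_at \<omega> X)) (support (link_at \<omega> Y))"
  have D: "v \<in> ?D \<longleftrightarrow> (\<exists>s\<in>facets (cells X). \<exists>t\<in>facets (cells Y). \<omega> \<in> s \<and> \<omega> \<in> t \<and> (\<exists>l\<in>link \<omega> s. \<exists>j\<in>link \<omega> t. v = l - j))" for v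
    unfolding pointwise_diff_def support_link_at[OF CX X(2)] support_link_at[OF CY Y(2)] by blast
  show ?thesis
  proof
    assume "\<omega> \<in> stable_support X Y"
    then have all: "\<And>v. v \<in> ?D" by (simp add: stable_support_def)
    let ?A = "(\<lambda>(s,t). dirs s + dirs t) ` {(s,t) \<in> facets (cells X) \<times> facets (cells Y). \<not> transversal s t}"
    have "\<exists>y\<in>UNIV. \<forall>A\<in>?A. y \<notin> A"
    proof (rule convex_avoid_affine)
      have "finite (facets (cells X) \<times> facets (cells Y))"
        using convex_complexD(1)[OF CX] convex_complexD(1)[OF CY] facets_subset finite_subset by (metis finite_cartesian_product)
      then show "finite ?A" by (rule finite_imageI[OF finite_subset[rotated]]) auto
      show "affine A \<and> \<not> UNIV \<subseteq> A" if "A \<in> ?A" for A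
        using that by (auto intro!: subspace_imp_affine subspace_set_plus)
    qed auto
    then obtain v where v: "\<forall>A\<in>?A. v \<notin> A" by blast
    obtain s t l j where st: "s \<in> facets (cells X)" "t \<in> facets (cells Y)" "\<omega> \<in> s" "\<omega> \<in> t" "l \<in> link \<omega> s" "j \<in> link \<omega> t" "v = l - j"
      using all[of v] unfolding D by blast
    have l: "l \<in> dirs s"
      using diff_in_dirs[OF st(5) zero_in_link[OF st(3)]] dirs_link[OF facet_convex[OF X(1) st(1)] st(3)] by simp
    have j: "j \<in> dirs t"
      using diff_in_dirs[OF st(6) zero_in_link[OF st(4)]] dirs_link[OF facet_convex[OF Y(1) st(2)] st(4)] by simp
    have "v \<in> dirs s + dirs t" unfolding set_plus_iff using l subspace_neg[OF subspace_dirs j] st(7)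
      by (intro bexI[of _ l]) auto
    then have "transversal s t" using v st(1,2) by blast
    then show "\<exists>s\<in>facets (cells X). \<exists>t\<in>facets (cells Y). \<omega> \<in> s \<and> \<omega> \<in> t \<and> transversal s t" using st(1-4) by blast
  next
    assume "\<exists>s\<in>facets (cells X). \<exists>t\<in>facets (cells Y). \<omega> \<in> s \<and> \<omega> \<in> t \<and> transversal s t"
    then obtain s0 t0 where 0: "s0 \<in> facets (cells X)" "t0 \<in> facets (cells Y)" "\<omega> \<in> s0" "\<omega> \<in> t0" "transversal s0 t0" by blast
    obtain M where cov: "\<And>z1 z2. \<exists>s\<in>facets (cells X). \<exists>t\<in>facets (cells Y). \<omega> \<in> s \<and> \<omega> \<in> t \<and> transversal s t \<and>
        (\<exists>y\<in>M. z1 - y \<in> link \<omega> s \<and> z2 - y \<in> link \<omega> t)"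
      using transversal_cover[OF X Y 0] by metis
    then have "v \<in> ?D" for v
    proof -
      obtain s t y where st: "s \<in> facets (cells X)" "t \<in> facets (cells Y)" "\<omega> \<in> s" "\<omega> \<in> t" "v - y \<in> link \<omega> s" "0 - y \<in> link \<omega> t"
        using cov[of v 0] by blast
      have "v = (v - y) - (0 - y)" by simp
      then show ?thesis unfolding D using st by blast
    qed
    then show "\<omega> \<in> stable_support X Y" unfolding stable_support_def by blast
  qed
qed

section \<open>Cells of the stable intersection\<close>

text \<open>For a relatively interior point \<open>x\<close> of the face, the carriers of
  \<open>x\<close> in the two complexes intersect in a face of \<open>s \<inter> t\<close> with
  \<open>x\<close> in its relative interior, which must be the given one.\<close>

lemma face_of_Int_cells:
  assumes X: "convex_complex C" and Y: "convex_complex D" and st: "s \<in> C" "t \<in> D"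
    and \<phi>: "\<phi> face_of s \<inter> t" "\<phi> \<noteq> {}"
  obtains s' t' where "s' \<in> C" "t' \<in> D" "\<phi> = s' \<inter> t'"
proof -
  obtain x where x: "x \<in> rel_interior \<phi>"
    using face_of_imp_convex[OF \<phi>(1)] \<phi>(2) rel_interior_eq_empty by blast
  have "x \<in> s \<inter> t" using x rel_interior_subset face_of_imp_subset[OF \<phi>(1)] by blast
  then have xs: "x \<in> s" and xt: "x \<in> t" by auto
  obtain s' where l: "s' \<in> C" "s' face_of s" "x \<in> rel_interior s'" using carrier_exists[OF X st(1) xs] by metis
  obtain t' where j: "t' \<in> D" "t' face_of t" "x \<in> rel_interior t'" using carrier_exists[OF Y st(2) xt] by metis
  have "rel_interior (s' \<inter> t') = rel_interior s' \<inter> rel_interior t'"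
    by (rule convex_rel_interior_inter_two[OF convex_complexD(3)[OF X l(1)] convex_complexD(3)[OF Y j(1)]])
      (use l(3) j(3) in blast)
  then have "x \<in> rel_interior (s' \<inter> t')" using l(3) j(3) by simp
  then have "\<phi> = s' \<inter> t'"
    using face_of_eq[OF \<phi>(1) face_of_Int_Int[OF l(2) j(2)]] x by blast
  then show ?thesis using that l(1) j(1) by blast
qed

lemma rational_polyhedron_Int:
  assumes "rational_polyhedron s" "rational_polyhedron t"
  shows "rational_polyhedron (s \<inter> t)"
proof -
  obtain H where H: "finite H" "\<forall>(u, c)\<in>H. u \<in> int_lattice" "s = (\<Inter>(u, c)\<in>H. {x. u \<bullet> x \<le> c})"
    using assms(1) unfolding rational_polyhedron_def by blast
  obtain G where G: "finite G" "\<forall>(u, c)\<in>G. u \<in> int_lattice" "t = (\<Inter>(u, c)\<in>G. {x. u \<bullet> x \<le> c})"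
    using assms(2) unfolding rational_polyhedron_def by blast
  have "s \<inter> t = (\<Inter>(u, c)\<in>H \<union> G. {x. u \<bullet> x \<le> c})" unfolding H(3) G(3) by auto
  moreover have "\<forall>(u, c)\<in>H \<union> G. u \<in> int_lattice" using H(2) G(2) by auto
  ultimately show ?thesis unfolding rational_polyhedron_def using H(1) G(1) by blast
qed

lemma cells_stable_intersection:
  "\<gamma> \<in> cells (stable_intersection X Y) \<longleftrightarrow>
     (\<exists>s\<in>cells X. \<exists>t\<in>cells Y. \<gamma> = s \<inter> t) \<and> \<gamma> \<noteq> {} \<and> \<gamma> \<subseteq> stable_support X Y"
  by (simp add: stable_intersection_def)

lemma polyhedral_stable_intersection:
  assumes X: "polyhedral_complex (cells X)" and Y: "polyhedral_complex (cells Y)"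
  shows "polyhedral_complex (cells (stable_intersection X Y))"
proof -
  note convex_cells_X = polyhedral_complex_convex[OF X] and convex_cells_Y = polyhedral_complex_convex[OF Y]
  have rat: "\<And>s. s \<in> cells X \<Longrightarrow> rational_polyhedron s" "\<And>s. s \<in> cells Y \<Longrightarrow> rational_polyhedron s"
    using X[unfolded polyhedral_complex_def, THEN conjunct2, THEN conjunct1]
      Y[unfolded polyhedral_complex_def, THEN conjunct2, THEN conjunct1] by blast+
  let ?S = "cells (stable_intersection X Y)"
  show ?thesis unfolding polyhedral_complex_def
  proof (intro conjI ballI allI impI)
    have "?S \<subseteq> (\<lambda>(s,t). s \<inter> t) ` (cells X \<times> cells Y)" by (auto simp: cells_stable_intersection)
    then show "finite ?S" by (rule finite_subset) (simp add: convex_complexD(1)[OF convex_cells_X] convex_complexD(1)[OF convex_cells_Y])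
  next
    fix \<gamma> assume "\<gamma> \<in> ?S"
    then obtain s t where "s \<in> cells X" "t \<in> cells Y" "\<gamma> = s \<inter> t" "\<gamma> \<noteq> {}" unfolding cells_stable_intersection by blast
    then show "rational_polyhedron \<gamma>" "\<gamma> \<noteq> {}" using rational_polyhedron_Int rat by blast+
  next
    fix \<gamma> \<phi> assume "\<gamma> \<in> ?S" and \<phi>: "\<phi> face_of \<gamma> \<and> \<phi> \<noteq> {}"
    then obtain s t where st: "s \<in> cells X" "t \<in> cells Y" "\<gamma> = s \<inter> t" "\<gamma> \<subseteq> stable_support X Y"
      unfolding cells_stable_intersection by blast
    obtain s' t' where "s' \<in> cells X" "t' \<in> cells Y" "\<phi> = s' \<inter> t'"
      using face_of_Int_cells[OF convex_cells_X convex_cells_Y st(1,2)] \<phi> st(3) by metis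
    moreover have "\<phi> \<subseteq> stable_support X Y" using face_of_imp_subset \<phi> st(4) by blast
    ultimately show "\<phi> \<in> ?S" unfolding cells_stable_intersection using \<phi> by blast
  next
    fix \<gamma> \<delta> assume "\<gamma> \<in> ?S" "\<delta> \<in> ?S"
    then obtain s t s' t' where st: "s \<in> cells X" "t \<in> cells Y" "\<gamma> = s \<inter> t" and st': "s' \<in> cells X" "t' \<in> cells Y" "\<delta> = s' \<inter> t'"
      unfolding cells_stable_intersection by blast
    have e1: "\<gamma> \<inter> \<delta> = (s \<inter> s') \<inter> (t \<inter> t')" and e2: "\<gamma> \<inter> \<delta> = (s' \<inter> s) \<inter> (t' \<inter> t)" using st(3) st'(3) by auto
    show "\<gamma> \<inter> \<delta> face_of \<delta>" unfolding e1 unfolding st'(3)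
      by (rule face_of_Int_Int[OF convex_complexD(6)[OF convex_cells_X st(1) st'(1)] convex_complexD(6)[OF convex_cells_Y st(2) st'(2)]])
    show "\<gamma> \<inter> \<delta> face_of \<gamma>" unfolding e2 unfolding st(3)
      by (rule face_of_Int_Int[OF convex_complexD(6)[OF convex_cells_X st'(1) st(1)] convex_complexD(6)[OF convex_cells_Y st'(2) st(2)]])
  qed
qed

context
  fixes X Y :: "(real ^ 'n) weighted_complex" and p q :: nat
  assumes X: "tropical_cycle p X" "positive X" and Y: "tropical_cycle q Y" "positive Y"
begin

lemma convex_cells_X: "convex_complex (cells X)" and convex_cells_Y: "convex_complex (cells Y)"
  by (rule tropical_cycleD(2)[OF X(1)] tropical_cycleD(2)[OF Y(1)])+

lemma facet_cell_X: "s \<in> facets (cells X) \<Longrightarrow> s \<in> cells X" and facet_cell_Y: "t \<in> facets (cells Y) \<Longrightarrow> t \<in> cells Y"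
  using facets_subset by blast+

abbreviation "SI \<equiv> cells (stable_intersection X Y)"

lemma convex_complex_SI: "convex_complex SI"
  by (rule polyhedral_complex_convex[OF polyhedral_stable_intersection[OF tropical_cycleD(1)[OF X(1)] tropical_cycleD(1)[OF Y(1)]]])

lemma facet_in_SI: "\<gamma> \<in> facets SI \<Longrightarrow> \<gamma> \<in> SI"
  using facets_subset by blast

text \<open>The intersection of such a cell with \<open>\<gamma>\<close> is a face of
  \<open>\<gamma>\<close> through a relatively interior point. Hence the cells through
  \<open>\<omega>\<close> are the same for all relatively interior points of
  \<open>\<gamma>\<close>.\<close>

lemma SI_carrier:
  assumes "\<gamma> \<in> SI" "\<omega> \<in> rel_interior \<gamma>"
  shows "s \<in> cells X \<Longrightarrow> \<omega> \<in> s \<Longrightarrow> \<gamma> \<subseteq> s" "t \<in> cells Y \<Longrightarrow> \<omega> \<in> t \<Longrightarrow> \<gamma> \<subseteq> t"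
proof -
  obtain s0 t0 where st: "s0 \<in> cells X" "t0 \<in> cells Y" "\<gamma> = s0 \<inter> t0" using assms(1) unfolding cells_stable_intersection by blast
  have w: "\<omega> \<in> \<gamma>" using assms(2) rel_interior_subset by blast
  show "\<gamma> \<subseteq> s" if "s \<in> cells X" "\<omega> \<in> s"
  proof -
    have "(s \<inter> s0) \<inter> t0 face_of \<gamma>" unfolding st(3)
      by (rule face_of_Int_Int[OF convex_complexD(6)[OF convex_cells_X that(1) st(1)] face_of_refl[OF convex_complexD(3)[OF convex_cells_Y st(2)]]])
    then have "\<gamma> \<subseteq> (s \<inter> s0) \<inter> t0"
      by (rule subset_of_face_of[OF _ order_refl]) (use assms(2) w that(2) st(3) in blast)
    then show ?thesis by blast
  qed
  show "\<gamma> \<subseteq> t" if "t \<in> cells Y" "\<omega> \<in> t"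
  proof -
    have "s0 \<inter> (t \<inter> t0) face_of \<gamma>" unfolding st(3)
      by (rule face_of_Int_Int[OF face_of_refl[OF convex_complexD(3)[OF convex_cells_X st(1)]] convex_complexD(6)[OF convex_cells_Y that(1) st(2)]])
    then have "\<gamma> \<subseteq> s0 \<inter> (t \<inter> t0)"
      by (rule subset_of_face_of[OF _ order_refl]) (use assms(2) w that(2) st(3) in blast)
    then show ?thesis by blast
  qed
qed

lemma transversal_in_SI:
  assumes "s \<in> facets (cells X)" "t \<in> facets (cells Y)" "transversal s t" "s \<inter> t \<noteq> {}"
  shows "s \<inter> t \<in> SI"
  unfolding cells_stable_intersection
proof (intro conjI)
  show "\<exists>s'\<in>cells X. \<exists>t'\<in>cells Y. s \<inter> t = s' \<inter> t'" using facet_cell_X[OF assms(1)] facet_cell_Y[OF assms(2)] by blast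
  show "s \<inter> t \<subseteq> stable_support X Y" using stable_support_iff[OF X Y] assms by blast
qed (fact assms(4))

lemma SI_transversal:
  assumes "\<gamma> \<in> SI"
  obtains s t where "s \<in> facets (cells X)" "t \<in> facets (cells Y)" "transversal s t" "\<gamma> \<subseteq> s \<inter> t"
proof -
  obtain \<omega> where \<omega>: "\<omega> \<in> rel_interior \<gamma>"
    using convex_complexD(3,4)[OF convex_complex_SI assms] rel_interior_eq_empty by blast
  have "\<omega> \<in> stable_support X Y" using \<omega> rel_interior_subset assms unfolding cells_stable_intersection by blast
  then obtain s t where st: "s \<in> facets (cells X)" "t \<in> facets (cells Y)" "\<omega> \<in> s" "\<omega> \<in> t" "transversal s t"
    unfolding stable_support_iff[OF X Y] by blast
  then show ?thesis using that[OF st(1,2,5)] SI_carrier(1)[OF assms \<omega> facet_cell_X[OF st(1)] st(3)] SI_carrier(2)[OF assms \<omega> facet_cell_Y[OF st(2)] st(4)] by blast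
qed

lemma SI_dim_le:
  assumes "\<gamma> \<in> SI"
  shows "int (dim (dirs \<gamma>)) \<le> int CARD('n) - int (p + q)"
proof -
  obtain s t where st: "s \<in> facets (cells X)" "t \<in> facets (cells Y)" "transversal s t" "\<gamma> \<subseteq> s \<inter> t"
    by (rule SI_transversal[OF assms])
  have "dirs \<gamma> \<subseteq> dirs s \<inter> dirs t" using st(4) dirs_mono[of \<gamma>] by blast
  then have "dim (dirs \<gamma>) \<le> dim (dirs s \<inter> dirs t)" by (rule dim_subset)
  then show ?thesis using transversal_dim[OF X(1) Y(1) st(1,2,3)] by linarith
qed

text \<open>If a maximal cell \<open>\<gamma>\<close> were too small,
  \<open>dirs \<gamma> + M\<close> would miss some \<open>z\<close>. The covering gives a
  transversal pair whose links share a direction congruent to \<open>z\<close> modulo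
  \<open>M\<close>. By maximality the pair meets exactly in \<open>\<gamma>\<close>, so this
  direction lies in \<open>dirs \<gamma>\<close>, a contradiction.\<close>

lemma SI_facet_dim:
  assumes \<gamma>: "\<gamma> \<in> facets SI"
  shows "int (dim (dirs \<gamma>)) = int CARD('n) - int (p + q)"
proof (rule ccontr)
  assume "\<not> ?thesis"
  then have less: "int (dim (dirs \<gamma>)) < int CARD('n) - int (p + q)" using SI_dim_le[OF facet_in_SI[OF \<gamma>]] by linarith
  have c\<gamma>: "convex \<gamma>" "\<gamma> \<noteq> {}" using convex_complexD(3,4)[OF convex_complex_SI facet_in_SI[OF \<gamma>]] by auto
  obtain \<omega> where \<omega>: "\<omega> \<in> rel_interior \<gamma>" using c\<gamma> rel_interior_eq_empty by blast
  have w\<gamma>: "\<omega> \<in> \<gamma>" using \<omega> rel_interior_subset by blast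
  obtain s0 t0 where 0: "s0 \<in> facets (cells X)" "t0 \<in> facets (cells Y)" "transversal s0 t0" "\<gamma> \<subseteq> s0 \<inter> t0"
    by (rule SI_transversal[OF facet_in_SI[OF \<gamma>]])
  have w0: "\<omega> \<in> s0" "\<omega> \<in> t0" using 0(4) w\<gamma> by auto
  obtain M where M: "subspace M" "int (dim M) = int (p + q)" and
    cov: "\<And>z1 z2. \<exists>s\<in>facets (cells X). \<exists>t\<in>facets (cells Y). \<omega> \<in> s \<and> \<omega> \<in> t \<and> transversal s t \<and>
        (\<exists>y\<in>M. z1 - y \<in> link \<omega> s \<and> z2 - y \<in> link \<omega> t)"
    using transversal_cover[OF X Y 0(1,2) w0 0(3)] by metis
  have "dim (dirs \<gamma> + M) + dim (dirs \<gamma> \<inter> M) = dim (dirs \<gamma>) + dim M"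
    by (rule dim_set_plus) (auto simp: M)
  then have "dim (dirs \<gamma> + M) < CARD('n)" using less M(2) by linarith
  then have "dirs \<gamma> + M \<noteq> UNIV" by (auto dest: arg_cong[where f = dim])
  then obtain z where z: "z \<notin> dirs \<gamma> + M" by blast
  \<comment> \<open>The point with both coordinates \<open>z\<close> is used, so that the same
    vector \<open>z - y\<close> lies in both links.\<close>
  obtain s t y where st: "s \<in> facets (cells X)" "t \<in> facets (cells Y)" "\<omega> \<in> s" "\<omega> \<in> t" "transversal s t"
    "y \<in> M" "z - y \<in> link \<omega> s" "z - y \<in> link \<omega> t"
    using cov[of z z] by blast
  have sub: "\<gamma> \<subseteq> s \<inter> t"
    using SI_carrier(1)[OF facet_in_SI[OF \<gamma>] \<omega> facet_cell_X[OF st(1)] st(3)] SI_carrier(2)[OF facet_in_SI[OF \<gamma>] \<omega> facet_cell_Y[OF st(2)] st(4)] by blast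
  have "s \<inter> t \<in> SI" by (rule transversal_in_SI[OF st(1,2,5)]) (use st(3,4) in blast)
  then have eq: "s \<inter> t = \<gamma>" using \<gamma> sub unfolding facets_def by blast
  have "z - y \<in> link \<omega> \<gamma>" using st(7,8) unfolding eq[symmetric] link_Int by blast
  then have "z - y \<in> dirs \<gamma>"
    using diff_in_dirs[OF _ zero_in_link[OF w\<gamma>], of "z - y"] dirs_link[OF c\<gamma>(1) w\<gamma>] by simp
  then have "(z - y) + y \<in> dirs \<gamma> + M" by (rule set_plus_intro[OF _ st(6)])
  then show False using z by simp
qed

lemma SI_facetI:
  assumes "\<gamma> \<in> SI" "int (dim (dirs \<gamma>)) = int CARD('n) - int (p + q)"
  shows "\<gamma> \<in> facets SI"
proof -
  obtain \<delta> where \<delta>: "\<delta> \<in> facets SI" "\<gamma> \<subseteq> \<delta>" using facet_exists[OF convex_complexD(1)[OF convex_complex_SI] assms(1)] by metis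
  have "\<gamma> face_of \<delta>" by (rule complex_face_subset[OF convex_complex_SI facet_in_SI[OF \<delta>(1)] assms(1) \<delta>(2)])
  then have "\<gamma> = \<delta>"
    using face_dim_less[OF convex_complexD(3)[OF convex_complex_SI facet_in_SI[OF \<delta>(1)]], of \<gamma>] SI_facet_dim[OF \<delta>(1)] assms(2)
      convex_complexD(4)[OF convex_complex_SI assms(1)] by (metis less_irrefl of_nat_eq_iff)
  then show ?thesis using \<delta>(1) by simp
qed

lemma SI_facet_pair:
  assumes \<gamma>: "\<gamma> \<in> facets SI" and st: "s \<in> facets (cells X)" "t \<in> facets (cells Y)" "transversal s t" "\<gamma> \<subseteq> s \<inter> t"
  shows "s \<inter> t = \<gamma>" "dirs s \<inter> dirs t = dirs \<gamma>"
proof -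
  have "s \<inter> t \<in> SI" by (rule transversal_in_SI[OF st(1,2,3)]) (use st(4) convex_complexD(4)[OF convex_complex_SI facet_in_SI[OF \<gamma>]] in blast)
  then show "s \<inter> t = \<gamma>" using \<gamma> st(4) unfolding facets_def by blast
  have "dirs \<gamma> \<subseteq> dirs s \<inter> dirs t" using st(4) dirs_mono[of \<gamma>] by blast
  then show "dirs s \<inter> dirs t = dirs \<gamma>"
    using subspace_dim_equal[of "dirs \<gamma>" "dirs s \<inter> dirs t"] transversal_dim[OF X(1) Y(1) st(1,2,3)] SI_facet_dim[OF \<gamma>]
    by (simp add: subspace_inter)
qed

lemma Union_SI: "\<Union>SI = stable_support X Y"
proof (intro subset_antisym subsetI)
  fix \<omega> assume "\<omega> \<in> \<Union>SI"
  then obtain \<gamma> where "\<gamma> \<in> SI" "\<omega> \<in> \<gamma>" by blast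
  then show "\<omega> \<in> stable_support X Y" using cells_stable_intersection[of \<gamma> X Y] by blast
next
  fix \<omega> assume "\<omega> \<in> stable_support X Y"
  then obtain s t where st: "s \<in> facets (cells X)" "t \<in> facets (cells Y)" "\<omega> \<in> s" "\<omega> \<in> t" "transversal s t"
    unfolding stable_support_iff[OF X Y] by blast
  have "s \<inter> t \<in> SI" by (rule transversal_in_SI[OF st(1,2,5)]) (use st(3,4) in blast)
  then show "\<omega> \<in> \<Union>SI" using st(3,4) by blast
qed

lemma pure_SI: "pure_codim (p + q) SI"
  unfolding pure_codim_def
proof
  fix \<gamma> assume \<gamma>: "\<gamma> \<in> facets SI"
  show "aff_dim \<gamma> = int CARD('n) - int (p + q)"
    using SI_facet_dim[OF \<gamma>] dim_dirs[OF convex_complexD(4)[OF convex_complex_SI facet_in_SI[OF \<gamma>]]] by simp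
qed

end

section \<open>Multiplicities of the stable intersection\<close>

lemma lattice_index_eq: "lattice_index s t = idx zlat (plat s (dirs t))"
proof -
  have "{x + a + b | a b. a \<in> dirs s \<inter> zlat \<and> b \<in> dirs t \<inter> zlat} = {x + c | c. c \<in> plat s (dirs t)}" for x
  proof (intro subset_antisym subsetI)
    fix y assume "y \<in> {x + a + b | a b. a \<in> dirs s \<inter> zlat \<and> b \<in> dirs t \<inter> zlat}"
    then obtain a b where "y = x + (a + b)" "a \<in> dirs s \<inter> zlat" "b \<in> dirs t \<inter> zlat" by (auto simp: add.assoc)
    then show "y \<in> {x + c | c. c \<in> plat s (dirs t)}" unfolding plat_def by blast
  next
    fix y assume "y \<in> {x + c | c. c \<in> plat s (dirs t)}"
    then obtain a b where "y = x + a + b" "a \<in> dirs s \<inter> zlat" "b \<in> dirs t \<inter> zlat"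
      unfolding plat_def by (auto simp: add.assoc)
    then show "y \<in> {x + a + b | a b. a \<in> dirs s \<inter> zlat \<and> b \<in> dirs t \<inter> zlat}" by blast
  qed
  then show ?thesis unfolding lattice_index_def idx_def lattice_of_eq int_lattice_eq by simp
qed

lemma idx_diag:
  fixes D B :: "'a::euclidean_space set"
  assumes D: "add_subgroup D" and B: "add_subgroup B" "B \<subseteq> D"
  shows "idx (diag D) (diag B) = idx D B"
proof -
  have dg: "add_subgroup (diag A)" if A: "add_subgroup A" for A :: "'a set"
    unfolding add_subgroup_def
  proof (intro conjI ballI)
    show "0 \<in> diag A" using add_subgroup_0[OF A] by (simp add: zero_prod_def)
    fix x y assume "x \<in> diag A" "y \<in> diag A"
    then show "x - y \<in> diag A" unfolding diag_def using add_subgroup_diff[OF A] by auto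
  qed
  have "idx (diag D) (diag B) = idx (fst ` diag D) (fst ` diag B) * idx {x\<in>diag D. fst x = 0} {x\<in>diag B. fst x = 0}"
    by (rule idx_hom[OF dg[OF D] dg[OF B(1)]]) (use B(2) in \<open>auto simp: diag_def\<close>)
  moreover have "fst ` diag A = A" for A :: "'a set" by (auto simp: diag_def image_iff)
  moreover have "{x\<in>diag A. fst x = 0} = {0}" if A: "add_subgroup A" for A :: "'a set"
    using add_subgroup_0[OF A] by (auto simp: diag_def zero_prod_def)
  moreover have "idx {0} {0::'a \<times> 'a} = 1" by (rule idx_refl) (simp add: add_subgroup_def)
  ultimately show ?thesis using D B by simp
qed

text \<open>The difference of coordinates maps the product lattice onto \<open>zlat\<close> with
  kernel the diagonal lattice. Multiplicativity of the index splits off the index for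
  \<open>A\<close> and \<open>B\<close>; what remains in the diagonal is the index for
  \<open>A \<inter> B\<close> and \<open>S\<close>.\<close>

lemma idx_prod_diag:
  fixes A B S :: "'a::euclidean_space set"
  assumes A: "subspace A" and B: "subspace B" and S: "subspace S"
  shows "idx zlat {a + b | a b. a \<in> (A \<times> B) \<inter> zlat \<and> b \<in> diag S \<inter> zlat} =
    idx zlat {a + b | a b. a \<in> A \<inter> zlat \<and> b \<in> B \<inter> zlat} * idx zlat {a + b | a b. a \<in> (A \<inter> B) \<inter> zlat \<and> b \<in> S \<inter> zlat}"
proof -
  let ?P = "{a + b | a b. a \<in> (A \<times> B) \<inter> zlat \<and> b \<in> diag S \<inter> zlat}"
  let ?Q = "{a + b | a b. a \<in> A \<inter> zlat \<and> b \<in> B \<inter> zlat}"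
  let ?R = "{a + b | a b. a \<in> (A \<inter> B) \<inter> zlat \<and> b \<in> S \<inter> zlat}"
  let ?\<phi> = "\<lambda>x::'a \<times> 'a. fst x - snd x"
  have gz: "add_subgroup (T \<inter> zlat)" if "subspace T" for T :: "'b::euclidean_space set"
    by (intro add_subgroup_Int subspace_imp_add_subgroup that add_subgroup_zlat)
  have P: "add_subgroup ?P" by (rule add_subgroup_plus[OF gz[OF subspace_Times[OF A B]] gz[OF subspace_diag[OF S]]])
  have Pz: "?P \<subseteq> zlat" using add_subgroup_add[OF add_subgroup_zlat] by blast
  have R: "add_subgroup ?R" by (rule add_subgroup_plus[OF gz[OF subspace_inter[OF A B]] gz[OF S]])
  have Rz: "?R \<subseteq> zlat" using add_subgroup_add[OF add_subgroup_zlat] by blast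
  have 0: "(0::'a) \<in> zlat" by (rule add_subgroup_0[OF add_subgroup_zlat])
  have "idx zlat ?P = idx (?\<phi> ` zlat) (?\<phi> ` ?P) * idx {x\<in>zlat. ?\<phi> x = 0} {x\<in>?P. ?\<phi> x = 0}"
    by (rule idx_hom[OF add_subgroup_zlat P Pz]) simp
  moreover have "?\<phi> ` zlat = zlat"
  proof (intro subset_antisym subsetI)
    fix x assume "x \<in> ?\<phi> ` zlat"
    then show "x \<in> zlat" using add_subgroup_diff[OF add_subgroup_zlat] by (auto simp: zlat_Times)
  next
    fix x :: 'a assume "x \<in> zlat"
    then show "x \<in> ?\<phi> ` zlat" using 0 by (intro image_eqI[of _ _ "(x, 0)"]) (auto simp: zlat_Times)
  qed
  moreover have "?\<phi> ` ?P = ?Q"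
  proof (intro subset_antisym subsetI)
    fix x assume "x \<in> ?\<phi> ` ?P"
    then obtain c d where cd: "x = ?\<phi> (c + d)" "c \<in> (A \<times> B) \<inter> zlat" "d \<in> diag S \<inter> zlat" by blast
    have "x = fst c + (- snd c)" using cd(1,3) by (auto simp: diag_def)
    moreover have "fst c \<in> A \<inter> zlat" "- snd c \<in> B \<inter> zlat"
      using cd(2) subspace_neg[OF B] add_subgroup_minus[OF add_subgroup_zlat] by (auto simp: zlat_Times)
    ultimately show "x \<in> ?Q" by blast
  next
    fix x assume "x \<in> ?Q"
    then obtain a b where ab: "x = a + b" "a \<in> A \<inter> zlat" "b \<in> B \<inter> zlat" by blast
    have "(a, - b) \<in> (A \<times> B) \<inter> zlat" using ab(2,3) subspace_neg[OF B] add_subgroup_minus[OF add_subgroup_zlat] by (auto simp: zlat_Times)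
    moreover have "(0, 0) \<in> diag S \<inter> zlat" using subspace_0[OF S] 0 by (simp add: zlat_Times)
    ultimately have "(a, - b) + (0, 0) \<in> ?P" by blast
    then show "x \<in> ?\<phi> ` ?P" using ab(1) by (intro image_eqI[of _ _ "(a, - b) + (0, 0)"]) simp_all
  qed
  moreover have "{x\<in>zlat. ?\<phi> x = 0} = diag zlat" by (auto simp: zlat_Times diag_def)
  moreover have "{x\<in>?P. ?\<phi> x = 0} = diag ?R"
  proof (intro subset_antisym subsetI)
    fix x assume "x \<in> {x\<in>?P. ?\<phi> x = 0}"
    then obtain c d where cd: "x = c + d" "c \<in> (A \<times> B) \<inter> zlat" "d \<in> diag S \<inter> zlat" "?\<phi> x = 0" by blast
    obtain s where s: "d = (s, s)" "s \<in> S" "s \<in> zlat" using cd(3) by (auto simp: diag_def zlat_Times)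
    have e: "fst c = snd c" using cd(1,4) s(1) by simp
    then have "fst c \<in> (A \<inter> B) \<inter> zlat" using cd(2) by (auto simp: zlat_Times)
    then have "fst c + s \<in> ?R" using s(2,3) by blast
    moreover have "x = (fst c + s, fst c + s)" using cd(1) s(1) e by (simp add: prod_eq_iff)
    ultimately show "x \<in> diag ?R" unfolding diag_def by blast
  next
    fix x assume "x \<in> diag ?R"
    then obtain a s where as: "x = (a + s, a + s)" "a \<in> (A \<inter> B) \<inter> zlat" "s \<in> S \<inter> zlat" unfolding diag_def by blast
    have "(a, a) \<in> (A \<times> B) \<inter> zlat" "(s, s) \<in> diag S \<inter> zlat" using as by (auto simp: zlat_Times)
    then have "(a, a) + (s, s) \<in> ?P" by blast
    then show "x \<in> {x\<in>?P. ?\<phi> x = 0}" using as(1) by simp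
  qed
  ultimately show ?thesis using idx_diag[OF add_subgroup_zlat R Rz] by (simp only:)
qed

lemma idx_zlat_UNIV: "subspace A \<Longrightarrow> idx zlat {a + b | a b. a \<in> A \<inter> zlat \<and> b \<in> (UNIV::'a::euclidean_space set) \<inter> zlat} = 1"
proof -
  assume A: "subspace A"
  have "{a + b | a b. a \<in> A \<inter> zlat \<and> b \<in> (UNIV::'a set) \<inter> zlat} = zlat"
  proof (intro subset_antisym subsetI)
    fix x :: 'a assume "x \<in> zlat"
    moreover have "0 \<in> A \<inter> zlat" using subspace_0[OF A] add_subgroup_0[OF add_subgroup_zlat] by blast
    ultimately have "0 + x \<in> {a + b | a b. a \<in> A \<inter> zlat \<and> b \<in> (UNIV::'a set) \<inter> zlat}" by blast
    then show "x \<in> {a + b | a b. a \<in> A \<inter> zlat \<and> b \<in> (UNIV::'a set) \<inter> zlat}" by simp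
  qed (use add_subgroup_add[OF add_subgroup_zlat] in blast)
  then show ?thesis using idx_refl[OF add_subgroup_zlat] by simp
qed

definition facet_pairs :: "real ^ 'n \<Rightarrow> (real ^ 'n) weighted_complex \<Rightarrow> (real ^ 'n) weighted_complex \<Rightarrow> ((real ^ 'n) set \<times> (real ^ 'n) set) set" where
  "facet_pairs \<omega> X Y = {(s, t). s \<in> facets (cells X) \<and> t \<in> facets (cells Y) \<and> \<omega> \<in> s \<and> \<omega> \<in> t}"

lemma finite_facet_pairs:
  assumes "convex_complex (cells X)" "convex_complex (cells Y)"
  shows "finite (facet_pairs \<omega> X Y)"
proof -
  have "finite (facets (cells X) \<times> facets (cells Y))"
    using convex_complexD(1)[OF assms(1)] convex_complexD(1)[OF assms(2)] facets_subset finite_subset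
    by (metis finite_cartesian_product)
  then show ?thesis by (rule rev_finite_subset) (auto simp: facet_pairs_def)
qed

lemma inj_facet_pairs_link:
  assumes X: "convex_complex (cells X)" and Y: "convex_complex (cells Y)"
  shows "inj_on (\<lambda>(s, t). (link \<omega> s, link \<omega> t)) (facet_pairs \<omega> X Y)"
proof (rule inj_onI)
  fix a b assume ab: "a \<in> facet_pairs \<omega> X Y" "b \<in> facet_pairs \<omega> X Y"
    and eq: "(\<lambda>(s, t). (link \<omega> s, link \<omega> t)) a = (\<lambda>(s, t). (link \<omega> s, link \<omega> t)) b"
  obtain s t s' t' where e: "a = (s, t)" "b = (s', t')" by (cases a, cases b)
  have l: "link \<omega> s = link \<omega> s'" "link \<omega> t = link \<omega> t'" using eq unfolding e by simp_all
  have "s \<in> {s\<in>cells X. \<omega> \<in> s}" "s' \<in> {s\<in>cells X. \<omega> \<in> s}" "t \<in> {s\<in>cells Y. \<omega> \<in> s}" "t' \<in> {s\<in>cells Y. \<omega> \<in> s}"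
    using ab facets_subset unfolding e facet_pairs_def by blast+
  then have "s = s'" "t = t'" using inj_onD[OF inj_on_link[OF X] l(1)] inj_onD[OF inj_on_link[OF Y] l(2)] by blast+
  then show "a = b" using e by simp
qed

lemma displacement_mult_link_at:
  assumes X: "tropical_cycle p X" and Y: "tropical_cycle q Y"
  shows "displacement_mult (link_at \<omega> X) (link_at \<omega> Y) v =
    (\<Sum>(s, t) | (s, t) \<in> facet_pairs \<omega> X Y \<and> v \<in> pointwise_diff (link \<omega> s) (link \<omega> t).
       facet_mult X s * facet_mult Y t * of_nat (lattice_index s t))"
proof -
  note convex_cells_X = tropical_cycleD(2)[OF X] and convex_cells_Y = tropical_cycleD(2)[OF Y]
  let ?S = "{(s, t). (s, t) \<in> facet_pairs \<omega> X Y \<and> v \<in> pointwise_diff (link \<omega> s) (link \<omega> t)}"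
  let ?l = "\<lambda>(s, t). (link \<omega> s, link \<omega> t)"
  have S: "{(\<kappa>, \<mu>). \<kappa> \<in> facets (cells (link_at \<omega> X)) \<and> \<mu> \<in> facets (cells (link_at \<omega> Y)) \<and> v \<in> pointwise_diff \<kappa> \<mu>} = ?l ` ?S"
    unfolding facets_link_at[OF convex_cells_X] facets_link_at[OF convex_cells_Y] facet_pairs_def by (auto simp: image_iff)
  have inj: "inj_on ?l ?S" by (rule inj_on_subset[OF inj_facet_pairs_link[OF convex_cells_X convex_cells_Y]]) auto
  have "displacement_mult (link_at \<omega> X) (link_at \<omega> Y) v =
      (\<Sum>x\<in>?S. case ?l x of (\<kappa>, \<mu>) \<Rightarrow> facet_mult (link_at \<omega> X) \<kappa> * facet_mult (link_at \<omega> Y) \<mu> * of_nat (lattice_index \<kappa> \<mu>))"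
    unfolding displacement_mult_def S sum.reindex[OF inj] comp_def ..
  also have "\<dots> = (\<Sum>(s, t)\<in>?S. facet_mult X s * facet_mult Y t * of_nat (lattice_index s t))"
  proof (rule sum.cong[OF refl])
    fix x assume x: "x \<in> ?S"
    obtain s t where e: "x = (s, t)" by (cases x)
    have st: "s \<in> facets (cells X)" "t \<in> facets (cells Y)" "\<omega> \<in> s" "\<omega> \<in> t" using x unfolding e facet_pairs_def by auto
    have c: "s \<in> cells X" "t \<in> cells Y" using st facets_subset by blast+
    have "lattice_index (link \<omega> s) (link \<omega> t) = lattice_index s t"
      unfolding lattice_index_eq plat_def dirs_link[OF facet_convex[OF X st(1)] st(3)] dirs_link[OF facet_convex[OF Y st(2)] st(4)] ..
    then show "(case ?l x of (\<kappa>, \<mu>) \<Rightarrow> facet_mult (link_at \<omega> X) \<kappa> * facet_mult (link_at \<omega> Y) \<mu> * of_nat (lattice_index \<kappa> \<mu>)) =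
        (case x of (s, t) \<Rightarrow> facet_mult X s * facet_mult Y t * of_nat (lattice_index s t))"
      unfolding e by (simp add: facet_mult_link_at[OF convex_cells_X c(1) st(3)] facet_mult_link_at[OF convex_cells_Y c(2) st(4)])
  qed
  finally show ?thesis .
qed

lemma sum_facets_link_prod:
  assumes X: "convex_complex (cells X)" and Y: "convex_complex (cells Y)"
  shows "(\<Sum>c | c \<in> facets (link_prod \<omega> X Y) \<and> P c. g c) =
    (\<Sum>(s, t) | (s, t) \<in> facet_pairs \<omega> X Y \<and> P (link \<omega> s \<times> link \<omega> t). g (link \<omega> s \<times> link \<omega> t))"
proof -
  let ?S = "{(s, t). (s, t) \<in> facet_pairs \<omega> X Y \<and> P (link \<omega> s \<times> link \<omega> t)}"
  let ?l = "\<lambda>(s, t). link \<omega> s \<times> link \<omega> t"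
  have S: "{c. c \<in> facets (link_prod \<omega> X Y) \<and> P c} = ?l ` ?S"
    unfolding facets_link_prod[OF X Y] facet_pairs_def by (auto simp: image_iff)
  have inj: "inj_on ?l ?S"
  proof (rule inj_onI)
    fix a b assume ab: "a \<in> ?S" "b \<in> ?S" and eq: "?l a = ?l b"
    obtain s t s' t' where e: "a = (s, t)" "b = (s', t')" by (cases a, cases b)
    have m: "(s, t) \<in> facet_pairs \<omega> X Y" "(s', t') \<in> facet_pairs \<omega> X Y" using ab unfolding e by auto
    then have "0 \<in> link \<omega> s" "0 \<in> link \<omega> t" by (auto simp: facet_pairs_def zero_in_link)
    then have "(link \<omega> s, link \<omega> t) = (link \<omega> s', link \<omega> t')" using eq unfolding e by (auto simp: times_eq_iff)
    then show "a = b" using inj_onD[OF inj_facet_pairs_link[OF X Y, of \<omega>] _ m] e by simp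
  qed
  show ?thesis unfolding S sum.reindex[OF inj] comp_def by (rule sum.cong) auto
qed

text \<open>Modulo the diagonal a point of the product is determined by the difference of its
  coordinates, so a displacement \<open>v\<close> is represented by \<open>(v, 0)\<close>.\<close>

lemma pointwise_diff_iff_diag: "v \<in> pointwise_diff S T \<longleftrightarrow> (v, 0) \<in> S \<times> T + diag UNIV"
proof
  assume "v \<in> pointwise_diff S T"
  then obtain s t where "v = s - t" "s \<in> S" "t \<in> T" unfolding pointwise_diff_def by blast
  then show "(v, 0) \<in> S \<times> T + diag UNIV" unfolding in_prod_plus_diag by (intro bexI[of _ "- t"]) auto
next
  assume "(v, 0) \<in> S \<times> T + diag UNIV"
  then obtain y where "v - y \<in> S" "0 - y \<in> T" unfolding in_prod_plus_diag by blast
  moreover have "v = (v - y) - (0 - y)" by simp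
  ultimately show "v \<in> pointwise_diff S T" unfolding pointwise_diff_def by blast
qed

lemma link_subset_dirs:
  assumes "convex s" "\<omega> \<in> s"
  shows "link \<omega> s \<subseteq> dirs s"
proof
  fix u assume "u \<in> link \<omega> s"
  then show "u \<in> dirs s"
    using diff_in_dirs[OF _ zero_in_link[OF assms(2)], of u] dirs_link[OF assms] by simp
qed

lemma pointwise_diff_links_dim:
  fixes s t :: "(real ^ 'n) set"
  assumes "convex s" "convex t" "\<omega> \<in> s" "\<omega> \<in> t"
  shows "aff_dim (pointwise_diff (link \<omega> s) (link \<omega> t)) = int CARD('n) \<longleftrightarrow> transversal s t"
proof -
  let ?D = "pointwise_diff (link \<omega> s) (link \<omega> t)"
  have z: "0 \<in> link \<omega> s" "0 \<in> link \<omega> t" using zero_in_link assms(3,4) by auto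
  have D: "l - j \<in> ?D" if "l \<in> link \<omega> s" "j \<in> link \<omega> t" for l j
    using that unfolding pointwise_diff_def by blast
  have 0: "0 \<in> ?D" using D[OF z] by simp
  have "dirs ?D = dirs s + dirs t"
  proof
    show "dirs ?D \<subseteq> dirs s + dirs t"
    proof (rule dirs_subset[OF _ 0])
      fix y assume "y \<in> ?D"
      then obtain l j where st: "y = l - j" "l \<in> link \<omega> s" "j \<in> link \<omega> t" unfolding pointwise_diff_def by blast
      have "l \<in> dirs s" "- j \<in> dirs t"
        using link_subset_dirs[OF assms(1,3)] link_subset_dirs[OF assms(2,4)] st(2,3) subspace_neg[OF subspace_dirs] by blast+
      then have "l + (- j) \<in> dirs s + dirs t" by (rule set_plus_intro)
      then show "y - 0 \<in> dirs s + dirs t" using st(1) by simp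
    qed (intro subspace_set_plus subspace_dirs)
    have "link \<omega> s \<subseteq> ?D" using D[OF _ z(2)] by fastforce
    then have a: "dirs s \<subseteq> dirs ?D" using dirs_mono dirs_link[OF assms(1,3)] by metis
    have "dirs (link \<omega> t) \<subseteq> dirs ?D"
    proof (rule dirs_subset[OF subspace_dirs z(2)])
      fix j assume "j \<in> link \<omega> t"
      then have "0 - j \<in> ?D" by (rule D[OF z(1)])
      then show "j - 0 \<in> dirs ?D" using diff_in_dirs[OF 0, of "0 - j"] by simp
    qed
    then have b: "dirs t \<subseteq> dirs ?D" using dirs_link[OF assms(2,4)] by simp
    show "dirs s + dirs t \<subseteq> dirs ?D"
    proof
      fix x assume "x \<in> dirs s + dirs t"
      then obtain l j where "x = l + j" "l \<in> dirs s" "j \<in> dirs t" by (rule set_plus_elim)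
      then show "x \<in> dirs ?D" using a b subspace_add[OF subspace_dirs] by blast
    qed
  qed
  moreover have "aff_dim ?D = int (dim (dirs ?D))" by (rule dim_dirs) (use 0 in blast)
  moreover have "dim (dirs s + dirs t) = CARD('n) \<longleftrightarrow> transversal s t"
    using dim_eq_full[of "dirs s + dirs t"] subspace_set_plus[OF subspace_dirs subspace_dirs, of s t]
    by (simp add: span_eq_iff[THEN iffD2])
  ultimately show ?thesis by simp
qed

lemma generic_link_at_iff:
  fixes X Y :: "(real ^ 'n) weighted_complex"
  assumes X: "convex_complex (cells X)" and Y: "convex_complex (cells Y)"
  shows "generic (link_at \<omega> X) (link_at \<omega> Y) v \<longleftrightarrow>
    (\<forall>s\<in>cells X. \<forall>t\<in>cells Y. \<omega> \<in> s \<and> \<omega> \<in> t \<and> v \<in> pointwise_diff (link \<omega> s) (link \<omega> t) \<longrightarrow> transversal s t)"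
proof -
  have *: "aff_dim (pointwise_diff (link \<omega> s) (link \<omega> t)) = int CARD('n) \<longleftrightarrow> transversal s t"
    if "s \<in> cells X" "t \<in> cells Y" "\<omega> \<in> s" "\<omega> \<in> t" for s t
    by (rule pointwise_diff_links_dim[OF convex_complexD(3)[OF X that(1)] convex_complexD(3)[OF Y that(2)] that(3,4)])
  show ?thesis unfolding generic_def cells_link_at
  proof (intro iffI ballI impI)
    fix s t assume g: "\<forall>s\<in>link \<omega> ` {s \<in> cells X. \<omega> \<in> s}. \<forall>t\<in>link \<omega> ` {s \<in> cells Y. \<omega> \<in> s}.
        v \<in> pointwise_diff s t \<longrightarrow> aff_dim (pointwise_diff s t) = int CARD('n)"
      and st: "s \<in> cells X" "t \<in> cells Y"
      and h: "\<omega> \<in> s \<and> \<omega> \<in> t \<and> v \<in> pointwise_diff (link \<omega> s) (link \<omega> t)"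
    have m: "link \<omega> s \<in> link \<omega> ` {s \<in> cells X. \<omega> \<in> s}" "link \<omega> t \<in> link \<omega> ` {s \<in> cells Y. \<omega> \<in> s}"
      using st h by auto
    show "transversal s t" using bspec[OF bspec[OF g m(1)] m(2)] h *[OF st] by blast
  next
    fix \<kappa> \<mu> assume l: "\<forall>s\<in>cells X. \<forall>t\<in>cells Y. \<omega> \<in> s \<and> \<omega> \<in> t \<and> v \<in> pointwise_diff (link \<omega> s) (link \<omega> t) \<longrightarrow> transversal s t"
      and "\<kappa> \<in> link \<omega> ` {s \<in> cells X. \<omega> \<in> s}" "\<mu> \<in> link \<omega> ` {s \<in> cells Y. \<omega> \<in> s}" and v: "v \<in> pointwise_diff \<kappa> \<mu>"
    then obtain s t where st: "\<kappa> = link \<omega> s" "s \<in> cells X" "\<omega> \<in> s" "\<mu> = link \<omega> t" "t \<in> cells Y" "\<omega> \<in> t" by blast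
    then show "aff_dim (pointwise_diff \<kappa> \<mu>) = int CARD('n)" using *[OF st(2,5,3,6)] l v by simp
  qed
qed

text \<open>The hypothesis on \<open>v\<close> does not mention \<open>\<omega>\<close>: one vector
  is generic for the links at all points at once, as is needed when several facets around a ridge
  are treated together.\<close>

lemma avoid_nontransversal_generic:
  fixes X Y :: "(real ^ 'n) weighted_complex"
  assumes X: "convex_complex (cells X)" and Y: "convex_complex (cells Y)"
    and v: "\<And>s t. s \<in> cells X \<Longrightarrow> t \<in> cells Y \<Longrightarrow> v \<in> dirs s + dirs t \<Longrightarrow> transversal s t"
  shows "generic (link_at \<omega> X) (link_at \<omega> Y) v"
  unfolding generic_link_at_iff[OF X Y]
proof (intro ballI impI)
  fix s t assume st: "s \<in> cells X" "t \<in> cells Y" and h: "\<omega> \<in> s \<and> \<omega> \<in> t \<and> v \<in> pointwise_diff (link \<omega> s) (link \<omega> t)"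
  obtain l j where "v = l - j" "l \<in> link \<omega> s" "j \<in> link \<omega> t" using h unfolding pointwise_diff_def by blast
  moreover have "l \<in> dirs s" "- j \<in> dirs t"
    using link_subset_dirs convex_complexD(3)[OF X st(1)] convex_complexD(3)[OF Y st(2)] h calculation subspace_neg[OF subspace_dirs] by blast+
  moreover have "l + (- j) \<in> dirs s + dirs t" using calculation(4,5) by (rule set_plus_intro)
  ultimately show "transversal s t" using v[OF st] by simp
qed

lemma generic_exists:
  fixes X Y :: "(real ^ 'n) weighted_complex"
  assumes X: "convex_complex (cells X)" and Y: "convex_complex (cells Y)"
  shows "\<exists>v. generic (link_at \<omega> X) (link_at \<omega> Y) v"
proof -
  let ?A = "(\<lambda>(s,t). dirs s + dirs t) ` {(s,t) \<in> cells X \<times> cells Y. \<not> transversal s t}"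
  have "\<exists>y\<in>UNIV. \<forall>A\<in>?A. y \<notin> A"
  proof (rule convex_avoid_affine)
    have "finite (cells X \<times> cells Y)" using convex_complexD(1)[OF X] convex_complexD(1)[OF Y] by blast
    then show "finite ?A" by (rule finite_imageI[OF finite_subset[rotated]]) auto
    show "affine A \<and> \<not> UNIV \<subseteq> A" if "A \<in> ?A" for A
      using that by (auto intro!: subspace_imp_affine subspace_set_plus)
  qed auto
  then obtain v where v: "\<forall>A\<in>?A. v \<notin> A" by blast
  have "generic (link_at \<omega> X) (link_at \<omega> Y) v"
    by (rule avoid_nontransversal_generic[OF X Y]) (use v in blast)
  then show ?thesis by blast
qed

text \<open>This frees \<open>link_cell\<close> from the point chosen in its definition.\<close>

lemma link_at_rel_interior:
  assumes C: "convex_complex (cells X)" and \<gamma>: "\<And>s \<omega>. s \<in> cells X \<Longrightarrow> \<omega> \<in> rel_interior \<gamma> \<Longrightarrow> \<omega> \<in> s \<Longrightarrow> \<gamma> \<subseteq> s"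
    and w: "\<omega> \<in> rel_interior \<gamma>" "\<omega>' \<in> rel_interior \<gamma>"
  shows "link_at \<omega> X = link_at \<omega>' X"
proof -
  have A: "{s\<in>cells X. \<omega> \<in> s} = {s\<in>cells X. \<omega>' \<in> s}"
    using \<gamma>[OF _ w(1)] \<gamma>[OF _ w(2)] w rel_interior_subset by blast
  have l: "link \<omega> s = link \<omega>' s" if "s \<in> {s\<in>cells X. \<omega> \<in> s}" for s
    using link_rel_interior_eq[OF convex_complexD(3)[OF C] \<gamma>[OF _ w(1)] w] that by blast
  have "the_inv_into {s\<in>cells X. \<omega> \<in> s} (link \<omega>) = the_inv_into {s\<in>cells X. \<omega>' \<in> s} (link \<omega>')"
    unfolding the_inv_into_def A[symmetric] by (intro ext arg_cong[where f = The]) (auto simp: l)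
  moreover have "link \<omega> ` {s\<in>cells X. \<omega> \<in> s} = link \<omega>' ` {s\<in>cells X. \<omega>' \<in> s}"
    unfolding A[symmetric] by (rule image_cong[OF refl l])
  ultimately show ?thesis by (simp add: link_at_def)
qed

context
  fixes X Y :: "(real ^ 'n) weighted_complex" and p q :: nat
  assumes X: "tropical_cycle p X" "positive X" and Y: "tropical_cycle q Y" "positive Y"
begin

lemmas convex_X = convex_cells_X[OF X Y] and convex_Y = convex_cells_Y[OF X Y]

text \<open>The displacement multiplicity is the degree along the whole diagonal at
  \<open>(v, 0)\<close>: with \<open>S\<close> everything, the second factor in
  \<open>idx_prod_diag\<close> is 1. The directions of \<open>\<gamma>\<close> form the invariant
  subspace, and the dimension of \<open>\<gamma>\<close> is what the degree theorem asks
  for.\<close>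

lemma displacement_mult_generic:
  assumes \<gamma>: "\<gamma> \<in> facets (cells (stable_intersection X Y))" and \<omega>: "\<omega> \<in> rel_interior \<gamma>"
    and v: "generic (link_at \<omega> X) (link_at \<omega> Y) v" "generic (link_at \<omega> X) (link_at \<omega> Y) v'"
  shows "displacement_mult (link_at \<omega> X) (link_at \<omega> Y) v = displacement_mult (link_at \<omega> X) (link_at \<omega> Y) v'"
proof -
  note fS = facet_in_SI[OF X Y \<gamma>]
  let ?E = "link_prod \<omega> X Y" and ?M = "diag (UNIV::(real ^ 'n) set)"
  have deg: "real_of_rat (displacement_mult (link_at \<omega> X) (link_at \<omega> Y) w) =
      (\<Sum>c | c \<in> facets ?E \<and> (w, 0) \<in> c + ?M. link_prod_mult \<omega> X Y c * real (idx zlat (plat c ?M)))" for w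
    unfolding displacement_mult_link_at[OF X(1) Y(1)] sum_facets_link_prod[OF convex_X convex_Y] pointwise_diff_iff_diag of_rat_sum
  proof (rule sum.cong[OF refl])
    fix x assume "x \<in> {(s, t). (s, t) \<in> facet_pairs \<omega> X Y \<and> (w, 0) \<in> link \<omega> s \<times> link \<omega> t + ?M}"
    then obtain s t where st: "x = (s, t)" "s \<in> facets (cells X)" "t \<in> facets (cells Y)" "\<omega> \<in> s" "\<omega> \<in> t"
      unfolding facet_pairs_def by blast
    have "plat (link \<omega> s \<times> link \<omega> t) ?M = {a + b | a b. a \<in> (dirs s \<times> dirs t) \<inter> zlat \<and> b \<in> ?M \<inter> zlat}"
      unfolding plat_def dirs_link_prod[OF facet_convex[OF X(1) st(2)] facet_convex[OF Y(1) st(3)] st(4,5)] ..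
    then have "idx zlat (plat (link \<omega> s \<times> link \<omega> t) ?M) = lattice_index s t"
      using idx_prod_diag[OF subspace_dirs subspace_dirs subspace_UNIV, of s t]
        idx_zlat_UNIV[of "dirs s \<inter> dirs t"] unfolding lattice_index_eq plat_def by (simp add: subspace_inter)
    then show "real_of_rat (case x of (s, t) \<Rightarrow> facet_mult X s * facet_mult Y t * of_nat (lattice_index s t)) =
        (case x of (s, t) \<Rightarrow> link_prod_mult \<omega> X Y (link \<omega> s \<times> link \<omega> t) * real (idx zlat (plat (link \<omega> s \<times> link \<omega> t) ?M)))"
      unfolding st(1) split_conv
      using link_prod_mult_eq[OF convex_X convex_Y facet_cell_X[OF X Y st(2)] facet_cell_Y[OF X Y st(3)] st(4,5)] by (simp add: of_rat_mult)
  qed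
  have gen: "(w, 0) \<in> generic_pts ?E ?M" if w: "generic (link_at \<omega> X) (link_at \<omega> Y) w" for w
  proof clarify
    fix c assume c: "c \<in> ?E" "(w, 0) \<in> c + ?M"
    obtain s t where st: "c = link \<omega> s \<times> link \<omega> t" "s \<in> cells X" "t \<in> cells Y" "\<omega> \<in> s" "\<omega> \<in> t"
      using c(1) unfolding link_prod_def prod_complex_def cells_link_at by blast
    have "w \<in> pointwise_diff (link \<omega> s) (link \<omega> t)" using c(2) unfolding st(1) pointwise_diff_iff_diag .
    then have "transversal s t" using w st(2-5) unfolding generic_link_at_iff[OF convex_X convex_Y] by blast
    then have "dirs s \<times> dirs t + ?M = UNIV"
      unfolding prod_plus_diag_full[OF subspace_dirs subspace_dirs subspace_UNIV]
      using set_plus_intro[OF subspace_0[OF subspace_inter[OF subspace_dirs subspace_dirs]], of _ UNIV s t] by auto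
    then show "dirs c + ?M = UNIV"
      unfolding st(1) dirs_link_prod[OF convex_complexD(3)[OF convex_X st(2)] convex_complexD(3)[OF convex_Y st(3)] st(4,5)] .
  qed
  have "(\<Sum>c | c \<in> facets ?E \<and> (v, 0) \<in> c + ?M. link_prod_mult \<omega> X Y c * real (idx zlat (plat c ?M))) =
      (\<Sum>c | c \<in> facets ?E \<and> (v', 0) \<in> c + ?M. link_prod_mult \<omega> X Y c * real (idx zlat (plat c ?M)))"
  proof (rule lattice_degree_constant[where K = "diag (dirs \<gamma>)"])
    show "balanced_complex ?E (link_prod_mult \<omega> X Y) ((int CARD('n) - int p) + (int CARD('n) - int q))"
      by (rule balanced_link_prod[OF X(1) Y(1)])
    show "rational_subspace ?M" by (rule rational_diag) simp
    show "subspace (diag (dirs \<gamma>))" by (rule subspace_diag) simp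
    show "diag (dirs \<gamma>) \<subseteq> ?M" by (auto simp: diag_def)
    show "x + k \<in> c" if h: "c \<in> ?E" "x \<in> c" "k \<in> diag (dirs \<gamma>)" for c x k
    proof -
      obtain s t where st: "c = link \<omega> s \<times> link \<omega> t" "s \<in> cells X" "t \<in> cells Y" "\<omega> \<in> s" "\<omega> \<in> t"
        using h(1) unfolding link_prod_def prod_complex_def cells_link_at by blast
      obtain a b d where e: "x = (a, b)" "k = (d, d)" "d \<in> dirs \<gamma>" using h(3) by (cases x) (auto simp: diag_def)
      have "a + d \<in> link \<omega> s"
        by (rule link_dirs_inv[OF convex_complexD(3)[OF convex_X st(2)] SI_carrier(1)[OF X Y fS \<omega> st(2,4)] \<omega> _ e(3)])
          (use h(2) st(1) e(1) in auto)
      moreover have "b + d \<in> link \<omega> t"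
        by (rule link_dirs_inv[OF convex_complexD(3)[OF convex_Y st(3)] SI_carrier(2)[OF X Y fS \<omega> st(3,5)] \<omega> _ e(3)])
          (use h(2) st(1) e(1) in auto)
      ultimately show ?thesis using st(1) e by simp
    qed
    show "(int CARD('n) - int p) + (int CARD('n) - int q) + int (dim ?M) = int DIM((real ^ 'n) \<times> (real ^ 'n)) + int (dim (diag (dirs \<gamma>)))"
      unfolding dim_diag using SI_facet_dim[OF X Y \<gamma>] by simp
    show "(v, 0) \<in> generic_pts ?E ?M" "(v', 0) \<in> generic_pts ?E ?M" by (rule gen[OF v(1)], rule gen[OF v(2)])
  qed
  then have "real_of_rat (displacement_mult (link_at \<omega> X) (link_at \<omega> Y) v) = real_of_rat (displacement_mult (link_at \<omega> X) (link_at \<omega> Y) v')"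
    unfolding deg .
  then show ?thesis by (simp only: of_rat_eq_iff)
qed

lemma facet_mult_stable_intersection:
  assumes \<gamma>: "\<gamma> \<in> facets (cells (stable_intersection X Y))" and \<omega>: "\<omega> \<in> rel_interior \<gamma>"
    and v: "generic (link_at \<omega> X) (link_at \<omega> Y) v"
  shows "facet_mult (stable_intersection X Y) \<gamma> = displacement_mult (link_at \<omega> X) (link_at \<omega> Y) v"
proof -
  note fS = facet_in_SI[OF X Y \<gamma>]
  define \<omega>' where "\<omega>' = (SOME \<omega>. \<omega> \<in> rel_interior \<gamma>)"
  have \<omega>': "\<omega>' \<in> rel_interior \<gamma>" unfolding \<omega>'_def using \<omega> by (rule someI)
  have lX: "link_cell \<gamma> X = link_at \<omega> X" unfolding link_cell_def \<omega>'_def[symmetric]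
    by (rule link_at_rel_interior[OF convex_X SI_carrier(1)[OF X Y fS] \<omega>' \<omega>])
  have lY: "link_cell \<gamma> Y = link_at \<omega> Y" unfolding link_cell_def \<omega>'_def[symmetric]
    by (rule link_at_rel_interior[OF convex_Y SI_carrier(2)[OF X Y fS] \<omega>' \<omega>])
  have "generic (link_at \<omega> X) (link_at \<omega> Y) (SOME v. generic (link_at \<omega> X) (link_at \<omega> Y) v)"
    using v by (rule someI)
  then show ?thesis unfolding stable_intersection_def weighted_complex.select_convs lX lY
    by (rule displacement_mult_generic[OF \<gamma> \<omega> _ v])
qed

text \<open>A relatively interior point lies in the stable support, so some pair of links reaches
  the generic \<open>v\<close> and the sum is not empty. Genericity makes each contributing pair
  transversal, hence each index finite and positive.\<close>

lemma positive_stable_intersection: "positive (stable_intersection X Y)"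
  unfolding positive_def
proof
  fix \<gamma> assume \<gamma>: "\<gamma> \<in> facets (cells (stable_intersection X Y))"
  note fS = facet_in_SI[OF X Y \<gamma>]
  obtain \<omega> where \<omega>: "\<omega> \<in> rel_interior \<gamma>" using convex_complexD(3,4)[OF convex_complex_SI[OF X Y] fS] rel_interior_eq_empty by blast
  obtain v where v: "generic (link_at \<omega> X) (link_at \<omega> Y) v" using generic_exists[OF convex_X convex_Y] by blast
  let ?S = "{(s, t). (s, t) \<in> facet_pairs \<omega> X Y \<and> v \<in> pointwise_diff (link \<omega> s) (link \<omega> t)}"
  have fin: "finite ?S" by (rule finite_subset[OF _ finite_facet_pairs[OF convex_X convex_Y]]) auto
  have "\<omega> \<in> stable_support X Y" using \<omega> rel_interior_subset fS unfolding cells_stable_intersection by blast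
  then have "v \<in> pointwise_diff (support (link_at \<omega> X)) (support (link_at \<omega> Y))" unfolding stable_support_def by blast
  then have ne: "?S \<noteq> {}"
    unfolding pointwise_diff_def support_link_at[OF convex_X X(2)] support_link_at[OF convex_Y Y(2)] facet_pairs_def by blast
  have "0 < (\<Sum>(s, t)\<in>?S. facet_mult X s * facet_mult Y t * of_nat (lattice_index s t))"
  proof (rule sum_pos[OF fin ne])
    fix x assume "x \<in> ?S"
    then obtain s t where st: "x = (s, t)" "s \<in> facets (cells X)" "t \<in> facets (cells Y)" "\<omega> \<in> s" "\<omega> \<in> t"
      "v \<in> pointwise_diff (link \<omega> s) (link \<omega> t)" unfolding facet_pairs_def by blast
    have c: "s \<in> cells X" "t \<in> cells Y" by (rule facet_cell_X[OF X Y st(2)], rule facet_cell_Y[OF X Y st(3)])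
    have "transversal s t" using v st(4-6) c unfolding generic_link_at_iff[OF convex_X convex_Y] by blast
    moreover have "s \<noteq> {}" "t \<noteq> {}" using st(4,5) by auto
    ultimately have "lattice_index s t > 0" unfolding lattice_index_eq
      by (intro idx_plat_pos rational_polyhedron_dirs tropical_cycleD(5)[OF X(1) c(1)] tropical_cycleD(5)[OF Y(1) c(2)])
    then show "0 < (case x of (s, t) \<Rightarrow> facet_mult X s * facet_mult Y t * of_nat (lattice_index s t))"
      using X(2) Y(2) st(2,3) unfolding st(1) positive_def by simp
  qed
  then show "0 < facet_mult (stable_intersection X Y) \<gamma>"
    unfolding facet_mult_stable_intersection[OF \<gamma> \<omega> v] displacement_mult_link_at[OF X(1) Y(1)] .
qed

end

section \<open>Balancing of the stable intersection\<close>

text \<open>A lattice generator modulo \<open>dirs t\<close> is fixed up to sign, and the sign is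
  chosen towards a relatively interior point \<open>b\<close> of \<open>\<gamma>\<close>. The
  half-ball lemma, used inside the span of \<open>\<gamma>\<close>, shows that the vector then
  enters \<open>\<gamma>\<close> from every relatively interior point of \<open>t\<close>.\<close>

lemma primitive_normal_exists:
  assumes t\<gamma>: "t facet_of \<gamma>" and rat: "rational_polyhedron t" "rational_polyhedron \<gamma>"
  shows "\<exists>v. primitive_normal t \<gamma> v"
proof -
  have f: "t face_of \<gamma>" "t \<noteq> {}" "aff_dim t = aff_dim \<gamma> - 1" using t\<gamma> by (auto simp: facet_of_def)
  have sub: "t \<subseteq> \<gamma>" by (rule face_of_imp_subset[OF f(1)])
  have ne: "\<gamma> \<noteq> {}" using sub f(2) by blast
  have cv: "convex t" "convex \<gamma>" using rational_polyhedron_closed_convex(2) rat by auto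
  have dim1: "dim (dirs \<gamma>) = dim (dirs t) + 1" using f(3) dim_dirs[OF f(2)] dim_dirs[OF ne] by linarith
  obtain u0 v0 where uv0: "u0 \<in> zlat" "v0 \<in> dirs \<gamma> \<inter> zlat" "u0 \<bullet> v0 > 0" "dirs t = dirs \<gamma> \<inter> {x. u0 \<bullet> x = 0}"
    "dirs \<gamma> \<inter> zlat = {w + of_int a *\<^sub>R v0 | w a. w \<in> dirs t \<inter> zlat}"
    by (rule primitive_vector_exists[OF rational_polyhedron_dirs[OF rat(1) f(2)] rational_polyhedron_dirs[OF rat(2) ne] dirs_mono[OF sub] dim1])
  obtain b where b: "b \<in> rel_interior \<gamma>" using cv(2) ne rel_interior_eq_empty by blast
  have b\<gamma>: "b \<in> \<gamma>" using b rel_interior_subset by blast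
  obtain x where x: "x \<in> t" using f(2) by blast
  have "t \<noteq> \<gamma>" using f(3) by auto
  then have "b \<notin> affine hull t" using affine_hull_face_of_disjoint_rel_interior[OF cv(2) f(1)] b by blast
  then have "b - x \<notin> dirs t" by (simp add: affine_hull_dirs[OF x])
  moreover have "b - x \<in> dirs \<gamma>" using diff_in_dirs b\<gamma> x sub by blast
  ultimately have ub: "u0 \<bullet> (b - x) \<noteq> 0" unfolding uv0(4) by blast
  \<comment> \<open>Functional and vector are both multiplied by this sign, so
    \<open>u \<bullet> v\<close> stays positive while \<open>u\<close> becomes positive towards
    \<open>b\<close>.\<close>
  define s :: int where "s = (if u0 \<bullet> (b - x) > 0 then 1 else - 1)"
  define u where "u = of_int s *\<^sub>R u0"
  define v where "v = of_int s *\<^sub>R v0"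
  have s: "s * s = 1" by (simp add: s_def)
  have ubx: "u \<bullet> (b - x) > 0" using ub by (auto simp: u_def s_def)
  have "u \<bullet> v = of_int (s * s) * (u0 \<bullet> v0)" by (simp add: u_def v_def)
  then have uv: "u \<bullet> v > 0" using uv0(3) s by simp
  have s0: "s \<noteq> 0" using s by auto
  then have ker: "dirs t = dirs \<gamma> \<inter> {x. u \<bullet> x = 0}" unfolding uv0(4) u_def by simp
  have lat: "dirs \<gamma> \<inter> zlat = {w + of_int a *\<^sub>R v | w a. w \<in> dirs t \<inter> zlat}"
    unfolding uv0(5)
  proof (intro subset_antisym subsetI)
    fix y assume "y \<in> {w + of_int a *\<^sub>R v0 | w a. w \<in> dirs t \<inter> zlat}"
    then obtain w a where "y = w + of_int a *\<^sub>R v0" "w \<in> dirs t \<inter> zlat" by blast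
    moreover have "of_int (a * s) *\<^sub>R v = of_int (a * (s * s)) *\<^sub>R v0" by (simp add: v_def)
    then have "of_int (a * s) *\<^sub>R v = of_int a *\<^sub>R v0" by (simp only: s) simp
    ultimately show "y \<in> {w + of_int a *\<^sub>R v | w a. w \<in> dirs t \<inter> zlat}"
      by (intro CollectI exI[of _ w] exI[of _ "a * s"]) auto
  next
    fix y assume "y \<in> {w + of_int a *\<^sub>R v | w a. w \<in> dirs t \<inter> zlat}"
    then obtain w a where "y = w + of_int a *\<^sub>R v" "w \<in> dirs t \<inter> zlat" by blast
    moreover have "of_int a *\<^sub>R v = of_int (a * s) *\<^sub>R v0" by (simp add: v_def)
    ultimately show "y \<in> {w + of_int a *\<^sub>R v0 | w a. w \<in> dirs t \<inter> zlat}"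
      by (intro CollectI exI[of _ w] exI[of _ "a * s"]) simp
  qed
  have v\<gamma>: "v \<in> dirs \<gamma>" unfolding v_def using uv0(2) by (simp add: subspace_scale)
  have "v \<in> link \<omega> \<gamma>" if \<omega>: "\<omega> \<in> rel_interior t" for \<omega>
  proof -
    have w: "\<omega> \<in> t" using \<omega> rel_interior_subset by blast
    have "u \<bullet> (x - \<omega>) = 0" using diff_in_dirs[OF x w] unfolding ker by blast
    then have ubw: "u \<bullet> b > u \<bullet> \<omega>" using ubx by (simp add: inner_diff_right)
    have "\<exists>e>0. \<forall>y. dist \<omega> y < e \<and> y - \<omega> \<in> dirs \<gamma> \<and> u \<bullet> y \<ge> u \<bullet> \<omega> \<longrightarrow> y \<in> \<gamma>"
    proof (rule half_ball_in_convex[OF cv(2) sub \<omega> _ b\<gamma> ubw _ subspace_dirs])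
      show "b - \<omega> \<in> dirs \<gamma>" using diff_in_dirs b\<gamma> w sub by blast
      fix y assume "u \<bullet> (y - \<omega>) = 0" "y - \<omega> \<in> dirs \<gamma>"
      then show "y \<in> affine hull t" unfolding affine_hull_dirs[OF w] ker by blast
    qed
    then obtain e where e: "e > 0" "\<And>y. dist \<omega> y < e \<Longrightarrow> y - \<omega> \<in> dirs \<gamma> \<Longrightarrow> u \<bullet> y \<ge> u \<bullet> \<omega> \<Longrightarrow> y \<in> \<gamma>" by blast
    define l where "l = (e / 2) / (norm v + 1)"
    have n1: "norm v + 1 > 0" by (simp add: add_nonneg_pos)
    have l: "l > 0" using e(1) n1 by (simp add: l_def)
    have "l * norm v < e"
    proof -
      have "l * norm v \<le> l * (norm v + 1)" using l by simp
      also have "\<dots> = e / 2" unfolding l_def using n1 by (intro nonzero_eq_divide_eq[THEN iffD1, OF _ refl]) simp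
      also have "\<dots> < e" using e(1) by simp
      finally show ?thesis .
    qed
    then have "dist \<omega> (\<omega> + l *\<^sub>R v) < e" using l by (simp add: dist_norm)
    then have "\<omega> + l *\<^sub>R v \<in> \<gamma>"
      using e(2)[of "\<omega> + l *\<^sub>R v"] subspace_scale[OF subspace_dirs v\<gamma>, of l] l uv by (simp add: inner_add_right)
    then show ?thesis using link_iff[OF cv(2), of \<omega> v] w sub l by blast
  qed
  then show ?thesis unfolding primitive_normal_def lattice_of_eq using lat by blast
qed

text \<open>Clearing denominators: some positive multiple \<open>D\<close> of the sum is a lattice
  vector, and it lies in \<open>dirs t\<close>. This is the passage from real direction spaces back
  to the rational span in \<open>balanced_at\<close>.\<close>

lemma rational_point_in_rat_span:
  fixes x :: "real ^ 'n"
  assumes "\<And>i. i \<in> I \<Longrightarrow> w i \<in> zlat" "finite I" "(\<Sum>i\<in>I. of_rat (c i) *\<^sub>R w i) \<in> dirs t"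
  shows "(\<Sum>i\<in>I. of_rat (c i) *\<^sub>R w i) \<in> rat_span (lattice_of t)"
proof -
  have ex: "\<exists>D::int. D > 0 \<and> of_int D *\<^sub>R (\<Sum>i\<in>J. of_rat (c i) *\<^sub>R w i) \<in> zlat" if "J \<subseteq> I" for J
    using finite_subset[OF that assms(2)] that
  proof (induction J)
    case empty
    then show ?case using add_subgroup_0[OF add_subgroup_zlat] by (intro exI[of _ 1]) simp
  next
    case (insert j J)
    then obtain D where D: "D > 0" "of_int D *\<^sub>R (\<Sum>i\<in>J. of_rat (c i) *\<^sub>R w i) \<in> zlat" by auto
    obtain a b where ab: "quotient_of (c j) = (a, b)" by (cases "quotient_of (c j)")
    have b: "b > 0" by (rule quotient_of_denom_pos[OF ab])
    have cj: "c j = of_int a / of_int b" by (rule quotient_of_div[OF ab])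
    have "of_int (D * b) *\<^sub>R (of_rat (c j) *\<^sub>R w j) = of_int (D * a) *\<^sub>R w j"
      using b by (simp add: cj of_rat_divide)
    moreover have "of_int (D * a) *\<^sub>R w j \<in> zlat" using assms(1) insert.prems by (intro add_subgroup_scale_int) auto
    moreover have "of_int (D * b) *\<^sub>R (\<Sum>i\<in>J. of_rat (c i) *\<^sub>R w i) = of_int b *\<^sub>R (of_int D *\<^sub>R (\<Sum>i\<in>J. of_rat (c i) *\<^sub>R w i))"
      by (simp add: mult.commute)
    moreover have "of_int b *\<^sub>R (of_int D *\<^sub>R (\<Sum>i\<in>J. of_rat (c i) *\<^sub>R w i)) \<in> zlat"
      by (rule add_subgroup_scale_int[OF add_subgroup_zlat D(2)])
    ultimately have "of_int (D * b) *\<^sub>R (\<Sum>i\<in>insert j J. of_rat (c i) *\<^sub>R w i) \<in> zlat"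
      using insert.hyps by (simp add: scaleR_add_right add_subgroup_add del: scaleR_scaleR of_int_mult)
    then show ?case using D(1) b by (intro exI[of _ "D * b"]) simp
  qed
  let ?x = "\<Sum>i\<in>I. of_rat (c i) *\<^sub>R w i"
  obtain D :: int where D: "D > 0" "of_int D *\<^sub>R ?x \<in> zlat" using ex[OF order_refl] by blast
  have "of_int D *\<^sub>R ?x \<in> lattice_of t" unfolding lattice_of_eq using D(2) assms(3) by (simp add: subspace_scale)
  moreover have "?x = of_rat (1 / of_int D) *\<^sub>R (of_int D *\<^sub>R ?x)" using D(1) by (simp add: of_rat_divide)
  ultimately have "\<exists>F C. ?x = (\<Sum>y\<in>F. of_rat (C y) *\<^sub>R y) \<and> finite F \<and> F \<subseteq> lattice_of t"
    by (intro exI[of _ "{of_int D *\<^sub>R ?x}"] exI[of _ "\<lambda>_. 1 / of_int D"]) simp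
  then show ?thesis unfolding rat_span_def by blast
qed

text \<open>The point \<open>y\<close> is the midpoint of a segment in \<open>\<gamma>\<close>
  starting at \<open>\<omega>\<close>, so the face \<open>\<phi>\<close> carrying it contains
  \<open>\<omega>\<close> and with it \<open>R\<close>. It also has the direction \<open>x\<close>,
  which is not parallel to \<open>R\<close>, so by dimension it is all of
  \<open>\<gamma>\<close>.\<close>

lemma rel_interior_beyond_ridge:
  assumes C: "convex_complex C" and R: "R \<in> C" "\<omega> \<in> rel_interior R" and \<gamma>: "\<gamma> \<in> C" "R \<subseteq> \<gamma>" "dim (dirs \<gamma>) \<le> dim (dirs R) + 1"
    and x: "x \<in> link \<omega> \<gamma>" "x \<notin> dirs R"
  shows "\<exists>\<delta>>0. \<omega> + \<delta> *\<^sub>R x \<in> rel_interior \<gamma>"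
proof -
  have w: "\<omega> \<in> R" "\<omega> \<in> \<gamma>" using R(2) \<gamma>(2) rel_interior_subset by blast+
  have cv: "convex \<gamma>" by (rule convex_complexD(3)[OF C \<gamma>(1)])
  obtain e where e: "e > 0" "\<forall>t. 0 \<le> t \<and> t < e \<longrightarrow> \<omega> + t *\<^sub>R x \<in> \<gamma>" using link_small[OF cv w(2) x(1)] by blast
  define y where "y = \<omega> + (e/3) *\<^sub>R x"
  have y\<gamma>: "y \<in> \<gamma>" and y2: "\<omega> + (2*e/3) *\<^sub>R x \<in> \<gamma>" unfolding y_def using e by auto
  obtain \<phi> where \<phi>: "\<phi> \<in> C" "\<phi> face_of \<gamma>" "y \<in> rel_interior \<phi>" using carrier_exists[OF C \<gamma>(1) y\<gamma>] by metis
  have y\<phi>: "y \<in> \<phi>" using \<phi>(3) rel_interior_subset by blast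
  have x0: "x \<noteq> 0" using x(2) subspace_0[OF subspace_dirs] by auto
  have "y = (1 - 1/2) *\<^sub>R \<omega> + (1/2) *\<^sub>R (\<omega> + (2*e/3) *\<^sub>R x)"
  proof -
    have "(1 - 1/2) *\<^sub>R \<omega> + (1/2) *\<^sub>R (\<omega> + (2*e/3) *\<^sub>R x) = ((1/2) *\<^sub>R \<omega> + (1/2) *\<^sub>R \<omega>) + (e/3) *\<^sub>R x"
      by (simp add: scaleR_add_right)
    also have "(1/2) *\<^sub>R \<omega> + (1/2) *\<^sub>R \<omega> = \<omega>" by (simp flip: scaleR_add_left)
    finally show ?thesis by (simp add: y_def)
  qed
  then have "y \<in> open_segment \<omega> (\<omega> + (2*e/3) *\<^sub>R x)" unfolding in_segment(2)
    using e(1) x0 by (intro conjI exI[of _ "1/2"]) auto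
  then have w\<phi>: "\<omega> \<in> \<phi>" by (rule face_ofD[OF \<phi>(2) _ w(2) y2 y\<phi>, THEN conjunct1])
  have sub: "R \<subseteq> \<phi>" by (rule carrier_subset[OF C R(1) \<phi>(1) R(2) w\<phi>])
  have "\<phi> = \<gamma>"
  proof (rule ccontr)
    assume "\<phi> \<noteq> \<gamma>"
    then have "dim (dirs \<phi>) < dim (dirs \<gamma>)" by (rule face_dim_less[OF cv \<phi>(2) _ convex_complexD(4)[OF C \<phi>(1)]])
    then have "dirs R = dirs \<phi>"
      using subspace_dim_equal[of "dirs R" "dirs \<phi>"] dirs_mono[OF sub] \<gamma>(3) by simp
    then have "y - \<omega> \<in> dirs R" using diff_in_dirs[OF y\<phi> w\<phi>] by simp
    then have "(e/3) *\<^sub>R x \<in> dirs R" by (simp add: y_def)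
    then have "(3/e) *\<^sub>R ((e/3) *\<^sub>R x) \<in> dirs R" by (rule subspace_scale[OF subspace_dirs])
    then show False using x(2) e(1) by simp
  qed
  then have "\<omega> + (e/3) *\<^sub>R x \<in> rel_interior \<gamma>" using \<phi>(3) by (simp add: y_def)
  then show ?thesis using e(1) by (intro exI[of _ "e/3"]) simp
qed

text \<open>Rescaled by \<open>\<delta>\<close>, the links at \<open>\<omega>\<close> look near
  \<open>x\<close> like the links at the point \<open>\<omega> + \<delta> *\<^sub>R x\<close> of the
  facet. If a displacement by \<open>d1 - d2\<close> makes the latter meet, it also works for the
  former near \<open>x\<close>, up to a translation that must be kept in the kernel of
  \<open>f\<close>.\<close>

lemma displaced_eventually_in:
  fixes s t :: "(real ^ 'n) set"
  assumes cv: "convex s" "convex t" and \<gamma>: "\<gamma> \<subseteq> s" "\<gamma> \<subseteq> t" "convex \<gamma>" "\<omega> \<in> \<gamma>"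
    and x: "x \<in> link \<omega> \<gamma>" "f \<bullet> x = l" "l * l = 1" "\<delta> > 0" "\<omega> + \<delta> *\<^sub>R x \<in> rel_interior \<gamma>" and a: "f \<bullet> a = 1"
    and d: "d1 - d2 \<in> pointwise_diff (link (\<omega> + \<delta> *\<^sub>R x) s) (link (\<omega> + \<delta> *\<^sub>R x) t)"
  shows "\<forall>\<^sub>F \<epsilon> in at_right 0. (l *\<^sub>R a + \<epsilon> *\<^sub>R d1, l *\<^sub>R a + \<epsilon> *\<^sub>R d2) \<in> link \<omega> s \<times> link \<omega> t + diag {y. f \<bullet> y = 0}"
proof -
  let ?w = "\<omega> + \<delta> *\<^sub>R x"
  have w: "\<omega> \<in> s" "\<omega> \<in> t" "?w \<in> s" "?w \<in> t" using \<gamma> x(5) rel_interior_subset by blast+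
  obtain s' t' where st: "d1 - d2 = s' - t'" "s' \<in> link ?w s" "t' \<in> link ?w t"
    using d unfolding pointwise_diff_def by blast
  \<comment> \<open>The translation common to both factors: \<open>s'\<close> is
    \<open>d1 + q\<close> and \<open>t'\<close> is \<open>d2 + q\<close>.\<close>
  define q where "q = s' - d1"
  have q: "q = t' - d2" using st(1) by (simp add: q_def algebra_simps)
  \<comment> \<open>Moving along \<open>x\<close>, a direction of \<open>\<gamma>\<close>, stays
    inside both links. This multiple makes \<open>f\<close> vanish on
    \<open>q + k *\<^sub>R x\<close>, because \<open>l * l = 1\<close>.\<close>
  define k where "k = - (l * (f \<bullet> q))"
  have kx: "k *\<^sub>R x \<in> dirs \<gamma>" using link_subset_dirs[OF \<gamma>(3,4)] x(1) subspace_scale[OF subspace_dirs] by blast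
  have s'': "s' + k *\<^sub>R x \<in> link ?w s" by (rule link_dirs_inv[OF cv(1) \<gamma>(1) x(5) st(2) kx])
  have t'': "t' + k *\<^sub>R x \<in> link ?w t" by (rule link_dirs_inv[OF cv(2) \<gamma>(2) x(5) st(3) kx])
  obtain e1 where e1: "e1 > 0" "\<And>y. 0 \<le> y \<Longrightarrow> y < e1 \<Longrightarrow> ?w + y *\<^sub>R (s' + k *\<^sub>R x) \<in> s" using link_small[OF cv(1) w(3) s''] by blast
  obtain e2 where e2: "e2 > 0" "\<And>y. 0 \<le> y \<Longrightarrow> y < e2 \<Longrightarrow> ?w + y *\<^sub>R (t' + k *\<^sub>R x) \<in> t" using link_small[OF cv(2) w(4) t''] by blast
  have step: "x + \<epsilon> *\<^sub>R h \<in> link \<omega> \<rho>" if "convex \<rho>" "\<omega> \<in> \<rho>" "?w + (\<delta> * \<epsilon>) *\<^sub>R h \<in> \<rho>" for \<epsilon> h \<rho>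
  proof -
    have "(?w + (\<delta> * \<epsilon>) *\<^sub>R h) - \<omega> \<in> link \<omega> \<rho>" by (rule diff_in_link[OF that])
    then have "(1/\<delta>) *\<^sub>R ((?w + (\<delta> * \<epsilon>) *\<^sub>R h) - \<omega>) \<in> link \<omega> \<rho>" by (rule link_scale[OF that(1,2)]) (use x(4) in simp)
    moreover have "(1/\<delta>) *\<^sub>R ((?w + (\<delta> * \<epsilon>) *\<^sub>R h) - \<omega>) = x + \<epsilon> *\<^sub>R h" using x(4) by (simp add: scaleR_add_right)
    ultimately show ?thesis by simp
  qed
  have "(l *\<^sub>R a + \<epsilon> *\<^sub>R d1, l *\<^sub>R a + \<epsilon> *\<^sub>R d2) \<in> link \<omega> s \<times> link \<omega> t + diag {y. f \<bullet> y = 0}"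
    if \<epsilon>: "0 < \<epsilon>" "\<epsilon> < min e1 e2 / \<delta>" for \<epsilon>
  proof -
    have de: "\<delta> * \<epsilon> < e1" "\<delta> * \<epsilon> < e2" "0 \<le> \<delta> * \<epsilon>" using \<epsilon> x(4) by (auto simp: field_simps)
    define y where "y = l *\<^sub>R a - (x + \<epsilon> *\<^sub>R (q + k *\<^sub>R x))"
    have "f \<bullet> y = l - (l + \<epsilon> * (f \<bullet> q + k * l))" unfolding y_def using a x(2) by (simp add: inner_diff_right inner_add_right)
    also have "k * l = - (f \<bullet> q) * (l * l)" by (simp add: k_def)
    finally have fy: "f \<bullet> y = 0" using x(3) by simp
    have 1: "l *\<^sub>R a + \<epsilon> *\<^sub>R d1 - y = x + \<epsilon> *\<^sub>R (s' + k *\<^sub>R x)" unfolding y_def q_def by (simp add: algebra_simps)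
    have 2: "l *\<^sub>R a + \<epsilon> *\<^sub>R d2 - y = x + \<epsilon> *\<^sub>R (t' + k *\<^sub>R x)" unfolding y_def q by (simp add: algebra_simps)
    show ?thesis unfolding in_prod_plus_diag
      by (rule bexI[of _ y]) (use fy 1 2 step[OF cv(1) w(1) e1(2)[OF de(3,1)]] step[OF cv(2) w(2) e2(2)[OF de(3,2)]] in simp_all)
  qed
  moreover have "min e1 e2 / \<delta> > 0" using e1(1) e2(1) x(4) by simp
  ultimately show ?thesis unfolding eventually_at_right_field by blast
qed

text \<open>Links only grow from \<open>\<omega>\<close> to a relatively interior point of
  \<open>\<gamma>\<close>. The base point \<open>b\<close> and the diagonal translation cancel in
  the difference, and the factor \<open>\<epsilon>\<close> is removed because links are
  cones.\<close>

lemma displaced_in_imp: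
  fixes s t :: "(real ^ 'n) set"
  assumes cv: "convex s" "convex t" and \<gamma>: "\<gamma> \<subseteq> s" "\<gamma> \<subseteq> t" "\<omega> \<in> \<gamma>" "\<omega>' \<in> rel_interior \<gamma>" "\<epsilon> > 0"
    and z: "(b + \<epsilon> *\<^sub>R d1, b + \<epsilon> *\<^sub>R d2) \<in> link \<omega> s \<times> link \<omega> t + diag S"
  shows "d1 - d2 \<in> pointwise_diff (link \<omega>' s) (link \<omega>' t)"
proof -
  have w: "\<omega>' \<in> s" "\<omega>' \<in> t" using \<gamma> rel_interior_subset by blast+
  obtain y where y: "b + \<epsilon> *\<^sub>R d1 - y \<in> link \<omega> s" "b + \<epsilon> *\<^sub>R d2 - y \<in> link \<omega> t" using z unfolding in_prod_plus_diag by blast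
  have "(1/\<epsilon>) *\<^sub>R (b + \<epsilon> *\<^sub>R d1 - y) \<in> link \<omega>' s"
    by (rule link_scale[OF cv(1) w(1)]) (use y(1) link_rel_interior_mono[OF cv(1) \<gamma>(1,3,4)] \<gamma>(5) in auto)
  moreover have "(1/\<epsilon>) *\<^sub>R (b + \<epsilon> *\<^sub>R d2 - y) \<in> link \<omega>' t"
    by (rule link_scale[OF cv(2) w(2)]) (use y(2) link_rel_interior_mono[OF cv(2) \<gamma>(2,3,4)] \<gamma>(5) in auto)
  moreover have "d1 - d2 = (1/\<epsilon>) *\<^sub>R (b + \<epsilon> *\<^sub>R d1 - y) - (1/\<epsilon>) *\<^sub>R (b + \<epsilon> *\<^sub>R d2 - y)"
    using \<gamma>(5) by (simp add: algebra_simps)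
  ultimately show ?thesis unfolding pointwise_diff_def by blast
qed

text \<open>A line in a direction outside a subspace meets it at most once, wherever the line
  starts; so the base point \<open>x\<close> may itself lie in the subspaces.\<close>

lemma eventually_avoid_affine:
  fixes x d :: "'a::euclidean_space"
  assumes "finite \<A>" "\<And>A. A \<in> \<A> \<Longrightarrow> subspace A \<and> d \<notin> A"
  shows "\<forall>\<^sub>F \<epsilon> in at_right 0. \<forall>A\<in>\<A>. x + \<epsilon> *\<^sub>R d \<notin> A"
proof -
  have fin: "finite {t. \<exists>A\<in>\<A>. x + t *\<^sub>R d \<in> A}"
  proof (rule segment_finite_bad[OF assms(1)])
    fix A assume A: "A \<in> \<A>"
    show "affine A" using assms(2)[OF A] subspace_imp_affine by blast
    show "\<exists>t. x + t *\<^sub>R d \<notin> A"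
    proof (rule ccontr)
      assume "\<not> ?thesis"
      then have "x + 1 *\<^sub>R d \<in> A" "x + 0 *\<^sub>R d \<in> A" by blast+
      then have "(x + 1 *\<^sub>R d) - (x + 0 *\<^sub>R d) \<in> A" using assms(2)[OF A] subspace_diff by blast
      then show False using assms(2)[OF A] by simp
    qed
  qed
  have "\<forall>\<^sub>F \<epsilon> in at_right 0. \<forall>b\<in>{t. \<exists>A\<in>\<A>. x + t *\<^sub>R d \<in> A}. \<epsilon> \<noteq> b"
    using fin by (intro eventually_ball_finite) (auto simp: eventually_neq_at_within)
  then show ?thesis by eventually_elim blast
qed

section \<open>The facets around a ridge, tested against one functional\<close>

context
  fixes X Y :: "(real ^ 'n) weighted_complex" and p q :: nat
    and R :: "(real ^ 'n) set" and \<omega> :: "real ^ 'n"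
    and v :: "(real ^ 'n) set \<Rightarrow> real ^ 'n" and f :: "real ^ 'n" and d1 d2 :: "real ^ 'n"
  assumes X: "tropical_cycle p X" "positive X" and Y: "tropical_cycle q Y" "positive Y"
    and R: "R \<in> cells (stable_intersection X Y)" "int (dim (dirs R)) + 1 = int CARD('n) - int (p + q)" "\<omega> \<in> rel_interior R"
    and v: "\<And>\<gamma>. \<gamma> \<in> facets (cells (stable_intersection X Y)) \<Longrightarrow> R \<subseteq> \<gamma> \<Longrightarrow> primitive_normal R \<gamma> (v \<gamma>)"
    and f: "f \<in> zlat" "f \<noteq> 0" "\<And>y. y \<in> dirs R \<Longrightarrow> f \<bullet> y = 0"
    and d: "\<And>s t. s \<in> cells X \<Longrightarrow> t \<in> cells Y \<Longrightarrow> d1 - d2 \<in> dirs s + dirs t \<Longrightarrow> transversal s t"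
      "\<And>c. c \<in> link_prod \<omega> X Y \<Longrightarrow> (d1, d2) \<in> dirs c + diag {y. f \<bullet> y = 0} \<Longrightarrow> dirs c + diag {y. f \<bullet> y = 0} = UNIV"
begin

abbreviation "stable_cells \<equiv> cells (stable_intersection X Y)"
abbreviation "diag_ker \<equiv> diag {y. f \<bullet> y = 0}"
text \<open>Normalised by the value 1 of \<open>f\<close>, not by length: only the height with
  respect to \<open>f\<close> matters modulo \<open>diag_ker\<close>.\<close>

abbreviation "unit_normal \<equiv> (1 / (f \<bullet> f)) *\<^sub>R f"
text \<open>For \<open>r\<close> equal to 1 or -1 it starts on the diagonal at that height. The pair
  \<open>(d1, d2)\<close> makes it generic and, by its difference, imposes the displacement rule at
  the adjacent facets.\<close>

abbreviation "moving_point r \<epsilon> \<equiv> (r *\<^sub>R unit_normal + \<epsilon> *\<^sub>R d1, r *\<^sub>R unit_normal + \<epsilon> *\<^sub>R d2)"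

lemma inner_unit_normal: "f \<bullet> unit_normal = 1"
  using f(2) by simp

lemma subspace_ker: "subspace {y. f \<bullet> y = 0}"
  by (rule subspace_hyperplane)

lemma star_facet:
  assumes "\<gamma> \<in> facets stable_cells" "R \<subseteq> \<gamma>"
  shows "inward_primitive R \<gamma> (v \<gamma>)" "v \<gamma> \<in> link \<omega> \<gamma>" "\<omega> \<in> \<gamma>" "convex \<gamma>" "dim (dirs \<gamma>) \<le> dim (dirs R) + 1" "\<gamma> \<in> stable_cells"
proof -
  show gS: "\<gamma> \<in> stable_cells" by (rule facet_in_SI[OF X Y assms(1)])
  note CSS = convex_complex_SI[OF X Y]
  show cg: "convex \<gamma>" by (rule convex_complexD(3)[OF CSS gS])
  show "inward_primitive R \<gamma> (v \<gamma>)"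
    by (rule primitive_normal_inward[OF v[OF assms] convex_complexD(3)[OF CSS R(1)] convex_complexD(4)[OF CSS R(1)] cg assms(2)])
  show "v \<gamma> \<in> link \<omega> \<gamma>" using v[OF assms] R(3) unfolding primitive_normal_def by blast
  show "\<omega> \<in> \<gamma>" using R(3) rel_interior_subset assms(2) by blast
  show "dim (dirs \<gamma>) \<le> dim (dirs R) + 1" using SI_facet_dim[OF X Y assms(1)] R(2) by linarith
qed

text \<open>The vector \<open>x\<close> is a direction of \<open>s \<inter> t\<close> on which
  \<open>f\<close> is nonzero, so \<open>s \<inter> t\<close> is strictly larger than
  \<open>R\<close> in dimension and must be a facet. It reaches to the side of \<open>x\<close>, and
  its primitive normal points to the same side by \<open>wall_side_iff\<close>.\<close>

lemma star_direction:
  assumes s: "s \<in> facets (cells X)" "t \<in> facets (cells Y)" "\<omega> \<in> s" "\<omega> \<in> t" "transversal s t"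
    and x: "x \<in> link \<omega> s" "x \<in> link \<omega> t" "r * (f \<bullet> x) > 0"
  shows "s \<inter> t \<in> facets stable_cells" "R \<subseteq> s \<inter> t" "r * (f \<bullet> v (s \<inter> t)) > 0"
proof -
  note CSS = convex_complex_SI[OF X Y]
  have gS: "s \<inter> t \<in> stable_cells" by (rule transversal_in_SI[OF X Y s(1,2,5)]) (use s(3,4) in blast)
  show Rg: "R \<subseteq> s \<inter> t"
    using SI_carrier(1)[OF X Y R(1,3) facet_cell_X[OF X Y s(1)] s(3)] SI_carrier(2)[OF X Y R(1,3) facet_cell_Y[OF X Y s(2)] s(4)] by blast
  have cg: "convex (s \<inter> t)" by (rule convex_complexD(3)[OF CSS gS])
  have wg: "\<omega> \<in> s \<inter> t" using s(3,4) by blast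
  have xg: "x \<in> link \<omega> (s \<inter> t)" unfolding link_Int using x by blast
  then have "x \<in> dirs (s \<inter> t)" using link_subset_dirs[OF cg wg] by blast
  moreover have xR: "x \<notin> dirs R" using f(3) x(3) by auto
  ultimately have "dirs R \<subset> dirs (s \<inter> t)" using dirs_mono[OF Rg] by blast
  then have "dim (dirs R) < dim (dirs (s \<inter> t))"
    using dim_psubset[of "dirs R" "dirs (s \<inter> t)"] by (simp add: span_eq_iff[THEN iffD2])
  then have dimg: "int (dim (dirs (s \<inter> t))) = int CARD('n) - int (p + q)" using SI_dim_le[OF X Y gS] R(2) by linarith
  show gf: "s \<inter> t \<in> facets stable_cells" by (rule SI_facetI[OF X Y gS dimg])
  obtain e where e: "e > 0" "\<omega> + e *\<^sub>R x \<in> s \<inter> t" using xg link_iff[OF cg wg] by blast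
  have wR: "\<omega> \<in> R" using R(3) rel_interior_subset by blast
  have "(r *\<^sub>R f) \<bullet> \<omega> < (r *\<^sub>R f) \<bullet> (\<omega> + e *\<^sub>R x)"
    using e(1) x(3) by (simp add: inner_add_right distrib_left mult.left_commute)
  then have "s \<inter> t \<in> wall_side stable_cells R (r *\<^sub>R f)" by (rule wall_sideI[OF gf Rg wR e(2)])
  then have "(r *\<^sub>R f) \<bullet> v (s \<inter> t) > 0"
  proof (subst (asm) wall_side_iff[OF gf cg complex_face_subset[OF CSS gS R(1) Rg] _ star_facet(1)[OF gf Rg]])
    show "rational_subspace (dirs (s \<inter> t))"
      using rational_polyhedron_dirs[OF rational_polyhedron_Int[OF tropical_cycleD(5)[OF X(1) facet_cell_X[OF X Y s(1)]]
          tropical_cycleD(5)[OF Y(1) facet_cell_Y[OF X Y s(2)]]]] wg by blast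
  qed (use f(3) in auto)
  then show "r * (f \<bullet> v (s \<inter> t)) > 0" by simp
qed

lemma beyond_point:
  assumes "\<gamma> \<in> facets stable_cells" "R \<subseteq> \<gamma>" "x \<in> link \<omega> \<gamma>" "f \<bullet> x \<noteq> 0"
  shows "\<exists>\<delta>>0. \<omega> + \<delta> *\<^sub>R x \<in> rel_interior \<gamma>"
  by (rule rel_interior_beyond_ridge[OF convex_complex_SI[OF X Y] R(1,3) star_facet(6)[OF assms(1,2)] assms(2) star_facet(5)[OF assms(1,2)] assms(3)])
    (use f(3) assms(4) in auto)

text \<open>The pairs that the displacement \<open>d1 - d2\<close> selects at those facets around
  \<open>R\<close> whose primitive normal lies on the side of \<open>r\<close>.\<close>

definition star_pairs :: "real \<Rightarrow> ((real ^ 'n) set \<times> (real ^ 'n) set) set" where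
  "star_pairs r = {(s, t). (s, t) \<in> facet_pairs \<omega> X Y \<and> transversal s t \<and> s \<inter> t \<in> facets stable_cells \<and> R \<subseteq> s \<inter> t \<and>
     r * (f \<bullet> v (s \<inter> t)) > 0 \<and>
     (\<forall>\<omega>'\<in>rel_interior (s \<inter> t). d1 - d2 \<in> pointwise_diff (link \<omega>' s) (link \<omega>' t))}"

lemma generic_pts_eventually: "\<forall>\<^sub>F \<epsilon> in at_right 0. moving_point r \<epsilon> \<in> generic_pts (link_prod \<omega> X Y) diag_ker"
proof -
  let ?E = "link_prod \<omega> X Y"
  have fin: "finite ?E"
    by (rule convex_complexD(1)[OF balanced_complexD(1)[OF balanced_link_prod[OF X(1) Y(1)]]])
  let ?A = "(\<lambda>c. dirs c + diag_ker) ` {c\<in>?E. dirs c + diag_ker \<noteq> UNIV}"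
  have "\<forall>\<^sub>F \<epsilon> in at_right 0. \<forall>A\<in>?A. (r *\<^sub>R unit_normal, r *\<^sub>R unit_normal) + \<epsilon> *\<^sub>R (d1, d2) \<notin> A"
  proof (rule eventually_avoid_affine)
    show "finite ?A" using fin by simp
    show "subspace A \<and> (d1, d2) \<notin> A" if "A \<in> ?A" for A
      using that d(2) by (auto intro!: subspace_set_plus subspace_diag subspace_ker)
  qed
  then show ?thesis
  proof eventually_elim
    case (elim \<epsilon>)
    show ?case
    proof clarify
      fix c assume c: "c \<in> ?E" "moving_point r \<epsilon> \<in> c + diag_ker"
      obtain s t where st: "c = link \<omega> s \<times> link \<omega> t" "s \<in> cells X" "t \<in> cells Y" "\<omega> \<in> s" "\<omega> \<in> t"
        using c(1) unfolding link_prod_def prod_complex_def cells_link_at by blast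
      have "c \<subseteq> dirs s \<times> dirs t" unfolding st(1)
        using link_subset_dirs[OF convex_complexD(3)[OF convex_cells_X[OF X Y] st(2)] st(4)]
          link_subset_dirs[OF convex_complexD(3)[OF convex_cells_Y[OF X Y] st(3)] st(5)] by blast
      then have "c \<subseteq> dirs c"
        unfolding st(1) dirs_link_prod[OF convex_complexD(3)[OF convex_cells_X[OF X Y] st(2)] convex_complexD(3)[OF convex_cells_Y[OF X Y] st(3)] st(4,5)] .
      then have "moving_point r \<epsilon> \<in> dirs c + diag_ker" using c(2) set_plus_mono_left by blast
      moreover have "(r *\<^sub>R unit_normal, r *\<^sub>R unit_normal) + \<epsilon> *\<^sub>R (d1, d2) = moving_point r \<epsilon>" by simp
      ultimately show "dirs c + diag_ker = UNIV" using elim c(1) by (metis (mono_tags, lifting) image_eqI mem_Collect_eq)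
    qed
  qed
qed

lemma link_prod_diag_inv:
  assumes "c \<in> link_prod \<omega> X Y" "x \<in> c" "k \<in> diag (dirs R)"
  shows "x + k \<in> c"
proof -
  obtain s t where st: "c = link \<omega> s \<times> link \<omega> t" "s \<in> cells X" "t \<in> cells Y" "\<omega> \<in> s" "\<omega> \<in> t"
    using assms(1) unfolding link_prod_def prod_complex_def cells_link_at by blast
  obtain b b' l where e: "x = (b, b')" "k = (l, l)" "l \<in> dirs R" using assms(3) by (cases x) (auto simp: diag_def)
  have "b + l \<in> link \<omega> s"
    by (rule link_dirs_inv[OF convex_complexD(3)[OF convex_cells_X[OF X Y] st(2)] SI_carrier(1)[OF X Y R(1,3) st(2,4)] R(3) _ e(3)])
      (use assms(2) st(1) e(1) in auto)
  moreover have "b' + l \<in> link \<omega> t"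
    by (rule link_dirs_inv[OF convex_complexD(3)[OF convex_cells_Y[OF X Y] st(3)] SI_carrier(2)[OF X Y R(1,3) st(3,5)] R(3) _ e(3)])
      (use assms(2) st(1) e(1) in auto)
  ultimately show ?thesis using st(1) e by simp
qed

lemma diag_subset_diag_ker: "diag (dirs R) \<subseteq> diag_ker"
  using f(3) by (auto simp: diag_def)

lemma dim_diag_ker: "(int CARD('n) - int p) + (int CARD('n) - int q) + int (dim diag_ker) = int DIM((real ^ 'n) \<times> (real ^ 'n)) + int (dim (diag (dirs R)))"
proof -
  have "dim {y. f \<bullet> y = 0} = CARD('n) - 1" using dim_hyperplane[OF f(2)] by simp
  moreover have "CARD('n) \<ge> 1" by (simp add: Suc_leI)
  ultimately show ?thesis unfolding dim_diag using R(2) by simp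
qed

text \<open>A selected pair is reached by \<open>displaced_eventually_in\<close>. For any other
  pair, an image that is not full is missed by generic points, and a closed full image not
  containing the starting point is missed nearby. If it contains the starting point,
  \<open>star_direction\<close> supplies every other condition, so only the displacement can fail,
  and \<open>displaced_in_imp\<close> excludes the point.\<close>

lemma pair_eventually:
  assumes st: "(s, t) \<in> facet_pairs \<omega> X Y" and r: "r * r = 1"
  shows "\<forall>\<^sub>F \<epsilon> in at_right 0. moving_point r \<epsilon> \<in> link \<omega> s \<times> link \<omega> t + diag_ker \<longleftrightarrow> (s, t) \<in> star_pairs r"
proof -
  let ?C = "link \<omega> s \<times> link \<omega> t"
  have fp: "s \<in> facets (cells X)" "t \<in> facets (cells Y)" "\<omega> \<in> s" "\<omega> \<in> t" using st by (auto simp: facet_pairs_def)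
  have cv: "convex s" "convex t" by (rule facet_convex[OF X(1) fp(1)], rule facet_convex[OF Y(1) fp(2)])
  have pos: "\<forall>\<^sub>F \<epsilon> in at_right 0. (\<epsilon>::real) > 0" by (simp add: eventually_at_right_less)
  show ?thesis
  proof (cases "(s, t) \<in> star_pairs r")
    case True
    then have t0: "s \<inter> t \<in> facets stable_cells" "R \<subseteq> s \<inter> t" "r * (f \<bullet> v (s \<inter> t)) > 0"
      "\<And>\<omega>'. \<omega>' \<in> rel_interior (s \<inter> t) \<Longrightarrow> d1 - d2 \<in> pointwise_diff (link \<omega>' s) (link \<omega>' t)"
      by (auto simp: star_pairs_def)
    note sf = star_facet[OF t0(1,2)]
    \<comment> \<open>The primitive normal rescaled to height \<open>r\<close>; the height obtained
      is \<open>1 / r\<close>, which is \<open>r\<close> since \<open>r * r = 1\<close>.\<close>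
    define x where "x = (1 / (r * (f \<bullet> v (s \<inter> t)))) *\<^sub>R v (s \<inter> t)"
    have x: "x \<in> link \<omega> (s \<inter> t)" unfolding x_def by (rule link_scale[OF sf(4,3,2)]) (use t0(3) in simp)
    have "r \<noteq> 0" "f \<bullet> v (s \<inter> t) \<noteq> 0" using t0(3) by auto
    then have "f \<bullet> x = 1 / r" by (simp add: x_def)
    also have "\<dots> = r" using r \<open>r \<noteq> 0\<close> by (simp add: field_simps)
    finally have fx: "f \<bullet> x = r" .
    then have "f \<bullet> x \<noteq> 0" using \<open>r \<noteq> 0\<close> by simp
    then obtain \<delta> where \<delta>: "\<delta> > 0" "\<omega> + \<delta> *\<^sub>R x \<in> rel_interior (s \<inter> t)" using beyond_point[OF t0(1,2) x] by blast
    have "\<forall>\<^sub>F \<epsilon> in at_right 0. moving_point r \<epsilon> \<in> ?C + diag_ker"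
      by (rule displaced_eventually_in[OF cv Int_lower1 Int_lower2 sf(4,3) x fx r \<delta> inner_unit_normal t0(4)[OF \<delta>(2)]])
    then show ?thesis by eventually_elim (use True in simp)
  next
    case False
    have Cf: "?C \<in> facets (link_prod \<omega> X Y)" unfolding facets_link_prod[OF convex_cells_X[OF X Y] convex_cells_Y[OF X Y]] using fp by blast
    have CE: "?C \<in> link_prod \<omega> X Y" using Cf facets_subset by blast
    have "\<forall>\<^sub>F \<epsilon> in at_right 0. moving_point r \<epsilon> \<notin> ?C + diag_ker"
    proof (cases "dirs ?C + diag_ker = UNIV")
      case nf: False
      show ?thesis using generic_pts_eventually[of r] by eventually_elim (use nf CE in blast)
    next
      case full: True
      have dC: "dirs ?C = dirs s \<times> dirs t" by (rule dirs_link_prod[OF cv fp(3,4)])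
      have tr: "transversal s t" using full unfolding dC prod_plus_diag_full[OF subspace_dirs subspace_dirs subspace_ker] by blast
      have dims: "dim (dirs c) + dim diag_ker = DIM((real ^ 'n) \<times> (real ^ 'n)) + dim (diag (dirs R))" if "c \<in> facets (link_prod \<omega> X Y)" for c
        using balanced_complexD(3)[OF balanced_link_prod[OF X(1) Y(1)] that] dim_diag_ker by linarith
      have cl: "closed (?C + diag_ker)"
      proof (rule closed_full[where E = "link_prod \<omega> X Y" and K = "diag (dirs R)"])
        show "convex_complex (link_prod \<omega> X Y)" by (rule balanced_complexD(1)[OF balanced_link_prod[OF X(1) Y(1)]])
      qed (fact link_prod_diag_inv dims Cf full diag_subset_diag_ker subspace_diag[OF subspace_ker] subspace_diag[OF subspace_dirs])+
      show ?thesis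
      proof (cases "(r *\<^sub>R unit_normal, r *\<^sub>R unit_normal) \<in> ?C + diag_ker")
        case out: False
        have "((\<lambda>\<epsilon>. moving_point r \<epsilon>) \<longlongrightarrow> (r *\<^sub>R unit_normal + 0 *\<^sub>R d1, r *\<^sub>R unit_normal + 0 *\<^sub>R d2)) (at_right 0)"
          by (intro tendsto_intros)
        moreover have "open (- (?C + diag_ker))" using cl by (simp add: open_Compl)
        ultimately have "\<forall>\<^sub>F \<epsilon> in at_right 0. moving_point r \<epsilon> \<in> - (?C + diag_ker)"
          using out by (intro topological_tendstoD) auto
        then show ?thesis by eventually_elim simp
      next
        case inn: True
        then obtain y where y: "f \<bullet> y = 0" "r *\<^sub>R unit_normal - y \<in> link \<omega> s" "r *\<^sub>R unit_normal - y \<in> link \<omega> t" unfolding in_prod_plus_diag by blast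
        have fx: "f \<bullet> (r *\<^sub>R unit_normal - y) = r" using y(1) inner_unit_normal by (simp add: inner_diff_right del: inner_scaleR_right) (simp add: f(2))
        have sd: "s \<inter> t \<in> facets stable_cells" "R \<subseteq> s \<inter> t" "r * (f \<bullet> v (s \<inter> t)) > 0"
        proof -
          have "r * (f \<bullet> (r *\<^sub>R unit_normal - y)) > 0" unfolding fx using r by simp
          from star_direction[OF fp tr y(2,3) this]
          show "s \<inter> t \<in> facets stable_cells" "R \<subseteq> s \<inter> t" "r * (f \<bullet> v (s \<inter> t)) > 0" by auto
        qed
        obtain \<omega>' where \<omega>': "\<omega>' \<in> rel_interior (s \<inter> t)" "d1 - d2 \<notin> pointwise_diff (link \<omega>' s) (link \<omega>' t)"
          using False st tr sd unfolding star_pairs_def by blast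
        show ?thesis using pos
        proof eventually_elim
          case (elim \<epsilon>)
          then show ?case
            using displaced_in_imp[OF cv Int_lower1 Int_lower2 star_facet(3)[OF sd(1,2)] \<omega>'(1) elim] \<omega>'(2) by blast
        qed
      qed
    qed
    then show ?thesis by eventually_elim (use False in simp)
  qed
qed

text \<open>A pair selected at a relatively interior point of a facet \<open>\<gamma>\<close> is
  transversal, as \<open>d1 - d2\<close> is generic there, and so it meets exactly in
  \<open>\<gamma>\<close>. Hence the facet is determined by the pair, and the sets in the union are
  disjoint.\<close>

lemma star_pairs_Union:
  fixes \<omega>' :: "(real ^ 'n) set \<Rightarrow> real ^ 'n"
  assumes \<omega>': "\<And>\<gamma>. \<gamma> \<in> facets stable_cells \<Longrightarrow> \<omega>' \<gamma> \<in> rel_interior \<gamma>"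
  shows "star_pairs r = (\<Union>\<gamma>\<in>{\<gamma>\<in>facets stable_cells. R \<subseteq> \<gamma> \<and> r * (f \<bullet> v \<gamma>) > 0}.
    {(s, t). (s, t) \<in> facet_pairs (\<omega>' \<gamma>) X Y \<and> d1 - d2 \<in> pointwise_diff (link (\<omega>' \<gamma>) s) (link (\<omega>' \<gamma>) t)})"
    (is "_ = (\<Union>\<gamma>\<in>?G. ?P \<gamma>)")
    and "\<And>\<gamma> s t. \<gamma> \<in> facets stable_cells \<Longrightarrow> R \<subseteq> \<gamma> \<Longrightarrow> (s, t) \<in> facet_pairs (\<omega>' \<gamma>) X Y \<Longrightarrow>
      d1 - d2 \<in> pointwise_diff (link (\<omega>' \<gamma>) s) (link (\<omega>' \<gamma>) t) \<Longrightarrow> transversal s t \<and> s \<inter> t = \<gamma>"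
proof -
  have *: "transversal s t \<and> s \<inter> t = \<gamma>"
    if \<gamma>: "\<gamma> \<in> facets stable_cells" "R \<subseteq> \<gamma>" and st: "(s, t) \<in> facet_pairs (\<omega>' \<gamma>) X Y"
      "d1 - d2 \<in> pointwise_diff (link (\<omega>' \<gamma>) s) (link (\<omega>' \<gamma>) t)" for \<gamma> s t
  proof -
    have fp: "s \<in> facets (cells X)" "t \<in> facets (cells Y)" "\<omega>' \<gamma> \<in> s" "\<omega>' \<gamma> \<in> t" using st(1) by (auto simp: facet_pairs_def)
    have "generic (link_at (\<omega>' \<gamma>) X) (link_at (\<omega>' \<gamma>) Y) (d1 - d2)"
      by (rule avoid_nontransversal_generic[OF convex_cells_X[OF X Y] convex_cells_Y[OF X Y] d(1)])
    then have tr: "transversal s t"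
      unfolding generic_link_at_iff[OF convex_cells_X[OF X Y] convex_cells_Y[OF X Y]] using st(2) fp facet_cell_X[OF X Y fp(1)] facet_cell_Y[OF X Y fp(2)] by blast
    have "\<gamma> \<subseteq> s \<inter> t"
      using SI_carrier(1)[OF X Y facet_in_SI[OF X Y \<gamma>(1)] \<omega>'[OF \<gamma>(1)] facet_cell_X[OF X Y fp(1)] fp(3)]
        SI_carrier(2)[OF X Y facet_in_SI[OF X Y \<gamma>(1)] \<omega>'[OF \<gamma>(1)] facet_cell_Y[OF X Y fp(2)] fp(4)] by blast
    then show ?thesis using tr SI_facet_pair(1)[OF X Y \<gamma>(1) fp(1,2) tr] by blast
  qed
  then show "\<And>\<gamma> s t. \<gamma> \<in> facets stable_cells \<Longrightarrow> R \<subseteq> \<gamma> \<Longrightarrow> (s, t) \<in> facet_pairs (\<omega>' \<gamma>) X Y \<Longrightarrow>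
      d1 - d2 \<in> pointwise_diff (link (\<omega>' \<gamma>) s) (link (\<omega>' \<gamma>) t) \<Longrightarrow> transversal s t \<and> s \<inter> t = \<gamma>" .
  show "star_pairs r = (\<Union>\<gamma>\<in>?G. ?P \<gamma>)"
  proof (intro subset_antisym subsetI)
    fix x assume "x \<in> star_pairs r"
    then obtain s t where t0: "x = (s, t)" "(s, t) \<in> facet_pairs \<omega> X Y" "s \<inter> t \<in> facets stable_cells" "R \<subseteq> s \<inter> t"
      "r * (f \<bullet> v (s \<inter> t)) > 0" "\<forall>\<omega>'\<in>rel_interior (s \<inter> t). d1 - d2 \<in> pointwise_diff (link \<omega>' s) (link \<omega>' t)"
      unfolding star_pairs_def by blast
    have "\<omega>' (s \<inter> t) \<in> s \<inter> t" using \<omega>'[OF t0(3)] rel_interior_subset by blast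
    then have "(s, t) \<in> facet_pairs (\<omega>' (s \<inter> t)) X Y" using t0(2) by (auto simp: facet_pairs_def)
    then have "x \<in> ?P (s \<inter> t)" using t0(1,6) \<omega>'[OF t0(3)] by blast
    moreover have "s \<inter> t \<in> ?G" using t0(3-5) by blast
    ultimately show "x \<in> (\<Union>\<gamma>\<in>?G. ?P \<gamma>)" by (rule UN_I[rotated])
  next
    fix x assume "x \<in> (\<Union>\<gamma>\<in>?G. ?P \<gamma>)"
    then obtain \<gamma> s t where t0: "\<gamma> \<in> facets stable_cells" "R \<subseteq> \<gamma>" "r * (f \<bullet> v \<gamma>) > 0" "x = (s, t)" "(s, t) \<in> facet_pairs (\<omega>' \<gamma>) X Y"
      "d1 - d2 \<in> pointwise_diff (link (\<omega>' \<gamma>) s) (link (\<omega>' \<gamma>) t)" by blast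
    have tr: "transversal s t" "s \<inter> t = \<gamma>" using *[OF t0(1,2,5,6)] by auto
    have fp: "s \<in> facets (cells X)" "t \<in> facets (cells Y)" using t0(5) by (auto simp: facet_pairs_def)
    have "(s, t) \<in> facet_pairs \<omega> X Y" using fp star_facet(3)[OF t0(1,2)] tr(2) by (auto simp: facet_pairs_def)
    moreover have "d1 - d2 \<in> pointwise_diff (link \<omega>'' s) (link \<omega>'' t)" if w: "\<omega>'' \<in> rel_interior (s \<inter> t)" for \<omega>''
    proof -
      have "link \<omega>'' s = link (\<omega>' \<gamma>) s"
        by (rule link_rel_interior_eq[OF facet_convex[OF X(1) fp(1)] Int_lower1 w]) (use \<omega>'[OF t0(1)] tr(2) in simp)
      moreover have "link \<omega>'' t = link (\<omega>' \<gamma>) t"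
        by (rule link_rel_interior_eq[OF facet_convex[OF Y(1) fp(2)] Int_lower2 w]) (use \<omega>'[OF t0(1)] tr(2) in simp)
      ultimately show ?thesis using t0(6) by simp
    qed
    ultimately show "x \<in> star_pairs r" unfolding star_pairs_def using t0(1-4) tr by blast
  qed
qed

text \<open>In \<open>idx_prod_diag\<close> the second factor is the index of the lattice generated
  by the kernel of \<open>f\<close> and the directions of \<open>s \<inter> t\<close>. Those along
  \<open>R\<close> are already in the kernel, so only the primitive normal counts, with its height
  times \<open>\<kappa>\<close>.\<close>

lemma star_weight:
  assumes \<kappa>: "\<forall>w\<in>zlat. f \<bullet> w \<noteq> 0 \<longrightarrow> real (idx zlat {b + of_int i *\<^sub>R w | b i. b \<in> {y. f \<bullet> y = 0} \<inter> zlat}) = \<kappa> * \<bar>f \<bullet> w\<bar>"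
    and st: "(s, t) \<in> star_pairs r"
  shows "link_prod_mult \<omega> X Y (link \<omega> s \<times> link \<omega> t) * real (idx zlat (plat (link \<omega> s \<times> link \<omega> t) diag_ker)) =
    \<kappa> * \<bar>f \<bullet> v (s \<inter> t)\<bar> * real_of_rat (facet_mult X s * facet_mult Y t * of_nat (lattice_index s t))"
proof -
  let ?\<gamma> = "s \<inter> t"
  have t0: "(s, t) \<in> facet_pairs \<omega> X Y" "transversal s t" "?\<gamma> \<in> facets stable_cells" "R \<subseteq> ?\<gamma>" "r * (f \<bullet> v ?\<gamma>) > 0"
    using st unfolding star_pairs_def by blast+
  have fp: "s \<in> facets (cells X)" "t \<in> facets (cells Y)" "\<omega> \<in> s" "\<omega> \<in> t" using t0(1) by (auto simp: facet_pairs_def)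
  have cv: "convex s" "convex t" by (rule facet_convex[OF X(1) fp(1)], rule facet_convex[OF Y(1) fp(2)])
  note ip = star_facet(1)[OF t0(3,4)]
  have lat: "dirs ?\<gamma> \<inter> zlat = {w + of_int i *\<^sub>R v ?\<gamma> | w i. w \<in> dirs R \<inter> zlat}" using ip unfolding inward_primitive_def by blast
  have dg: "dirs s \<inter> dirs t = dirs ?\<gamma>" by (rule SI_facet_pair(2)[OF X Y t0(3) fp(1,2) t0(2)]) simp
  have "{b + c | b c. b \<in> (dirs s \<inter> dirs t) \<inter> zlat \<and> c \<in> {y. f \<bullet> y = 0} \<inter> zlat} =
      {b + of_int i *\<^sub>R v ?\<gamma> | b i. b \<in> {y. f \<bullet> y = 0} \<inter> zlat}"
  proof (intro subset_antisym subsetI)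
    fix x assume "x \<in> {b + c | b c. b \<in> (dirs s \<inter> dirs t) \<inter> zlat \<and> c \<in> {y. f \<bullet> y = 0} \<inter> zlat}"
    then obtain w i c where x: "x = (w + of_int i *\<^sub>R v ?\<gamma>) + c" "w \<in> dirs R" "w \<in> zlat" "f \<bullet> c = 0" "c \<in> zlat"
      unfolding dg lat by blast
    have "w + c \<in> {y. f \<bullet> y = 0} \<inter> zlat" using x(2-5) f(3) add_subgroup_add[OF add_subgroup_zlat] by (simp add: inner_add_right)
    moreover have "x = (w + c) + of_int i *\<^sub>R v ?\<gamma>" using x(1) by simp
    ultimately show "x \<in> {b + of_int i *\<^sub>R v ?\<gamma> | b i. b \<in> {y. f \<bullet> y = 0} \<inter> zlat}" by blast
  next
    fix x assume "x \<in> {b + of_int i *\<^sub>R v ?\<gamma> | b i. b \<in> {y. f \<bullet> y = 0} \<inter> zlat}"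
    then obtain b i where x: "x = b + of_int i *\<^sub>R v ?\<gamma>" "b \<in> {y. f \<bullet> y = 0} \<inter> zlat" by blast
    have "0 + of_int i *\<^sub>R v ?\<gamma> \<in> dirs ?\<gamma> \<inter> zlat"
      unfolding lat using add_subgroup_0[OF add_subgroup_zlat] subspace_0[OF subspace_dirs] by blast
    then have "(0 + of_int i *\<^sub>R v ?\<gamma>) + b \<in> {b + c | b c. b \<in> (dirs s \<inter> dirs t) \<inter> zlat \<and> c \<in> {y. f \<bullet> y = 0} \<inter> zlat}"
      unfolding dg using x(2) by blast
    then show "x \<in> {b + c | b c. b \<in> (dirs s \<inter> dirs t) \<inter> zlat \<and> c \<in> {y. f \<bullet> y = 0} \<inter> zlat}" using x(1) by (simp add: add.commute)
  qed
  then have "idx zlat (plat (link \<omega> s \<times> link \<omega> t) diag_ker) =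
      lattice_index s t * idx zlat {b + of_int i *\<^sub>R v ?\<gamma> | b i. b \<in> {y. f \<bullet> y = 0} \<inter> zlat}"
    using idx_prod_diag[OF subspace_dirs subspace_dirs subspace_ker, of s t]
    unfolding plat_def dirs_link_prod[OF cv fp(3,4)] lattice_index_eq by (simp only:)
  moreover have "f \<bullet> v ?\<gamma> \<noteq> 0" using t0(5) by auto
  ultimately have "real (idx zlat (plat (link \<omega> s \<times> link \<omega> t) diag_ker)) = real (lattice_index s t) * (\<kappa> * \<bar>f \<bullet> v ?\<gamma>\<bar>)"
    using \<kappa> inward_primitive_mem(1)[OF ip] by simp
  then show ?thesis
    using link_prod_mult_eq[OF convex_cells_X[OF X Y] convex_cells_Y[OF X Y] facet_cell_X[OF X Y fp(1)] facet_cell_Y[OF X Y fp(2)] fp(3,4)] by (simp add: of_rat_mult)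
qed

text \<open>Grouping the selected pairs by the facet in which they meet turns the degree at the
  ridge into displacement multiplicities of the adjacent facets, each scaled by
  \<open>\<kappa>\<close> and the height of its normal. There are finitely many pairs, so one small
  \<open>\<epsilon>\<close> serves all of them.\<close>

lemma star_degree:
  assumes \<kappa>: "\<forall>w\<in>zlat. f \<bullet> w \<noteq> 0 \<longrightarrow> real (idx zlat {b + of_int i *\<^sub>R w | b i. b \<in> {y. f \<bullet> y = 0} \<inter> zlat}) = \<kappa> * \<bar>f \<bullet> w\<bar>"
    and r: "r * r = 1"
  shows "\<forall>\<^sub>F \<epsilon> in at_right 0. (\<Sum>c | c \<in> facets (link_prod \<omega> X Y) \<and> moving_point r \<epsilon> \<in> c + diag_ker. link_prod_mult \<omega> X Y c * real (idx zlat (plat c diag_ker))) =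
    \<kappa> * (\<Sum>\<gamma> | \<gamma> \<in> facets stable_cells \<and> R \<subseteq> \<gamma> \<and> r * (f \<bullet> v \<gamma>) > 0. \<bar>f \<bullet> v \<gamma>\<bar> * of_rat (facet_mult (stable_intersection X Y) \<gamma>))"
proof -
  let ?g = "\<lambda>(s, t). link_prod_mult \<omega> X Y (link \<omega> s \<times> link \<omega> t) * real (idx zlat (plat (link \<omega> s \<times> link \<omega> t) diag_ker))"
  let ?h = "\<lambda>(s, t). real_of_rat (facet_mult X s * facet_mult Y t * of_nat (lattice_index s t))"
  let ?G = "{\<gamma>\<in>facets stable_cells. R \<subseteq> \<gamma> \<and> r * (f \<bullet> v \<gamma>) > 0}"
  have "\<exists>w. w \<in> rel_interior \<gamma>" if "\<gamma> \<in> facets stable_cells" for \<gamma>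
    using convex_complexD(3,4)[OF convex_complex_SI[OF X Y] facet_in_SI[OF X Y that]] rel_interior_eq_empty by blast
  then obtain \<omega>' where \<omega>': "\<And>\<gamma>. \<gamma> \<in> facets stable_cells \<Longrightarrow> \<omega>' \<gamma> \<in> rel_interior \<gamma>" by metis
  let ?P = "\<lambda>\<gamma>. {(s, t). (s, t) \<in> facet_pairs (\<omega>' \<gamma>) X Y \<and> d1 - d2 \<in> pointwise_diff (link (\<omega>' \<gamma>) s) (link (\<omega>' \<gamma>) t)}"
  have spU: "star_pairs r = (\<Union>\<gamma>\<in>?G. ?P \<gamma>)" by (rule star_pairs_Union(1)) (fact \<omega>')
  have sp2: "transversal s t \<and> s \<inter> t = \<gamma>" if "\<gamma> \<in> facets stable_cells" "R \<subseteq> \<gamma>" "(s, t) \<in> facet_pairs (\<omega>' \<gamma>) X Y"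
    "d1 - d2 \<in> pointwise_diff (link (\<omega>' \<gamma>) s) (link (\<omega>' \<gamma>) t)" for \<gamma> s t
    by (rule star_pairs_Union(2)) (fact \<omega>' that)+
  have finG: "finite ?G" using convex_complexD(1)[OF convex_complex_SI[OF X Y]] facets_subset[of stable_cells] by (auto intro: finite_subset)
  have finP: "finite (?P \<gamma>)" for \<gamma> by (rule finite_subset[OF _ finite_facet_pairs[OF convex_cells_X[OF X Y] convex_cells_Y[OF X Y]]]) auto
  have "sum ?g (star_pairs r) = (\<Sum>\<gamma>\<in>?G. sum ?g (?P \<gamma>))"
    unfolding spU
  proof (rule sum.UNION_disjoint[OF finG])
    show "\<forall>\<gamma>\<in>?G. finite (?P \<gamma>)" using finP by blast
    show "\<forall>\<gamma>\<in>?G. \<forall>\<gamma>'\<in>?G. \<gamma> \<noteq> \<gamma>' \<longrightarrow> ?P \<gamma> \<inter> ?P \<gamma>' = {}"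
    proof (intro ballI impI equals0I)
      fix \<gamma> \<gamma>' x assume g: "\<gamma> \<in> ?G" "\<gamma>' \<in> ?G" "\<gamma> \<noteq> \<gamma>'" and "x \<in> ?P \<gamma> \<inter> ?P \<gamma>'"
      then obtain s t where "(s, t) \<in> facet_pairs (\<omega>' \<gamma>) X Y" "d1 - d2 \<in> pointwise_diff (link (\<omega>' \<gamma>) s) (link (\<omega>' \<gamma>) t)"
        "(s, t) \<in> facet_pairs (\<omega>' \<gamma>') X Y" "d1 - d2 \<in> pointwise_diff (link (\<omega>' \<gamma>') s) (link (\<omega>' \<gamma>') t)" by blast
      then have "s \<inter> t = \<gamma>" "s \<inter> t = \<gamma>'" using sp2[of \<gamma> s t] sp2[of \<gamma>' s t] g(1,2) by simp_all
      then show False using g(3) by simp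
    qed
  qed
  also have "\<dots> = (\<Sum>\<gamma>\<in>?G. \<kappa> * (\<bar>f \<bullet> v \<gamma>\<bar> * of_rat (facet_mult (stable_intersection X Y) \<gamma>)))"
  proof (rule sum.cong[OF refl])
    fix \<gamma> assume \<gamma>: "\<gamma> \<in> ?G"
    have "sum ?g (?P \<gamma>) = (\<Sum>x\<in>?P \<gamma>. \<kappa> * \<bar>f \<bullet> v \<gamma>\<bar> * ?h x)"
    proof (rule sum.cong[OF refl])
      fix x assume x: "x \<in> ?P \<gamma>"
      then obtain s t where st: "x = (s, t)" "(s, t) \<in> facet_pairs (\<omega>' \<gamma>) X Y" "d1 - d2 \<in> pointwise_diff (link (\<omega>' \<gamma>) s) (link (\<omega>' \<gamma>) t)" by blast
      have eq: "s \<inter> t = \<gamma>" using sp2[of \<gamma> s t] \<gamma> st(2,3) by simp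
      have "x \<in> star_pairs r" unfolding spU using \<gamma> x by blast
      then show "?g x = \<kappa> * \<bar>f \<bullet> v \<gamma>\<bar> * ?h x" unfolding st(1) split_conv using star_weight[OF \<kappa>, of s t r] eq by simp
    qed
    also have "\<dots> = \<kappa> * \<bar>f \<bullet> v \<gamma>\<bar> * sum ?h (?P \<gamma>)" by (simp add: sum_distrib_left)
    also have "sum ?h (?P \<gamma>) = real_of_rat (displacement_mult (link_at (\<omega>' \<gamma>) X) (link_at (\<omega>' \<gamma>) Y) (d1 - d2))"
      unfolding displacement_mult_link_at[OF X(1) Y(1)] of_rat_sum by (rule sum.cong) auto
    also have "displacement_mult (link_at (\<omega>' \<gamma>) X) (link_at (\<omega>' \<gamma>) Y) (d1 - d2) = facet_mult (stable_intersection X Y) \<gamma>"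
    proof (rule facet_mult_stable_intersection[OF X Y _ _, symmetric])
      show "\<gamma> \<in> facets stable_cells" "\<omega>' \<gamma> \<in> rel_interior \<gamma>" using \<gamma> \<omega>' by auto
      show "generic (link_at (\<omega>' \<gamma>) X) (link_at (\<omega>' \<gamma>) Y) (d1 - d2)"
        by (rule avoid_nontransversal_generic[OF convex_cells_X[OF X Y] convex_cells_Y[OF X Y] d(1)])
    qed
    finally show "sum ?g (?P \<gamma>) = \<kappa> * (\<bar>f \<bullet> v \<gamma>\<bar> * of_rat (facet_mult (stable_intersection X Y) \<gamma>))" by simp
  qed
  also have "\<dots> = \<kappa> * (\<Sum>\<gamma>\<in>?G. \<bar>f \<bullet> v \<gamma>\<bar> * of_rat (facet_mult (stable_intersection X Y) \<gamma>))"
    by (simp add: sum_distrib_left)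
  finally have main: "sum ?g (star_pairs r) = \<kappa> * (\<Sum>\<gamma>\<in>?G. \<bar>f \<bullet> v \<gamma>\<bar> * of_rat (facet_mult (stable_intersection X Y) \<gamma>))" .
  have "\<forall>\<^sub>F \<epsilon> in at_right 0. \<forall>x\<in>facet_pairs \<omega> X Y. case x of (s, t) \<Rightarrow> moving_point r \<epsilon> \<in> link \<omega> s \<times> link \<omega> t + diag_ker \<longleftrightarrow> (s, t) \<in> star_pairs r"
  proof (rule eventually_ball_finite[OF finite_facet_pairs[OF convex_cells_X[OF X Y] convex_cells_Y[OF X Y]]], rule ballI)
    fix x assume x: "x \<in> facet_pairs \<omega> X Y"
    obtain s t where e: "x = (s, t)" by (cases x)
    show "\<forall>\<^sub>F \<epsilon> in at_right 0. case x of (s, t) \<Rightarrow> moving_point r \<epsilon> \<in> link \<omega> s \<times> link \<omega> t + diag_ker \<longleftrightarrow> (s, t) \<in> star_pairs r"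
      using pair_eventually[OF x[unfolded e] r] unfolding e split_conv .
  qed
  then show ?thesis
  proof eventually_elim
    case (elim \<epsilon>)
    have sub: "star_pairs r \<subseteq> facet_pairs \<omega> X Y" unfolding star_pairs_def by blast
    have "{(s, t). (s, t) \<in> facet_pairs \<omega> X Y \<and> moving_point r \<epsilon> \<in> link \<omega> s \<times> link \<omega> t + diag_ker} = star_pairs r"
    proof -
      have iff: "moving_point r \<epsilon> \<in> link \<omega> s \<times> link \<omega> t + diag_ker \<longleftrightarrow> (s, t) \<in> star_pairs r" if "(s, t) \<in> facet_pairs \<omega> X Y" for s t
        using bspec[OF elim that] by simp
      have "(s, t) \<in> facet_pairs \<omega> X Y \<and> moving_point r \<epsilon> \<in> link \<omega> s \<times> link \<omega> t + diag_ker \<longleftrightarrow> (s, t) \<in> star_pairs r" for s t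
        using iff[of s t] subsetD[OF sub, of "(s, t)"] by blast
      then show ?thesis by (simp only:) simp
    qed
    then show ?case unfolding sum_facets_link_prod[OF convex_cells_X[OF X Y] convex_cells_Y[OF X Y]] using main by simp
  qed
qed

text \<open>The degrees at heights 1 and -1 agree, and their difference is \<open>\<kappa>\<close>
  times the sum in question. It remains to cancel \<open>\<kappa>\<close>, or to note that all
  heights vanish.\<close>

theorem star_balanced:
  "(\<Sum>\<gamma> | \<gamma> \<in> facets stable_cells \<and> R \<subseteq> \<gamma>. (f \<bullet> v \<gamma>) * of_rat (facet_mult (stable_intersection X Y) \<gamma>)) = 0"
proof -
  let ?m = "\<lambda>\<gamma>. real_of_rat (facet_mult (stable_intersection X Y) \<gamma>)"
  let ?G = "\<lambda>r. {\<gamma>. \<gamma> \<in> facets stable_cells \<and> R \<subseteq> \<gamma> \<and> r * (f \<bullet> v \<gamma>) > 0}"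
  let ?T = "\<lambda>r. \<Sum>\<gamma>\<in>?G r. \<bar>f \<bullet> v \<gamma>\<bar> * ?m \<gamma>"
  have A: "add_subgroup ({y. f \<bullet> y = 0} \<inter> zlat)"
    by (intro add_subgroup_Int subspace_imp_add_subgroup subspace_ker add_subgroup_zlat)
  obtain \<kappa> where \<kappa>: "\<forall>w\<in>zlat. f \<bullet> w \<noteq> 0 \<longrightarrow> real (idx zlat {b + of_int i *\<^sub>R w | b i. b \<in> {y. f \<bullet> y = 0} \<inter> zlat}) = \<kappa> * \<bar>f \<bullet> w\<bar>"
    using idx_hyperplane[OF f(1,2) A] by blast
  have rM: "rational_subspace {y. f \<bullet> y = 0}" using rational_subspace_hyperplane[OF rational_subspace_UNIV f(1)] by simp
  have "\<forall>\<^sub>F \<epsilon> in at_right (0::real). \<kappa> * ?T 1 = \<kappa> * ?T (- 1)"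
    using star_degree[OF \<kappa>, of 1] star_degree[OF \<kappa>, of "- 1"] generic_pts_eventually[of 1] generic_pts_eventually[of "- 1"]
  proof -
    have r: "(1::real) * 1 = 1" "(- 1::real) * (- 1) = 1" by simp_all
    show ?thesis
      using star_degree[OF \<kappa> r(1)] star_degree[OF \<kappa> r(2)] generic_pts_eventually[of 1] generic_pts_eventually[of "- 1"]
    proof eventually_elim
      case (elim \<epsilon>)
      have "(\<Sum>c | c \<in> facets (link_prod \<omega> X Y) \<and> moving_point 1 \<epsilon> \<in> c + diag_ker. link_prod_mult \<omega> X Y c * real (idx zlat (plat c diag_ker))) =
          (\<Sum>c | c \<in> facets (link_prod \<omega> X Y) \<and> moving_point (- 1) \<epsilon> \<in> c + diag_ker. link_prod_mult \<omega> X Y c * real (idx zlat (plat c diag_ker)))"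
      proof (rule lattice_degree_constant[where K = "diag (dirs R)"])
        show "balanced_complex (link_prod \<omega> X Y) (link_prod_mult \<omega> X Y) ((int CARD('n) - int p) + (int CARD('n) - int q))"
          by (rule balanced_link_prod[OF X(1) Y(1)])
        show "rational_subspace diag_ker" by (rule rational_diag[OF rM])
      qed (fact diag_subset_diag_ker link_prod_diag_inv dim_diag_ker elim subspace_diag[OF subspace_dirs])+
      then show ?case using elim(1,2) by simp
    qed
  qed
  then have eq: "\<kappa> * ?T 1 = \<kappa> * ?T (- 1)" by simp
  have finF: "finite {\<gamma>. \<gamma> \<in> facets stable_cells \<and> R \<subseteq> \<gamma>}"
    using convex_complexD(1)[OF convex_complex_SI[OF X Y]] facets_subset[of stable_cells] by (auto intro: finite_subset)
  have split: "(\<Sum>\<gamma> | \<gamma> \<in> facets stable_cells \<and> R \<subseteq> \<gamma>. (f \<bullet> v \<gamma>) * ?m \<gamma>) = ?T 1 - ?T (- 1)"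
  proof -
    have "(\<Sum>\<gamma> | \<gamma> \<in> facets stable_cells \<and> R \<subseteq> \<gamma>. (f \<bullet> v \<gamma>) * ?m \<gamma>) = (\<Sum>\<gamma>\<in>?G 1 \<union> ?G (- 1). (f \<bullet> v \<gamma>) * ?m \<gamma>)"
      by (rule sum.mono_neutral_right[OF finF]) auto
    also have "\<dots> = (\<Sum>\<gamma>\<in>?G 1. (f \<bullet> v \<gamma>) * ?m \<gamma>) + (\<Sum>\<gamma>\<in>?G (- 1). (f \<bullet> v \<gamma>) * ?m \<gamma>)"
      by (rule sum.union_disjoint) (auto intro: finite_subset[OF _ finF])
    also have "(\<Sum>\<gamma>\<in>?G 1. (f \<bullet> v \<gamma>) * ?m \<gamma>) = ?T 1" by (rule sum.cong) auto
    also have "(\<Sum>\<gamma>\<in>?G (- 1). (f \<bullet> v \<gamma>) * ?m \<gamma>) = (\<Sum>\<gamma>\<in>?G (- 1). - (\<bar>f \<bullet> v \<gamma>\<bar> * ?m \<gamma>))" by (rule sum.cong) auto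
    finally show ?thesis by (simp add: sum_negf)
  qed
  show ?thesis
  proof (cases "\<exists>\<gamma>. \<gamma> \<in> facets stable_cells \<and> R \<subseteq> \<gamma> \<and> f \<bullet> v \<gamma> \<noteq> 0")
    case True
    then obtain \<gamma> where \<gamma>: "\<gamma> \<in> facets stable_cells" "R \<subseteq> \<gamma>" "f \<bullet> v \<gamma> \<noteq> 0" by blast
    have vz: "v \<gamma> \<in> zlat" by (rule inward_primitive_mem(1)[OF star_facet(1)[OF \<gamma>(1,2)]])
    \<comment> \<open>A normal of nonzero height together with the kernel of \<open>f\<close>
      generates a lattice of finite index, which forces \<open>\<kappa>\<close> to be
      nonzero.\<close>
    have "idx zlat {b + of_int i *\<^sub>R v \<gamma> | b i. b \<in> {y. f \<bullet> y = 0} \<inter> zlat} > 0"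
    proof (rule idx_pos)
      let ?B = "{b + of_int i *\<^sub>R v \<gamma> | b i. b \<in> {y. f \<bullet> y = 0} \<inter> zlat}"
      show "add_subgroup ?B" unfolding add_subgroup_def
      proof (intro conjI ballI)
        have "0 + of_int 0 *\<^sub>R v \<gamma> \<in> ?B" using add_subgroup_0[OF A] by blast
        then show "0 \<in> ?B" by simp
        fix x y assume "x \<in> ?B" "y \<in> ?B"
        then obtain b i b' j where xy: "x = b + of_int i *\<^sub>R v \<gamma>" "b \<in> {y. f \<bullet> y = 0} \<inter> zlat"
          "y = b' + of_int j *\<^sub>R v \<gamma>" "b' \<in> {y. f \<bullet> y = 0} \<inter> zlat" by blast
        have "x - y = (b - b') + of_int (i - j) *\<^sub>R v \<gamma>" using xy by (simp add: algebra_simps)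
        moreover have "b - b' \<in> {y. f \<bullet> y = 0} \<inter> zlat" by (rule add_subgroup_diff[OF A xy(2,4)])
        ultimately show "x - y \<in> ?B" by blast
      qed
      show "?B \<subseteq> zlat"
      proof clarify
        fix b :: "real ^ 'n" and i :: int assume "b \<in> zlat"
        then show "b + of_int i *\<^sub>R v \<gamma> \<in> zlat"
          using add_subgroup_add[OF add_subgroup_zlat] add_subgroup_scale_int[OF add_subgroup_zlat vz] by blast
      qed
      have "x \<in> span ?B" for x
      proof -
        have "0 + of_int 1 *\<^sub>R v \<gamma> \<in> ?B" using add_subgroup_0[OF A] by blast
        then have v1: "v \<gamma> \<in> span ?B" by (intro span_base) simp
        have "{y. f \<bullet> y = 0} \<inter> zlat \<subseteq> ?B"
        proof
          fix b assume "b \<in> {y. f \<bullet> y = 0} \<inter> zlat"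
          then have "b + of_int 0 *\<^sub>R v \<gamma> \<in> ?B" by blast
          then show "b \<in> ?B" by simp
        qed
        from span_mono[OF this] have M1: "{y. f \<bullet> y = 0} \<subseteq> span ?B" unfolding span_rational[OF rM] .
        define c where "c = (f \<bullet> x) / (f \<bullet> v \<gamma>)"
        have "f \<bullet> (x - c *\<^sub>R v \<gamma>) = 0" using \<gamma>(3) by (simp add: c_def inner_diff_right)
        then have "(x - c *\<^sub>R v \<gamma>) + c *\<^sub>R v \<gamma> \<in> span ?B" using M1 v1 by (intro span_add span_scale) auto
        then show ?thesis by simp
      qed
      then show "span ?B = UNIV" by blast
    qed
    then have "\<kappa> \<noteq> 0" using \<kappa> vz \<gamma>(3) by fastforce
    then show ?thesis using split eq by simp
  next
    case False
    then show ?thesis by (intro sum.neutral) auto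
  qed
qed

end

text \<open>Both requirements exclude finitely many proper subspaces of the product: the sums of
  \<open>dirs c\<close> and the diagonal kernel that are not everything, and the preimages of
  nontransversal sums under the difference of coordinates.\<close>

lemma generic_direction_exists:
  fixes X Y :: "(real ^ 'n) weighted_complex"
  assumes X: "tropical_cycle p X" and Y: "tropical_cycle q Y"
  shows "\<exists>d1 d2. (\<forall>s\<in>cells X. \<forall>t\<in>cells Y. d1 - d2 \<in> dirs s + dirs t \<longrightarrow> transversal s t) \<and>
    (\<forall>c\<in>link_prod \<omega> X Y. (d1, d2) \<in> dirs c + diag {y. f \<bullet> y = 0} \<longrightarrow> dirs c + diag {y. f \<bullet> y = 0} = UNIV)"
proof -
  note CX = tropical_cycleD(2)[OF X] and CY = tropical_cycleD(2)[OF Y]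
  let ?E = "link_prod \<omega> X Y" and ?M = "diag {y. f \<bullet> y = 0}"
  let ?D = "\<lambda>(s, t). (\<lambda>x::(real ^ 'n) \<times> (real ^ 'n). fst x - snd x) -` (dirs s + dirs t)"
  let ?A = "(\<lambda>c. dirs c + ?M) ` {c\<in>?E. dirs c + ?M \<noteq> UNIV}"
  let ?B = "?D ` {(s, t) \<in> cells X \<times> cells Y. \<not> transversal s t}"
  have ex: "\<exists>y\<in>UNIV. \<forall>S\<in>?A \<union> ?B. y \<notin> S"
  proof (rule convex_avoid_affine)
    have "finite ?E" by (rule convex_complexD(1)[OF balanced_complexD(1)[OF balanced_link_prod[OF X Y]]])
    moreover have "finite (cells X \<times> cells Y)" using convex_complexD(1)[OF CX] convex_complexD(1)[OF CY] by blast
    then have "finite ?B" by (rule finite_imageI[OF finite_subset[rotated]]) auto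
    ultimately show "finite (?A \<union> ?B)" by simp
    fix S assume "S \<in> ?A \<union> ?B"
    then consider "S \<in> ?A" | "S \<in> ?B" by blast
    then show "affine S \<and> \<not> UNIV \<subseteq> S"
    proof cases
      case 1
      then show ?thesis by (auto intro!: subspace_imp_affine subspace_set_plus subspace_diag subspace_hyperplane)
    next
      case 2
      then obtain s t where st: "S = ?D (s, t)" "\<not> transversal s t" by blast
      have lin: "linear (\<lambda>x::(real ^ 'n) \<times> (real ^ 'n). fst x - snd x)" by (auto intro!: linearI simp: algebra_simps)
      have "subspace S" unfolding st(1) split_conv
        by (rule linear_subspace_vimage[OF lin]) (intro subspace_set_plus subspace_dirs)
      moreover obtain w where "w \<notin> dirs s + dirs t" using st(2) by blast
      then have "(w, 0) \<notin> S" unfolding st(1) by simp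
      ultimately show ?thesis using subspace_imp_affine by blast
    qed
  qed auto
  obtain d where d0: "\<forall>S\<in>?A \<union> ?B. d \<notin> S" using ex by (elim bexE)
  have d: "d \<notin> S" if S: "S \<in> ?A \<or> S \<in> ?B" for S
    by (rule d0[THEN bspec, OF Un_iff[THEN iffD2, OF S]])
  obtain d1 d2 where dd: "d = (d1, d2)" by (cases d)
  show ?thesis
  proof (rule exI[of _ d1], rule exI[of _ d2], intro conjI ballI impI)
    fix s t assume st: "s \<in> cells X" "t \<in> cells Y" "d1 - d2 \<in> dirs s + dirs t"
    show "transversal s t"
    proof (rule ccontr)
      assume "\<not> transversal s t"
      then have "(s, t) \<in> {(s, t) \<in> cells X \<times> cells Y. \<not> transversal s t}" using st by simp
      then have "d \<notin> ?D (s, t)" by (intro d disjI2 imageI)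
      then show False using st(3) by (simp add: dd)
    qed
  next
    fix c assume c: "c \<in> ?E" "(d1, d2) \<in> dirs c + ?M"
    show "dirs c + ?M = UNIV"
    proof (rule ccontr)
      assume "dirs c + ?M \<noteq> UNIV"
      then have "d \<notin> dirs c + ?M" using c(1) by (intro d disjI1 imageI) simp
      then show False using c(2) unfolding dd by (rule notE)
    qed
  qed
qed

lemma facet_ridge_facet_of:
  fixes C :: "(real ^ 'n) set set"
  assumes C: "convex_complex C" and pure: "pure_codim r C" and t: "t \<in> ridges C"
  shows "t \<in> C" "t \<noteq> {}" "aff_dim t = int CARD('n) - int r - 1"
    "\<And>s. s \<in> facets C \<Longrightarrow> t \<subseteq> s \<Longrightarrow> t facet_of s"
proof -
  obtain s0 where s0: "s0 \<in> facets C" "t facet_of s0" using t by (auto simp: ridges_def)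
  have f: "t face_of s0" "t \<noteq> {}" "aff_dim t = aff_dim s0 - 1" using s0(2) by (auto simp: facet_of_def)
  show ne: "t \<noteq> {}" by (rule f(2))
  have FC: "\<And>s. s \<in> facets C \<Longrightarrow> s \<in> C" using facets_subset by blast
  show tC: "t \<in> C" by (rule convex_complexD(5)[OF C FC[OF s0(1)] f(1,2)])
  show dim: "aff_dim t = int CARD('n) - int r - 1" using f(3) s0(1) pure by (simp add: pure_codim_def)
  fix s assume s: "s \<in> facets C" "t \<subseteq> s"
  show "t facet_of s" unfolding facet_of_def
    using complex_face_subset[OF C FC[OF s(1)] tC s(2)] ne dim pure s(1) by (simp add: pure_codim_def)
qed

theorem tropical_stable_intersection:
  fixes X Y :: "(real ^ 'n) weighted_complex"
  assumes X: "tropical_cycle p X" "positive X" and Y: "tropical_cycle q Y" "positive Y"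
  shows "tropical_cycle (p + q) (stable_intersection X Y)"
  unfolding tropical_cycle_def
proof (intro conjI ballI)
  let ?S = "cells (stable_intersection X Y)"
  note poly = polyhedral_stable_intersection[OF tropical_cycleD(1)[OF X(1)] tropical_cycleD(1)[OF Y(1)]]
  show "polyhedral_complex ?S" by (rule poly)
  show pure: "pure_codim (p + q) ?S" by (rule pure_SI[OF X Y])
  note CSS = convex_complex_SI[OF X Y]
  have rat: "\<And>\<gamma>. \<gamma> \<in> ?S \<Longrightarrow> rational_polyhedron \<gamma>"
    using poly[unfolded polyhedral_complex_def, THEN conjunct2, THEN conjunct1] by blast
  fix R assume R: "R \<in> ridges ?S"
  note fr = facet_ridge_facet_of[OF CSS pure R]
  have dimR: "int (dim (dirs R)) + 1 = int CARD('n) - int (p + q)" using fr(3) dim_dirs[OF fr(2)] by linarith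
  obtain \<omega> where \<omega>: "\<omega> \<in> rel_interior R" using convex_complexD(3)[OF CSS fr(1)] fr(2) rel_interior_eq_empty by blast
  have "\<exists>v. primitive_normal R \<gamma> v" if "\<gamma> \<in> facets ?S" "R \<subseteq> \<gamma>" for \<gamma>
    by (rule primitive_normal_exists[OF fr(4)[OF that] rat[OF fr(1)] rat[OF facet_in_SI[OF X Y that(1)]]])
  then obtain v where v: "\<And>\<gamma>. \<gamma> \<in> facets ?S \<Longrightarrow> R \<subseteq> \<gamma> \<Longrightarrow> primitive_normal R \<gamma> (v \<gamma>)" by metis
  let ?G = "{\<gamma>. \<gamma> \<in> facets ?S \<and> R \<subseteq> \<gamma>}"
  let ?m = "\<lambda>\<gamma>. real_of_rat (facet_mult (stable_intersection X Y) \<gamma>)"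
  have ratR: "rational_subspace (dirs R)" by (rule rational_polyhedron_dirs[OF rat[OF fr(1)] fr(2)])
  have f0: "f \<bullet> (\<Sum>\<gamma>\<in>?G. ?m \<gamma> *\<^sub>R v \<gamma>) = 0" if f: "f \<in> orthogonal_comp (dirs R) \<inter> zlat" for f
  proof (cases "f = 0")
    case False
    have fR: "\<And>y. y \<in> dirs R \<Longrightarrow> f \<bullet> y = 0" using f by (auto simp: orthogonal_comp_def orthogonal_def inner_commute)
    obtain d1 d2 where d: "\<forall>s\<in>cells X. \<forall>t\<in>cells Y. d1 - d2 \<in> dirs s + dirs t \<longrightarrow> transversal s t"
      "\<forall>c\<in>link_prod \<omega> X Y. (d1, d2) \<in> dirs c + diag {y. f \<bullet> y = 0} \<longrightarrow> dirs c + diag {y. f \<bullet> y = 0} = UNIV"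
      using generic_direction_exists[OF X(1) Y(1)] by blast
    have "(\<Sum>\<gamma>\<in>?G. (f \<bullet> v \<gamma>) * ?m \<gamma>) = 0"
    proof (rule star_balanced[OF X Y fr(1) dimR \<omega>, where ?d1.0 = d1 and ?d2.0 = d2])
      show "\<And>s t. s \<in> cells X \<Longrightarrow> t \<in> cells Y \<Longrightarrow> d1 - d2 \<in> dirs s + dirs t \<Longrightarrow> transversal s t" using d(1) by blast
      show "\<And>c. c \<in> link_prod \<omega> X Y \<Longrightarrow> (d1, d2) \<in> dirs c + diag {y. f \<bullet> y = 0} \<Longrightarrow> dirs c + diag {y. f \<bullet> y = 0} = UNIV" using d(2) by blast
    qed (use v f False fR in auto)
    then show ?thesis by (simp add: inner_sum_right mult.commute)
  qed simp
  \<comment> \<open>As \<open>R\<close> is rational, the integral functionals vanishing on it span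
    the whole orthogonal complement. Each of them was tested with a generic direction of its
    own.\<close>
  have "orthogonal_comp (dirs R) \<subseteq> {f. f \<bullet> (\<Sum>\<gamma>\<in>?G. ?m \<gamma> *\<^sub>R v \<gamma>) = 0}"
  proof -
    have "span (orthogonal_comp (dirs R) \<inter> zlat) \<subseteq> {f. f \<bullet> (\<Sum>\<gamma>\<in>?G. ?m \<gamma> *\<^sub>R v \<gamma>) = 0}"
    proof (rule span_minimal)
      show "subspace {f. f \<bullet> (\<Sum>\<gamma>\<in>?G. ?m \<gamma> *\<^sub>R v \<gamma>) = 0}"
        using subspace_hyperplane[of "\<Sum>\<gamma>\<in>?G. ?m \<gamma> *\<^sub>R v \<gamma>"] by (simp only: inner_commute)
    qed (use f0 in blast)
    then show ?thesis unfolding span_rational[OF rational_orthogonal_comp[OF ratR]] .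
  qed
  then have "(\<Sum>\<gamma>\<in>?G. ?m \<gamma> *\<^sub>R v \<gamma>) \<in> orthogonal_comp (orthogonal_comp (dirs R))"
    by (auto simp: orthogonal_comp_def orthogonal_def)
  then have inR: "(\<Sum>\<gamma>\<in>?G. ?m \<gamma> *\<^sub>R v \<gamma>) \<in> dirs R" unfolding orthogonal_comp_self[OF subspace_dirs] .
  have "(\<Sum>\<gamma>\<in>?G. ?m \<gamma> *\<^sub>R v \<gamma>) \<in> rat_span (lattice_of R)"
  proof (rule rational_point_in_rat_span[OF _ _ inR])
    show "finite ?G" using convex_complexD(1)[OF CSS] facets_subset[of ?S] by (auto intro: finite_subset)
    show "v \<gamma> \<in> zlat" if "\<gamma> \<in> ?G" for \<gamma>
      using inward_primitive_mem(1)[OF primitive_normal_inward[OF v convex_complexD(3)[OF CSS fr(1)] fr(2)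
            convex_complexD(3)[OF CSS facet_in_SI[OF X Y]]]] that by blast
  qed
  then show "balanced_at (stable_intersection X Y) R" unfolding balanced_at_def using v by blast
qed

text \<open>All multiplicities are positive, so no facet is lost when those of multiplicity
  \<open>0\<close> are discarded, and the facets have the same union as all cells.\<close>

theorem support_stable_intersection:
  fixes X Y :: "(real ^ 'n) weighted_complex"
  assumes X: "tropical_cycle p X" "positive X" and Y: "tropical_cycle q Y" "positive Y"
  shows "support (stable_intersection X Y) = stable_support X Y"
proof -
  let ?S = "cells (stable_intersection X Y)"
  have "{\<gamma>\<in>facets ?S. facet_mult (stable_intersection X Y) \<gamma> \<noteq> 0} = facets ?S"
    using positive_stable_intersection[OF X Y] by (fastforce simp: positive_def)
  then have "support (stable_intersection X Y) = \<Union>(facets ?S)" by (simp add: support_def)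
  also have "\<dots> = \<Union>?S"
  proof (rule subset_antisym[OF Union_mono[OF facets_subset]], rule subsetI)
    fix x assume "x \<in> \<Union>?S"
    then obtain \<gamma> where "\<gamma> \<in> ?S" "x \<in> \<gamma>" by blast
    then show "x \<in> \<Union>(facets ?S)" using facet_exists[OF convex_complexD(1)[OF convex_complex_SI[OF X Y]]] by (metis UnionI subsetD)
  qed
  finally show ?thesis using Union_SI[OF X Y] by simp
qed

section \<open>Linear combinations of cycles\<close>

text \<open>Then \<open>x\<close> is an inner point of a segment in \<open>s\<close> parallel to
  \<open>w\<close>, and the face \<open>t\<close> contains the endpoints.\<close>

lemma line_through_rel_interior:
  assumes "t face_of s" "convex s" "x \<in> rel_interior t" "w \<in> link x s" "- w \<in> link x s"
  shows "w \<in> dirs t"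
proof (cases "w = 0")
  case False
  have xt: "x \<in> t" using assms(3) rel_interior_subset by blast
  have x: "x \<in> s" using xt face_of_imp_subset[OF assms(1)] by blast
  obtain e1 where e1: "e1 > 0" "\<And>y. 0 \<le> y \<Longrightarrow> y < e1 \<Longrightarrow> x + y *\<^sub>R w \<in> s" using link_small[OF assms(2) x assms(4)] by blast
  obtain e2 where e2: "e2 > 0" "\<And>y. 0 \<le> y \<Longrightarrow> y < e2 \<Longrightarrow> x + y *\<^sub>R (- w) \<in> s" using link_small[OF assms(2) x assms(5)] by blast
  define e where "e = min e1 e2 / 2"
  have e: "e > 0" "e < e1" "e < e2" using e1(1) e2(1) by (auto simp: e_def)
  let ?a = "x - e *\<^sub>R w" and ?b = "x + e *\<^sub>R w"
  have "?a \<in> s" "?b \<in> s" using e1(2)[of e] e2(2)[of e] e by auto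
  moreover have "x \<in> open_segment ?a ?b"
  proof -
    have "?b - ?a = (2 * e) *\<^sub>R w" by (simp add: scaleR_add_left[symmetric])
    then have "?a \<noteq> ?b" using e(1) False by auto
    moreover have "x = (1 - 1/2) *\<^sub>R ?a + (1/2) *\<^sub>R ?b"
      by (simp add: scaleR_add_right scaleR_diff_right flip: scaleR_add_left)
    ultimately show ?thesis unfolding in_segment by (intro conjI exI[of _ "1/2"]) auto
  qed
  ultimately have "?b \<in> t" using face_ofD[OF assms(1) _ _ _ xt] by blast
  then have "?b - x \<in> dirs t" by (rule diff_in_dirs[OF _ xt])
  then have "e *\<^sub>R w \<in> dirs t" by simp
  then have "(1/e) *\<^sub>R e *\<^sub>R w \<in> dirs t" by (rule subspace_scale[OF subspace_dirs])
  then show ?thesis using e(1) by simp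
qed (simp add: subspace_0)

text \<open>Substituting one expression into the other gives integers with \<open>a * b = 1\<close>,
  since \<open>w\<close> is not in \<open>S\<close>. So the generator is unique up to sign modulo
  \<open>S\<close>.\<close>

lemma primitive_unique:
  assumes S: "subspace S" and w: "w \<notin> S" "w \<in> L" "v \<in> L"
    and "L = {d + of_int a *\<^sub>R w | d a. d \<in> S \<inter> zlat}" "L = {d + of_int a *\<^sub>R v | d a. d \<in> S \<inter> zlat}"
  shows "v - w \<in> S \<or> v + w \<in> S"
proof -
  obtain d and a::int where a: "d \<in> S" "v = d + of_int a *\<^sub>R w" using w(3) assms(5) by blast
  obtain d' and b::int where b: "d' \<in> S" "w = d' + of_int b *\<^sub>R v" using w(2) assms(6) by blast
  have "w = d' + of_int b *\<^sub>R (d + of_int a *\<^sub>R w)" using b(2) a(2) by metis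
  then have "(1 - of_int (a * b)) *\<^sub>R w = d' + of_int b *\<^sub>R d" by (simp add: algebra_simps)
  then have in_S: "(1 - of_int (a * b)) *\<^sub>R w \<in> S" using a(1) b(1) S by (simp add: subspace_add subspace_scale)
  have "a * b = 1"
  proof (rule ccontr)
    assume "a * b \<noteq> 1"
    then have ne: "(1 - of_int (a * b) :: real) \<noteq> 0" by (metis eq_iff_diff_eq_0 of_int_eq_1_iff)
    have "(1 / (1 - of_int (a * b))) *\<^sub>R (1 - of_int (a * b)) *\<^sub>R w \<in> S" by (rule subspace_scale[OF S in_S])
    then show False using ne w(1) by simp
  qed
  then have "a = 1 \<or> a = - 1" by (auto simp: zmult_eq_1_iff)
  then show ?thesis using a by auto
qed

section \<open>The part of a subdivision around a codimension-one cell inside one convex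
  cell\<close>

context
  fixes C :: "(real ^ 'n) set set" and t \<rho> :: "(real ^ 'n) set" and x :: "real ^ 'n" and k :: nat
  assumes C: "convex_complex C" and t: "t \<in> C" "x \<in> rel_interior t" and k: "dim (dirs t) + 1 = k"
    and pure: "\<And>s. s \<in> facets C \<Longrightarrow> dim (dirs s) = k"
    and \<rho>: "convex \<rho>" "x \<in> \<rho>" "\<rho> = \<Union>{s\<in>C. s \<subseteq> \<rho>}" "dim (dirs \<rho>) = k"
begin

abbreviation "star_in \<equiv> {s\<in>facets C. t \<subseteq> s \<and> s \<subseteq> \<rho>}"

text \<open>Two different facets around \<open>t\<close> meet in a proper face containing
  \<open>t\<close>, which by dimension has only the directions of \<open>t\<close>; a common
  direction off \<open>t\<close> is then impossible.\<close>

lemma star_in_unique: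
  assumes "s \<in> star_in" "s' \<in> star_in" "w \<in> link x s" "w \<in> link x s'" "w \<notin> dirs t"
  shows "s = s'"
proof -
  have sub: "s \<inter> s' = s" if r: "s \<in> star_in" "s' \<in> star_in" "w \<in> link x s" "w \<in> link x s'" for s s'
  proof (rule ccontr)
    assume ne: "s \<inter> s' \<noteq> s"
    have s1: "s \<in> C" "s' \<in> C" "t \<subseteq> s \<inter> s'" using r facets_subset by blast+
    have xt: "x \<in> s \<inter> s'" using s1(3) t(2) rel_interior_subset by blast
    have f: "(s \<inter> s') face_of s" using convex_complexD(6)[OF C s1(2,1)] by (simp only: Int_commute)
    have "dim (dirs (s \<inter> s')) < dim (dirs s)"
      by (rule face_dim_less[OF convex_complexD(3)[OF C s1(1)] f ne]) (use xt in blast)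
    also have "dim (dirs s) = dim (dirs t) + 1" using pure r(1) k by simp
    finally have "dim (dirs (s \<inter> s')) \<le> dim (dirs t)" by simp
    then have "dirs t = dirs (s \<inter> s')"
      by (intro subspace_dim_equal subspace_dirs dirs_mono[OF s1(3)])
    moreover have "w \<in> dirs (s \<inter> s')"
    proof -
      have "w \<in> link x (s \<inter> s')" using r(3,4) by (simp add: link_Int)
      moreover have "convex (s \<inter> s')" using convex_complexD(3)[OF C] s1 by (intro convex_Int) auto
      ultimately show ?thesis using link_subset_dirs xt by blast
    qed
    ultimately show False using assms(5) by simp
  qed
  show ?thesis using sub[OF assms(1-4)] sub[OF assms(2,1,4,3)] by blast
qed

text \<open>A point slightly beyond \<open>x\<close> in the direction \<open>w\<close> avoids all
  cells not containing \<open>x\<close>. The cell of the subdivision that holds it therefore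
  contains \<open>x\<close>, hence \<open>t\<close>, and having also the direction \<open>w\<close>
  it is of dimension \<open>k\<close>.\<close>

lemma star_in_exists:
  assumes w: "w \<in> link x \<rho>" "w \<notin> dirs t"
  shows "\<exists>s\<in>star_in. w \<in> link x s"
proof -
  have "eventually (\<lambda>\<epsilon>. x + \<epsilon> *\<^sub>R w \<notin> s) (at_right 0)" if s: "s \<in> {s\<in>C. x \<notin> s}" for s
  proof -
    have "open (- s)" "x \<in> - s" using s convex_complexD(2)[OF C] by auto
    moreover have "((\<lambda>\<epsilon>. x + \<epsilon> *\<^sub>R w) \<longlongrightarrow> x + 0 *\<^sub>R w) (at_right 0)" by (intro tendsto_intros)
    ultimately have "eventually (\<lambda>\<epsilon>. x + \<epsilon> *\<^sub>R w \<in> - s) (at_right 0)" by (intro topological_tendstoD) auto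
    then show ?thesis by simp
  qed
  then have "\<forall>s\<in>{s\<in>C. x \<notin> s}. eventually (\<lambda>\<epsilon>. x + \<epsilon> *\<^sub>R w \<notin> s) (at_right 0)" by blast
  then have "eventually (\<lambda>\<epsilon>. \<forall>s\<in>{s\<in>C. x \<notin> s}. x + \<epsilon> *\<^sub>R w \<notin> s) (at_right 0)"
    by (rule eventually_ball_finite[rotated]) (use convex_complexD(1)[OF C] in simp)
  moreover have "eventually (\<lambda>\<epsilon>. x + \<epsilon> *\<^sub>R w \<in> \<rho>) (at_right 0)" using w(1) by (simp add: link_def)
  moreover have "eventually (\<lambda>\<epsilon>::real. \<epsilon> > 0) (at_right 0)" by (rule eventually_at_right_less)
  ultimately have "eventually (\<lambda>\<epsilon>. (\<forall>s\<in>{s\<in>C. x \<notin> s}. x + \<epsilon> *\<^sub>R w \<notin> s) \<and> x + \<epsilon> *\<^sub>R w \<in> \<rho> \<and> \<epsilon> > 0) (at_right 0)"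
    by (intro eventually_conj)
  then obtain e where e: "\<forall>s\<in>{s\<in>C. x \<notin> s}. x + e *\<^sub>R w \<notin> s" "x + e *\<^sub>R w \<in> \<rho>" "e > 0"
    using eventually_happens[of _ "at_right (0::real)"] by (metis (no_types, lifting) trivial_limit_at_right_real)
  obtain s where s: "s \<in> C" "s \<subseteq> \<rho>" "x + e *\<^sub>R w \<in> s" using e(2) \<rho>(3) by blast
  have x: "x \<in> s" using e(1) s by blast
  have sub: "t \<subseteq> s" by (rule carrier_subset[OF C t(1) s(1) t(2) x])
  have link: "w \<in> link x s" using link_iff[OF convex_complexD(3)[OF C s(1)] x] e(3) s(3) by blast
  have "dim (dirs t) < dim (dirs s)"
  proof (rule ccontr)
    assume "\<not> ?thesis"
    then have "dirs t = dirs s" by (intro subspace_dim_equal subspace_dirs dirs_mono[OF sub]) simp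
    then show False using w(2) link link_subset_dirs[OF convex_complexD(3)[OF C s(1)] x] by blast
  qed
  then have dim: "dim (dirs s) \<ge> k" using k by simp
  obtain s' where s': "s' \<in> facets C" "s \<subseteq> s'" using facet_exists[OF convex_complexD(1)[OF C] s(1)] by blast
  then have s'C: "s' \<in> C" using facets_subset by blast
  have "s = s'"
  proof (rule ccontr)
    assume ne: "s \<noteq> s'"
    have "dim (dirs s) < dim (dirs s')"
      by (rule face_dim_less[OF convex_complexD(3)[OF C s'C] complex_face_subset[OF C s'C s(1) s'(2)] ne convex_complexD(4)[OF C s(1)]])
    then show False using dim pure[OF s'(1)] by simp
  qed
  then show ?thesis using s'(1) sub s(2) link by blast
qed

text \<open>Modulo \<open>dirs t\<close> each primitive normal is \<open>w\<close> or
  \<open>- w\<close>, and each of the two occurs exactly when it points into \<open>\<rho>\<close>.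
  The sum is thus \<open>0\<close> if \<open>x\<close> is inside \<open>\<rho>\<close>, and a single
  inward normal if \<open>t\<close> lies along the boundary.\<close>

lemma sum_star_in:
  assumes v: "\<And>s. s \<in> star_in \<Longrightarrow> primitive_normal t s (v s)"
    and w: "w \<notin> dirs t" "dirs \<rho> \<inter> zlat = {d + of_int a *\<^sub>R w | d a. d \<in> dirs t \<inter> zlat}"
  shows "(\<Sum>s\<in>star_in. v s) - ((if w \<in> link x \<rho> then w else 0) + (if - w \<in> link x \<rho> then - w else 0)) \<in> dirs t"
proof -
  have fin: "finite star_in" using convex_complexD(1)[OF C] facets_subset[of C] by (auto intro: finite_subset)
  have mem: "w \<in> dirs \<rho> \<inter> zlat"
    unfolding w(2) 
    by - (rule CollectI, rule exI[of _ 0], rule exI[of _ "1::int"], simp add: subspace_0 add_subgroup_0)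
  have st: "s \<in> C" "convex s" "x \<in> s" "t face_of s" "dirs s = dirs \<rho>" "v s \<in> link x s" "v s \<notin> dirs t"
    "v s - w \<in> dirs t \<or> v s + w \<in> dirs t" if s: "s \<in> star_in" for s
  proof -
    show r: "s \<in> C" using s facets_subset by blast
    show cv: "convex s" by (rule convex_complexD(3)[OF C r])
    show x: "x \<in> s" using s t(2) rel_interior_subset by blast
    show "t face_of s" using complex_face_subset[OF C r t(1)] s by blast
    show eq: "dirs s = dirs \<rho>" 
    proof (rule subspace_dim_equal[OF subspace_dirs subspace_dirs dirs_mono])
      show "s \<subseteq> \<rho>" using s by blast
      show "dim (dirs s) \<ge> dim (dirs \<rho>)" using s pure \<rho>(4) by simp
    qed
    show "v s \<in> link x s" using v[OF s] t(2) by (simp add: primitive_normal_def)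
    have lat: "dirs \<rho> \<inter> zlat = {d + of_int a *\<^sub>R v s | d a. d \<in> dirs t \<inter> zlat}"
      using v[OF s] by (simp add: primitive_normal_def lattice_of_eq eq)
    show vn: "v s \<notin> dirs t"
    proof
      assume vt: "v s \<in> dirs t"
      obtain d and a::int where "d \<in> dirs t" "w = d + of_int a *\<^sub>R v s" using mem unfolding lat by blast
      then show False using w(1) vt by (simp add: subspace_add subspace_scale)
    qed
    have "v s \<in> dirs \<rho> \<inter> zlat" unfolding lat 
      by - (rule CollectI, rule exI[of _ 0], rule exI[of _ "1::int"], simp add: subspace_0 add_subgroup_0)
    then show "v s - w \<in> dirs t \<or> v s + w \<in> dirs t" by (intro primitive_unique[OF subspace_dirs w(1) mem _ w(2) lat])
  qed
  have side: "v s - r *\<^sub>R w \<in> dirs t \<longleftrightarrow> r *\<^sub>R w \<in> link x s" if s: "s \<in> star_in" and r: "r = 1 \<or> r = - 1" for s and r::real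
  proof
    note j = st[OF s]
    have sub: "t \<subseteq> s" using s by blast
    {
      assume "v s - r *\<^sub>R w \<in> dirs t"
      then have "- (v s - r *\<^sub>R w) \<in> dirs t" by (rule subspace_neg[OF subspace_dirs])
      from link_dirs_inv[OF j(2) sub t(2) j(6) this] show "r *\<^sub>R w \<in> link x s" by simp
    next
      assume l: "r *\<^sub>R w \<in> link x s"
      show "v s - r *\<^sub>R w \<in> dirs t"
      proof (rule ccontr)
        assume n: "v s - r *\<^sub>R w \<notin> dirs t"
        then have "v s + r *\<^sub>R w \<in> dirs t" using j(8) r by auto
        then have "- (v s + r *\<^sub>R w) \<in> dirs t" by (rule subspace_neg[OF subspace_dirs])
        from link_dirs_inv[OF j(2) sub t(2) j(6) this] have "- (r *\<^sub>R w) \<in> link x s" by simp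
        from line_through_rel_interior[OF j(4,2) t(2) l this] have "r *\<^sub>R w \<in> dirs t" .
        then have "r *\<^sub>R r *\<^sub>R w \<in> dirs t" by (rule subspace_scale[OF subspace_dirs])
        then show False using w(1) r by auto
      qed
    }
  qed
  have half: "(\<Sum>s | s \<in> star_in \<and> r *\<^sub>R w \<in> link x s. v s) - (if r *\<^sub>R w \<in> link x \<rho> then r *\<^sub>R w else 0) \<in> dirs t"
    if r: "r = 1 \<or> r = - 1" for r::real
  proof (cases "r *\<^sub>R w \<in> link x \<rho>")
    case True
    have sw: "r *\<^sub>R w \<notin> dirs t" using w(1) r subspace_neg[OF subspace_dirs, of "- w" t] by auto
    obtain s where s: "s \<in> star_in" "r *\<^sub>R w \<in> link x s" using star_in_exists[OF True sw] by blast
    then have "{s. s \<in> star_in \<and> r *\<^sub>R w \<in> link x s} = {s}" using star_in_unique[OF _ _ _ _ sw] by blast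
    then show ?thesis using True side[OF s(1) r] s(2) by simp
  next
    case False
    then have "{s. s \<in> star_in \<and> r *\<^sub>R w \<in> link x s} = {}" using link_mono by blast
    then show ?thesis using False by (simp only:) (simp add: subspace_0)
  qed
  have "star_in = {s. s \<in> star_in \<and> 1 *\<^sub>R w \<in> link x s} \<union> {s. s \<in> star_in \<and> (- 1) *\<^sub>R w \<in> link x s}"
    (is "_ = ?A \<union> ?B")
  proof (rule subset_antisym[OF subsetI])
    fix s assume s: "s \<in> star_in"
    show "s \<in> ?A \<union> ?B" using st(8)[OF s] side[OF s, of 1] side[OF s, of "- 1"] s by simp
  qed blast
  moreover have "?A \<inter> ?B = {}"
  proof (rule equals0I)
    fix s assume s: "s \<in> ?A \<inter> ?B"
    then have "s \<in> star_in" by blast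
    from line_through_rel_interior[OF st(4,2)[OF this] t(2), of w] w(1) s show False by simp
  qed
  moreover have "finite ?A" "finite ?B" by (rule finite_subset[OF _ fin], blast)+
  ultimately have sum: "(\<Sum>s\<in>star_in. v s) = (\<Sum>s\<in>?A. v s) + (\<Sum>s\<in>?B. v s)" by (metis (no_types, lifting) sum.union_disjoint)
  have 1: "(if w \<in> link x \<rho> then w else 0) = (if 1 *\<^sub>R w \<in> link x \<rho> then 1 *\<^sub>R w else 0)"
    and 2: "(if - w \<in> link x \<rho> then - w else 0) = (if (- 1) *\<^sub>R w \<in> link x \<rho> then (- 1) *\<^sub>R w else 0)" by simp_all
  show ?thesis unfolding sum 1 2 add_diff_add by (rule subspace_add[OF subspace_dirs half half]) simp_all
qed

end

lemma lincomb_cell_subset: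
  assumes C: "convex_complex C" and s: "s \<in> C" "x \<in> rel_interior s" and \<rho>: "x \<in> \<rho>" "\<rho> = \<Union>{s\<in>C. s \<subseteq> \<rho>}"
  shows "s \<subseteq> \<rho>"
proof -
  obtain s' where "s' \<in> C" "s' \<subseteq> \<rho>" "x \<in> s'" using \<rho> by blast
  then show ?thesis using carrier_subset[OF C s(1) _ s(2)] by blast
qed

text \<open>By \<open>convex_cover_full\<close>, a relatively interior point of \<open>s\<close>
  lies in a piece that spans the affine hull of \<open>\<rho>\<close>. This piece contains
  \<open>s\<close>, and maximality makes it equal to \<open>s\<close>.\<close>

lemma facet_dim_subdivision:
  assumes C: "convex_complex C" and s: "s \<in> facets C" "s \<subseteq> \<rho>" and \<rho>: "convex \<rho>" "\<rho> = \<Union>{s\<in>C. s \<subseteq> \<rho>}"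
  shows "dirs s = dirs \<rho>"
proof -
  have sC: "s \<in> C" using s(1) facets_subset by blast
  obtain x where x: "x \<in> rel_interior s" using convex_complexD(3,4)[OF C sC] rel_interior_eq_empty by blast
  then have x\<rho>: "x \<in> \<rho>" using s(2) rel_interior_subset by blast
  have "\<rho> \<subseteq> \<Union>{s'\<in>{s\<in>C. s \<subseteq> \<rho>}. \<rho> \<subseteq> affine hull s'}"
    by (rule convex_cover_full[OF \<rho>(1)]) (use \<rho>(2) convex_complexD(1,2)[OF C] in auto)
  then obtain s' where s': "s' \<in> C" "s' \<subseteq> \<rho>" "x \<in> s'" "\<rho> \<subseteq> affine hull s'" using x\<rho> by blast
  have "s \<subseteq> s'" by (rule carrier_subset[OF C sC s'(1) x s'(3)])
  then have eq: "s' = s" using s(1) s'(1) by (simp add: facets_def)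
  have "\<rho> \<subseteq> {y. y - x \<in> dirs s}" using s'(4) unfolding affine_hull_dirs[OF s'(3)] unfolding eq .
  then have "dirs \<rho> \<subseteq> dirs s" by (intro dirs_subset[OF subspace_dirs x\<rho>]) blast
  then show ?thesis using dirs_mono[OF s(2)] by blast
qed

lemma sum_scaleR_of_rat_list:
  fixes v :: "'b \<Rightarrow> 'a::real_vector"
  assumes S: "subspace S" and "\<And>a X. (a, X) \<in> set ts \<Longrightarrow> (\<Sum>s\<in>G. of_rat (m X s) *\<^sub>R v s) \<in> S"
  shows "(\<Sum>s\<in>G. of_rat (\<Sum>(a, X)\<leftarrow>ts. a * m X s) *\<^sub>R v s) \<in> S"
  using assms(2)
proof (induction ts)
  case (Cons t ts)
  obtain a X where t: "t = (a, X)" by (cases t)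
  have "(\<Sum>s\<in>G. of_rat (\<Sum>(a, X)\<leftarrow>t # ts. a * m X s) *\<^sub>R v s)
      = of_rat a *\<^sub>R (\<Sum>s\<in>G. of_rat (m X s) *\<^sub>R v s) + (\<Sum>s\<in>G. of_rat (\<Sum>(a, X)\<leftarrow>ts. a * m X s) *\<^sub>R v s)"
    unfolding t by (simp add: of_rat_add of_rat_mult scaleR_add_left scaleR_sum_right sum.distrib)
  moreover have "(\<Sum>s\<in>G. of_rat (m X s) *\<^sub>R v s) \<in> S" by (rule Cons.prems[of a]) (simp add: t)
  moreover have "(\<Sum>s\<in>G. of_rat (\<Sum>(a, X)\<leftarrow>ts. a * m X s) *\<^sub>R v s) \<in> S"
    by (rule Cons.IH) (use Cons.prems in auto)
  ultimately show ?case using S by (simp add: subspace_add subspace_scale)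
qed (simp add: subspace_0[OF S])

text \<open>Reordering the sum by the facets of \<open>X\<close> leaves, for each facet through
  \<open>x\<close>, the sum computed in \<open>sum_star_in\<close>. If \<open>t\<close> lies inside
  a facet of \<open>X\<close> the two sides cancel; if it lies along a ridge, the inward normals of
  \<open>X\<close> appear and the balancing of \<open>X\<close> applies. Facets not through
  \<open>x\<close> contribute nothing.\<close>

lemma balanced_subdivision:
  fixes X :: "(real ^ 'n) weighted_complex"
  assumes X: "tropical_cycle r X" and C: "convex_complex C"
    and sub: "\<And>\<rho>. \<rho> \<in> cells X \<Longrightarrow> \<rho> = \<Union>{s\<in>C. s \<subseteq> \<rho>}"
    and t: "t \<in> C" and k: "dim (dirs t) + 1 = k" "int k = int CARD('n) - int r"
    and pure: "\<And>s. s \<in> facets C \<Longrightarrow> dim (dirs s) = k"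
    and v: "\<And>s. s \<in> facets C \<Longrightarrow> t \<subseteq> s \<Longrightarrow> primitive_normal t s (v s)"
    and rat: "rational_subspace (dirs t)"
  shows "(\<Sum>s | s \<in> facets C \<and> t \<subseteq> s. of_rat (mult_on X s) *\<^sub>R v s) \<in> dirs t"
proof -
  note CX = tropical_cycleD(2)[OF X]
  let ?G = "{s. s \<in> facets C \<and> t \<subseteq> s}"
  obtain x where x: "x \<in> rel_interior t" using convex_complexD(3,4)[OF C t] rel_interior_eq_empty by blast
  have xt: "x \<in> t" using x rel_interior_subset by blast
  have finG: "finite ?G" using convex_complexD(1)[OF C] facets_subset[of C] by (auto intro: finite_subset)
  have finX: "finite (facets (cells X))" using convex_complexD(1)[OF CX] facets_subset[of "cells X"] by (auto intro: finite_subset)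
  let ?F = "{\<rho>\<in>facets (cells X). x \<in> \<rho>}" and ?m = "\<lambda>\<rho>. real_of_rat (facet_mult X \<rho>)"
  have finF: "finite ?F" using finX by simp
  let ?S = "\<lambda>\<rho>. \<Sum>s\<in>{s\<in>facets C. t \<subseteq> s \<and> s \<subseteq> \<rho>}. v s"
  have "(\<Sum>s\<in>?G. of_rat (mult_on X s) *\<^sub>R v s)
      = (\<Sum>s\<in>?G. \<Sum>\<rho> | \<rho> \<in> facets (cells X) \<and> s \<subseteq> \<rho>. ?m \<rho> *\<^sub>R v s)"
    by (simp add: mult_on_def of_rat_sum scaleR_sum_left)
  also have "\<dots> = (\<Sum>\<rho>\<in>facets (cells X). \<Sum>s | s \<in> ?G \<and> s \<subseteq> \<rho>. ?m \<rho> *\<^sub>R v s)"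
    by (rule sum.swap_restrict[OF finG finX])
  also have "\<dots> = (\<Sum>\<rho>\<in>facets (cells X). ?m \<rho> *\<^sub>R ?S \<rho>)"
    by (intro sum.cong refl) (simp add: scaleR_sum_right conj_assoc)
  also have "\<dots> = (\<Sum>\<rho>\<in>?F. ?m \<rho> *\<^sub>R ?S \<rho>)"
  proof (rule sum.mono_neutral_right[OF finX])
    show "\<forall>\<rho>\<in>facets (cells X) - ?F. ?m \<rho> *\<^sub>R ?S \<rho> = 0"
    proof
      fix \<rho> assume "\<rho> \<in> facets (cells X) - ?F"
      then have "{s\<in>facets C. t \<subseteq> s \<and> s \<subseteq> \<rho>} = {}" using xt by blast
      then show "?m \<rho> *\<^sub>R ?S \<rho> = 0" by (simp only: sum.empty scaleR_zero_right)
    qed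
  qed auto
  finally have eq: "(\<Sum>s\<in>?G. of_rat (mult_on X s) *\<^sub>R v s) = (\<Sum>\<rho>\<in>?F. ?m \<rho> *\<^sub>R ?S \<rho>)" .
  have "(\<Sum>\<rho>\<in>?F. ?m \<rho> *\<^sub>R ?S \<rho>) \<in> dirs t"
  proof (cases "?F = {}")
    case True
    show ?thesis unfolding True by (simp add: subspace_0)
  next
    case False
    then obtain \<rho>0 where \<rho>0: "\<rho>0 \<in> facets (cells X)" "x \<in> \<rho>0" by blast
    have FX: "\<And>\<rho>. \<rho> \<in> facets (cells X) \<Longrightarrow> \<rho> \<in> cells X" using facets_subset by blast
    have cvX: "\<And>\<rho>. \<rho> \<in> facets (cells X) \<Longrightarrow> convex \<rho>" using convex_complexD(3)[OF CX FX] .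
    have dimX: "\<And>\<rho>. \<rho> \<in> facets (cells X) \<Longrightarrow> dim (dirs \<rho>) = k" using facet_dim[OF X] k(2) by fastforce
    obtain c where c: "c \<in> cells X" "c face_of \<rho>0" "x \<in> rel_interior c" using carrier_exists[OF CX FX[OF \<rho>0(1)] \<rho>0(2)] by blast
    have xc: "x \<in> c" using c(3) rel_interior_subset by blast
    have tc: "t \<subseteq> c" by (rule lincomb_cell_subset[OF C t x xc sub[OF c(1)]])
    have c\<rho>: "c \<subseteq> \<rho>" if "\<rho> \<in> ?F" for \<rho> using carrier_subset[OF CX c(1) FX c(3)] that by blast
    have star: "?S \<rho> - ((if w \<in> link x \<rho> then w else 0) + (if - w \<in> link x \<rho> then - w else 0)) \<in> dirs t"
      if \<rho>: "\<rho> \<in> ?F" and w: "w \<notin> dirs t" "dirs \<rho> \<inter> zlat = {d + of_int a *\<^sub>R w | d a. d \<in> dirs t \<inter> zlat}" for \<rho> w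
      by (rule sum_star_in[OF C t x k(1) pure cvX _ sub[OF FX] dimX v w]) (use \<rho> in auto)
    show ?thesis
    \<comment> \<open>The cell \<open>c\<close> of \<open>X\<close> carrying \<open>x\<close>
      contains \<open>t\<close>, so it is either a facet, of dimension \<open>k\<close>, or a ridge
      with the directions of \<open>t\<close>.\<close>
    proof (cases "dim (dirs c) = dim (dirs t)")
      case False
      then have "dim (dirs c) > dim (dirs t)" using dim_subset[OF dirs_mono[OF tc]] by simp
      then have "dim (dirs c) \<ge> k" using k(1) by simp
      then have c0: "c = \<rho>0"
        using face_dim_less[OF cvX[OF \<rho>0(1)] c(2)] dimX[OF \<rho>0(1)] xc by force
      then have F: "?F = {\<rho>0}" 
      proof (intro subset_antisym subsetI)
        fix \<rho> assume \<rho>: "\<rho> \<in> ?F"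
        have "\<rho>0 \<subseteq> \<rho>" "\<rho> \<in> cells X" using c\<rho>[OF \<rho>] c0 FX \<rho> by blast+
        then show "\<rho> \<in> {\<rho>0}" using \<rho>0(1) by (simp add: facets_def)
      qed (use \<rho>0 in blast)
      have \<rho>0F: "\<rho>0 \<in> ?F" using \<rho>0 by simp
      obtain u w where w: "u \<bullet> w > 0" "dirs t = dirs \<rho>0 \<inter> {x. u \<bullet> x = 0}" "w \<in> dirs \<rho>0 \<inter> zlat"
        "dirs \<rho>0 \<inter> zlat = {d + of_int a *\<^sub>R w | d a. d \<in> dirs t \<inter> zlat}"
      proof (rule primitive_vector_exists[OF rat rational_polyhedron_dirs[OF tropical_cycleD(5)[OF X FX[OF \<rho>0(1)]]]
            dirs_mono[OF tc[unfolded c0]]])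
        show "\<rho>0 \<noteq> {}" using \<rho>0(2) by blast
        show "dim (dirs \<rho>0) = dim (dirs t) + 1" using dimX[OF \<rho>0(1)] k(1) by simp
      qed (rule that)
      have wn: "w \<notin> dirs t" unfolding w(2) using w(1) by simp
      \<comment> \<open>Here \<open>x\<close> is relatively interior in the facet, so both signs of
        \<open>w\<close> point into it and their contributions cancel.\<close>
      have "d \<in> link x \<rho>0" if d: "d \<in> dirs \<rho>0" for d
      proof -
        obtain e where "e > 0" "\<forall>j. \<bar>j\<bar> \<le> e \<longrightarrow> x + j *\<^sub>R d \<in> \<rho>0" using rel_interior_dirs[OF c(3)[unfolded c0] d] by blast
        then show ?thesis using link_iff[OF cvX[OF \<rho>0(1)] \<rho>0(2)] by (metis abs_of_pos order_refl)
      qed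
      then have "w \<in> link x \<rho>0" "- w \<in> link x \<rho>0" using w(3) subspace_neg[OF subspace_dirs] by blast+
      then have "?S \<rho>0 \<in> dirs t" using star[OF \<rho>0F wn w(4)] by simp
      then show ?thesis unfolding F by (simp add: subspace_scale)
    next
      case True
      then have dc: "dirs t = dirs c" by (intro subspace_dim_equal subspace_dirs dirs_mono[OF tc]) simp
      have cne: "c \<noteq> {}" using xc by blast
      have ne0: "\<rho>0 \<noteq> {}" using \<rho>0(2) by blast
      have "c facet_of \<rho>0" unfolding facet_of_def
        using c(2) cne True k(1) dimX[OF \<rho>0(1)] by (simp add: dim_dirs[OF cne] dim_dirs[OF ne0])
      then have "c \<in> ridges (cells X)" using \<rho>0(1) by (auto simp: ridges_def)
      from tropical_cycleD(4)[OF X this] obtain w where w: "\<And>\<rho>. \<rho> \<in> facets (cells X) \<Longrightarrow> c \<subseteq> \<rho> \<Longrightarrow> primitive_normal c \<rho> (w \<rho>)"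
        "(\<Sum>\<rho> | \<rho> \<in> facets (cells X) \<and> c \<subseteq> \<rho>. ?m \<rho> *\<^sub>R w \<rho>) \<in> rat_span (lattice_of c)"
        unfolding balanced_at_def by blast
      have F: "{\<rho>. \<rho> \<in> facets (cells X) \<and> c \<subseteq> \<rho>} = ?F" using c\<rho> xc by blast
      have "rat_span (lattice_of c) \<subseteq> dirs c"
        using rat_span_subset_span[of "lattice_of c"] span_minimal[OF _ subspace_dirs, of "lattice_of c" c] by (auto simp: lattice_of_eq)
      then have 1: "(\<Sum>\<rho>\<in>?F. ?m \<rho> *\<^sub>R w \<rho>) \<in> dirs t" using w(2) unfolding F dc by blast
      have "?S \<rho> - w \<rho> \<in> dirs t" if \<rho>: "\<rho> \<in> ?F" for \<rho>
      proof -
        have \<rho>': "\<rho> \<in> facets (cells X)" using \<rho> by simp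
        have p: "primitive_normal c \<rho> (w \<rho>)" by (rule w(1)[OF \<rho>' c\<rho>[OF \<rho>]])
        then have lat: "dirs \<rho> \<inter> zlat = {d + of_int a *\<^sub>R w \<rho> | d a. d \<in> dirs t \<inter> zlat}"
          by (simp add: primitive_normal_def lattice_of_eq dc)
        have l: "w \<rho> \<in> link x \<rho>" using p c(3) by (simp add: primitive_normal_def)
        have wn: "w \<rho> \<notin> dirs t"
        proof
          assume wt: "w \<rho> \<in> dirs t"
          have "dirs \<rho> \<inter> zlat \<subseteq> dirs t" unfolding lat using wt by (auto simp: subspace_add subspace_scale)
          then have "span (dirs \<rho> \<inter> zlat) \<subseteq> dirs t" by (rule span_minimal[OF _ subspace_dirs])
          then have "dirs \<rho> \<subseteq> dirs t"
            using span_rational[OF rational_polyhedron_dirs[OF tropical_cycleD(5)[OF X FX[OF \<rho>']]]] \<rho> by blast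
          then show False using dim_subset[of "dirs \<rho>" "dirs t"] dimX[OF \<rho>'] k(1) by simp
        qed
        \<comment> \<open>Along a ridge only the inward sign survives: otherwise a line through
          \<open>x\<close> inside \<open>\<rho>\<close> would have to lie in the face
          \<open>c\<close>.\<close>
        have "- w \<rho> \<notin> link x \<rho>"
          using line_through_rel_interior[OF complex_face_subset[OF CX FX[OF \<rho>'] c(1) c\<rho>[OF \<rho>]] cvX[OF \<rho>'] c(3) l] wn dc by blast
        then show ?thesis using star[OF \<rho> wn lat] l by simp
      qed
      then have "(\<Sum>\<rho>\<in>?F. ?m \<rho> *\<^sub>R (?S \<rho> - w \<rho>)) \<in> dirs t" by (intro subspace_sum[OF subspace_dirs] subspace_scale[OF subspace_dirs])
      from subspace_add[OF subspace_dirs this 1] show ?thesis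
        by (simp add: sum.distrib[symmetric] scaleR_add_right[symmetric])
    qed
  qed
  then show ?thesis by (simp only: eq)
qed

lemma lincombD:
  assumes "lincomb ts Z"
  shows "polyhedral_complex (cells Z)" "\<Union>(cells Z) = (\<Union>(a, X)\<in>set ts. \<Union>(cells X))"
    "(a, X) \<in> set ts \<Longrightarrow> \<rho> \<in> cells X \<Longrightarrow> \<rho> = \<Union>{s\<in>cells Z. s \<subseteq> \<rho>}"
    "s \<in> facets (cells Z) \<Longrightarrow> facet_mult Z s = (\<Sum>(a, X)\<leftarrow>ts. a * mult_on X s)"
  using assms unfolding lincomb_def by fast+

lemma lincomb_facet:
  assumes Z: "lincomb ts Z" and ts: "\<And>a X. (a, X) \<in> set ts \<Longrightarrow> polyhedral_complex (cells X)"
    and s: "s \<in> facets (cells Z)"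
  shows "\<exists>a X \<rho>. (a, X) \<in> set ts \<and> \<rho> \<in> facets (cells X) \<and> s \<subseteq> \<rho> \<and> dirs s = dirs \<rho>"
proof -
  note C = polyhedral_complex_convex[OF lincombD(1)[OF Z]]
  have sC: "s \<in> cells Z" using s facets_subset by blast
  obtain x where x: "x \<in> rel_interior s" using convex_complexD(3,4)[OF C sC] rel_interior_eq_empty by blast
  then have "x \<in> \<Union>(cells Z)" using sC rel_interior_subset by blast
  then obtain a X \<rho>' where X: "(a, X) \<in> set ts" "\<rho>' \<in> cells X" "x \<in> \<rho>'" unfolding lincombD(2)[OF Z] by blast
  note CX = polyhedral_complex_convex[OF ts[OF X(1)]]
  obtain \<rho> where \<rho>: "\<rho> \<in> facets (cells X)" "\<rho>' \<subseteq> \<rho>" using facet_exists[OF convex_complexD(1)[OF CX] X(2)] by blast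
  then have \<rho>X: "\<rho> \<in> cells X" using facets_subset by blast
  note sub = lincombD(3)[OF Z X(1) \<rho>X]
  have "x \<in> \<rho>" using X(3) \<rho>(2) by blast
  then have l: "s \<subseteq> \<rho>" by (rule lincomb_cell_subset[OF C sC x _ sub])
  show ?thesis using X(1) \<rho>(1) l facet_dim_subdivision[OF C s l convex_complexD(3)[OF CX \<rho>X] sub] by blast
qed

text \<open>With one choice of primitive normals for the common subdivision, the balancing sum is
  linear in the multiplicities, so each summand can be balanced separately and the relations
  added.\<close>

theorem tropical_lincomb:
  fixes Z :: "(real ^ 'n) weighted_complex"
  assumes Z: "lincomb ts Z" and ts: "\<And>a X. (a, X) \<in> set ts \<Longrightarrow> tropical_cycle r X"
  shows "tropical_cycle r Z"
  unfolding tropical_cycle_def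
proof (intro conjI ballI)
  let ?C = "cells Z"
  note poly = lincombD(1)[OF Z]
  note C = polyhedral_complex_convex[OF poly]
  show "polyhedral_complex ?C" by (rule poly)
  have rat: "\<And>\<gamma>. \<gamma> \<in> ?C \<Longrightarrow> rational_polyhedron \<gamma>"
    using poly[unfolded polyhedral_complex_def, THEN conjunct2, THEN conjunct1] by blast
  have FC: "\<And>s. s \<in> facets ?C \<Longrightarrow> s \<in> ?C" using facets_subset by blast
  have pts: "\<And>a X. (a, X) \<in> set ts \<Longrightarrow> polyhedral_complex (cells X)" using tropical_cycleD(1)[OF ts] by blast
  have dimC: "int (dim (dirs s)) = int CARD('n) - int r" if s: "s \<in> facets ?C" for s
  proof -
    have "\<exists>a X \<rho>. (a, X) \<in> set ts \<and> \<rho> \<in> facets (cells X) \<and> s \<subseteq> \<rho> \<and> dirs s = dirs \<rho>"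
      by (rule lincomb_facet[OF Z _ s]) (erule pts)
    then obtain a X \<rho> where \<rho>: "(a, X) \<in> set ts" "\<rho> \<in> facets (cells X)" "dirs s = dirs \<rho>"
      by blast
    then show ?thesis using facet_dim[OF ts[OF \<rho>(1)] \<rho>(2)] by simp
  qed
  show pure: "pure_codim r ?C" unfolding pure_codim_def
    using dimC dim_dirs[OF convex_complexD(4)[OF C FC]] by simp
  fix t assume t: "t \<in> ridges ?C"
  note fr = facet_ridge_facet_of[OF C pure t]
  define k where "k = dim (dirs t) + 1"
  have k: "int k = int CARD('n) - int r" using fr(3) dim_dirs[OF fr(2)] by (simp add: k_def)
  have "\<exists>v. primitive_normal t s v" if "s \<in> facets ?C" "t \<subseteq> s" for s
    by (rule primitive_normal_exists[OF fr(4)[OF that] rat[OF fr(1)] rat[OF FC[OF that(1)]]])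
  then obtain v where v: "\<And>s. s \<in> facets ?C \<Longrightarrow> t \<subseteq> s \<Longrightarrow> primitive_normal t s (v s)" by metis
  let ?G = "{s. s \<in> facets ?C \<and> t \<subseteq> s}"
  have "(\<Sum>s\<in>?G. of_rat (mult_on X s) *\<^sub>R v s) \<in> dirs t" if X: "(a, X) \<in> set ts" for a X
  proof (rule balanced_subdivision[OF ts[OF X] C lincombD(3)[OF Z X] fr(1) k_def[symmetric] k _ v])
    show "\<And>s. s \<in> facets ?C \<Longrightarrow> dim (dirs s) = k" using dimC k by fastforce
    show "rational_subspace (dirs t)" by (rule rational_polyhedron_dirs[OF rat[OF fr(1)] fr(2)])
  qed
  from sum_scaleR_of_rat_list[OF subspace_dirs this]
  have "(\<Sum>s\<in>?G. of_rat (\<Sum>(a, X)\<leftarrow>ts. a * mult_on X s) *\<^sub>R v s) \<in> dirs t" .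
  moreover have "(\<Sum>s\<in>?G. of_rat (\<Sum>(a, X)\<leftarrow>ts. a * mult_on X s) *\<^sub>R v s) = (\<Sum>s\<in>?G. of_rat (facet_mult Z s) *\<^sub>R v s)"
    by (intro sum.cong refl) (simp add: lincombD(4)[OF Z])
  ultimately have int0: "(\<Sum>s\<in>?G. of_rat (facet_mult Z s) *\<^sub>R v s) \<in> dirs t" by simp
  have "(\<Sum>s\<in>?G. of_rat (facet_mult Z s) *\<^sub>R v s) \<in> rat_span (lattice_of t)"
  proof (rule rational_point_in_rat_span[OF _ _ int0])
    show "finite ?G" using convex_complexD(1)[OF C] facets_subset[of ?C] by (auto intro: finite_subset)
    show "v s \<in> zlat" if "s \<in> ?G" for s
      using inward_primitive_mem(1)[OF primitive_normal_inward[OF v convex_complexD(3)[OF C fr(1)] fr(2)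
            convex_complexD(3)[OF C FC]]] that by blast
  qed
  then show "balanced_at Z t" unfolding balanced_at_def using v by blast
qed

section \<open>Common refinements by arrangements\<close>

text \<open>The closed cell of the hyperplane arrangement that has \<open>x\<close> in its relative
  interior: weak inequalities valid at \<open>x\<close> are imposed, and a hyperplane through
  \<open>x\<close> contributes both of them, that is, an equation.\<close>

definition arr_cell :: "((real ^ 'n) \<times> real) set \<Rightarrow> real ^ 'n \<Rightarrow> (real ^ 'n) set" where
  "arr_cell H x = {y. \<forall>(u, c)\<in>H. (u \<bullet> x \<le> c \<longrightarrow> u \<bullet> y \<le> c) \<and> (c \<le> u \<bullet> x \<longrightarrow> c \<le> u \<bullet> y)}"

lemma arr_cellI:
  "(\<And>u c. (u, c) \<in> H \<Longrightarrow> u \<bullet> x \<le> c \<Longrightarrow> u \<bullet> y \<le> c) \<Longrightarrow> (\<And>u c. (u, c) \<in> H \<Longrightarrow> c \<le> u \<bullet> x \<Longrightarrow> c \<le> u \<bullet> y) \<Longrightarrow> y \<in> arr_cell H x"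
  by (auto simp: arr_cell_def)

lemma arr_cellD:
  assumes "y \<in> arr_cell H x" "(u, c) \<in> H"
  shows "u \<bullet> x \<le> c \<Longrightarrow> u \<bullet> y \<le> c" "c \<le> u \<bullet> x \<Longrightarrow> c \<le> u \<bullet> y"
  using assms by (auto simp: arr_cell_def)

lemma arr_cell_self: "x \<in> arr_cell H x"
  by (simp add: arr_cell_def)

lemma finite_arr_cells:
  assumes "finite H"
  shows "finite (range (arr_cell H))"
proof (rule finite_subset)
  let ?f = "\<lambda>(A, B). {y. (\<forall>(u, c)\<in>A. u \<bullet> y \<le> c) \<and> (\<forall>(u, c)\<in>B. c \<le> u \<bullet> y)}"
  show "range (arr_cell H) \<subseteq> ?f ` (Pow H \<times> Pow H)"
  proof
    fix \<kappa> assume "\<kappa> \<in> range (arr_cell H)"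
    then obtain x where "\<kappa> = arr_cell H x" by blast
    then have "\<kappa> = ?f ({(u, c)\<in>H. u \<bullet> x \<le> c}, {(u, c)\<in>H. c \<le> u \<bullet> x})" by (auto simp: arr_cell_def)
    then show "\<kappa> \<in> ?f ` (Pow H \<times> Pow H)" by (rule image_eqI) auto
  qed
qed (use assms in simp)

lemma rational_polyhedron_arr_cell:
  assumes H: "finite H" "\<And>u c. (u, c) \<in> H \<Longrightarrow> u \<in> int_lattice"
  shows "rational_polyhedron (arr_cell H x)"
proof -
  let ?A = "{(u, c)\<in>H. u \<bullet> x \<le> c}" and ?B = "(\<lambda>(u, c). (- u, - c)) ` {(u, c)\<in>H. c \<le> u \<bullet> x}"
  have "finite (?A \<union> ?B)" by (intro finite_UnI finite_imageI finite_subset[OF _ H(1)]) auto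
  moreover have "\<forall>(u, c)\<in>?A \<union> ?B. u \<in> int_lattice"
    using H(2) by (auto simp: int_lattice_eq add_subgroup_minus)
  moreover have "arr_cell H x = (\<Inter>(u, c)\<in>?A \<union> ?B. {y. u \<bullet> y \<le> c})"
    unfolding INT_Un INT_simps(10) by (auto simp: arr_cell_def)
  ultimately show ?thesis unfolding rational_polyhedron_def by blast
qed

text \<open>A constraint of the cell of \<open>y\<close> that is not one of the cell of
  \<open>x\<close> holds at \<open>w\<close> with the opposite sense to that at \<open>a\<close> and
  \<open>b\<close>. Then \<open>w\<close> lies on the hyperplane, and as an inner point of the
  segment it forces both ends onto it.\<close>

lemma arr_cell_Int_face: "(arr_cell H x \<inter> arr_cell H y) face_of arr_cell H x"
  unfolding face_of_def
proof (intro conjI ballI impI)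
  show "convex (arr_cell H x \<inter> arr_cell H y)"
  proof -
    have "convex (arr_cell H z)" for z
    proof -
      have "arr_cell H z = (\<Inter>(u, c)\<in>H. (if u \<bullet> z \<le> c then {w. u \<bullet> w \<le> c} else UNIV) \<inter> (if c \<le> u \<bullet> z then {w. u \<bullet> w \<ge> c} else UNIV))"
        by (auto simp: arr_cell_def)
      then show ?thesis by (auto intro!: convex_INT convex_Int convex_halfspace_le convex_halfspace_ge)
    qed
    then show ?thesis by (intro convex_Int)
  qed
  fix a b w assume ab: "a \<in> arr_cell H x" "b \<in> arr_cell H x" and w: "w \<in> arr_cell H x \<inter> arr_cell H y" "w \<in> open_segment a b"
  obtain t where t: "0 < t" "t < 1" "w = (1 - t) *\<^sub>R a + t *\<^sub>R b" using w(2) by (auto simp: in_segment)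
  have both: "u \<bullet> a = c \<and> u \<bullet> b = c" if h: "u \<bullet> w = c" "u \<bullet> a \<le> c \<and> u \<bullet> b \<le> c \<or> c \<le> u \<bullet> a \<and> c \<le> u \<bullet> b" for u c
  proof -
    have "(1 - t) * (u \<bullet> a - c) + t * (u \<bullet> b - c) = 0" using h(1) t(3) by (simp add: inner_add_right algebra_simps)
    then have s: "(1 - t) * (u \<bullet> a - c) = - (t * (u \<bullet> b - c))" by simp
    show ?thesis
    proof (cases "u \<bullet> a \<le> c \<and> u \<bullet> b \<le> c")
      case True
      then have "(1 - t) * (u \<bullet> a - c) \<le> 0" "t * (u \<bullet> b - c) \<le> 0" using t(1,2) by (auto simp: mult_le_0_iff)
      then have "(1 - t) * (u \<bullet> a - c) = 0" "t * (u \<bullet> b - c) = 0" using s by linarith+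
      then show ?thesis using t(1,2) by simp
    next
      case False
      then have "c \<le> u \<bullet> a \<and> c \<le> u \<bullet> b" using h(2) by blast
      then have "(1 - t) * (u \<bullet> a - c) \<ge> 0" "t * (u \<bullet> b - c) \<ge> 0" using t(1,2) by simp_all
      then have "(1 - t) * (u \<bullet> a - c) = 0" "t * (u \<bullet> b - c) = 0" using s by linarith+
      then show ?thesis using t(1,2) by simp
    qed
  qed
  have "a \<in> arr_cell H y \<and> b \<in> arr_cell H y"
  proof (intro conjI arr_cellI)
    fix u c assume h: "(u, c) \<in> H" "u \<bullet> y \<le> c"
    have wc: "u \<bullet> w \<le> c" using w(1) arr_cellD(1)[OF _ h] by blast
    have "u \<bullet> a \<le> c \<and> u \<bullet> b \<le> c"
    proof (cases "u \<bullet> x \<le> c")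
      case True
      then show ?thesis using arr_cellD(1)[OF ab(1) h(1)] arr_cellD(1)[OF ab(2) h(1)] by blast
    next
      case False
      then have x: "c \<le> u \<bullet> x" by simp
      have "c \<le> u \<bullet> w" using arr_cellD(2)[OF _ h(1) x] w(1) by blast
      then show ?thesis using both[of u c] arr_cellD(2)[OF ab(1) h(1) x] arr_cellD(2)[OF ab(2) h(1) x] wc by simp
    qed
    then show "u \<bullet> a \<le> c" "u \<bullet> b \<le> c" by auto
  next
    fix u c assume h: "(u, c) \<in> H" "c \<le> u \<bullet> y"
    have wc: "c \<le> u \<bullet> w" using w(1) arr_cellD(2)[OF _ h] by blast
    have "c \<le> u \<bullet> a \<and> c \<le> u \<bullet> b"
    proof (cases "c \<le> u \<bullet> x")
      case True
      then show ?thesis using arr_cellD(2)[OF ab(1) h(1)] arr_cellD(2)[OF ab(2) h(1)] by blast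
    next
      case False
      then have x: "u \<bullet> x \<le> c" by simp
      have "u \<bullet> w \<le> c" using arr_cellD(1)[OF _ h(1) x] w(1) by blast
      then show ?thesis using both[of u c] arr_cellD(1)[OF ab(1) h(1) x] arr_cellD(1)[OF ab(2) h(1) x] wc by simp
    qed
    then show "c \<le> u \<bullet> a" "c \<le> u \<bullet> b" by auto
  qed
  then show "a \<in> arr_cell H x \<inter> arr_cell H y" "b \<in> arr_cell H x \<inter> arr_cell H y" using ab by auto
qed auto

lemma arr_cell_mono: "y \<in> arr_cell H x \<Longrightarrow> arr_cell H y \<subseteq> arr_cell H x"
proof
  fix w assume y: "y \<in> arr_cell H x" and w: "w \<in> arr_cell H y"
  show "w \<in> arr_cell H x"
    by (rule arr_cellI) (use arr_cellD[OF y] arr_cellD[OF w] in blast)+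
qed

text \<open>Inequalities strict at \<open>y\<close> persist nearby, and those tight at
  \<open>y\<close> are equations on the whole cell, so they are unaffected by moving along its
  directions.\<close>

lemma rel_interior_arr_cell:
  assumes H: "finite H"
  shows "y \<in> rel_interior (arr_cell H y)"
proof -
  have "eventually (\<lambda>z. \<forall>(u, c)\<in>H. (u \<bullet> y < c \<longrightarrow> u \<bullet> z < c) \<and> (c < u \<bullet> y \<longrightarrow> c < u \<bullet> z)) (nhds y)"
  proof (rule eventually_ball_finite[OF H], rule ballI)
    fix h assume "h \<in> H"
    obtain u c where h: "h = (u, c)" by (cases h)
    have lim: "((\<lambda>z. u \<bullet> z) \<longlongrightarrow> u \<bullet> y) (nhds y)" by (intro tendsto_intros filterlim_ident)
    have "eventually (\<lambda>z. u \<bullet> y < c \<longrightarrow> u \<bullet> z < c) (nhds y)"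
      using order_tendstoD(2)[OF lim, of c] by (cases "u \<bullet> y < c") auto
    moreover have "eventually (\<lambda>z. c < u \<bullet> y \<longrightarrow> c < u \<bullet> z) (nhds y)"
      using order_tendstoD(1)[OF lim, of c] by (cases "c < u \<bullet> y") auto
    ultimately show "eventually (\<lambda>z. case h of (u, c) \<Rightarrow> (u \<bullet> y < c \<longrightarrow> u \<bullet> z < c) \<and> (c < u \<bullet> y \<longrightarrow> c < u \<bullet> z)) (nhds y)"
      unfolding h split_conv by (rule eventually_conj)
  qed
  then obtain e where e: "e > 0" "\<And>z. dist z y < e \<Longrightarrow> \<forall>(u, c)\<in>H. (u \<bullet> y < c \<longrightarrow> u \<bullet> z < c) \<and> (c < u \<bullet> y \<longrightarrow> c < u \<bullet> z)"
    by (auto simp: eventually_nhds_metric)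
  show ?thesis
  proof (rule rel_interiorI_dirs[OF arr_cell_self e(1)])
    fix d assume d: "d \<in> dirs (arr_cell H y)" "norm d < e"
    have "dist (y + d) y < e" using d(2) by (simp add: dist_norm)
    note strict = e(2)[OF this]
    have eq: "u \<bullet> d = 0" if "(u, c) \<in> H" "u \<bullet> y = c" for u c
    proof -
      have "dirs (arr_cell H y) \<subseteq> {d. u \<bullet> d = 0}"
      proof (rule dirs_subset[OF subspace_hyperplane arr_cell_self])
        fix z assume z: "z \<in> arr_cell H y"
        have "u \<bullet> z \<le> c" "c \<le> u \<bullet> z" using arr_cellD[OF z that(1)] that(2) by simp_all
        then show "z - y \<in> {d. u \<bullet> d = 0}" using that(2) by (simp add: inner_diff_right)
      qed
      then show ?thesis using d(1) by blast
    qed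
    show "y + d \<in> arr_cell H y"
    proof (rule arr_cellI)
      fix u c assume h: "(u, c) \<in> H" "u \<bullet> y \<le> c"
      show "u \<bullet> (y + d) \<le> c"
        using strict[THEN bspec, OF h(1)] eq[OF h(1)] h(2) by (cases "u \<bullet> y = c") (auto simp: inner_add_right)
    next
      fix u c assume h: "(u, c) \<in> H" "c \<le> u \<bullet> y"
      show "c \<le> u \<bullet> (y + d)"
        using strict[THEN bspec, OF h(1)] eq[OF h(1)] h(2) by (cases "u \<bullet> y = c") (auto simp: inner_add_right)
    qed
  qed
qed

lemma face_of_arr_cell:
  assumes H: "finite H" and \<phi>: "\<phi> face_of arr_cell H x" "\<phi> \<noteq> {}"
  shows "\<phi> \<in> range (arr_cell H)"
proof -
  obtain y where y: "y \<in> rel_interior \<phi>" using rel_interior_eq_empty face_of_imp_convex[OF \<phi>(1)] \<phi>(2) by blast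
  then have "y \<in> arr_cell H x" using rel_interior_subset face_of_imp_subset[OF \<phi>(1)] by blast
  then have "arr_cell H x \<inter> arr_cell H y = arr_cell H y" using arr_cell_mono by blast
  then have "arr_cell H y face_of arr_cell H x" using arr_cell_Int_face[of H x y] by simp
  moreover have "rel_interior \<phi> \<inter> rel_interior (arr_cell H y) \<noteq> {}" using y rel_interior_arr_cell[OF H] by blast
  ultimately show ?thesis using face_of_eq[OF \<phi>(1)] by blast
qed

lemma polyhedral_complex_arr:
  assumes H: "finite H" "\<And>u c. (u, c) \<in> H \<Longrightarrow> u \<in> int_lattice"
  shows "polyhedral_complex {\<kappa>\<in>range (arr_cell H). \<exists>\<rho>\<in>P. \<kappa> \<subseteq> \<rho>}"
  unfolding polyhedral_complex_def
proof (intro conjI ballI allI impI)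
  show "finite {\<kappa>\<in>range (arr_cell H). \<exists>\<rho>\<in>P. \<kappa> \<subseteq> \<rho>}" using finite_arr_cells[OF H(1)] by simp
next
  fix s assume "s \<in> {\<kappa>\<in>range (arr_cell H). \<exists>\<rho>\<in>P. \<kappa> \<subseteq> \<rho>}"
  then obtain x where x: "s = arr_cell H x" by blast
  show "rational_polyhedron s" unfolding x by (rule rational_polyhedron_arr_cell[OF H])
  show "s \<noteq> {}" unfolding x using arr_cell_self by blast
next
  fix s \<phi> assume l: "s \<in> {\<kappa>\<in>range (arr_cell H). \<exists>\<rho>\<in>P. \<kappa> \<subseteq> \<rho>}" and f: "\<phi> face_of s \<and> \<phi> \<noteq> {}"
  then obtain x \<rho> where x: "s = arr_cell H x" "\<rho> \<in> P" "s \<subseteq> \<rho>" by blast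
  have "\<phi> \<in> range (arr_cell H)" using face_of_arr_cell[OF H(1)] f x(1) by blast
  moreover have "\<phi> \<subseteq> \<rho>" using face_of_imp_subset f x(3) by blast
  ultimately show "\<phi> \<in> {\<kappa>\<in>range (arr_cell H). \<exists>\<rho>\<in>P. \<kappa> \<subseteq> \<rho>}" using x(2) by blast
next
  fix s t assume l: "s \<in> {\<kappa>\<in>range (arr_cell H). \<exists>\<rho>\<in>P. \<kappa> \<subseteq> \<rho>}" "t \<in> {\<kappa>\<in>range (arr_cell H). \<exists>\<rho>\<in>P. \<kappa> \<subseteq> \<rho>}"
  then obtain x y where xy: "s = arr_cell H x" "t = arr_cell H y" by blast
  show "(s \<inter> t) face_of s" unfolding xy by (rule arr_cell_Int_face)
  show "(s \<inter> t) face_of t" unfolding xy using arr_cell_Int_face[of H y x] by (simp only: Int_commute)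
qed

text \<open>The arrangement consists of all hyperplanes occurring in some description of some cell
  of some \<open>X\<close>. Its cell through a point of \<open>\<rho>\<close> obeys the inequalities
  of \<open>\<rho>\<close> and so lies in \<open>\<rho>\<close>. The arrangement covers the whole
  space; only cells inside some given cell are kept.\<close>

theorem lincomb_exists:
  fixes ts :: "(rat \<times> (real ^ 'n) weighted_complex) list"
  assumes ts: "\<And>b X. (b, X) \<in> set ts \<Longrightarrow> polyhedral_complex (cells X)"
  shows "\<exists>Z. lincomb ts Z"
proof -
  define P where "P = (\<Union>(b, X)\<in>set ts. cells X)"
  have PX: "\<exists>b X. (b, X) \<in> set ts \<and> \<rho> \<in> cells X" if "\<rho> \<in> P" for \<rho> using that unfolding P_def by blast
  have finP: "finite P" unfolding P_def
  proof (rule finite_UN_I)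
    fix t assume t: "t \<in> set ts"
    obtain b X where bX: "t = (b, X)" by (cases t)
    show "finite (case t of (b, X) \<Rightarrow> cells X)"
      using ts[OF t[unfolded bX]] unfolding bX split_conv polyhedral_complex_def by (rule conjunct1)
  qed simp
  have "\<exists>H. finite H \<and> (\<forall>(u, c)\<in>H. u \<in> int_lattice) \<and> \<rho> = (\<Inter>(u, c)\<in>H. {x. u \<bullet> x \<le> c})" if \<rho>: "\<rho> \<in> P" for \<rho>
  proof -
    obtain b X where bX: "(b, X) \<in> set ts" "\<rho> \<in> cells X" using PX[OF \<rho>] by blast
    have "rational_polyhedron \<rho>"
      using ts[OF bX(1), unfolded polyhedral_complex_def, THEN conjunct2, THEN conjunct1] bX(2) by blast
    then show ?thesis by (simp only: rational_polyhedron_def)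
  qed
  then obtain h where h: "\<And>\<rho>. \<rho> \<in> P \<Longrightarrow> finite (h \<rho>)" "\<And>\<rho>. \<rho> \<in> P \<Longrightarrow> \<forall>(u, c)\<in>h \<rho>. u \<in> int_lattice"
    "\<And>\<rho>. \<rho> \<in> P \<Longrightarrow> \<rho> = (\<Inter>(u, c)\<in>h \<rho>. {x. u \<bullet> x \<le> c})" by metis
  define H where "H = \<Union>(h ` P)"
  have H: "finite H" "\<And>u c. (u, c) \<in> H \<Longrightarrow> u \<in> int_lattice" using h(1,2) finP by (auto simp: H_def) blast
  define Z where "Z = \<lparr>cells = {\<kappa>\<in>range (arr_cell H). \<exists>\<rho>\<in>P. \<kappa> \<subseteq> \<rho>}, facet_mult = (\<lambda>s. \<Sum>(b, X)\<leftarrow>ts. b * mult_on X s)\<rparr>"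
  have sub: "arr_cell H x \<subseteq> \<rho>" if \<rho>: "\<rho> \<in> P" "x \<in> \<rho>" for x \<rho>
  proof
    fix y assume y: "y \<in> arr_cell H x"
    have "u \<bullet> y \<le> c" if uc: "(u, c) \<in> h \<rho>" for u c
    proof (rule arr_cellD(1)[OF y])
      show "(u, c) \<in> H" using uc \<rho>(1) by (auto simp: H_def)
      have "x \<in> (\<Inter>(u, c)\<in>h \<rho>. {x. u \<bullet> x \<le> c})" using h(3)[OF \<rho>(1)] \<rho>(2) by blast
      then show "u \<bullet> x \<le> c" using uc by blast
    qed
    then have "y \<in> (\<Inter>(u, c)\<in>h \<rho>. {x. u \<bullet> x \<le> c})" by blast
    then show "y \<in> \<rho>" using h(3)[OF \<rho>(1)] by blast
  qed
  have cov: "\<rho> = \<Union>{s\<in>cells Z. s \<subseteq> \<rho>}" if \<rho>: "\<rho> \<in> P" for \<rho>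
  proof (intro subset_antisym subsetI)
    fix x assume x: "x \<in> \<rho>"
    have "arr_cell H x \<in> {s\<in>cells Z. s \<subseteq> \<rho>}" using sub[OF \<rho> x] \<rho> by (auto simp: Z_def)
    then show "x \<in> \<Union>{s\<in>cells Z. s \<subseteq> \<rho>}" using arr_cell_self by blast
  qed blast
  have "lincomb ts Z" unfolding lincomb_def
  proof (intro conjI)
    show "polyhedral_complex (cells Z)" unfolding Z_def using polyhedral_complex_arr[OF H] by simp
    have "\<Union>(cells Z) = \<Union>P"
    proof (intro subset_antisym subsetI)
      fix x assume "x \<in> \<Union>(cells Z)"
      then show "x \<in> \<Union>P" by (auto simp: Z_def)
    next
      fix x assume "x \<in> \<Union>P"
      then obtain \<rho> where "\<rho> \<in> P" "x \<in> \<rho>" by blast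
      then show "x \<in> \<Union>(cells Z)" using cov[OF \<open>\<rho> \<in> P\<close>] by blast
    qed
    then show "\<Union>(cells Z) = (\<Union>(b, X)\<in>set ts. \<Union>(cells X))" unfolding P_def by auto
    show "\<forall>(b, X)\<in>set ts. \<forall>\<rho>\<in>cells X. \<rho> = \<Union>{s\<in>cells Z. s \<subseteq> \<rho>}"
    proof (clarify)
      fix b X \<rho> assume "(b, X) \<in> set ts" "\<rho> \<in> cells X"
      then have "\<rho> \<in> P" unfolding P_def by blast
      then show "\<rho> = \<Union>{s\<in>cells Z. s \<subseteq> \<rho>}" by (rule cov)
    qed
    show "\<forall>s\<in>facets (cells Z). facet_mult Z s = (\<Sum>(b, X)\<leftarrow>ts. b * mult_on X s)" by (simp add: Z_def)
  qed
  then show ?thesis by blast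
qed

section \<open>Decomposition into positive cycles\<close>

lemma rational_polyhedron_affine_hull:
  assumes "rational_polyhedron s" "s \<noteq> {}"
  shows "rational_polyhedron (affine hull s)"
proof -
  obtain x where x: "x \<in> s" using assms(2) by blast
  obtain F where F: "F \<subseteq> orthogonal_comp (dirs s) \<inter> zlat" "span F = orthogonal_comp (dirs s)" "finite F"
    by (rule rational_subspace_basis[OF rational_orthogonal_comp[OF rational_polyhedron_dirs[OF assms]]])
  have mem: "y \<in> dirs s \<longleftrightarrow> (\<forall>u\<in>F. u \<bullet> y = 0)" for y
  proof -
    have "y \<in> dirs s \<longleftrightarrow> y \<in> orthogonal_comp (span F)"
      unfolding F(2) orthogonal_comp_self[OF subspace_dirs] ..
    also have "\<dots> \<longleftrightarrow> (\<forall>u\<in>F. u \<bullet> y = 0)"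
      using orthogonal_span_iff[of F y] by (auto simp: orthogonal_comp_def orthogonal_def)
    finally show ?thesis .
  qed
  let ?H = "(\<lambda>u. (u, u \<bullet> x)) ` F \<union> (\<lambda>u. (- u, - (u \<bullet> x))) ` F"
  have "affine hull s = (\<Inter>(u, c)\<in>?H. {y. u \<bullet> y \<le> c})"
  proof -
    have "(\<Inter>(u, c)\<in>?H. {y. u \<bullet> y \<le> c}) = {y. \<forall>u\<in>F. u \<bullet> y = u \<bullet> x}"
      unfolding INT_Un by force
    then show ?thesis unfolding affine_hull_dirs[OF x] mem by (simp add: inner_diff_right)
  qed
  moreover have "\<forall>(u, c)\<in>?H. u \<in> int_lattice" using F(1) by (auto simp: int_lattice_eq intro: add_subgroup_minus)
  ultimately show ?thesis unfolding rational_polyhedron_def using F(3) by (intro exI[of _ ?H]) auto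
qed

text \<open>The affine span of \<open>s\<close> as a cycle of multiplicity 1. An affine space has no
  proper nonempty face, so there is no ridge at which to balance.\<close>

definition hull_cycle :: "(real ^ 'n) set \<Rightarrow> (real ^ 'n) weighted_complex" where
  "hull_cycle s = \<lparr>cells = {affine hull s}, facet_mult = (\<lambda>_. 1)\<rparr>"

lemma facets_hull_cycle: "facets (cells (hull_cycle s)) = {affine hull s}"
  by (auto simp: hull_cycle_def facets_def)

lemma positive_hull_cycle: "positive (hull_cycle s)"
  by (simp add: positive_def hull_cycle_def)

lemma mult_on_hull_cycle: "mult_on (hull_cycle s) \<kappa> = (if \<kappa> \<subseteq> affine hull s then 1 else 0)"
proof -
  have "{\<rho>. \<rho> \<in> facets (cells (hull_cycle s)) \<and> \<kappa> \<subseteq> \<rho>} = (if \<kappa> \<subseteq> affine hull s then {affine hull s} else {})"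
    unfolding facets_hull_cycle by auto
  then show ?thesis by (simp add: mult_on_def) (simp add: hull_cycle_def)
qed

lemma tropical_hull_cycle:
  assumes X: "tropical_cycle p X" and s: "s \<in> facets (cells X)"
  shows "tropical_cycle p (hull_cycle s)"
proof -
  have sX: "s \<in> cells X" using s facets_subset by blast
  have ne: "s \<noteq> {}" by (rule convex_complexD(4)[OF tropical_cycleD(2)[OF X] sX])
  have triv: "\<phi> = affine hull s" if "\<phi> face_of affine hull s" "\<phi> \<noteq> {}" for \<phi>
    using face_of_affine_trivial[OF affine_affine_hull that(1)] that(2) by blast
  have "polyhedral_complex (cells (hull_cycle s))"
    unfolding polyhedral_complex_def hull_cycle_def
    using rational_polyhedron_affine_hull[OF tropical_cycleD(5)[OF X sX] ne] ne triv
    by (auto intro: face_of_refl affine_imp_convex)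
  moreover have "pure_codim p (cells (hull_cycle s))"
    unfolding pure_codim_def facets_hull_cycle using tropical_cycleD(3)[OF X s] by simp
  moreover have "ridges (cells (hull_cycle s)) = {}"
    unfolding ridges_def facets_hull_cycle using triv by (fastforce simp: facet_of_def)
  ultimately show ?thesis by (simp add: tropical_cycle_def)
qed

lemma mult_on_facet:
  assumes C: "finite (cells X)" and \<kappa>: "\<kappa> \<in> facets (cells X)"
  shows "mult_on X \<kappa> = facet_mult X \<kappa>"
proof -
  have "{\<rho>. \<rho> \<in> facets (cells X) \<and> \<kappa> \<subseteq> \<rho>} = {\<kappa>}" using \<kappa> by (auto simp: facets_def)
  then show ?thesis by (simp add: mult_on_def)
qed

text \<open>A set with all the directions of \<open>\<rho>\<close> lies in no other facet, since two
  distinct facets meet in a face of smaller dimension. So the sum defining \<open>mult_on\<close>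
  has a single term.\<close>

lemma mult_on_inside_facet:
  assumes X: "tropical_cycle p X" and \<rho>: "\<rho> \<in> facets (cells X)" and \<kappa>: "\<kappa> \<subseteq> \<rho>" "\<kappa> \<noteq> {}" "dirs \<kappa> = dirs \<rho>"
  shows "mult_on X \<kappa> = facet_mult X \<rho>"
proof -
  note CX = tropical_cycleD(2)[OF X]
  have FX: "\<And>\<rho>. \<rho> \<in> facets (cells X) \<Longrightarrow> \<rho> \<in> cells X" using facets_subset by blast
  have "\<rho>' = \<rho>" if \<rho>': "\<rho>' \<in> facets (cells X)" "\<kappa> \<subseteq> \<rho>'" for \<rho>'
  proof -
    have f: "(\<rho> \<inter> \<rho>') face_of \<rho>" using convex_complexD(6)[OF CX FX[OF \<rho>'(1)] FX[OF \<rho>]] by (simp only: Int_commute)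
    have ne: "\<rho> \<inter> \<rho>' \<noteq> {}" using \<kappa> \<rho>'(2) by blast
    have "dirs \<rho> \<subseteq> dirs (\<rho> \<inter> \<rho>')" using dirs_mono[of \<kappa> "\<rho> \<inter> \<rho>'"] \<kappa>(1,3) \<rho>'(2) by simp
    then have "dim (dirs \<rho>) \<le> dim (dirs (\<rho> \<inter> \<rho>'))" by (rule dim_subset)
    then have "\<rho> \<inter> \<rho>' = \<rho>" using face_dim_less[OF convex_complexD(3)[OF CX FX[OF \<rho>]] f _ ne] by linarith
    then have "\<rho> \<subseteq> \<rho>'" by blast
    then show ?thesis using \<rho> FX[OF \<rho>'(1)] by (simp add: facets_def)
  qed
  then have "{\<rho>'. \<rho>' \<in> facets (cells X) \<and> \<kappa> \<subseteq> \<rho>'} = {\<rho>}" using \<rho> \<kappa>(1) by blast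
  then show ?thesis by (simp add: mult_on_def)
qed

lemma cells_drop_zero: "cells (drop_zero X) = {t\<in>cells X. \<exists>s\<in>facets (cells X). facet_mult X s \<noteq> 0 \<and> t \<subseteq> s}"
  and facet_mult_drop_zero: "facet_mult (drop_zero X) = facet_mult X"
  by (simp_all add: drop_zero_def)

lemma facets_drop_zero: "facets (cells (drop_zero X)) = {s\<in>facets (cells X). facet_mult X s \<noteq> 0}"
proof (intro set_eqI iffI)
  fix s assume s: "s \<in> facets (cells (drop_zero X))"
  then obtain \<rho> where \<rho>: "\<rho> \<in> facets (cells X)" "facet_mult X \<rho> \<noteq> 0" "s \<subseteq> \<rho>" by (auto simp: facets_def cells_drop_zero)
  then have "\<rho> \<in> cells (drop_zero X)" using facets_subset[of "cells X"] by (auto simp: cells_drop_zero)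
  then have "\<rho> = s" using s \<rho>(3) by (simp add: facets_def)
  then show "s \<in> {s\<in>facets (cells X). facet_mult X s \<noteq> 0}" using \<rho> by simp
next
  fix s assume "s \<in> {s\<in>facets (cells X). facet_mult X s \<noteq> 0}"
  then show "s \<in> facets (cells (drop_zero X))" by (auto simp: facets_def cells_drop_zero)
qed

lemma polyhedral_drop_zero:
  assumes "polyhedral_complex (cells X)"
  shows "polyhedral_complex (cells (drop_zero X))"
proof -
  note d = assms[unfolded polyhedral_complex_def]
  note face = d[THEN conjunct2, THEN conjunct2, THEN conjunct1, rule_format]
  show ?thesis unfolding polyhedral_complex_def
  proof (intro conjI ballI allI impI)
    show "finite (cells (drop_zero X))" using d by (simp add: cells_drop_zero)
  next
    fix s \<phi> assume l: "s \<in> cells (drop_zero X)" and f: "\<phi> face_of s \<and> \<phi> \<noteq> {}"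
    have s: "s \<in> cells X" using l by (simp add: cells_drop_zero)
    show "\<phi> \<in> cells (drop_zero X)" using face[OF s f] l face_of_imp_subset[OF f[THEN conjunct1]] by (auto simp: cells_drop_zero)
  qed (use d in \<open>auto simp: cells_drop_zero\<close>)
qed

text \<open>The facets of nonzero multiplicity of \<open>Z\<close> already give the common
  refinement. Purity matters twice: a facet of \<open>Z\<close> inside a facet of \<open>X\<close>
  has full dimension in it, and facets of \<open>X\<close> are covered by facets of
  \<open>Z\<close>, not merely by cells.\<close>

lemma cycle_eqI:
  fixes Z X :: "(real ^ 'n) weighted_complex"
  assumes X: "tropical_cycle p X" and Z: "tropical_cycle p Z"
    and sub: "\<And>\<rho>. \<rho> \<in> cells X \<Longrightarrow> \<rho> = \<Union>{\<kappa>\<in>cells Z. \<kappa> \<subseteq> \<rho>}"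
    and mult: "\<And>\<kappa>. \<kappa> \<in> facets (cells Z) \<Longrightarrow> facet_mult Z \<kappa> = mult_on X \<kappa>"
  shows "cycle_eq Z X"
proof -
  note CX = tropical_cycleD(2)[OF X] and CZ = tropical_cycleD(2)[OF Z]
  have FX: "\<And>\<rho>. \<rho> \<in> facets (cells X) \<Longrightarrow> \<rho> \<in> cells X" and FZ: "\<And>\<rho>. \<rho> \<in> facets (cells Z) \<Longrightarrow> \<rho> \<in> cells Z"
    using facets_subset by blast+
  have dimX: "int (dim (dirs \<rho>)) = int CARD('n) - int p" if "\<rho> \<in> facets (cells X)" for \<rho> by (rule facet_dim[OF X that])
  have dimZ: "int (dim (dirs \<rho>)) = int CARD('n) - int p" if "\<rho> \<in> facets (cells Z)" for \<rho> by (rule facet_dim[OF Z that])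
  have up: "\<exists>\<rho>\<in>facets (cells X). facet_mult X \<rho> \<noteq> 0 \<and> \<kappa> \<subseteq> \<rho>" if \<kappa>: "\<kappa> \<in> facets (cells Z)" "facet_mult Z \<kappa> \<noteq> 0" for \<kappa>
  proof (rule ccontr)
    assume "\<not> ?thesis"
    then have "mult_on X \<kappa> = 0" unfolding mult_on_def by (intro sum.neutral) blast
    then show False using mult[OF \<kappa>(1)] \<kappa>(2) by simp
  qed
  have eq: "facet_mult Z \<kappa> = facet_mult X \<rho>" if \<kappa>: "\<kappa> \<in> facets (cells Z)" "\<rho> \<in> facets (cells X)" "\<kappa> \<subseteq> \<rho>" for \<kappa> \<rho>
  proof -
    have "dirs \<kappa> = dirs \<rho>"
      by (rule subspace_dim_equal[OF subspace_dirs subspace_dirs dirs_mono[OF \<kappa>(3)]]) (use dimX[OF \<kappa>(2)] dimZ[OF \<kappa>(1)] in simp)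
    then show ?thesis
      using mult_on_inside_facet[OF X \<kappa>(2,3) convex_complexD(4)[OF CZ FZ[OF \<kappa>(1)]]] mult[OF \<kappa>(1)] by simp
  qed
  have down: "\<exists>\<kappa>\<in>facets (cells Z). x \<in> \<kappa> \<and> \<kappa> \<subseteq> \<rho>" if \<rho>: "\<rho> \<in> facets (cells X)" and x: "x \<in> \<rho>" for \<rho> x
  proof -
    have "\<rho> \<subseteq> \<Union>{\<kappa>\<in>{\<kappa>\<in>cells Z. \<kappa> \<subseteq> \<rho>}. \<rho> \<subseteq> affine hull \<kappa>}"
      by (rule convex_cover_full[OF convex_complexD(3)[OF CX FX[OF \<rho>]]])
        (use sub[OF FX[OF \<rho>]] convex_complexD(1,2)[OF CZ] in auto)
    then obtain \<kappa> where \<kappa>: "\<kappa> \<in> cells Z" "\<kappa> \<subseteq> \<rho>" "\<rho> \<subseteq> affine hull \<kappa>" "x \<in> \<kappa>" using x by blast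
    have "\<rho> \<subseteq> {y. y - x \<in> dirs \<kappa>}" using \<kappa>(3) unfolding affine_hull_dirs[OF \<kappa>(4)] .
    then have "dirs \<rho> \<subseteq> dirs \<kappa>" by (intro dirs_subset[OF subspace_dirs x]) blast
    then have le: "dim (dirs \<rho>) \<le> dim (dirs \<kappa>)" by (rule dim_subset)
    obtain \<kappa>' where \<kappa>': "\<kappa>' \<in> facets (cells Z)" "\<kappa> \<subseteq> \<kappa>'" using facet_exists[OF convex_complexD(1)[OF CZ] \<kappa>(1)] by blast
    have "\<kappa> = \<kappa>'"
    proof (rule ccontr)
      assume ne: "\<kappa> \<noteq> \<kappa>'"
      have "dim (dirs \<kappa>) < dim (dirs \<kappa>')"
        by (rule face_dim_less[OF convex_complexD(3)[OF CZ FZ[OF \<kappa>'(1)]]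
              complex_face_subset[OF CZ FZ[OF \<kappa>'(1)] \<kappa>(1) \<kappa>'(2)] ne convex_complexD(4)[OF CZ \<kappa>(1)]])
      then show False using le dimX[OF \<rho>] dimZ[OF \<kappa>'(1)] by simp
    qed
    then show ?thesis using \<kappa>' \<kappa> by blast
  qed
  have "refines (drop_zero Z) (drop_zero Z)"
    unfolding refines_def by (auto simp: facets_def)
  moreover have "refines (drop_zero Z) (drop_zero X)"
    unfolding refines_def
  proof (intro conjI ballI impI)
    show "\<Union>(cells (drop_zero Z)) = \<Union>(cells (drop_zero X))"
    proof (intro subset_antisym subsetI)
      fix x assume "x \<in> \<Union>(cells (drop_zero Z))"
      then obtain \<kappa> where "\<kappa> \<in> facets (cells Z)" "facet_mult Z \<kappa> \<noteq> 0" "x \<in> \<kappa>" by (auto simp: cells_drop_zero)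
      then obtain \<rho> where "\<rho> \<in> facets (cells X)" "facet_mult X \<rho> \<noteq> 0" "x \<in> \<rho>" using up by blast
      then show "x \<in> \<Union>(cells (drop_zero X))" using FX by (auto simp: cells_drop_zero)
    next
      fix x assume "x \<in> \<Union>(cells (drop_zero X))"
      then obtain \<rho> where \<rho>: "\<rho> \<in> facets (cells X)" "facet_mult X \<rho> \<noteq> 0" "x \<in> \<rho>" by (auto simp: cells_drop_zero)
      then obtain \<kappa> where \<kappa>: "\<kappa> \<in> facets (cells Z)" "x \<in> \<kappa>" "\<kappa> \<subseteq> \<rho>" using down by blast
      then have "facet_mult Z \<kappa> \<noteq> 0" using eq[OF \<kappa>(1) \<rho>(1)] \<rho>(2) by simp
      then show "x \<in> \<Union>(cells (drop_zero Z))" using \<kappa> FZ by (auto simp: cells_drop_zero)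
    qed
  next
    fix s assume "s \<in> cells (drop_zero Z)"
    then obtain \<kappa> where "\<kappa> \<in> facets (cells Z)" "facet_mult Z \<kappa> \<noteq> 0" "s \<subseteq> \<kappa>" by (auto simp: cells_drop_zero)
    then obtain \<rho> where "\<rho> \<in> facets (cells X)" "facet_mult X \<rho> \<noteq> 0" "s \<subseteq> \<rho>" using up by blast
    then show "\<exists>\<rho>\<in>cells (drop_zero X). s \<subseteq> \<rho>" using FX by (auto simp: cells_drop_zero)
  next
    fix s \<rho> assume "s \<in> facets (cells (drop_zero Z))" "\<rho> \<in> facets (cells (drop_zero X))" "s \<subseteq> \<rho>"
    then show "facet_mult (drop_zero Z) s = facet_mult (drop_zero X) \<rho>"
      by (auto simp: facets_drop_zero facet_mult_drop_zero intro: eq)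
  qed
  ultimately show ?thesis unfolding cycle_eq_def using polyhedral_drop_zero[OF tropical_cycleD(1)[OF Z]] by blast
qed

text \<open>Adding sufficiently many copies of the affine spans of the facets makes all multiplicities positive.\<close>

lemma positive_decomposition_exists:
  fixes X :: "(real ^ 'n) weighted_complex"
  assumes X: "tropical_cycle p X"
  shows "\<exists>ts. positive_decomposition p X ts"
proof -
  let ?F = "facets (cells X)"
  have finF: "finite ?F" using convex_complexD(1)[OF tropical_cycleD(2)[OF X]] facets_subset[of "cells X"] by (rule rev_finite_subset)
  obtain fs where fs: "set fs = ?F" "distinct fs" using finite_distinct_list[OF finF] by blast
  \<comment> \<open>Larger than the absolute value of every multiplicity that \<open>X\<close> can
    contribute. Each facet of the sum lies in at least one of the affine spans and so receives at
    least \<open>b\<close> in addition.\<close>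
  define b where "b = 1 + (\<Sum>s\<in>?F. \<bar>facet_mult X s\<bar>)"
  define lines where "lines e = map (\<lambda>s. (e, hull_cycle s)) fs" for e :: rat
  have sum_lines: "(\<Sum>(a, X)\<leftarrow>lines e. a * mult_on X \<kappa>) = e * (\<Sum>s\<in>?F. mult_on (hull_cycle s) \<kappa>)" for e \<kappa>
    by (simp add: lines_def o_def sum_list_const_mult sum_list_distinct_conv_sum_set[OF fs(2)] fs(1))
  have set_lines: "(a, L) \<in> set (lines e) \<longleftrightarrow> a = e \<and> (\<exists>s\<in>?F. L = hull_cycle s)" for a L e
    unfolding lines_def using fs(1) by auto
  have trop: "tropical_cycle p L" if "(a, L) \<in> set ((1, X) # lines b)" for a L
    using that X tropical_hull_cycle[OF X] set_lines[of a L b] by auto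
  have "\<exists>X'. lincomb ((1, X) # lines b) X'"
    by (rule lincomb_exists) (erule tropical_cycleD(1)[OF trop])
  then obtain X' where X': "lincomb ((1, X) # lines b) X'" by blast
  have tX': "tropical_cycle p X'" by (rule tropical_lincomb[OF X']) (erule trop)
  have pos: "positive X'" unfolding positive_def
  proof
    fix \<kappa> assume \<kappa>: "\<kappa> \<in> facets (cells X')"
    have "\<exists>s\<in>?F. \<kappa> \<subseteq> affine hull s"
    proof -
      have "\<exists>a L \<rho>. (a, L) \<in> set ((1, X) # lines b) \<and> \<rho> \<in> facets (cells L) \<and> \<kappa> \<subseteq> \<rho> \<and> dirs \<kappa> = dirs \<rho>"
        by (rule lincomb_facet[OF X' _ \<kappa>]) (erule tropical_cycleD(1)[OF trop])
      then obtain a L \<rho> where \<rho>: "(a, L) = (1, X) \<or> (a, L) \<in> set (lines b)" "\<rho> \<in> facets (cells L)" "\<kappa> \<subseteq> \<rho>" by auto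
      from \<rho>(1) show ?thesis
      proof
        assume "(a, L) = (1, X)"
        then have "\<rho> \<in> ?F" using \<rho>(2) by simp
        then show ?thesis using \<rho>(3) hull_subset[of \<rho> affine] by blast
      next
        assume "(a, L) \<in> set (lines b)"
        then obtain s where "s \<in> ?F" "L = hull_cycle s" using set_lines by blast
        then show ?thesis using \<rho>(2,3) by (auto simp: facets_hull_cycle)
      qed
    qed
    then obtain s where s: "s \<in> ?F" "\<kappa> \<subseteq> affine hull s" by blast
    have "mult_on (hull_cycle s) \<kappa> \<le> (\<Sum>s\<in>?F. mult_on (hull_cycle s) \<kappa>)"
      by (rule member_le_sum[OF s(1) _ finF]) (simp add: mult_on_hull_cycle)
    then have 1: "1 \<le> (\<Sum>s\<in>?F. mult_on (hull_cycle s) \<kappa>)" using s(2) by (simp add: mult_on_hull_cycle)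
    have b: "b \<ge> 1" by (simp add: b_def sum_nonneg)
    have "\<bar>mult_on X \<kappa>\<bar> \<le> (\<Sum>s | s \<in> ?F \<and> \<kappa> \<subseteq> s. \<bar>facet_mult X s\<bar>)" unfolding mult_on_def by (rule sum_abs)
    also have "\<dots> \<le> (\<Sum>s\<in>?F. \<bar>facet_mult X s\<bar>)" by (rule sum_mono2[OF finF]) auto
    finally have "\<bar>mult_on X \<kappa>\<bar> < b" by (simp add: b_def)
    moreover have "b * 1 \<le> b * (\<Sum>s\<in>?F. mult_on (hull_cycle s) \<kappa>)" by (rule mult_left_mono[OF 1]) (use b in simp)
    moreover have "facet_mult X' \<kappa> = mult_on X \<kappa> + b * (\<Sum>s\<in>?F. mult_on (hull_cycle s) \<kappa>)"
      using lincombD(4)[OF X' \<kappa>] by (simp add: sum_lines)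
    ultimately show "facet_mult X' \<kappa> > 0" by linarith
  qed
  define ts where "ts = (1, X') # lines (- b)"
  \<comment> \<open>The cells of \<open>X'\<close> already subdivide the affine spans and
    \<open>X\<close>, so subtracting the spans again needs new multiplicities but no new
    cells.\<close>
  define Z where "Z = \<lparr>cells = cells X', facet_mult = (\<lambda>\<kappa>. \<Sum>(a, X)\<leftarrow>ts. a * mult_on X \<kappa>)\<rparr>"
  have tts: "tropical_cycle p L \<and> positive L" if "(a, L) \<in> set ts" for a L
    using that tX' pos tropical_hull_cycle[OF X] positive_hull_cycle set_lines[of a L "- b"] by (auto simp: ts_def)
  have lines_cover: "\<exists>a. (a, L) \<in> set ((1, X) # lines b)" if "(a, L) \<in> set (lines (- b))" for a L
    using that set_lines by auto
  have Z: "lincomb ts Z" unfolding lincomb_def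
  proof (intro conjI)
    show "polyhedral_complex (cells Z)" using lincombD(1)[OF X'] by (simp add: Z_def)
    show "\<forall>s\<in>facets (cells Z). facet_mult Z s = (\<Sum>(a, X)\<leftarrow>ts. a * mult_on X s)" by (simp add: Z_def)
    have sub: "\<Union>(cells L) \<subseteq> \<Union>(cells X')" if "(a, L) \<in> set (lines (- b))" for a L
      using lines_cover[OF that] lincombD(2)[OF X'] by blast
    have "(\<Union>(a, X)\<in>set (lines (- b)). \<Union>(cells X)) \<subseteq> \<Union>(cells X')"
    proof (rule UN_least)
      fix t assume t: "t \<in> set (lines (- b))"
      obtain a L where "t = (a, L)" by (rule prod.exhaust)
      then show "(case t of (a, X) \<Rightarrow> \<Union>(cells X)) \<subseteq> \<Union>(cells X')" using sub[of a L] t by simp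
    qed
    then show "\<Union>(cells Z) = (\<Union>(a, X)\<in>set ts. \<Union>(cells X))" by (simp add: Z_def ts_def Un_absorb2)
    show "\<forall>(a, X)\<in>set ts. \<forall>\<rho>\<in>cells X. \<rho> = \<Union>{s\<in>cells Z. s \<subseteq> \<rho>}"
    proof clarify
      fix a L \<rho> assume L: "(a, L) \<in> set ts" "\<rho> \<in> cells L"
      consider "L = X'" | "(a, L) \<in> set (lines (- b))" using L(1) by (auto simp: ts_def)
      then show "\<rho> = \<Union>{s\<in>cells Z. s \<subseteq> \<rho>}"
      proof cases
        case 1
        then show ?thesis using L(2) by (auto simp: Z_def)
      next
        case 2
        then obtain a' where "(a', L) \<in> set ((1, X) # lines b)" using lines_cover by blast
        from lincombD(3)[OF X' this L(2)] show ?thesis by (simp add: Z_def)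
      qed
    qed
  qed
  have tZ: "tropical_cycle p Z" by (rule tropical_lincomb[OF Z]) (use tts in blast)
  have "cycle_eq Z X"
  proof (rule cycle_eqI[OF X tZ])
    fix \<rho> assume "\<rho> \<in> cells X"
    then show "\<rho> = \<Union>{\<kappa>\<in>cells Z. \<kappa> \<subseteq> \<rho>}" using lincombD(3)[OF X', of 1 X \<rho>] by (simp add: Z_def)
  next
    fix \<kappa> assume "\<kappa> \<in> facets (cells Z)"
    then have \<kappa>: "\<kappa> \<in> facets (cells X')" by (simp add: Z_def)
    have "facet_mult X' \<kappa> = mult_on X \<kappa> + b * (\<Sum>s\<in>?F. mult_on (hull_cycle s) \<kappa>)"
      using lincombD(4)[OF X' \<kappa>] by (simp add: sum_lines)
    moreover have "mult_on X' \<kappa> = facet_mult X' \<kappa>"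
      by (rule mult_on_facet[OF convex_complexD(1)[OF tropical_cycleD(2)[OF tX']] \<kappa>])
    ultimately show "facet_mult Z \<kappa> = mult_on X \<kappa>" by (simp add: Z_def ts_def sum_lines)
  qed
  then show ?thesis unfolding positive_decomposition_def using Z tts by blast
qed

text \<open>The existence of \<open>W\<close> keeps the statement about all representatives of the
  product from being vacuous. Purity of the support is expressed by a complex of the right
  codimension that fills it, for which the cells of \<open>stable_intersection X Y\<close>
  serve.\<close>

theorem theorem2p13:
  fixes X Y :: "(real ^ 'n) weighted_complex" and p q :: nat
  assumes "tropical_cycle p X" and "tropical_cycle q Y"
  shows "(\<exists>W. stable_product p q X Y W) \<and>
         (\<forall>W. stable_product p q X Y W \<longrightarrow> tropical_cycle (p + q) W) \<and>
         (positive X \<and> positive Y \<longrightarrow>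
            tropical_cycle (p + q) (stable_intersection X Y) \<and>
            support (stable_intersection X Y) = stable_support X Y \<and>
            (stable_support X Y = {} \<or>
             (\<exists>C. polyhedral_complex C \<and> pure_codim (p + q) C \<and> \<Union>C = stable_support X Y)))"
proof -
  \<comment> \<open>Every term in the bilinear expansion is a product of positive cycles of
    codimensions \<open>p\<close> and \<open>q\<close>, so all terms have codimension
    \<open>p + q\<close> and may be combined.\<close>
  have prod: "tropical_cycle (p + q) Z"
    if ps: "positive_decomposition p X xs" "positive_decomposition q Y ys"
      and mem: "(c, Z) \<in> set [(a * b, stable_intersection X' Y'). (a, X') \<leftarrow> xs, (b, Y') \<leftarrow> ys]" for xs ys c Z
  proof -
    obtain a X' b Y' where "(a, X') \<in> set xs" "(b, Y') \<in> set ys" "Z = stable_intersection X' Y'" using mem by auto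
    then show ?thesis using tropical_stable_intersection[of p X' q Y'] ps unfolding positive_decomposition_def by blast
  qed
  have "\<exists>W. stable_product p q X Y W"
  proof -
    obtain xs ys where ps: "positive_decomposition p X xs" "positive_decomposition q Y ys"
      using positive_decomposition_exists[OF assms(1)] positive_decomposition_exists[OF assms(2)] by blast
    have "\<exists>W. lincomb [(a * b, stable_intersection X' Y'). (a, X') \<leftarrow> xs, (b, Y') \<leftarrow> ys] W"
      by (rule lincomb_exists) (erule tropical_cycleD(1)[OF prod[OF ps]])
    then show ?thesis unfolding stable_product_def using ps by blast
  qed
  moreover have "tropical_cycle (p + q) W" if W: "stable_product p q X Y W" for W
  proof -
    obtain xs ys where ps: "positive_decomposition p X xs" "positive_decomposition q Y ys"
      and lc: "lincomb [(a * b, stable_intersection X' Y'). (a, X') \<leftarrow> xs, (b, Y') \<leftarrow> ys] W"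
      using W unfolding stable_product_def by blast
    show ?thesis by (rule tropical_lincomb[OF lc]) (erule prod[OF ps])
  qed
  moreover have "tropical_cycle (p + q) (stable_intersection X Y) \<and> support (stable_intersection X Y) = stable_support X Y \<and>
      (stable_support X Y = {} \<or> (\<exists>C. polyhedral_complex C \<and> pure_codim (p + q) C \<and> \<Union>C = stable_support X Y))"
    if pos: "positive X \<and> positive Y"
  proof -
    note XY = assms(1) pos[THEN conjunct1] assms(2) pos[THEN conjunct2]
    note t = tropical_stable_intersection[OF XY]
    show ?thesis
      using t support_stable_intersection[OF XY] tropical_cycleD(1)[OF t] pure_SI[OF XY] Union_SI[OF XY] by blast
  qed
  ultimately show ?thesis by blast
qed

end
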